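(* Let $n\ge 1$, let $Q=(q_{ij})\in M_n(\mathbb{C}^* )$ be a multiplicatively skew-symmetric matrix, and let $U=S_QV$ be the associated quantum affine space, i.e. the $\mathbb{C}$-algebra generated by $v_1,\ldots,v_n$ with relations $v_iv_j=q_{ij}v_jv_i$ for all $1\le i,j\le n$. Let $\sigma$ be the automorphism of $U$ defined by $\sigma(v_i)=p_iv_i$ with $p_i=\prod_{j=1}^n q_{ji}$, and let ${}_\sigma U$ be the $U$-bimodule obtained from $U$ by twisting the left action by $\sigma$. Then there is a duality between the Hochschild cohomology of $U$ and the Hochschild homology of $U$ with values in ${}_\sigma U$: for all $k$ there is an isomorphism of vector spaces $$H_k(U,{}_\sigma U)\simeq H^{n-k}(U,U).$$
   Context: A matrix $Q=(q_{ij})$ is multiplicatively skew-symmetric if $q_{ij}q_{ji}=q_{ii}=1$ for all $i,j$. The bimodule ${}_\sigma U$ is $U$ as a vector space, with left and right actions $a\cdot b\cdot c=\sigma(a)bc$ for $a,c\in U$, $b\in{}_\sigma U$. $H_*(U,N)$ and $H^*(U,N)$ denote the Hochschild homology and cohomology of the $\mathbb{C}$-algebra $U$ with values in the bimodule $N$, that is $\mathrm{Tor}^{U^e}_*(N,U)$ and $\mathrm{Ext}_{U^e}^*(U,N)$ with $U^e=U\otimes_{\mathbb{C}} U^{op}$; they are zero in negative degree. *)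

theory Defs
  imports Complex_Main "HOL-Algebra.Algebra" "HOL-Algebra.Algebraic_Closure_Type"
begin

section \<open>Linear algebra over a possibly noncommutative ring\<close>

text \<open>
  The locale \<^locale>\<open>module\<close> of HOL-Algebra asks for a commutative ring of scalars. Left modules over
  an arbitrary ring use the same record type. As for \<^locale>\<open>module\<close>, the fields \<^const>\<open>mult\<close>
  and \<^const>\<open>one\<close> of the record of a module are irrelevant.
\<close>

locale left_module = R?: ring R + M?: abelian_group M
  for R :: "('a, 'r) ring_scheme" and M :: "('a, 'b, 'm) module_scheme" (structure) +
  assumes lsmult_closed [simp, intro]:
      "\<lbrakk>a \<in> carrier R; x \<in> carrier M\<rbrakk> \<Longrightarrow> a \<odot>\<^bsub>M\<^esub> x \<in> carrier M"
    and lsmult_l_distr: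
      "\<lbrakk>a \<in> carrier R; b \<in> carrier R; x \<in> carrier M\<rbrakk> \<Longrightarrow>
        (a \<oplus>\<^bsub>R\<^esub> b) \<odot>\<^bsub>M\<^esub> x = a \<odot>\<^bsub>M\<^esub> x \<oplus>\<^bsub>M\<^esub> b \<odot>\<^bsub>M\<^esub> x"
    and lsmult_r_distr:
      "\<lbrakk>a \<in> carrier R; x \<in> carrier M; y \<in> carrier M\<rbrakk> \<Longrightarrow>
        a \<odot>\<^bsub>M\<^esub> (x \<oplus>\<^bsub>M\<^esub> y) = a \<odot>\<^bsub>M\<^esub> x \<oplus>\<^bsub>M\<^esub> a \<odot>\<^bsub>M\<^esub> y"
    and lsmult_assoc:
      "\<lbrakk>a \<in> carrier R; b \<in> carrier R; x \<in> carrier M\<rbrakk> \<Longrightarrow>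
        (a \<otimes>\<^bsub>R\<^esub> b) \<odot>\<^bsub>M\<^esub> x = a \<odot>\<^bsub>M\<^esub> (b \<odot>\<^bsub>M\<^esub> x)"
    and lsmult_one [simp]:
      "x \<in> carrier M \<Longrightarrow> \<one>\<^bsub>R\<^esub> \<odot>\<^bsub>M\<^esub> x = x"

text \<open>Homomorphisms are extensional, so that equality of homomorphisms is equality of functions.\<close>

definition module_homs ::
  "('a, 'r) ring_scheme \<Rightarrow> ('a, 'b, 'm) module_scheme \<Rightarrow> ('a, 'c, 'n) module_scheme \<Rightarrow> ('b \<Rightarrow> 'c) set"
  where "module_homs R M N =
    {f \<in> carrier M \<rightarrow>\<^sub>E carrier N.
      (\<forall>x\<in>carrier M. \<forall>y\<in>carrier M. f (x \<oplus>\<^bsub>M\<^esub> y) = f x \<oplus>\<^bsub>N\<^esub> f y) \<and>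
      (\<forall>a\<in>carrier R. \<forall>x\<in>carrier M. f (a \<odot>\<^bsub>M\<^esub> x) = a \<odot>\<^bsub>N\<^esub> f x)}"

definition free_module :: "('a, 'r) ring_scheme \<Rightarrow> 'i set \<Rightarrow> ('a, 'i \<Rightarrow> 'a) module"
  where "free_module R I =
    \<lparr>carrier = {f. (\<forall>i\<in>I. f i \<in> carrier R) \<and> (\<forall>i. i \<notin> I \<longrightarrow> f i = \<zero>\<^bsub>R\<^esub>) \<and> finite {i. f i \<noteq> \<zero>\<^bsub>R\<^esub>}},
     monoid.mult = undefined, monoid.one = undefined,
     ring.zero = (\<lambda>i. \<zero>\<^bsub>R\<^esub>), ring.add = (\<lambda>f g i. f i \<oplus>\<^bsub>R\<^esub> g i),
     module.smult = (\<lambda>a f i. a \<otimes>\<^bsub>R\<^esub> f i)\<rparr>"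

text \<open>Projective modules: direct summands of free modules. Every module \<open>P\<close> is a quotient of the
  free module on \<^term>\<open>carrier P\<close>, so index sets in the type of elements of \<open>P\<close> suffice.\<close>

definition projective :: "('a, 'r) ring_scheme \<Rightarrow> ('a, 'p, 'm) module_scheme \<Rightarrow> bool"
  where "projective R P \<longleftrightarrow> left_module R P \<and>
    (\<exists>(I :: 'p set) s r. s \<in> module_homs R P (free_module R I) \<and>
      r \<in> module_homs R (free_module R I) P \<and> (\<forall>x\<in>carrier P. r (s x) = x))"

text \<open>Quotients of modules and of algebras. On the additive part this is \<^const>\<open>FactRing\<close>; the
  multiplication of the quotient is meaningful when \<open>W\<close> is an ideal of an algebra.\<close>

definition quot_module :: "('a, 'b, 'm) module_scheme \<Rightarrow> 'b set \<Rightarrow> ('a, 'b set) module"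
  where "quot_module M W =
    \<lparr>carrier = carrier (M Quot W), monoid.mult = monoid.mult (M Quot W), monoid.one = monoid.one (M Quot W),
     ring.zero = ring.zero (M Quot W), ring.add = ring.add (M Quot W),
     module.smult = (\<lambda>c Y. \<Union>x\<in>Y. W +>\<^bsub>M\<^esub> (c \<odot>\<^bsub>M\<^esub> x))\<rparr>"


section \<open>Complex vector spaces and algebras\<close>

abbreviation complex_field :: "complex ring"
  where "complex_field \<equiv> ring_of_type_algebra"

definition vector_space_iso ::
  "(complex, 'b, 'm) module_scheme \<Rightarrow> (complex, 'c, 'n) module_scheme \<Rightarrow> bool"
  where "vector_space_iso V W \<longleftrightarrow> module complex_field V \<and> module complex_field W \<and>
    (\<exists>h \<in> module_homs complex_field V W. bij_betw h (carrier V) (carrier W))"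

definition lin_span :: "(complex, 'b, 'm) module_scheme \<Rightarrow> 'b set \<Rightarrow> 'b set"
  where "lin_span V S = \<Inter>{W. submodule W complex_field V \<and> S \<subseteq> W}"

definition single :: "'x \<Rightarrow> 'x \<Rightarrow> complex"
  where "single x = (\<lambda>y. if y = x then 1 else 0)"

definition monoid_algebra :: "('x, 'g) monoid_scheme \<Rightarrow> (complex, 'x \<Rightarrow> complex) module"
  where "monoid_algebra G = (free_module complex_field (carrier G))
    \<lparr>monoid.mult := (\<lambda>f g x. \<Sum>(a, b) | f a \<noteq> 0 \<and> g b \<noteq> 0 \<and> a \<otimes>\<^bsub>G\<^esub> b = x. f a * g b),
     monoid.one := single \<one>\<^bsub>G\<^esub>\<rparr>"

definition free_monoid :: "'x set \<Rightarrow> 'x list monoid"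
  where "free_monoid Y = \<lparr>carrier = lists Y, monoid.mult = (@), monoid.one = []\<rparr>"

definition opposite :: "(complex, 'u) module \<Rightarrow> (complex, 'u) module"
  where "opposite A = A\<lparr>monoid.mult := (\<lambda>a b. b \<otimes>\<^bsub>A\<^esub> a)\<rparr>"

text \<open>The tensor product over \<open>\<complex>\<close> of two algebras is the algebra of the product of their
  multiplicative monoids modulo the bilinearity relations; \<^term>\<open>single (a, b)\<close> represents
  \<open>a \<otimes> b\<close>. The linear span of these relations is already an ideal.\<close>

definition tensor_algebra ::
  "(complex, 'a) module \<Rightarrow> (complex, 'b) module \<Rightarrow> (complex, ('a \<times> 'b \<Rightarrow> complex) set) module"
  where "tensor_algebra A B = (let F = monoid_algebra (A \<times>\<times> B) in quot_module F (Idl\<^bsub>F\<^esub>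
    ({single (a \<oplus>\<^bsub>A\<^esub> a', b) \<ominus>\<^bsub>F\<^esub> (single (a, b) \<oplus>\<^bsub>F\<^esub> single (a', b)) | a a' b.
        a \<in> carrier A \<and> a' \<in> carrier A \<and> b \<in> carrier B} \<union>
     {single (a, b \<oplus>\<^bsub>B\<^esub> b') \<ominus>\<^bsub>F\<^esub> (single (a, b) \<oplus>\<^bsub>F\<^esub> single (a, b')) | a b b'.
        a \<in> carrier A \<and> b \<in> carrier B \<and> b' \<in> carrier B} \<union>
     {single (c \<odot>\<^bsub>A\<^esub> a, b) \<ominus>\<^bsub>F\<^esub> c \<odot>\<^bsub>F\<^esub> single (a, b) | c a b.
        a \<in> carrier A \<and> b \<in> carrier B} \<union>
     {single (a, c \<odot>\<^bsub>B\<^esub> b) \<ominus>\<^bsub>F\<^esub> c \<odot>\<^bsub>F\<^esub> single (a, b) | c a b.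
        a \<in> carrier A \<and> b \<in> carrier B})))"

definition enveloping_algebra ::
  "(complex, 'u) module \<Rightarrow> (complex, ('u \<times> 'u \<Rightarrow> complex) set) module"
  where "enveloping_algebra U = tensor_algebra U (opposite U)"

definition algebra_automorphism :: "(complex, 'u) module \<Rightarrow> ('u \<Rightarrow> 'u) \<Rightarrow> bool"
  where "algebra_automorphism U s \<longleftrightarrow> s \<in> ring_iso U U \<and>
    (\<forall>c. \<forall>x\<in>carrier U. s (c \<odot>\<^bsub>U\<^esub> x) = c \<odot>\<^bsub>U\<^esub> s x)"


section \<open>Tor and Ext over a complex algebra\<close>

subsection \<open>Complexes\<close>

definition homology ::
  "(nat \<Rightarrow> (complex, 'v) module) \<Rightarrow> (nat \<Rightarrow> 'v \<Rightarrow> 'v) \<Rightarrow> nat \<Rightarrow> (complex, 'v set) module"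
  \<comment> \<open>\<open>d k\<close> maps \<open>V (Suc k)\<close> to \<open>V k\<close>\<close>
  where "homology V d k = quot_module
    ((V k)\<lparr>carrier := {x \<in> carrier (V k). case k of 0 \<Rightarrow> True | Suc j \<Rightarrow> d j x = \<zero>\<^bsub>V j\<^esub>}\<rparr>)
    (d k ` carrier (V (Suc k)))"

definition cohomology ::
  "(nat \<Rightarrow> (complex, 'v) module) \<Rightarrow> (nat \<Rightarrow> 'v \<Rightarrow> 'v) \<Rightarrow> nat \<Rightarrow> (complex, 'v set) module"
  \<comment> \<open>\<open>d k\<close> maps \<open>V k\<close> to \<open>V (Suc k)\<close>\<close>
  where "cohomology V d k = quot_module
    ((V k)\<lparr>carrier := {x \<in> carrier (V k). d k x = \<zero>\<^bsub>V (Suc k)\<^esub>}\<rparr>)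
    (case k of 0 \<Rightarrow> {\<zero>\<^bsub>V 0\<^esub>} | Suc j \<Rightarrow> d j ` carrier (V j))"

subsection \<open>Tensor products and spaces of homomorphisms\<close>

text \<open>Here \<open>A\<close> is a complex algebra, which acts on \<open>N\<close> from the right and on \<open>M\<close> from the left.
  In the record of a right module, \<^term>\<open>a \<odot>\<^bsub>N\<^esub> n\<close> stands for \<open>n a\<close>. The scalar \<open>c\<close> acts on a
  module as \<^term>\<open>c \<odot>\<^bsub>A\<^esub> \<one>\<^bsub>A\<^esub>\<close>.\<close>

definition tensor_relations ::
  "(complex, 'a) module \<Rightarrow> ('a, 'n) module \<Rightarrow> ('a, 'm) module \<Rightarrow> ('n \<times> 'm \<Rightarrow> complex) set"
  where "tensor_relations A N M = (let F = free_module complex_field (carrier N \<times> carrier M) in lin_span F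
    ({single (n \<oplus>\<^bsub>N\<^esub> n', m) \<ominus>\<^bsub>F\<^esub> (single (n, m) \<oplus>\<^bsub>F\<^esub> single (n', m)) | n n' m.
        n \<in> carrier N \<and> n' \<in> carrier N \<and> m \<in> carrier M} \<union>
     {single (n, m \<oplus>\<^bsub>M\<^esub> m') \<ominus>\<^bsub>F\<^esub> (single (n, m) \<oplus>\<^bsub>F\<^esub> single (n, m')) | n m m'.
        n \<in> carrier N \<and> m \<in> carrier M \<and> m' \<in> carrier M} \<union>
     {single (a \<odot>\<^bsub>N\<^esub> n, m) \<ominus>\<^bsub>F\<^esub> single (n, a \<odot>\<^bsub>M\<^esub> m) | a n m.
        a \<in> carrier A \<and> n \<in> carrier N \<and> m \<in> carrier M} \<union>
     {single ((c \<odot>\<^bsub>A\<^esub> \<one>\<^bsub>A\<^esub>) \<odot>\<^bsub>N\<^esub> n, m) \<ominus>\<^bsub>F\<^esub> c \<odot>\<^bsub>F\<^esub> single (n, m) | c n m.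
        n \<in> carrier N \<and> m \<in> carrier M}))"

definition tensor_product ::
  "(complex, 'a) module \<Rightarrow> ('a, 'n) module \<Rightarrow> ('a, 'm) module \<Rightarrow>
    (complex, ('n \<times> 'm \<Rightarrow> complex) set) module"
  where "tensor_product A N M =
    quot_module (free_module complex_field (carrier N \<times> carrier M)) (tensor_relations A N M)"

text \<open>The linear extension of a map between bases.\<close>

definition push_forward :: "('x \<Rightarrow> 'y) \<Rightarrow> ('x \<Rightarrow> complex) \<Rightarrow> 'y \<Rightarrow> complex"
  where "push_forward h f = (\<lambda>y. \<Sum>x | f x \<noteq> 0 \<and> h x = y. f x)"

text \<open>The map \<open>id \<otimes> g\<close> from \<^term>\<open>tensor_product A N M\<close> to \<^term>\<open>tensor_product A N M'\<close>.\<close>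

definition tensor_map ::
  "(complex, 'a) module \<Rightarrow> ('a, 'n) module \<Rightarrow> ('a, 'm) module \<Rightarrow> ('m \<Rightarrow> 'm) \<Rightarrow>
    ('n \<times> 'm \<Rightarrow> complex) set \<Rightarrow> ('n \<times> 'm \<Rightarrow> complex) set"
  where "tensor_map A N M' g Y =
    (\<Union>f\<in>Y. tensor_relations A N M' +>\<^bsub>free_module complex_field (carrier N \<times> carrier M')\<^esub>
      push_forward (map_prod id g) f)"

definition hom_space ::
  "(complex, 'a) module \<Rightarrow> ('a, 'm) module \<Rightarrow> ('a, 'n) module \<Rightarrow> (complex, 'm \<Rightarrow> 'n) module"
  where "hom_space A M N =
    \<lparr>carrier = module_homs A M N, monoid.mult = undefined, monoid.one = undefined,
     ring.zero = (\<lambda>x\<in>carrier M. \<zero>\<^bsub>N\<^esub>), ring.add = (\<lambda>f g. \<lambda>x\<in>carrier M. f x \<oplus>\<^bsub>N\<^esub> g x),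
     module.smult = (\<lambda>c f. \<lambda>x\<in>carrier M. (c \<odot>\<^bsub>A\<^esub> \<one>\<^bsub>A\<^esub>) \<odot>\<^bsub>N\<^esub> f x)\<rparr>"

subsection \<open>Projective resolutions\<close>

definition projective_resolution ::
  "('a, 'r) ring_scheme \<Rightarrow> ('a, 'm, 's) module_scheme \<Rightarrow>
    (nat \<Rightarrow> ('a, 'p) module) \<Rightarrow> (nat \<Rightarrow> 'p \<Rightarrow> 'p) \<Rightarrow> ('p \<Rightarrow> 'm) \<Rightarrow> bool"
  where "projective_resolution R M P d e \<longleftrightarrow>
    (\<forall>k. projective R (P k)) \<and>
    (\<forall>k. d k \<in> module_homs R (P (Suc k)) (P k)) \<and>
    e \<in> module_homs R (P 0) M \<and>
    e ` carrier (P 0) = carrier M \<and>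
    {x \<in> carrier (P 0). e x = \<zero>\<^bsub>M\<^esub>} = d 0 ` carrier (P 1) \<and>
    (\<forall>k. {x \<in> carrier (P (Suc k)). d k x = \<zero>\<^bsub>P k\<^esub>} = d (Suc k) ` carrier (P (Suc (Suc k))))"

text \<open>
  Tor and Ext are computed from a projective resolution, chosen among those whose modules consist of
  functions on the following type of symbols. The type contains a basis for each step of the standard
  free resolution: \<open>Base m\<close> for the elements of \<open>M\<close>, and \<open>Syzygy\<close> of a listed formal linear
  combination for the elements of the successive kernels. Hence every module has such a
  resolution (\<open>projective_resolution_exists\<close> below).
\<close>

datatype ('a, 'm) symb = Base 'm | Syzygy "(('a, 'm) symb \<times> 'a) list"

definition chosen_resolution ::
  "('a, 'r) ring_scheme \<Rightarrow> ('a, 'm, 's) module_scheme \<Rightarrow>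
    (nat \<Rightarrow> ('a, ('a, 'm) symb \<Rightarrow> 'a) module) \<times>
    (nat \<Rightarrow> (('a, 'm) symb \<Rightarrow> 'a) \<Rightarrow> (('a, 'm) symb \<Rightarrow> 'a))"
  where "chosen_resolution R M = (SOME (P, d). \<exists>e. projective_resolution R M P d e)"

lemma (in left_module) lsmult_l_null:
  assumes "x \<in> carrier M"
  shows "\<zero>\<^bsub>R\<^esub> \<odot>\<^bsub>M\<^esub> x = \<zero>\<^bsub>M\<^esub>"
proof -
  have "\<zero>\<^bsub>R\<^esub> \<odot>\<^bsub>M\<^esub> x = \<zero>\<^bsub>R\<^esub> \<odot>\<^bsub>M\<^esub> x \<oplus>\<^bsub>M\<^esub> \<zero>\<^bsub>R\<^esub> \<odot>\<^bsub>M\<^esub> x"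
    using lsmult_l_distr[of "\<zero>\<^bsub>R\<^esub>" "\<zero>\<^bsub>R\<^esub>" x] assms by simp
  then show ?thesis
    using assms by (metis M.add.r_cancel_one' R.zero_closed lsmult_closed)
qed

lemma (in left_module) lsmult_r_null:
  assumes "a \<in> carrier R"
  shows "a \<odot>\<^bsub>M\<^esub> \<zero>\<^bsub>M\<^esub> = \<zero>\<^bsub>M\<^esub>"
proof -
  have "a \<odot>\<^bsub>M\<^esub> \<zero>\<^bsub>M\<^esub> = a \<odot>\<^bsub>M\<^esub> \<zero>\<^bsub>M\<^esub> \<oplus>\<^bsub>M\<^esub> a \<odot>\<^bsub>M\<^esub> \<zero>\<^bsub>M\<^esub>"
    using lsmult_r_distr[of a "\<zero>\<^bsub>M\<^esub>" "\<zero>\<^bsub>M\<^esub>"] assms by simp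
  then show ?thesis
    using assms by (metis M.add.r_cancel_one' M.zero_closed lsmult_closed)
qed

lemma (in left_module) lsmult_finsum:
  assumes "a \<in> carrier R" "f \<in> S \<rightarrow> carrier M"
  shows "a \<odot>\<^bsub>M\<^esub> (\<Oplus>\<^bsub>M\<^esub>i\<in>S. f i) = (\<Oplus>\<^bsub>M\<^esub>i\<in>S. a \<odot>\<^bsub>M\<^esub> f i)"
  using assms
proof (induction S rule: infinite_finite_induct)
  case (infinite S)
  then show ?case by (simp add: lsmult_r_null)
next
  case empty
  then show ?case by (simp add: lsmult_r_null)
next
  case (insert i S)
  then have f: "f \<in> S \<rightarrow> carrier M" "f i \<in> carrier M" by auto
  then have g: "(\<lambda>i. a \<odot>\<^bsub>M\<^esub> f i) \<in> S \<rightarrow> carrier M" "a \<odot>\<^bsub>M\<^esub> f i \<in> carrier M"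
    using insert.prems(1) by blast+
  show ?case
    unfolding M.finsum_insert[OF insert.hyps f] M.finsum_insert[OF insert.hyps g]
    using insert.IH[OF insert.prems(1) f(1)]
      lsmult_r_distr[OF insert.prems(1) f(2) M.finsum_closed[OF f(1)]] by simp
qed

lemma free_module_simps:
  "f \<in> carrier (free_module R I) \<longleftrightarrow>
    (\<forall>i\<in>I. f i \<in> carrier R) \<and> (\<forall>i. i \<notin> I \<longrightarrow> f i = \<zero>\<^bsub>R\<^esub>) \<and> finite {i. f i \<noteq> \<zero>\<^bsub>R\<^esub>}"
  "\<zero>\<^bsub>free_module R I\<^esub> = (\<lambda>i. \<zero>\<^bsub>R\<^esub>)"
  "f \<oplus>\<^bsub>free_module R I\<^esub> g = (\<lambda>i. f i \<oplus>\<^bsub>R\<^esub> g i)"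
  "a \<odot>\<^bsub>free_module R I\<^esub> f = (\<lambda>i. a \<otimes>\<^bsub>R\<^esub> f i)"
  by (simp_all add: free_module_def)

lemma module_homs_zero:
  assumes "left_module R M" "left_module R N" "g \<in> module_homs R M N"
  shows "g \<zero>\<^bsub>M\<^esub> = \<zero>\<^bsub>N\<^esub>"
proof -
  interpret M: left_module R M by fact
  interpret N: left_module R N by fact
  have "g (\<zero>\<^bsub>R\<^esub> \<odot>\<^bsub>M\<^esub> \<zero>\<^bsub>M\<^esub>) = \<zero>\<^bsub>R\<^esub> \<odot>\<^bsub>N\<^esub> g \<zero>\<^bsub>M\<^esub>"
    using assms(3) by (simp add: module_homs_def)
  moreover have "g \<zero>\<^bsub>M\<^esub> \<in> carrier N"
    using assms(3) by (auto simp: module_homs_def)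
  ultimately show ?thesis
    by (simp add: M.lsmult_l_null N.lsmult_l_null)
qed

lemma left_module_free_module:
  assumes "ring R"
  shows "left_module R (free_module R I)"
proof -
  interpret R: ring R by fact
  let ?F = "free_module R I"
  have val: "f i \<in> carrier R" if "f \<in> carrier ?F" for f i
    using that by (cases "i \<in> I") (auto simp: free_module_simps)
  have add: "f \<oplus>\<^bsub>?F\<^esub> g \<in> carrier ?F" if "f \<in> carrier ?F" "g \<in> carrier ?F" for f g
  proof -
    have "{i. f i \<oplus>\<^bsub>R\<^esub> g i \<noteq> \<zero>\<^bsub>R\<^esub>} \<subseteq> {i. f i \<noteq> \<zero>\<^bsub>R\<^esub>} \<union> {i. g i \<noteq> \<zero>\<^bsub>R\<^esub>}" by auto
    from finite_subset[OF this] that show ?thesis by (simp add: free_module_simps)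
  qed
  have inv: "(\<lambda>i. \<ominus>\<^bsub>R\<^esub> f i) \<in> carrier ?F" if "f \<in> carrier ?F" for f
  proof -
    have "{i. \<ominus>\<^bsub>R\<^esub> f i \<noteq> \<zero>\<^bsub>R\<^esub>} \<subseteq> {i. f i \<noteq> \<zero>\<^bsub>R\<^esub>}" by auto
    from finite_subset[OF this] that show ?thesis by (simp add: free_module_simps)
  qed
  have smult: "a \<odot>\<^bsub>?F\<^esub> f \<in> carrier ?F" if "a \<in> carrier R" "f \<in> carrier ?F" for a f
  proof -
    have "{i. a \<otimes>\<^bsub>R\<^esub> f i \<noteq> \<zero>\<^bsub>R\<^esub>} \<subseteq> {i. f i \<noteq> \<zero>\<^bsub>R\<^esub>}" using that by auto
    from finite_subset[OF this] that show ?thesis by (simp add: free_module_simps)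
  qed
  have "abelian_group ?F"
  proof (rule abelian_groupI)
    show "f \<oplus>\<^bsub>?F\<^esub> g \<in> carrier ?F" if "f \<in> carrier ?F" "g \<in> carrier ?F" for f g
      using add that .
    show "\<zero>\<^bsub>?F\<^esub> \<in> carrier ?F"
      by (simp add: free_module_simps)
    show "f \<oplus>\<^bsub>?F\<^esub> g \<oplus>\<^bsub>?F\<^esub> h = f \<oplus>\<^bsub>?F\<^esub> (g \<oplus>\<^bsub>?F\<^esub> h)"
      if "f \<in> carrier ?F" "g \<in> carrier ?F" "h \<in> carrier ?F" for f g h
      unfolding free_module_simps using that[THEN val] by (simp add: R.a_assoc)
    show "f \<oplus>\<^bsub>?F\<^esub> g = g \<oplus>\<^bsub>?F\<^esub> f" if "f \<in> carrier ?F" "g \<in> carrier ?F" for f g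
      unfolding free_module_simps using that[THEN val] by (simp add: R.a_comm)
    show "\<zero>\<^bsub>?F\<^esub> \<oplus>\<^bsub>?F\<^esub> f = f" if "f \<in> carrier ?F" for f
      unfolding free_module_simps using that[THEN val] by simp
    show "\<exists>g\<in>carrier ?F. g \<oplus>\<^bsub>?F\<^esub> f = \<zero>\<^bsub>?F\<^esub>" if "f \<in> carrier ?F" for f
      by (rule bexI[OF _ inv[OF that]]) (simp add: free_module_simps(2,3) val[OF that] R.l_neg)
  qed
  moreover have "left_module_axioms R ?F"
  proof (rule left_module_axioms.intro)
    show "a \<odot>\<^bsub>?F\<^esub> f \<in> carrier ?F" if "a \<in> carrier R" "f \<in> carrier ?F" for a f
      using smult that .
    show "(a \<oplus>\<^bsub>R\<^esub> b) \<odot>\<^bsub>?F\<^esub> f = a \<odot>\<^bsub>?F\<^esub> f \<oplus>\<^bsub>?F\<^esub> b \<odot>\<^bsub>?F\<^esub> f"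
      if "a \<in> carrier R" "b \<in> carrier R" "f \<in> carrier ?F" for a b f
      unfolding free_module_simps using that(1,2) val[OF that(3)] by (simp add: R.l_distr)
    show "a \<odot>\<^bsub>?F\<^esub> (f \<oplus>\<^bsub>?F\<^esub> g) = a \<odot>\<^bsub>?F\<^esub> f \<oplus>\<^bsub>?F\<^esub> a \<odot>\<^bsub>?F\<^esub> g"
      if "a \<in> carrier R" "f \<in> carrier ?F" "g \<in> carrier ?F" for a f g
      unfolding free_module_simps using that(1) val[OF that(2)] val[OF that(3)]
      by (simp add: R.r_distr)
    show "(a \<otimes>\<^bsub>R\<^esub> b) \<odot>\<^bsub>?F\<^esub> f = a \<odot>\<^bsub>?F\<^esub> (b \<odot>\<^bsub>?F\<^esub> f)"
      if "a \<in> carrier R" "b \<in> carrier R" "f \<in> carrier ?F" for a b f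
      unfolding free_module_simps using that(1,2) val[OF that(3)] by (simp add: R.m_assoc)
    show "\<one>\<^bsub>R\<^esub> \<odot>\<^bsub>?F\<^esub> f = f" if "f \<in> carrier ?F" for f
      unfolding free_module_simps using val[OF that] by simp
  qed
  ultimately show ?thesis
    using assms by (simp add: left_module_def)
qed

lemma (in left_module) free_module_extend:
  assumes \<phi>: "\<phi> \<in> I \<rightarrow> carrier M"
  obtains h where "h \<in> module_homs R (free_module R I) M"
    and "\<And>i. i \<in> I \<Longrightarrow> h (\<lambda>j. if j = i then \<one>\<^bsub>R\<^esub> else \<zero>\<^bsub>R\<^esub>) = \<phi> i"
proof -
  let ?F = "free_module R I"
  let ?s = "\<lambda>f. {i. f i \<noteq> \<zero>\<^bsub>R\<^esub>}"
  define h where "h = (\<lambda>f\<in>carrier ?F. \<Oplus>\<^bsub>M\<^esub>i\<in>?s f. f i \<odot>\<^bsub>M\<^esub> \<phi> i)"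
  interpret F: left_module R ?F by (rule left_module_free_module) (rule R.ring_axioms)
  have h: "h f = (\<Oplus>\<^bsub>M\<^esub>i\<in>S. f i \<odot>\<^bsub>M\<^esub> \<phi> i)"
    if "f \<in> carrier ?F" "finite S" "?s f \<subseteq> S" "S \<subseteq> I" for f S
    unfolding h_def using that \<phi>
    by (auto simp: free_module_def Pi_def lsmult_l_null intro!: M.add.finprod_mono_neutral_cong_left)
  have sub: "?s f \<subseteq> I" "finite (?s f)" "\<And>i. i \<in> I \<Longrightarrow> f i \<in> carrier R" if "f \<in> carrier ?F" for f
    using that by (auto simp: free_module_def)
  have "h \<in> module_homs R ?F M"
    unfolding module_homs_def
  proof (intro CollectI conjI ballI)
    show "h \<in> carrier ?F \<rightarrow>\<^sub>E carrier M"
      unfolding h_def using \<phi> by (fastforce simp: free_module_def intro!: M.finsum_closed)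
  next
    fix f g assume f: "f \<in> carrier ?F" and g: "g \<in> carrier ?F"
    let ?S = "?s f \<union> ?s g"
    have fg: "f \<oplus>\<^bsub>?F\<^esub> g \<in> carrier ?F" using f g by simp
    have S: "finite ?S" "?S \<subseteq> I" using sub f g by auto
    have "?s (f \<oplus>\<^bsub>?F\<^esub> g) \<subseteq> ?S" by (auto simp: free_module_def)
    then have "h (f \<oplus>\<^bsub>?F\<^esub> g) = (\<Oplus>\<^bsub>M\<^esub>i\<in>?S. (f \<oplus>\<^bsub>?F\<^esub> g) i \<odot>\<^bsub>M\<^esub> \<phi> i)"
      using h fg S by blast
    also have "\<dots> = (\<Oplus>\<^bsub>M\<^esub>i\<in>?S. f i \<odot>\<^bsub>M\<^esub> \<phi> i \<oplus>\<^bsub>M\<^esub> g i \<odot>\<^bsub>M\<^esub> \<phi> i)"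
    proof (rule M.finsum_cong'[OF refl])
      show "(\<lambda>i. f i \<odot>\<^bsub>M\<^esub> \<phi> i \<oplus>\<^bsub>M\<^esub> g i \<odot>\<^bsub>M\<^esub> \<phi> i) \<in> ?S \<rightarrow> carrier M"
        using S \<phi> sub(3)[OF f] sub(3)[OF g] by blast
      fix i assume "i \<in> ?S"
      then have "i \<in> I" using S by blast
      then show "(f \<oplus>\<^bsub>?F\<^esub> g) i \<odot>\<^bsub>M\<^esub> \<phi> i = f i \<odot>\<^bsub>M\<^esub> \<phi> i \<oplus>\<^bsub>M\<^esub> g i \<odot>\<^bsub>M\<^esub> \<phi> i"
        using lsmult_l_distr[OF sub(3)[OF f] sub(3)[OF g]] \<phi> by (auto simp: free_module_def)
    qed
    also have "\<dots> = (\<Oplus>\<^bsub>M\<^esub>i\<in>?S. f i \<odot>\<^bsub>M\<^esub> \<phi> i) \<oplus>\<^bsub>M\<^esub> (\<Oplus>\<^bsub>M\<^esub>i\<in>?S. g i \<odot>\<^bsub>M\<^esub> \<phi> i)"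
      using S(2) \<phi> sub(3)[OF f] sub(3)[OF g] by (intro M.finsum_addf) blast+
    also have "\<dots> = h f \<oplus>\<^bsub>M\<^esub> h g"
      using h[OF f S(1) _ S(2)] h[OF g S(1) _ S(2)] by simp
    finally show "h (f \<oplus>\<^bsub>?F\<^esub> g) = h f \<oplus>\<^bsub>M\<^esub> h g" .
  next
    fix a f assume a: "a \<in> carrier R" and f: "f \<in> carrier ?F"
    have af: "a \<odot>\<^bsub>?F\<^esub> f \<in> carrier ?F" using a f by simp
    have "?s (a \<odot>\<^bsub>?F\<^esub> f) \<subseteq> ?s f" using a by (auto simp: free_module_def)
    then have "h (a \<odot>\<^bsub>?F\<^esub> f) = (\<Oplus>\<^bsub>M\<^esub>i\<in>?s f. (a \<odot>\<^bsub>?F\<^esub> f) i \<odot>\<^bsub>M\<^esub> \<phi> i)"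
      using h af sub[OF f] by blast
    also have "\<dots> = (\<Oplus>\<^bsub>M\<^esub>i\<in>?s f. a \<odot>\<^bsub>M\<^esub> (f i \<odot>\<^bsub>M\<^esub> \<phi> i))"
    proof (rule M.finsum_cong'[OF refl])
      show "(\<lambda>i. a \<odot>\<^bsub>M\<^esub> (f i \<odot>\<^bsub>M\<^esub> \<phi> i)) \<in> ?s f \<rightarrow> carrier M"
        using \<phi> sub[OF f] a by blast
      fix i assume "i \<in> ?s f"
      then have "i \<in> I" using sub[OF f] by blast
      then show "(a \<odot>\<^bsub>?F\<^esub> f) i \<odot>\<^bsub>M\<^esub> \<phi> i = a \<odot>\<^bsub>M\<^esub> (f i \<odot>\<^bsub>M\<^esub> \<phi> i)"
        using lsmult_assoc[OF a sub(3)[OF f]] \<phi> by (auto simp: free_module_def)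
    qed
    also have "\<dots> = a \<odot>\<^bsub>M\<^esub> (\<Oplus>\<^bsub>M\<^esub>i\<in>?s f. f i \<odot>\<^bsub>M\<^esub> \<phi> i)"
      using \<phi> sub[OF f] by (intro lsmult_finsum[symmetric] a) blast
    also have "\<dots> = a \<odot>\<^bsub>M\<^esub> h f"
      using h[OF f sub(2)[OF f] order.refl sub(1)[OF f]] by simp
    finally show "h (a \<odot>\<^bsub>?F\<^esub> f) = a \<odot>\<^bsub>M\<^esub> h f" .
  qed
  moreover have "h (\<lambda>j. if j = i then \<one>\<^bsub>R\<^esub> else \<zero>\<^bsub>R\<^esub>) = \<phi> i" if i: "i \<in> I" for i
  proof -
    let ?e = "\<lambda>j. if j = i then \<one>\<^bsub>R\<^esub> else \<zero>\<^bsub>R\<^esub>"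
    have "?e \<in> carrier ?F"
      using i by (auto simp: free_module_def)
    then have "h ?e = (\<Oplus>\<^bsub>M\<^esub>j\<in>{i}. ?e j \<odot>\<^bsub>M\<^esub> \<phi> j)"
      using i by (intro h) auto
    also have "\<dots> = \<phi> i"
      using funcset_mem[OF \<phi> i] by (subst M.finsum_insert) simp_all
    finally show ?thesis .
  qed
  ultimately show thesis using that by blast
qed

lemma projective_free_module:
  assumes "ring R"
  shows "projective R (free_module R I)"
proof -
  let ?F = "free_module R I"
  interpret F: left_module R ?F by (rule left_module_free_module) fact
  define e where "e = (\<lambda>(x :: 'c \<Rightarrow> 'a) y. if y = x then \<one>\<^bsub>R\<^esub> else \<zero>\<^bsub>R\<^esub>)"
  define b where "b = (\<lambda>(i :: 'c) j. if j = i then \<one>\<^bsub>R\<^esub> else \<zero>\<^bsub>R\<^esub>)"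
  let ?G = "free_module R (carrier ?F)"
  interpret G: left_module R ?G by (rule left_module_free_module) fact
  have b: "b i \<in> carrier ?F" if "i \<in> I" for i
    using that by (auto simp: free_module_def b_def)
  have e: "e x \<in> carrier ?G" if "x \<in> carrier ?F" for x
    using that by (auto simp: free_module_def e_def)
  obtain r where r: "r \<in> module_homs R ?G ?F" "\<And>x. x \<in> carrier ?F \<Longrightarrow> r (e x) = x"
    using F.free_module_extend[of "\<lambda>x. x" "carrier ?F"] by (auto simp: e_def)
  obtain s where s: "s \<in> module_homs R ?F ?G" "\<And>i. i \<in> I \<Longrightarrow> s (b i) = e (b i)"
    using G.free_module_extend[of "\<lambda>i. e (b i)" I] b e by (auto simp: b_def)
  have rs: "r (s x) = x" if "x \<in> carrier ?F" "finite S" "{i. x i \<noteq> \<zero>\<^bsub>R\<^esub>} \<subseteq> S" "S \<subseteq> I" for S x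
    using that(2,1,3,4)
  proof (induction S arbitrary: x rule: finite_induct)
    case empty
    then have "x = \<zero>\<^bsub>?F\<^esub>" by (simp add: free_module_simps fun_eq_iff)
    moreover have "s \<zero>\<^bsub>?F\<^esub> = \<zero>\<^bsub>?G\<^esub>" by (rule module_homs_zero[OF F.left_module_axioms G.left_module_axioms s(1)])
    moreover have "r \<zero>\<^bsub>?G\<^esub> = \<zero>\<^bsub>?F\<^esub>" by (rule module_homs_zero[OF G.left_module_axioms F.left_module_axioms r(1)])
    ultimately show ?case by simp
  next
    case (insert i S)
    define y where "y = x(i := \<zero>\<^bsub>R\<^esub>)"
    have xi: "x i \<in> carrier R" and i: "i \<in> I" using insert by (auto simp: free_module_def)
    have y: "y \<in> carrier ?F"
      using insert.prems by (auto simp: free_module_def y_def elim!: finite_subset[rotated])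
    have "x j \<in> carrier R" for j
      using insert.prems by (cases "j \<in> I") (auto simp: free_module_def)
    then have x: "x = y \<oplus>\<^bsub>?F\<^esub> x i \<odot>\<^bsub>?F\<^esub> b i"
      by (auto simp: free_module_def y_def b_def fun_eq_iff)
    have IH: "r (s y) = y"
      using insert.prems by (intro insert.IH y) (auto simp: y_def)
    have sc: "s z \<in> carrier ?G" if "z \<in> carrier ?F" for z
      using s(1) that by (auto simp: module_homs_def)
    have bi: "b i \<in> carrier ?F" using b i by simp
    have "s x = s y \<oplus>\<^bsub>?G\<^esub> x i \<odot>\<^bsub>?G\<^esub> e (b i)"
      using s(1) s(2)[OF i] y xi bi F.lsmult_closed[OF xi bi]
      by (subst x) (simp add: module_homs_def)
    then have "r (s x) = y \<oplus>\<^bsub>?F\<^esub> x i \<odot>\<^bsub>?F\<^esub> b i"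
      using r(1) r(2)[OF bi] IH sc[OF y] xi e[OF bi] G.lsmult_closed[OF xi e[OF bi]]
      by (simp add: module_homs_def)
    then show ?case using x by simp
  qed
  have "r (s x) = x" if "x \<in> carrier ?F" for x
    by (rule rs[OF that, of "{i. x i \<noteq> \<zero>\<^bsub>R\<^esub>}"]) (use that in \<open>auto simp: free_module_def\<close>)
  then show ?thesis
    unfolding projective_def using r(1) s(1) F.left_module_axioms by blast
qed

lemma (in left_module) free_cover:
  assumes "inj_on \<iota> (carrier M)"
  obtains h where "h \<in> module_homs R (free_module R (\<iota> ` carrier M)) M"
    and "h ` carrier (free_module R (\<iota> ` carrier M)) = carrier M"
proof -
  let ?F = "free_module R (\<iota> ` carrier M)"
  obtain h where h: "h \<in> module_homs R ?F M"
    "\<And>i. i \<in> \<iota> ` carrier M \<Longrightarrow>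
      h (\<lambda>j. if j = i then \<one>\<^bsub>R\<^esub> else \<zero>\<^bsub>R\<^esub>) = inv_into (carrier M) \<iota> i"
    using free_module_extend[of "inv_into (carrier M) \<iota>" "\<iota> ` carrier M"]
    by (metis Pi_I inv_into_into)
  have "y \<in> h ` carrier ?F" if "y \<in> carrier M" for y
    using h(2)[of "\<iota> y"] that assms
    by (intro image_eqI[of _ _ "\<lambda>j. if j = \<iota> y then \<one>\<^bsub>R\<^esub> else \<zero>\<^bsub>R\<^esub>"])
      (auto simp: free_module_def)
  moreover have "h ` carrier ?F \<subseteq> carrier M"
    using h(1) by (auto simp: module_homs_def)
  ultimately show thesis using that h(1) by blast
qed

lemma left_module_kernel:
  assumes "left_module R M" "left_module R N" "g \<in> module_homs R M N"
  shows "left_module R (M\<lparr>carrier := {x \<in> carrier M. g x = \<zero>\<^bsub>N\<^esub>}\<rparr>)"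
proof -
  interpret M: left_module R M by fact
  interpret N: left_module R N by fact
  have add: "g (x \<oplus>\<^bsub>M\<^esub> y) = g x \<oplus>\<^bsub>N\<^esub> g y" if "x \<in> carrier M" "y \<in> carrier M" for x y
    using assms(3) that by (simp add: module_homs_def)
  have smult: "g (a \<odot>\<^bsub>M\<^esub> x) = a \<odot>\<^bsub>N\<^esub> g x" if "a \<in> carrier R" "x \<in> carrier M" for a x
    using assms(3) that by (simp add: module_homs_def)
  have g: "g x \<in> carrier N" if "x \<in> carrier M" for x
    using assms(3) that by (auto simp: module_homs_def)
  have g0: "g \<zero>\<^bsub>M\<^esub> = \<zero>\<^bsub>N\<^esub>" by (rule module_homs_zero[OF assms])
  have gm: "g (\<ominus>\<^bsub>M\<^esub> x) = \<zero>\<^bsub>N\<^esub>" if "x \<in> carrier M" "g x = \<zero>\<^bsub>N\<^esub>" for x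
    using add[of "\<ominus>\<^bsub>M\<^esub> x" x] that g[of "\<ominus>\<^bsub>M\<^esub> x"] g0 by (simp add: M.M.l_neg)
  let ?K = "M\<lparr>carrier := {x \<in> carrier M. g x = \<zero>\<^bsub>N\<^esub>}\<rparr>"
  have "abelian_group ?K"
  proof (rule abelian_groupI)
    show "\<exists>y\<in>carrier ?K. y \<oplus>\<^bsub>?K\<^esub> x = \<zero>\<^bsub>?K\<^esub>" if "x \<in> carrier ?K" for x
      by (rule bexI[of _ "\<ominus>\<^bsub>M\<^esub> x"]) (use that gm in \<open>simp_all add: M.M.l_neg\<close>)
    show "x \<oplus>\<^bsub>?K\<^esub> y \<oplus>\<^bsub>?K\<^esub> z = x \<oplus>\<^bsub>?K\<^esub> (y \<oplus>\<^bsub>?K\<^esub> z)"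
      if "x \<in> carrier ?K" "y \<in> carrier ?K" "z \<in> carrier ?K" for x y z
      using that by (simp add: M.M.a_assoc)
    show "x \<oplus>\<^bsub>?K\<^esub> y = y \<oplus>\<^bsub>?K\<^esub> x" if "x \<in> carrier ?K" "y \<in> carrier ?K" for x y
      using that by (simp add: M.M.a_comm)
  qed (simp_all add: add g0)
  moreover have "left_module_axioms R ?K"
  proof (rule left_module_axioms.intro)
    show "(a \<oplus>\<^bsub>R\<^esub> b) \<odot>\<^bsub>?K\<^esub> x = a \<odot>\<^bsub>?K\<^esub> x \<oplus>\<^bsub>?K\<^esub> b \<odot>\<^bsub>?K\<^esub> x"
      if "a \<in> carrier R" "b \<in> carrier R" "x \<in> carrier ?K" for a b x
      using that by (simp add: M.lsmult_l_distr)
    show "a \<odot>\<^bsub>?K\<^esub> (x \<oplus>\<^bsub>?K\<^esub> y) = a \<odot>\<^bsub>?K\<^esub> x \<oplus>\<^bsub>?K\<^esub> a \<odot>\<^bsub>?K\<^esub> y"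
      if "a \<in> carrier R" "x \<in> carrier ?K" "y \<in> carrier ?K" for a x y
      using that by (simp add: M.lsmult_r_distr)
    show "(a \<otimes>\<^bsub>R\<^esub> b) \<odot>\<^bsub>?K\<^esub> x = a \<odot>\<^bsub>?K\<^esub> (b \<odot>\<^bsub>?K\<^esub> x)"
      if "a \<in> carrier R" "b \<in> carrier R" "x \<in> carrier ?K" for a b x
      using that by (simp add: M.lsmult_assoc)
  qed (simp_all add: smult N.lsmult_r_null)
  ultimately show ?thesis
    using M.R.ring_axioms by (simp add: left_module_def)
qed

lemma kernel_cover:
  fixes \<iota> :: "'b \<Rightarrow> 'i"
  assumes "left_module R (M :: ('a, 'b, 'm) module_scheme)" "left_module R N" "g \<in> module_homs R M N" "inj_on \<iota> (carrier M)"
  shows "\<exists>(J :: 'i set) h. h \<in> module_homs R (free_module R J) M \<and>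
    h ` carrier (free_module R J) = {x \<in> carrier M. g x = \<zero>\<^bsub>N\<^esub>}"
proof -
  let ?K = "M\<lparr>carrier := {x \<in> carrier M. g x = \<zero>\<^bsub>N\<^esub>}\<rparr>"
  interpret K: left_module R ?K by (rule left_module_kernel[OF assms(1-3)])
  have "inj_on \<iota> (carrier ?K)" using assms(4) by (rule inj_on_subset) auto
  then obtain h where "h \<in> module_homs R (free_module R (\<iota> ` carrier ?K)) ?K"
    "h ` carrier (free_module R (\<iota> ` carrier ?K)) = carrier ?K"
    by (rule K.free_cover)
  then have "h \<in> module_homs R (free_module R (\<iota> ` carrier ?K)) M \<and>
      h ` carrier (free_module R (\<iota> ` carrier ?K)) = {x \<in> carrier M. g x = \<zero>\<^bsub>N\<^esub>}"
    by (simp add: module_homs_def PiE_iff)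
  then show ?thesis by blast
qed

text \<open>The choice made in \<^const>\<open>chosen_resolution\<close> is always possible.\<close>

theorem projective_resolution_exists:
  fixes R :: "('a, 'r) ring_scheme" and M :: "('a, 'm, 's) module_scheme"
  assumes M: "left_module R M"
  shows "\<exists>(P :: nat \<Rightarrow> ('a, ('a, 'm) symb \<Rightarrow> 'a) module) d e. projective_resolution R M P d e"
proof -
  interpret M: left_module R M by fact
  have ring: "ring R" by (rule M.R.ring_axioms)
  define F :: "('a, 'm) symb set \<Rightarrow> ('a, ('a, 'm) symb \<Rightarrow> 'a) module" where "F = free_module R"
  have F: "left_module R (F I)" for I
    unfolding F_def by (rule left_module_free_module[OF ring])
  define graph :: "(('a, 'm) symb \<Rightarrow> 'a) \<Rightarrow> (('a, 'm) symb \<times> 'a) set"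
    where "graph = (\<lambda>f. {(i, f i) | i. f i \<noteq> \<zero>\<^bsub>R\<^esub>})"
  define \<iota> where "\<iota> = (\<lambda>f. Syzygy (SOME l. set l = graph f))"
  have inj: "inj_on \<iota> (carrier (F I))" for I
  proof (rule inj_onI)
    fix f g assume fg: "f \<in> carrier (F I)" "g \<in> carrier (F I)" "\<iota> f = \<iota> g"
    have fin: "finite (graph f)" if "f \<in> carrier (F I)" for f
    proof -
      have "graph f = (\<lambda>i. (i, f i)) ` {i. f i \<noteq> \<zero>\<^bsub>R\<^esub>}" by (auto simp: graph_def)
      then show ?thesis using that by (auto simp: F_def free_module_def)
    qed
    have "set (SOME l. set l = graph f) = graph f" if "f \<in> carrier (F I)" for f
      by (rule someI_ex) (use finite_list[OF fin[OF that]] in blast)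
    then have gr: "graph f = graph g"
      using fg by (metis \<iota>_def symb.inject(2))
    show "f = g"
    proof
      fix i
      have "(i, a) \<in> graph f \<longleftrightarrow> (i, a) \<in> graph g" for a by (simp add: gr)
      then show "f i = g i" by (auto simp: graph_def) metis
    qed
  qed
  note cover = kernel_cover[OF F _ _ inj, unfolded F_def[symmetric]]
  obtain I0 e where e: "e \<in> module_homs R (F I0) M" "e ` carrier (F I0) = carrier M"
    using M.free_cover[of Base] unfolding F_def by (metis inj_onI symb.inject(1))
  obtain I1 d0 where d0: "d0 \<in> module_homs R (F I1) (F I0)"
      "d0 ` carrier (F I1) = {x \<in> carrier (F I0). e x = \<zero>\<^bsub>M\<^esub>}"
    using cover[OF M e(1)] by blast
  define ok where "ok = (\<lambda>(I, J, h). h \<in> module_homs R (F J) (F I))"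
  define nxt where "nxt = (\<lambda>(I, J, h) (I', J', h'). I' = J \<and>
    h' ` carrier (F J') = {x \<in> carrier (F J). h x = \<zero>\<^bsub>F I\<^esub>})"
  have "\<exists>y. ok y \<and> nxt x y" if "ok x" for x
  proof -
    obtain I J h where x: "x = (I, J, h)" by (cases x)
    then have "h \<in> module_homs R (F J) (F I)" using that by (simp add: ok_def)
    then obtain J' h' where "h' \<in> module_homs R (F J') (F J)"
      "h' ` carrier (F J') = {x \<in> carrier (F J). h x = \<zero>\<^bsub>F I\<^esub>}"
      using cover[OF F] by blast
    then have "ok (J, J', h') \<and> nxt x (J, J', h')"
      unfolding ok_def nxt_def x by simp
    then show ?thesis by blast
  qed
  moreover have "ok (I0, I1, d0)" using d0 by (simp add: ok_def)
  ultimately obtain f where f: "f 0 = (I0, I1, d0)" "\<And>k. ok (f k)" "\<And>k. nxt (f k) (f (Suc k))"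
    using dependent_nat_choice[of "\<lambda>k x. ok x \<and> (k = 0 \<longrightarrow> x = (I0, I1, d0))" "\<lambda>_. nxt"]
    by (metis (no_types, lifting) nat.distinct(1))
  define P where "P = (\<lambda>k. F (fst (f k)))"
  define d where "d = (\<lambda>k. snd (snd (f k)))"
  have J: "fst (snd (f k)) = fst (f (Suc k))" for k
    using f(3)[of k] by (auto simp: nxt_def split: prod.splits)
  have "d k \<in> module_homs R (P (Suc k)) (P k)" for k
    using f(2)[of k] J[of k] by (auto simp: ok_def P_def d_def split: prod.splits)
  moreover have "{x \<in> carrier (P (Suc k)). d k x = \<zero>\<^bsub>P k\<^esub>} = d (Suc k) ` carrier (P (Suc (Suc k)))" for k
    using f(3)[of k] J[of "Suc k"] by (auto simp: nxt_def P_def d_def split: prod.splits)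
  moreover have "P 0 = F I0" "P 1 = F I1" "d 0 = d0"
    using f(1) J[of 0] by (auto simp: P_def d_def)
  moreover have "projective R (P k)" for k
    unfolding P_def F_def by (rule projective_free_module[OF ring])
  ultimately have "projective_resolution R M P d e"
    using e d0 by (simp add: projective_resolution_def)
  then show ?thesis by blast
qed

subsection \<open>Derived functors\<close>

definition Tor ::
  "(complex, 'a) module \<Rightarrow> ('a, 'n) module \<Rightarrow> ('a, 'm) module \<Rightarrow> nat \<Rightarrow>
    (complex, ('n \<times> (('a, 'm) symb \<Rightarrow> 'a) \<Rightarrow> complex) set set) module"
  where "Tor A N M k = (let (P, d) = chosen_resolution A M in
    homology (\<lambda>j. tensor_product A N (P j)) (\<lambda>j. tensor_map A N (P j) (d j)) k)"

definition Ext ::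
  "(complex, 'a) module \<Rightarrow> ('a, 'm) module \<Rightarrow> ('a, 'n) module \<Rightarrow> nat \<Rightarrow>
    (complex, ((('a, 'm) symb \<Rightarrow> 'a) \<Rightarrow> 'n) set) module"
  where "Ext A M N k = (let (P, d) = chosen_resolution A M in
    cohomology (\<lambda>j. hom_space A (P j) N) (\<lambda>j f. compose (carrier (P (Suc j))) f (d j)) k)"


section \<open>Hochschild homology and cohomology\<close>

record ('u, 'b) bimodule = "'b ring" +
  left_act :: "'u \<Rightarrow> 'b \<Rightarrow> 'b"
  right_act :: "'b \<Rightarrow> 'u \<Rightarrow> 'b"

definition twisted_bimodule :: "('u \<Rightarrow> 'u) \<Rightarrow> (complex, 'u) module \<Rightarrow> ('u, 'u) bimodule"
  where "twisted_bimodule s U =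
    \<lparr>carrier = carrier U, monoid.mult = monoid.mult U, monoid.one = monoid.one U, ring.zero = ring.zero U, ring.add = ring.add U,
     left_act = (\<lambda>a b. s a \<otimes>\<^bsub>U\<^esub> b), right_act = (\<lambda>b c. b \<otimes>\<^bsub>U\<^esub> c)\<rparr>"

abbreviation regular_bimodule :: "(complex, 'u) module \<Rightarrow> ('u, 'u) bimodule"
  where "regular_bimodule \<equiv> twisted_bimodule (\<lambda>a. a)"

text \<open>A bimodule \<open>N\<close> over \<open>U\<close> is a left module over the enveloping algebra \<open>U\<^sup>e\<close> by
  \<open>(a \<otimes> b) n = a n b\<close>, and a right module by \<open>n (a \<otimes> b) = b n a\<close>. An element of \<open>U\<^sup>e\<close> is a
  coset; any of its representatives \<open>f\<close> gives it as the sum of the \<open>f (a, b) a \<otimes> b\<close>.\<close>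

definition env_left :: "(complex, 'u) module \<Rightarrow> ('u, 'b) bimodule \<Rightarrow>
    (('u \<times> 'u \<Rightarrow> complex) set, 'b) module"
  where "env_left U N =
    \<lparr>carrier = carrier N, monoid.mult = monoid.mult N, monoid.one = monoid.one N, ring.zero = ring.zero N, ring.add = ring.add N,
     module.smult = (\<lambda>Y n. let f = (SOME f. f \<in> Y) in
       \<Oplus>\<^bsub>N\<^esub>p\<in>{p. f p \<noteq> 0}. left_act N (f p \<odot>\<^bsub>U\<^esub> fst p) (right_act N n (snd p)))\<rparr>"

definition env_right :: "(complex, 'u) module \<Rightarrow> ('u, 'b) bimodule \<Rightarrow>
    (('u \<times> 'u \<Rightarrow> complex) set, 'b) module"
  where "env_right U N =
    \<lparr>carrier = carrier N, monoid.mult = monoid.mult N, monoid.one = monoid.one N, ring.zero = ring.zero N, ring.add = ring.add N,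
     module.smult = (\<lambda>Y n. let f = (SOME f. f \<in> Y) in
       \<Oplus>\<^bsub>N\<^esub>p\<in>{p. f p \<noteq> 0}. left_act N (snd p) (right_act N n (f p \<odot>\<^bsub>U\<^esub> fst p)))\<rparr>"

definition zero_subspace :: "(complex, 'b) module \<Rightarrow> (complex, 'b) module"
  where "zero_subspace V = V\<lparr>carrier := {\<zero>\<^bsub>V\<^esub>}\<rparr>"

definition hochschild_homology ::
  "(complex, 'u) module \<Rightarrow> ('u, 'b) bimodule \<Rightarrow> int \<Rightarrow>
    (complex, ('b \<times> ((('u \<times> 'u \<Rightarrow> complex) set, 'u) symb \<Rightarrow> ('u \<times> 'u \<Rightarrow> complex) set)
      \<Rightarrow> complex) set set) module"
  where "hochschild_homology U N k =
    (let T = Tor (enveloping_algebra U) (env_right U N) (env_left U (regular_bimodule U))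
     in if k < 0 then zero_subspace (T 0) else T (nat k))"

definition hochschild_cohomology ::
  "(complex, 'u) module \<Rightarrow> ('u, 'b) bimodule \<Rightarrow> int \<Rightarrow>
    (complex, (((('u \<times> 'u \<Rightarrow> complex) set, 'u) symb \<Rightarrow> ('u \<times> 'u \<Rightarrow> complex) set)
      \<Rightarrow> 'b) set) module"
  where "hochschild_cohomology U N k =
    (let E = Ext (enveloping_algebra U) (env_left U (regular_bimodule U)) (env_left U N)
     in if k < 0 then zero_subspace (E 0) else E (nat k))"


section \<open>Quantum affine spaces\<close>

definition mult_skew_symmetric :: "nat \<Rightarrow> (nat \<Rightarrow> nat \<Rightarrow> complex) \<Rightarrow> bool"
  where "mult_skew_symmetric n Q \<longleftrightarrow>
    (\<forall>i\<in>{1..n}. \<forall>j\<in>{1..n}. Q i j * Q j i = 1 \<and> Q i i = 1)"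

definition quantum_relations :: "nat \<Rightarrow> (nat \<Rightarrow> nat \<Rightarrow> complex) \<Rightarrow> (nat list \<Rightarrow> complex) set"
  where "quantum_relations n Q = (let F = monoid_algebra (free_monoid {1..n}) in
    Idl\<^bsub>F\<^esub> {single [i, j] \<ominus>\<^bsub>F\<^esub> Q i j \<odot>\<^bsub>F\<^esub> single [j, i] | i j. i \<in> {1..n} \<and> j \<in> {1..n}})"

definition quantum_space ::
  "nat \<Rightarrow> (nat \<Rightarrow> nat \<Rightarrow> complex) \<Rightarrow> (complex, (nat list \<Rightarrow> complex) set) module"
  where "quantum_space n Q =
    quot_module (monoid_algebra (free_monoid {1..n})) (quantum_relations n Q)"

definition quantum_gen ::
  "nat \<Rightarrow> (nat \<Rightarrow> nat \<Rightarrow> complex) \<Rightarrow> nat \<Rightarrow> (nat list \<Rightarrow> complex) set"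
  where "quantum_gen n Q i =
    quantum_relations n Q +>\<^bsub>monoid_algebra (free_monoid {1..n})\<^esub> single [i]"

end

theory Submission
  imports Defs "HOL-Library.Poly_Mapping"
begin

text \<open>
  Both sides are computed from the Koszul resolution of \<open>U\<close> over its enveloping algebra, which in
  degree \<open>k\<close> is free on the subsets \<open>I\<close> of \<open>{1..n}\<close> with \<open>k\<close> elements. To see that it is exact,
  let \<open>U\<close> act on the space with basis the triples \<open>(\<alpha>, I, \<beta>)\<close>, which stand for the products
  \<open>v\<^sup>\<alpha> e\<^sub>I v\<^sup>\<beta>\<close> divided by suitable products of the \<open>q\<^sub>i\<^sub>j\<close>. In this basis the parameters disappear
  from the differential, so that exactness reduces to the commutative Koszul complex; the same
  action shows that the ordered monomials are linearly independent. Finally \<open>I \<mapsto> {1..n} - I\<close>, with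
  suitable scalars, turns the complex computing the homology with values in the twisted bimodule
  into the one computing the cohomology: the twist \<open>p\<^sub>i\<close> is what moving \<open>v\<^sub>i\<close> past all generators costs.
\<close>

section \<open>Module theory over a possibly noncommutative ring\<close>

subsection \<open>Linear maps\<close>

text \<open>Three features of the definitions shape the proof. \<open>Tor\<close> and
  \<open>Ext\<close> use a resolution picked by Hilbert choice, of which only the defining property
  is known; so uniqueness of projective resolutions is needed with its homotopies. Next,
  \<open>U\<close> and its enveloping algebra are quotients by generated ideals, with no basis at
  hand, and cosets act on bimodules through arbitrary representatives. One device answers both:
  where the generators of an ideal act as zero, so does the whole ideal, and the action descends.
  For bimodules this gives well-definedness; for the Koszul bimodule, whose basis is known
  beforehand, it also gives linear independence. Last, the parameters: a bicharacter
  \<open>chi\<close> with \<open>chi {#i#} {#j#} = Q i j * chi {#j#} {#i#}\<close> makes the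
  normalised monomials multiply by u_\<alpha> u_\<beta> = chi \<alpha> \<beta> u_(\<alpha> +
  \<beta>). All factors then depend on total multidegrees, which the differential preserves, and
  this is why it loses the parameters. In the dual complex left and right multiplication change
  places; what the asymmetry of \<open>chi\<close> leaves over is the twist.\<close>

definition linear_map ::
  "('a, 'r) ring_scheme \<Rightarrow> ('a, 'b, 'm) module_scheme \<Rightarrow> ('a, 'c, 'n) module_scheme \<Rightarrow> ('b \<Rightarrow> 'c) \<Rightarrow> bool"
  where "linear_map R E Y f \<longleftrightarrow> f \<in> carrier E \<rightarrow> carrier Y \<and>
    (\<forall>x\<in>carrier E. \<forall>y\<in>carrier E. f (x \<oplus>\<^bsub>E\<^esub> y) = f x \<oplus>\<^bsub>Y\<^esub> f y) \<and>
    (\<forall>a\<in>carrier R. \<forall>x\<in>carrier E. f (a \<odot>\<^bsub>E\<^esub> x) = a \<odot>\<^bsub>Y\<^esub> f x)"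

lemma linear_mapI:
  assumes "\<And>x. x \<in> carrier E \<Longrightarrow> f x \<in> carrier Y"
    and "\<And>x y. x \<in> carrier E \<Longrightarrow> y \<in> carrier E \<Longrightarrow> f (x \<oplus>\<^bsub>E\<^esub> y) = f x \<oplus>\<^bsub>Y\<^esub> f y"
    and "\<And>a x. a \<in> carrier R \<Longrightarrow> x \<in> carrier E \<Longrightarrow> f (a \<odot>\<^bsub>E\<^esub> x) = a \<odot>\<^bsub>Y\<^esub> f x"
  shows "linear_map R E Y f"
  using assms by (auto simp: linear_map_def)

lemma linear_map_closed: "linear_map R E Y f \<Longrightarrow> x \<in> carrier E \<Longrightarrow> f x \<in> carrier Y"
  by (auto simp: linear_map_def)

lemma linear_map_add:
  "linear_map R E Y f \<Longrightarrow> x \<in> carrier E \<Longrightarrow> y \<in> carrier E \<Longrightarrow> f (x \<oplus>\<^bsub>E\<^esub> y) = f x \<oplus>\<^bsub>Y\<^esub> f y"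
  by (auto simp: linear_map_def)

lemma linear_map_smult:
  "linear_map R E Y f \<Longrightarrow> a \<in> carrier R \<Longrightarrow> x \<in> carrier E \<Longrightarrow> f (a \<odot>\<^bsub>E\<^esub> x) = a \<odot>\<^bsub>Y\<^esub> f x"
  by (auto simp: linear_map_def)

text \<open>Extensionality is all that separates the two notions. Composites and pointwise sums are
  linear but not extensional, so the arguments run with \<open>linear_map\<close>, and
  \<open>restrict\<close> restores extensionality where \<open>module_homs\<close> is asked
  for.\<close>

lemma module_homs_iff: "f \<in> module_homs R E Y \<longleftrightarrow> linear_map R E Y f \<and> f \<in> extensional (carrier E)"
  by (auto simp: module_homs_def linear_map_def PiE_def)

lemma module_homs_linear: "f \<in> module_homs R E Y \<Longrightarrow> linear_map R E Y f"
  by (simp add: module_homs_iff)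

lemma linear_map_cong:
  assumes "left_module R E" "\<And>x. x \<in> carrier E \<Longrightarrow> f x = g x"
  shows "linear_map R E Y f \<longleftrightarrow> linear_map R E Y g"
proof -
  interpret E: left_module R E by fact
  show ?thesis using assms(2) by (auto simp: linear_map_def Pi_def)
qed

lemma restrict_in_module_homs:
  assumes "left_module R E" "linear_map R E Y f"
  shows "restrict f (carrier E) \<in> module_homs R E Y"
  unfolding module_homs_iff using assms(2) linear_map_cong[OF assms(1), of "restrict f (carrier E)" f Y]
  by simp

lemma linear_map_zero:
  assumes "left_module R E" "left_module R Y" "linear_map R E Y f"
  shows "f \<zero>\<^bsub>E\<^esub> = \<zero>\<^bsub>Y\<^esub>"
proof -
  interpret E: left_module R E by fact
  have "restrict f (carrier E) \<zero>\<^bsub>E\<^esub> = \<zero>\<^bsub>Y\<^esub>"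
    by (rule module_homs_zero[OF assms(1,2) restrict_in_module_homs[OF assms(1,3)]])
  then show ?thesis by simp
qed

lemma linear_map_minus:
  assumes "left_module R E" "left_module R Y" "linear_map R E Y f" "x \<in> carrier E" "y \<in> carrier E"
  shows "f (\<ominus>\<^bsub>E\<^esub> x) = \<ominus>\<^bsub>Y\<^esub> f x" "f (x \<ominus>\<^bsub>E\<^esub> y) = f x \<ominus>\<^bsub>Y\<^esub> f y"
proof -
  interpret E: left_module R E by fact
  interpret Y: left_module R Y by fact
  have neg: "f (\<ominus>\<^bsub>E\<^esub> z) = \<ominus>\<^bsub>Y\<^esub> f z" if z: "z \<in> carrier E" for z
  proof -
    have "f (\<ominus>\<^bsub>E\<^esub> z) \<oplus>\<^bsub>Y\<^esub> f z = \<zero>\<^bsub>Y\<^esub>"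
      using linear_map_add[OF assms(3), of "\<ominus>\<^bsub>E\<^esub> z" z] linear_map_zero[OF assms(1-3)] z
      by (simp add: E.M.l_neg)
    then show ?thesis
      using linear_map_closed[OF assms(3)] z by (simp add: Y.M.minus_equality)
  qed
  show "f (\<ominus>\<^bsub>E\<^esub> x) = \<ominus>\<^bsub>Y\<^esub> f x" by (rule neg) fact
  show "f (x \<ominus>\<^bsub>E\<^esub> y) = f x \<ominus>\<^bsub>Y\<^esub> f y"
    using neg assms(4,5) linear_map_add[OF assms(3)] by (simp add: E.M.minus_eq Y.M.minus_eq)
qed

lemma linear_map_finsum:
  assumes "left_module R E" "left_module R Y" "linear_map R E Y f" "g \<in> S \<rightarrow> carrier E"
  shows "f (\<Oplus>\<^bsub>E\<^esub>i\<in>S. g i) = (\<Oplus>\<^bsub>Y\<^esub>i\<in>S. f (g i))"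
proof -
  interpret E: left_module R E by fact
  interpret Y: left_module R Y by fact
  show ?thesis
    using assms(4)
  proof (induction S rule: infinite_finite_induct)
    case (infinite S)
    then show ?case using linear_map_zero[OF assms(1-3)] by simp
  next
    case empty
    then show ?case using linear_map_zero[OF assms(1-3)] by simp
  next
    case (insert i S)
    then have "g \<in> S \<rightarrow> carrier E" "g i \<in> carrier E" by auto
    moreover from this have "(\<lambda>i. f (g i)) \<in> S \<rightarrow> carrier Y" "f (g i) \<in> carrier Y"
      using linear_map_closed[OF assms(3)] by auto
    ultimately show ?case
      using insert linear_map_add[OF assms(3)] by simp
  qed
qed

lemma linear_map_compose:
  "linear_map R E Y f \<Longrightarrow> linear_map R Y Z g \<Longrightarrow> linear_map R E Z (\<lambda>x. g (f x))"
  by (auto simp: linear_map_def Pi_def)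

lemma linear_map_plus:
  assumes "left_module R Y" "linear_map R E Y f" "linear_map R E Y g"
  shows "linear_map R E Y (\<lambda>x. f x \<oplus>\<^bsub>Y\<^esub> g x)"
proof -
  interpret Y: left_module R Y by fact
  show ?thesis
    by (rule linear_mapI)
      (use assms(2,3) in \<open>auto simp: linear_map_def Pi_iff Y.M.a_ac Y.lsmult_r_distr\<close>)
qed

text \<open>Over a noncommutative ring a scalar multiple of a linear map need not be linear. The
  negative is, since negation commutes with every scalar by distributivity.\<close>

lemma linear_map_uminus:
  assumes "left_module R Y" "linear_map R E Y f"
  shows "linear_map R E Y (\<lambda>x. \<ominus>\<^bsub>Y\<^esub> f x)"
proof -
  interpret Y: left_module R Y by fact
  have "\<ominus>\<^bsub>Y\<^esub> (a \<odot>\<^bsub>Y\<^esub> y) = a \<odot>\<^bsub>Y\<^esub> (\<ominus>\<^bsub>Y\<^esub> y)" if "a \<in> carrier R" "y \<in> carrier Y" for a y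
  proof (rule Y.M.minus_equality)
    show "a \<odot>\<^bsub>Y\<^esub> (\<ominus>\<^bsub>Y\<^esub> y) \<oplus>\<^bsub>Y\<^esub> a \<odot>\<^bsub>Y\<^esub> y = \<zero>\<^bsub>Y\<^esub>"
      using that Y.lsmult_r_distr[of a "\<ominus>\<^bsub>Y\<^esub> y" y] by (simp add: Y.M.l_neg Y.lsmult_r_null)
  qed (use that in simp_all)
  then show ?thesis
    by (intro linear_mapI) (use assms(2) in \<open>auto simp: linear_map_def Pi_iff Y.M.minus_add\<close>)
qed

lemma linear_map_diff:
  assumes "left_module R Y" "linear_map R E Y f" "linear_map R E Y g"
  shows "linear_map R E Y (\<lambda>x. f x \<ominus>\<^bsub>Y\<^esub> g x)"
  unfolding a_minus_def using linear_map_plus[OF assms(1,2) linear_map_uminus[OF assms(1,3)]] .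

lemma linear_map_id: "linear_map R E E (\<lambda>x. x)"
  by (auto simp: linear_map_def)

subsection \<open>Submodules and quotients\<close>

context left_module
begin

lemma minus_zero_right [simp]: "x \<in> carrier M \<Longrightarrow> x \<ominus>\<^bsub>M\<^esub> \<zero>\<^bsub>M\<^esub> = x"
  using M.add.inv_one by (simp add: M.minus_eq)

lemma minus_eq_zero_iff:
  "x \<in> carrier M \<Longrightarrow> y \<in> carrier M \<Longrightarrow> x \<ominus>\<^bsub>M\<^esub> y = \<zero>\<^bsub>M\<^esub> \<longleftrightarrow> x = y"
  by (metis M.a_inv_closed M.minus_eq M.minus_minus M.minus_equality M.r_neg)

lemma submodule_leftI:
  assumes "H \<subseteq> carrier M" "\<zero>\<^bsub>M\<^esub> \<in> H"
    and "\<And>a b. a \<in> H \<Longrightarrow> b \<in> H \<Longrightarrow> a \<oplus>\<^bsub>M\<^esub> b \<in> H"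
    and "\<And>a x. a \<in> carrier R \<Longrightarrow> x \<in> H \<Longrightarrow> a \<odot>\<^bsub>M\<^esub> x \<in> H"
  shows "submodule H R M"
proof -
  \<comment> \<open>Negation is the action of -1, so closure under it follows from closure under
    scalars.\<close>
  have "\<ominus>\<^bsub>M\<^esub> x = (\<ominus>\<^bsub>R\<^esub> \<one>\<^bsub>R\<^esub>) \<odot>\<^bsub>M\<^esub> x" if "x \<in> carrier M" for x
  proof (rule M.minus_equality)
    show "(\<ominus>\<^bsub>R\<^esub> \<one>\<^bsub>R\<^esub>) \<odot>\<^bsub>M\<^esub> x \<oplus>\<^bsub>M\<^esub> x = \<zero>\<^bsub>M\<^esub>"
      using lsmult_l_distr[of "\<ominus>\<^bsub>R\<^esub> \<one>\<^bsub>R\<^esub>" "\<one>\<^bsub>R\<^esub>" x] that by (simp add: R.l_neg lsmult_l_null)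
  qed (use that in simp_all)
  then have "\<ominus>\<^bsub>M\<^esub> x \<in> H" if "x \<in> H" for x using that assms(1,4) by auto
  then show ?thesis
    using assms unfolding submodule_def submodule_axioms_def subgroup_def
    by (auto simp: a_inv_def)
qed

lemma submodule_leftD:
  assumes "submodule H R M"
  shows "H \<subseteq> carrier M" "\<zero>\<^bsub>M\<^esub> \<in> H"
    "\<And>a b. a \<in> H \<Longrightarrow> b \<in> H \<Longrightarrow> a \<oplus>\<^bsub>M\<^esub> b \<in> H"
    "\<And>a. a \<in> H \<Longrightarrow> \<ominus>\<^bsub>M\<^esub> a \<in> H"
    "\<And>a b. a \<in> H \<Longrightarrow> b \<in> H \<Longrightarrow> a \<ominus>\<^bsub>M\<^esub> b \<in> H"
    "\<And>a x. a \<in> carrier R \<Longrightarrow> x \<in> H \<Longrightarrow> a \<odot>\<^bsub>M\<^esub> x \<in> H"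
  using assms unfolding submodule_def submodule_axioms_def subgroup_def
  by (auto simp: a_inv_def a_minus_def)

lemma left_module_sub:
  assumes "submodule H R M"
  shows "left_module R (M\<lparr>carrier := H\<rparr>)"
proof -
  note H = submodule_leftD[OF assms]
  have "abelian_group (M\<lparr>carrier := H\<rparr>)"
  proof (rule abelian_groupI)
    show "\<exists>y\<in>carrier (M\<lparr>carrier := H\<rparr>). y \<oplus>\<^bsub>M\<lparr>carrier := H\<rparr>\<^esub> x = \<zero>\<^bsub>M\<lparr>carrier := H\<rparr>\<^esub>"
      if "x \<in> carrier (M\<lparr>carrier := H\<rparr>)" for x
      by (rule bexI[of _ "\<ominus>\<^bsub>M\<^esub> x"]) (use that H in \<open>auto simp: M.l_neg\<close>)
  qed (use H in \<open>auto simp: subset_iff M.a_ac\<close>)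
  then show ?thesis
    using H R.ring_axioms
    by (auto simp: left_module_def left_module_axioms_def subset_iff lsmult_l_distr
      lsmult_r_distr lsmult_assoc)
qed

lemma submodule_abelian_subgroup:
  assumes "submodule H R M"
  shows "abelian_subgroup H M"
  using assms M.abelian_group_axioms
  by (intro abelian_subgroupI3 additive_subgroup.intro) (auto simp: submodule_def)

end

lemma linear_map_image_submodule:
  assumes "left_module R E" "left_module R Y" "linear_map R E Y f"
  shows "submodule (f ` carrier E) R Y"
proof -
  interpret E: left_module R E by fact
  interpret Y: left_module R Y by fact
  show ?thesis
  proof (rule Y.submodule_leftI)
    show "\<zero>\<^bsub>Y\<^esub> \<in> f ` carrier E"
      using linear_map_zero[OF assms] by (metis E.M.zero_closed imageI)
  next
    show "a \<oplus>\<^bsub>Y\<^esub> b \<in> f ` carrier E" if "a \<in> f ` carrier E" "b \<in> f ` carrier E" for a b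
      using that linear_map_add[OF assms(3), symmetric] by auto
    show "a \<odot>\<^bsub>Y\<^esub> b \<in> f ` carrier E" if "a \<in> carrier R" "b \<in> f ` carrier E" for a b
      using that linear_map_smult[OF assms(3), symmetric] by auto
  qed (use linear_map_closed[OF assms(3)] in auto)
qed

lemma linear_map_kernel_submodule:
  assumes "left_module R E" "left_module R Y" "linear_map R E Y f"
  shows "submodule {x \<in> carrier E. f x = \<zero>\<^bsub>Y\<^esub>} R E"
proof -
  interpret E: left_module R E by fact
  interpret Y: left_module R Y by fact
  show ?thesis
    by (rule E.submodule_leftI)
      (use assms(3) linear_map_zero[OF assms] in \<open>auto simp: linear_map_def Y.lsmult_r_null\<close>)
qed

lemma quot_module_simps:
  "carrier (quot_module E W) = (\<lambda>x. W +>\<^bsub>E\<^esub> x) ` carrier E"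
  "\<zero>\<^bsub>quot_module E W\<^esub> = W"
  by (auto simp: quot_module_def FactRing_simps A_RCOSETS_def')

context
  fixes R :: "('a, 'r) ring_scheme" and E :: "('a, 'b, 'm) module_scheme" and W
  assumes E: "left_module R E" and W: "submodule W R E"
begin

interpretation E: left_module R E by (rule E)
interpretation W: abelian_subgroup W E by (rule E.submodule_abelian_subgroup[OF W])

lemma quot_module_zero: "\<zero>\<^bsub>quot_module E W\<^esub> = W +>\<^bsub>E\<^esub> \<zero>\<^bsub>E\<^esub>"
  by (simp add: quot_module_simps E.M.a_coset_add_zero[OF W.a_subset])

lemma quot_module_add:
  "x \<in> carrier E \<Longrightarrow> y \<in> carrier E \<Longrightarrow>
    (W +>\<^bsub>E\<^esub> x) \<oplus>\<^bsub>quot_module E W\<^esub> (W +>\<^bsub>E\<^esub> y) = W +>\<^bsub>E\<^esub> (x \<oplus>\<^bsub>E\<^esub> y)"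
  by (simp add: quot_module_def FactRing_simps W.a_rcos_sum)

lemma mem_coset_iff:
  "x \<in> carrier E \<Longrightarrow> y \<in> W +>\<^bsub>E\<^esub> x \<longleftrightarrow> y \<in> carrier E \<and> y \<ominus>\<^bsub>E\<^esub> x \<in> W"
  using W.a_rcos_module_minus[of x y] W.a_elemrcos_carrier[of x y] E.M.abelian_group_axioms E.M.minus_eq
  by (metis W.a_rcos_module)

lemma coset_eq_iff:
  "x \<in> carrier E \<Longrightarrow> y \<in> carrier E \<Longrightarrow> W +>\<^bsub>E\<^esub> x = W +>\<^bsub>E\<^esub> y \<longleftrightarrow> x \<ominus>\<^bsub>E\<^esub> y \<in> W"
  using mem_coset_iff[of y x] W.a_repr_independence'[of x y] W.a_repr_independenceD[of x y] by blast

lemma coset_self: "x \<in> carrier E \<Longrightarrow> x \<in> W +>\<^bsub>E\<^esub> x"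
  by (simp add: W.a_rcos_self)

text \<open>Scalar multiplication in \<open>quot_module\<close> and the map
  \<open>tensor_map\<close> are encoded as unions over all representatives. A coset is nonempty, so
  the union of a family that is constant on it is that constant.\<close>

lemma quot_module_UN:
  assumes x: "x \<in> carrier E" and h: "\<And>y. y \<in> carrier E \<Longrightarrow> y \<ominus>\<^bsub>E\<^esub> x \<in> W \<Longrightarrow> h y = h x"
  shows "(\<Union>y\<in>W +>\<^bsub>E\<^esub> x. h y) = h x"
  using coset_self[OF x] h mem_coset_iff[OF x] by blast

lemma quot_module_smult:
  assumes c: "c \<in> carrier R" and x: "x \<in> carrier E"
  shows "c \<odot>\<^bsub>quot_module E W\<^esub> (W +>\<^bsub>E\<^esub> x) = W +>\<^bsub>E\<^esub> (c \<odot>\<^bsub>E\<^esub> x)"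
proof -
  have "W +>\<^bsub>E\<^esub> (c \<odot>\<^bsub>E\<^esub> y) = W +>\<^bsub>E\<^esub> (c \<odot>\<^bsub>E\<^esub> x)" if y: "y \<in> carrier E" "y \<ominus>\<^bsub>E\<^esub> x \<in> W" for y
  proof -
    have l: "linear_map R E E (\<lambda>y. y)" by (rule linear_map_id)
    have "c \<odot>\<^bsub>E\<^esub> (\<ominus>\<^bsub>E\<^esub> x) \<oplus>\<^bsub>E\<^esub> c \<odot>\<^bsub>E\<^esub> x = \<zero>\<^bsub>E\<^esub>"
      using E.lsmult_r_distr[of c "\<ominus>\<^bsub>E\<^esub> x" x] c x by (simp add: E.M.l_neg E.lsmult_r_null)
    then have "c \<odot>\<^bsub>E\<^esub> (\<ominus>\<^bsub>E\<^esub> x) = \<ominus>\<^bsub>E\<^esub> (c \<odot>\<^bsub>E\<^esub> x)"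
      using c x by (simp add: E.M.minus_equality)
    then have "c \<odot>\<^bsub>E\<^esub> y \<ominus>\<^bsub>E\<^esub> c \<odot>\<^bsub>E\<^esub> x = c \<odot>\<^bsub>E\<^esub> (y \<ominus>\<^bsub>E\<^esub> x)"
      using c x y by (simp add: E.M.minus_eq E.lsmult_r_distr)
    then show ?thesis
      using E.submodule_leftD(6)[OF W c y(2)] c x y by (simp add: coset_eq_iff)
  qed
  from quot_module_UN[OF x, of "\<lambda>y. W +>\<^bsub>E\<^esub> (c \<odot>\<^bsub>E\<^esub> y)", OF this] show ?thesis by (simp add: quot_module_def)
qed

lemma left_module_quot: "left_module R (quot_module E W)"
proof -
  note simps = quot_module_simps(1) quot_module_zero quot_module_add quot_module_smult
  have "abelian_group (quot_module E W)"
  proof (rule abelian_groupI)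
    show "\<exists>y\<in>carrier (quot_module E W). y \<oplus>\<^bsub>quot_module E W\<^esub> x = \<zero>\<^bsub>quot_module E W\<^esub>"
      if x: "x \<in> carrier (quot_module E W)" for x
    proof -
      obtain z where z: "z \<in> carrier E" "x = W +>\<^bsub>E\<^esub> z" using x by (auto simp: simps)
      show ?thesis
        by (rule bexI[of _ "W +>\<^bsub>E\<^esub> (\<ominus>\<^bsub>E\<^esub> z)"]) (use z in \<open>simp_all add: simps E.M.l_neg\<close>)
    qed
  qed (auto simp: simps E.M.a_ac)
  then show ?thesis
    using E.R.ring_axioms
    by (auto simp: left_module_def left_module_axioms_def simps E.lsmult_l_distr
      E.lsmult_r_distr E.lsmult_assoc)
qed

lemma linear_map_coset: "linear_map R E (quot_module E W) (\<lambda>x. W +>\<^bsub>E\<^esub> x)"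
  by (rule linear_mapI) (auto simp: quot_module_simps(1) quot_module_add quot_module_smult)

lemma quot_module_factor:
  assumes Y: "left_module R Y" and f: "linear_map R E Y f" and f0: "\<And>x. x \<in> W \<Longrightarrow> f x = \<zero>\<^bsub>Y\<^esub>"
  obtains g where "linear_map R (quot_module E W) Y g"
    and "\<And>x. x \<in> carrier E \<Longrightarrow> g (W +>\<^bsub>E\<^esub> x) = f x"
proof -
  interpret Y: left_module R Y by fact
  define g where "g = (\<lambda>Z. f (SOME x. x \<in> carrier E \<and> Z = W +>\<^bsub>E\<^esub> x))"
  have g: "g (W +>\<^bsub>E\<^esub> x) = f x" if x: "x \<in> carrier E" for x
  proof -
    let ?y = "SOME y. y \<in> carrier E \<and> W +>\<^bsub>E\<^esub> x = W +>\<^bsub>E\<^esub> y"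
    have y: "?y \<in> carrier E \<and> W +>\<^bsub>E\<^esub> x = W +>\<^bsub>E\<^esub> ?y"
      by (rule someI[of "\<lambda>y. y \<in> carrier E \<and> W +>\<^bsub>E\<^esub> x = W +>\<^bsub>E\<^esub> y" x]) (use x in simp)
    then have "f (x \<ominus>\<^bsub>E\<^esub> ?y) = \<zero>\<^bsub>Y\<^esub>" using x f0 coset_eq_iff by blast
    then have "f x \<ominus>\<^bsub>Y\<^esub> f ?y = \<zero>\<^bsub>Y\<^esub>" using linear_map_minus(2)[OF E Y f x, of ?y] y by simp
    then show ?thesis
      unfolding g_def using y x linear_map_closed[OF f] by (simp add: Y.minus_eq_zero_iff)
  qed
  moreover have "linear_map R (quot_module E W) Y g"
    by (rule linear_mapI)
      (use f in \<open>auto simp: quot_module_simps(1) quot_module_add quot_module_smult g linear_map_def\<close>)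
  ultimately show thesis using that by blast
qed

end

subsection \<open>Isomorphisms of quotients\<close>

text \<open>A relation that is symmetric and transitive over any ring, so that comparisons can be
  chained; it is turned into \<open>vector_space_iso\<close> only at the very end.\<close>

definition module_iso ::
  "('a, 'r) ring_scheme \<Rightarrow> ('a, 'b, 'm) module_scheme \<Rightarrow> ('a, 'c, 'n) module_scheme \<Rightarrow> bool"
  where "module_iso R E Y \<longleftrightarrow> left_module R E \<and> left_module R Y \<and>
    (\<exists>f. linear_map R E Y f \<and> bij_betw f (carrier E) (carrier Y))"

lemma module_isoI:
  assumes "left_module R E" "left_module R Y" "linear_map R E Y f" "linear_map R Y E g"
    and "\<And>x. x \<in> carrier E \<Longrightarrow> g (f x) = x" "\<And>y. y \<in> carrier Y \<Longrightarrow> f (g y) = y"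
  shows "module_iso R E Y"
  unfolding module_iso_def
  by (intro conjI exI[of _ f] assms(1-3) bij_betw_byWitness[of _ g]) (use assms in \<open>auto simp: linear_map_def\<close>)

lemma module_iso_sym:
  assumes "module_iso R E Y"
  shows "module_iso R Y E"
proof -
  obtain f where XY: "left_module R E" "left_module R Y"
    and f: "linear_map R E Y f" "bij_betw f (carrier E) (carrier Y)"
    using assms by (auto simp: module_iso_def)
  interpret E: left_module R E by fact
  interpret Y: left_module R Y by fact
  let ?g = "inv_into (carrier E) f"
  have g: "?g y \<in> carrier E" "f (?g y) = y" if "y \<in> carrier Y" for y
    using that f(2) by (auto simp: bij_betw_def inv_into_into f_inv_into_f)
  have gf: "?g (f x) = x" if "x \<in> carrier E" for x
    using that f(2) by (auto simp: bij_betw_def inv_into_f_f)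
  have "linear_map R Y E ?g"
  proof (rule linear_mapI)
    show "?g (x \<oplus>\<^bsub>Y\<^esub> y) = ?g x \<oplus>\<^bsub>E\<^esub> ?g y" if "x \<in> carrier Y" "y \<in> carrier Y" for x y
      using gf[of "?g x \<oplus>\<^bsub>E\<^esub> ?g y"] g that linear_map_add[OF f(1), of "?g x" "?g y"] by simp
    show "?g (a \<odot>\<^bsub>Y\<^esub> y) = a \<odot>\<^bsub>E\<^esub> ?g y" if "a \<in> carrier R" "y \<in> carrier Y" for a y
      using gf[of "a \<odot>\<^bsub>E\<^esub> ?g y"] g that linear_map_smult[OF f(1), of a "?g y"] by simp
  qed (use g in auto)
  then show ?thesis
    using module_isoI[OF XY(2,1) _ f(1)] g gf by blast
qed

lemma module_iso_trans:
  assumes "module_iso R E Y" "module_iso R Y Z"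
  shows "module_iso R E Z"
  using assms unfolding module_iso_def
  by (meson linear_map_compose bij_betw_trans[unfolded comp_def])

text \<open>The criterion by which homotopy equivalences are seen to induce isomorphisms of homology:
  \<open>E\<close>, \<open>Y\<close> are spaces of cycles and \<open>V\<close>, \<open>W\<close> the boundaries in them.\<close>

lemma module_iso_quot:
  assumes E: "left_module R E" and V: "submodule V R E"
    and Y: "left_module R Y" and W: "submodule W R Y"
    and f: "linear_map R E Y f" and fV: "\<And>x. x \<in> V \<Longrightarrow> f x \<in> W"
    and g: "linear_map R Y E g" and gW: "\<And>y. y \<in> W \<Longrightarrow> g y \<in> V"
    and gf: "\<And>x. x \<in> carrier E \<Longrightarrow> x \<ominus>\<^bsub>E\<^esub> g (f x) \<in> V"
    and fg: "\<And>y. y \<in> carrier Y \<Longrightarrow> y \<ominus>\<^bsub>Y\<^esub> f (g y) \<in> W"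
  shows "module_iso R (quot_module E V) (quot_module Y W)"
proof -
  interpret E: left_module R E by fact
  interpret Y: left_module R Y by fact
  interpret V: left_module R "quot_module E V" by (rule left_module_quot[OF E V])
  interpret W: left_module R "quot_module Y W" by (rule left_module_quot[OF Y W])
  note cl = linear_map_closed[OF f] linear_map_closed[OF g]
  have coset0: "H +>\<^bsub>Z\<^esub> x = \<zero>\<^bsub>quot_module Z H\<^esub>" if "left_module R Z" "submodule H R Z" "x \<in> H"
    for Z :: "('a, 'z, 'y) module_scheme" and x H
  proof -
    interpret Z: left_module R Z by fact
    have "x \<in> carrier Z" using Z.submodule_leftD(1)[OF that(2)] that(3) by auto
    then show ?thesis
      using coset_eq_iff[OF that(1,2), of x "\<zero>\<^bsub>Z\<^esub>"] quot_module_zero[OF that(1,2)] that(3)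
      by simp
  qed
  obtain f' where f': "linear_map R (quot_module E V) (quot_module Y W) f'"
      "\<And>x. x \<in> carrier E \<Longrightarrow> f' (V +>\<^bsub>E\<^esub> x) = W +>\<^bsub>Y\<^esub> f x"
    by (rule quot_module_factor[OF E V W.left_module_axioms
        linear_map_compose[OF f linear_map_coset[OF Y W]]])
      (rule coset0[OF Y W fV], assumption, blast)
  obtain g' where g': "linear_map R (quot_module Y W) (quot_module E V) g'"
      "\<And>x. x \<in> carrier Y \<Longrightarrow> g' (W +>\<^bsub>Y\<^esub> x) = V +>\<^bsub>E\<^esub> g x"
    by (rule quot_module_factor[OF Y W V.left_module_axioms
        linear_map_compose[OF g linear_map_coset[OF E V]]])
      (rule coset0[OF E V gW], assumption, blast)
  show ?thesis
  proof (rule module_isoI[OF V.left_module_axioms W.left_module_axioms f'(1) g'(1)])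
    show "g' (f' Z) = Z" if Z: "Z \<in> carrier (quot_module E V)" for Z
    proof -
      obtain x where x: "x \<in> carrier E" "Z = V +>\<^bsub>E\<^esub> x" using Z by (auto simp: quot_module_simps)
      then have "g' (f' Z) = V +>\<^bsub>E\<^esub> g (f x)" using cl by (simp add: f'(2) g'(2))
      also have "\<dots> = Z" unfolding x(2) using gf x(1) cl by (subst eq_commute, subst coset_eq_iff[OF E V]) auto
      finally show ?thesis .
    qed
    show "f' (g' Z) = Z" if Z: "Z \<in> carrier (quot_module Y W)" for Z
    proof -
      obtain x where x: "x \<in> carrier Y" "Z = W +>\<^bsub>Y\<^esub> x" using Z by (auto simp: quot_module_simps)
      then have "f' (g' Z) = W +>\<^bsub>Y\<^esub> f (g x)" using cl by (simp add: f'(2) g'(2))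
      also have "\<dots> = Z" unfolding x(2) using fg x(1) cl by (subst eq_commute, subst coset_eq_iff[OF Y W]) auto
      finally show ?thesis .
    qed
  qed
qed

subsection \<open>Free and projective modules\<close>

definition basis_vec :: "('a, 'r) ring_scheme \<Rightarrow> 'i \<Rightarrow> 'i \<Rightarrow> 'a"
  where "basis_vec R i = (\<lambda>j. if j = i then \<one>\<^bsub>R\<^esub> else \<zero>\<^bsub>R\<^esub>)"

lemma basis_vec_closed: "ring R \<Longrightarrow> i \<in> I \<Longrightarrow> basis_vec R i \<in> carrier (free_module R I)"
  by (auto simp: free_module_simps basis_vec_def ring.ring_simprules)

lemma free_module_val: "ring R \<Longrightarrow> f \<in> carrier (free_module R I) \<Longrightarrow> f i \<in> carrier R"
  by (cases "i \<in> I") (auto simp: free_module_simps ring.ring_simprules)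

lemma free_module_induct [consumes 2, case_names zero step]:
  assumes R: "ring R" and f: "f \<in> carrier (free_module R I)"
    and zero: "P \<zero>\<^bsub>free_module R I\<^esub>"
    and step: "\<And>f i a. f \<in> carrier (free_module R I) \<Longrightarrow> P f \<Longrightarrow> i \<in> I \<Longrightarrow> a \<in> carrier R \<Longrightarrow>
      P (f \<oplus>\<^bsub>free_module R I\<^esub> a \<odot>\<^bsub>free_module R I\<^esub> basis_vec R i)"
  shows "P f"
proof -
  interpret R: ring R by fact
  have "P f" if "finite S" "f \<in> carrier (free_module R I)" "{i. f i \<noteq> \<zero>\<^bsub>R\<^esub>} \<subseteq> S" "S \<subseteq> I" for S f
    using that
  proof (induction S arbitrary: f rule: finite_induct)
    case empty
    then have "f = \<zero>\<^bsub>free_module R I\<^esub>" by (auto simp: free_module_simps)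
    then show ?case using zero by simp
  next
    case (insert i S)
    let ?g = "f(i := \<zero>\<^bsub>R\<^esub>)"
    have g: "?g \<in> carrier (free_module R I)"
      using insert.prems by (auto simp: free_module_simps elim!: finite_subset[rotated])
    have "P ?g"
      by (rule insert.IH[OF g]) (use insert.prems in auto)
    moreover have "f = ?g \<oplus>\<^bsub>free_module R I\<^esub> f i \<odot>\<^bsub>free_module R I\<^esub> basis_vec R i"
      using free_module_val[OF R insert.prems(1)]
      by (auto simp: free_module_simps basis_vec_def fun_eq_iff)
    ultimately show ?case
      using step[OF g, of i "f i"] insert.prems free_module_val[OF R insert.prems(1)] by simp
  qed
  from this[of "{i. f i \<noteq> \<zero>\<^bsub>R\<^esub>}" f] show ?thesis
    using f by (auto simp: free_module_simps)
qed

lemma free_module_map_eq: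
  assumes "ring R" "left_module R Y"
    and f: "linear_map R (free_module R I) Y f" and g: "linear_map R (free_module R I) Y g"
    and eq: "\<And>i. i \<in> I \<Longrightarrow> f (basis_vec R i) = g (basis_vec R i)"
    and "x \<in> carrier (free_module R I)"
  shows "f x = g x"
proof -
  interpret F: left_module R "free_module R I" by (rule left_module_free_module[OF assms(1)])
  note Fm = F.left_module_axioms
  show ?thesis using assms(1,6)
  proof (induction rule: free_module_induct)
    case zero
    show ?case using linear_map_zero[OF Fm assms(2)] f g by metis
  next
    case (step h i a)
    then have i: "i \<in> I" and a: "a \<in> carrier R" by auto
    have b: "basis_vec R i \<in> carrier (free_module R I)"
      by (rule basis_vec_closed[OF assms(1) i])
    show ?case
      using step b eq[OF i] F.lsmult_closed[OF a b]
      by (simp add: linear_map_add[OF f] linear_map_add[OF g] linear_map_smult[OF f] linear_map_smult[OF g])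
  qed
qed

lemma free_module_hom:
  assumes "left_module R Y" "\<phi> \<in> I \<rightarrow> carrier Y"
  obtains h where "h \<in> module_homs R (free_module R I) Y"
    and "\<And>i. i \<in> I \<Longrightarrow> h (basis_vec R i) = \<phi> i"
  using left_module.free_module_extend[OF assms] unfolding basis_vec_def by blast

lemma projective_left_module: "projective R P \<Longrightarrow> left_module R P"
  by (simp add: projective_def)

text \<open>\<open>projective\<close> means retract of a free module. On the free module a lift is
  obtained by choosing preimages for the images of the basis vectors; precomposing it with the
  section \<open>s\<close> gives the lift on \<open>P\<close>.\<close>

lemma projective_lift:
  fixes P :: "('a, 'p, 'm) module_scheme"
  assumes P: "projective R P" and E: "left_module R E" and Y: "left_module R Y"
    and p: "linear_map R E Y p" and f: "linear_map R P Y f"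
    and sub: "\<And>x. x \<in> carrier P \<Longrightarrow> f x \<in> p ` carrier E"
  obtains h where "h \<in> module_homs R P E" "\<And>x. x \<in> carrier P \<Longrightarrow> p (h x) = f x"
proof -
  interpret P: left_module R P by (rule projective_left_module[OF P])
  obtain I :: "'p set" and s r where sr: "s \<in> module_homs R P (free_module R I)" "r \<in> module_homs R (free_module R I) P"
    and rs: "\<And>x. x \<in> carrier P \<Longrightarrow> r (s x) = x"
    using P unfolding projective_def by blast
  note s = module_homs_linear[OF sr(1)] and r = module_homs_linear[OF sr(2)]
  have R: "ring R" by (rule P.R.ring_axioms)
  note Fm = left_module_free_module[OF R, of I]
  have "\<exists>y. y \<in> carrier E \<and> p y = f (r (basis_vec R i))" if "i \<in> I" for i
    using sub[OF linear_map_closed[OF r basis_vec_closed[OF R that]]] by fastforce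
  then obtain \<phi> where \<phi>: "\<And>i. i \<in> I \<Longrightarrow> \<phi> i \<in> carrier E \<and> p (\<phi> i) = f (r (basis_vec R i))"
    by metis
  then obtain h where h: "h \<in> module_homs R (free_module R I) E"
      "\<And>i. i \<in> I \<Longrightarrow> h (basis_vec R i) = \<phi> i"
    using free_module_hom[OF E, of \<phi> I] by auto
  note hl = module_homs_linear[OF h(1)]
  have ph: "p (h x) = f (r x)" if "x \<in> carrier (free_module R I)" for x
    by (rule free_module_map_eq[OF R Y linear_map_compose[OF hl p] linear_map_compose[OF r f] _ that])
      (use h(2) \<phi> in auto)
  have "p (restrict (\<lambda>x. h (s x)) (carrier P) x) = f x" if "x \<in> carrier P" for x
    using that ph[OF linear_map_closed[OF s that]] rs by simp
  then show thesis
    using that[OF restrict_in_module_homs[OF P.left_module_axioms linear_map_compose[OF s hl]]] by blast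
qed

section \<open>Projective resolutions are unique up to homotopy\<close>

subsection \<open>Comparison of projective resolutions\<close>

lemma projective_resolutionD:
  assumes "projective_resolution R M P d e"
  shows "projective R (P k)" "left_module R (P k)"
    "linear_map R (P (Suc k)) (P k) (d k)" "linear_map R (P 0) M e"
    "x \<in> carrier (P (Suc 0)) \<Longrightarrow> e (d 0 x) = \<zero>\<^bsub>M\<^esub>"
    "x \<in> carrier (P (Suc (Suc k))) \<Longrightarrow> d k (d (Suc k) x) = \<zero>\<^bsub>P k\<^esub>"
    "y \<in> carrier M \<Longrightarrow> y \<in> e ` carrier (P 0)"
    "x \<in> carrier (P 0) \<Longrightarrow> e x = \<zero>\<^bsub>M\<^esub> \<Longrightarrow> x \<in> d 0 ` carrier (P (Suc 0))"
    "x \<in> carrier (P (Suc k)) \<Longrightarrow> d k x = \<zero>\<^bsub>P k\<^esub> \<Longrightarrow> x \<in> d (Suc k) ` carrier (P (Suc (Suc k)))"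
proof -
  note P = assms[unfolded projective_resolution_def]
  have ex0: "{x \<in> carrier (P 0). e x = \<zero>\<^bsub>M\<^esub>} = d 0 ` carrier (P (Suc 0))" using P by simp
  have ex: "{x \<in> carrier (P (Suc k)). d k x = \<zero>\<^bsub>P k\<^esub>} = d (Suc k) ` carrier (P (Suc (Suc k)))"
    using P by simp
  show "x \<in> carrier (P (Suc 0)) \<Longrightarrow> e (d 0 x) = \<zero>\<^bsub>M\<^esub>"
    "x \<in> carrier (P 0) \<Longrightarrow> e x = \<zero>\<^bsub>M\<^esub> \<Longrightarrow> x \<in> d 0 ` carrier (P (Suc 0))" using ex0 by blast+
  show "x \<in> carrier (P (Suc (Suc k))) \<Longrightarrow> d k (d (Suc k) x) = \<zero>\<^bsub>P k\<^esub>"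
    "x \<in> carrier (P (Suc k)) \<Longrightarrow> d k x = \<zero>\<^bsub>P k\<^esub> \<Longrightarrow> x \<in> d (Suc k) ` carrier (P (Suc (Suc k)))"
    using ex by blast+
qed (use assms in \<open>auto simp: projective_resolution_def projective_left_module module_homs_linear\<close>)

text \<open>The identity of \<open>M\<close> is lifted degree by degree; exactness of
  \<open>Q\<close> in the degree already treated is what permits the next lift.\<close>

lemma comparison_map:
  assumes M: "left_module R M"
    and P: "projective_resolution R M P d e" and Q: "projective_resolution R M Q d' e'"
  obtains f where "\<And>k. f k \<in> module_homs R (P k) (Q k)"
    and "\<And>x. x \<in> carrier (P 0) \<Longrightarrow> e' (f 0 x) = e x"
    and "\<And>k x. x \<in> carrier (P (Suc k)) \<Longrightarrow> d' k (f (Suc k) x) = f k (d k x)"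
proof -
  note P' = projective_resolutionD[OF P] and Q' = projective_resolutionD[OF Q]
  \<comment> \<open>The second clause is the induction invariant: following \<open>d k\<close>, the
    map takes values in boundaries, which is exactly the hypothesis of the next use of
    \<open>projective_lift\<close>.\<close>
  define good where "good = (\<lambda>k h. h \<in> module_homs R (P k) (Q k) \<and>
    (\<forall>x\<in>carrier (P (Suc k)). h (d k x) \<in> d' k ` carrier (Q (Suc k))) \<and>
    (k = 0 \<longrightarrow> (\<forall>x\<in>carrier (P 0). e' (h x) = e x)))"
  have "\<exists>f. \<forall>k. good k (f k) \<and> (\<forall>x\<in>carrier (P (Suc k)). d' k (f (Suc k) x) = f k (d k x))"
  proof (rule dependent_nat_choice)
    obtain h where h: "h \<in> module_homs R (P 0) (Q 0)" "\<And>x. x \<in> carrier (P 0) \<Longrightarrow> e' (h x) = e x"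
      by (rule projective_lift[OF P'(1) Q'(2) M Q'(4) P'(4)])
        (use Q'(7) linear_map_closed[OF P'(4)] in auto)
    have "h (d 0 x) \<in> d' 0 ` carrier (Q (Suc 0))" if "x \<in> carrier (P (Suc 0))" for x
      using that h(2) P'(5) linear_map_closed[OF P'(3)] linear_map_closed[OF module_homs_linear[OF h(1)]]
      by (intro Q'(8)) auto
    with h show "\<exists>h. good 0 h" by (auto simp: good_def)
  next
    fix h k assume h: "good k h"
    then have hl: "linear_map R (P k) (Q k) h" by (auto simp: good_def module_homs_linear)
    obtain h' where h': "h' \<in> module_homs R (P (Suc k)) (Q (Suc k))"
      "\<And>x. x \<in> carrier (P (Suc k)) \<Longrightarrow> d' k (h' x) = h (d k x)"
      by (rule projective_lift[OF P'(1) Q'(2) Q'(2) Q'(3) linear_map_compose[OF P'(3) hl]])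
        (use h in \<open>auto simp: good_def\<close>)
    have "h' (d (Suc k) x) \<in> d' (Suc k) ` carrier (Q (Suc (Suc k)))"
      if x: "x \<in> carrier (P (Suc (Suc k)))" for x
    proof (rule Q'(9))
      show "h' (d (Suc k) x) \<in> carrier (Q (Suc k))"
        by (intro linear_map_closed[OF module_homs_linear[OF h'(1)]] linear_map_closed[OF P'(3)] x)
      show "d' k (h' (d (Suc k) x)) = \<zero>\<^bsub>Q k\<^esub>"
        using h'(2) linear_map_closed[OF P'(3)] x P'(6)[OF x] linear_map_zero[OF P'(2) Q'(2) hl] by simp
    qed
    with h' show "\<exists>h'. good (Suc k) h' \<and> (\<forall>x\<in>carrier (P (Suc k)). d' k (h' x) = h (d k x))"
      by (auto simp: good_def)
  qed
  then show thesis using that by (auto simp: good_def)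
qed

text \<open>The obstruction to the next component, \<open>u\<close> minus the part already built
  composed with \<open>d k\<close>, is a cycle because \<open>u\<close> is a chain map, hence a
  boundary by exactness of \<open>Q\<close>. Degree 0 is stated apart since no component lies below
  it.\<close>

lemma comparison_homotopy:
  assumes M: "left_module R M"
    and P: "projective_resolution R M P d e" and Q: "projective_resolution R M Q d' e'"
    and u: "\<And>k. linear_map R (P k) (Q k) (u k)" "\<And>x. x \<in> carrier (P 0) \<Longrightarrow> e' (u 0 x) = \<zero>\<^bsub>M\<^esub>"
      "\<And>k x. x \<in> carrier (P (Suc k)) \<Longrightarrow> d' k (u (Suc k) x) = u k (d k x)"
  obtains s where "\<And>k. s k \<in> module_homs R (P k) (Q (Suc k))"
    and "\<And>x. x \<in> carrier (P 0) \<Longrightarrow> u 0 x = d' 0 (s 0 x)"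
    and "\<And>k x. x \<in> carrier (P (Suc k)) \<Longrightarrow>
      u (Suc k) x = d' (Suc k) (s (Suc k) x) \<oplus>\<^bsub>Q (Suc k)\<^esub> s k (d k x)"
proof -
  note P' = projective_resolutionD[OF P] and Q' = projective_resolutionD[OF Q]
  define good where "good = (\<lambda>k h. h \<in> module_homs R (P k) (Q (Suc k)) \<and>
    (\<forall>x\<in>carrier (P (Suc k)). u (Suc k) x \<ominus>\<^bsub>Q (Suc k)\<^esub> h (d k x) \<in> d' (Suc k) ` carrier (Q (Suc (Suc k)))) \<and>
    (k = 0 \<longrightarrow> (\<forall>x\<in>carrier (P 0). d' 0 (h x) = u 0 x)))"
  have "\<exists>s. \<forall>k. good k (s k) \<and> (\<forall>x\<in>carrier (P (Suc k)).
    d' (Suc k) (s (Suc k) x) = u (Suc k) x \<ominus>\<^bsub>Q (Suc k)\<^esub> s k (d k x))"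
  proof (rule dependent_nat_choice)
    obtain h where h: "h \<in> module_homs R (P 0) (Q (Suc 0))" "\<And>x. x \<in> carrier (P 0) \<Longrightarrow> d' 0 (h x) = u 0 x"
      by (rule projective_lift[OF P'(1) Q'(2) Q'(2) Q'(3) u(1)])
        (use Q'(8) u(2) linear_map_closed[OF u(1)] in auto)
    note hl = module_homs_linear[OF h(1)]
    have "u (Suc 0) x \<ominus>\<^bsub>Q (Suc 0)\<^esub> h (d 0 x) \<in> d' (Suc 0) ` carrier (Q (Suc (Suc 0)))"
      if x: "x \<in> carrier (P (Suc 0))" for x
    proof -
      interpret Q0: left_module R "Q 0" by (rule Q')
      interpret Q1: left_module R "Q (Suc 0)" by (rule Q')
      note dx = linear_map_closed[OF P'(3) x]
      note c = linear_map_closed[OF u(1) x] linear_map_closed[OF hl dx]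
      show ?thesis
        using c linear_map_minus(2)[OF Q'(2) Q'(2) Q'(3) c] u(3)[OF x] h(2)[OF dx] linear_map_closed[OF u(1) dx]
        by (intro Q'(9)) (auto simp: Q0.minus_eq_zero_iff)
    qed
    with h show "\<exists>h. good 0 h" by (auto simp: good_def)
  next
    fix h k assume h: "good k h"
    interpret Qk: left_module R "Q k" by (rule Q')
    interpret Q0: left_module R "Q (Suc k)" by (rule Q')
    interpret Q1: left_module R "Q (Suc (Suc k))" by (rule Q')
    have hl: "linear_map R (P k) (Q (Suc k)) h" using h by (auto simp: good_def module_homs_linear)
    obtain h' where h': "h' \<in> module_homs R (P (Suc k)) (Q (Suc (Suc k)))"
      "\<And>x. x \<in> carrier (P (Suc k)) \<Longrightarrow> d' (Suc k) (h' x) = u (Suc k) x \<ominus>\<^bsub>Q (Suc k)\<^esub> h (d k x)"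
      by (rule projective_lift[OF P'(1) Q'(2) Q'(2) Q'(3)
            linear_map_diff[OF Q'(2) u(1) linear_map_compose[OF P'(3) hl]]])
        (use h in \<open>auto simp: good_def\<close>)
    note hl' = module_homs_linear[OF h'(1)]
    have "u (Suc (Suc k)) x \<ominus>\<^bsub>Q (Suc (Suc k))\<^esub> h' (d (Suc k) x)
        \<in> d' (Suc (Suc k)) ` carrier (Q (Suc (Suc (Suc k))))"
      if x: "x \<in> carrier (P (Suc (Suc k)))" for x
    proof -
      note dx = linear_map_closed[OF P'(3) x]
      note c = linear_map_closed[OF u(1) x] linear_map_closed[OF hl' dx]
      have "h (d k (d (Suc k) x)) = \<zero>\<^bsub>Q (Suc k)\<^esub>"
        using P'(6)[OF x] linear_map_zero[OF P'(2) Q'(2) hl] by simp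
      then have "d' (Suc k) (h' (d (Suc k) x)) = u (Suc k) (d (Suc k) x)"
        using h'(2)[OF dx] linear_map_closed[OF u(1) dx] by simp
      then show ?thesis
        using c linear_map_minus(2)[OF Q'(2) Q'(2) Q'(3) c] u(3)[OF x] linear_map_closed[OF u(1) dx]
        by (intro Q'(9)) (auto simp: Q0.minus_eq_zero_iff)
    qed
    with h' show "\<exists>h'. good (Suc k) h' \<and> (\<forall>x\<in>carrier (P (Suc k)).
        d' (Suc k) (h' x) = u (Suc k) x \<ominus>\<^bsub>Q (Suc k)\<^esub> h (d k x))"
      by (auto simp: good_def)
  qed
  then obtain s where s: "\<And>k. good k (s k)" "\<And>k x. x \<in> carrier (P (Suc k)) \<Longrightarrow>
    d' (Suc k) (s (Suc k) x) = u (Suc k) x \<ominus>\<^bsub>Q (Suc k)\<^esub> s k (d k x)" by blast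
  have "u (Suc k) x = d' (Suc k) (s (Suc k) x) \<oplus>\<^bsub>Q (Suc k)\<^esub> s k (d k x)"
    if x: "x \<in> carrier (P (Suc k))" for k x
  proof -
    interpret Q: left_module R "Q (Suc k)" by (rule Q')
    have "linear_map R (P k) (Q (Suc k)) (s k)" using s(1) by (auto simp: good_def module_homs_linear)
    then have "s k (d k x) \<in> carrier (Q (Suc k))"
      using linear_map_closed linear_map_closed[OF P'(3) x] by metis
    then show ?thesis
      using s(2)[OF x] linear_map_closed[OF u(1) x] by (simp add: Q.M.minus_eq Q.M.a_assoc Q.M.l_neg)
  qed
  then show thesis using that[of s] s(1) unfolding good_def by metis
qed

text \<open>The difference of the identity and a composite of the two comparison maps lifts zero on
  \<open>M\<close>, so \<open>comparison_homotopy\<close> applies to it on both sides.\<close>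

lemma resolutions_homotopy_equivalent:
  assumes M: "left_module R M"
    and P: "projective_resolution R M P d e" and Q: "projective_resolution R M Q d' e'"
  obtains f g s t where "\<And>k. f k \<in> module_homs R (P k) (Q k)" "\<And>k. g k \<in> module_homs R (Q k) (P k)"
    and "\<And>k. s k \<in> module_homs R (P k) (P (Suc k))" "\<And>k. t k \<in> module_homs R (Q k) (Q (Suc k))"
    and "\<And>k x. x \<in> carrier (P (Suc k)) \<Longrightarrow> d' k (f (Suc k) x) = f k (d k x)"
    and "\<And>k x. x \<in> carrier (Q (Suc k)) \<Longrightarrow> d k (g (Suc k) x) = g k (d' k x)"
    and "\<And>x. x \<in> carrier (P 0) \<Longrightarrow> x \<ominus>\<^bsub>P 0\<^esub> g 0 (f 0 x) = d 0 (s 0 x)"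
    and "\<And>k x. x \<in> carrier (P (Suc k)) \<Longrightarrow>
      x \<ominus>\<^bsub>P (Suc k)\<^esub> g (Suc k) (f (Suc k) x) = d (Suc k) (s (Suc k) x) \<oplus>\<^bsub>P (Suc k)\<^esub> s k (d k x)"
    and "\<And>x. x \<in> carrier (Q 0) \<Longrightarrow> x \<ominus>\<^bsub>Q 0\<^esub> f 0 (g 0 x) = d' 0 (t 0 x)"
    and "\<And>k x. x \<in> carrier (Q (Suc k)) \<Longrightarrow>
      x \<ominus>\<^bsub>Q (Suc k)\<^esub> f (Suc k) (g (Suc k) x) = d' (Suc k) (t (Suc k) x) \<oplus>\<^bsub>Q (Suc k)\<^esub> t k (d' k x)"
proof -
  have homotopy: "\<exists>s. (\<forall>k. s k \<in> module_homs R (A k) (A (Suc k))) \<and>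
      (\<forall>x\<in>carrier (A 0). x \<ominus>\<^bsub>A 0\<^esub> b 0 (a 0 x) = dA 0 (s 0 x)) \<and>
      (\<forall>k. \<forall>x\<in>carrier (A (Suc k)). x \<ominus>\<^bsub>A (Suc k)\<^esub> b (Suc k) (a (Suc k) x)
        = dA (Suc k) (s (Suc k) x) \<oplus>\<^bsub>A (Suc k)\<^esub> s k (dA k x))"
    if A: "projective_resolution R M A dA eA" and B: "projective_resolution R M B dB eB"
      and a: "\<And>k. a k \<in> module_homs R (A k) (B k)" "\<And>x. x \<in> carrier (A 0) \<Longrightarrow> eB (a 0 x) = eA x"
        "\<And>k x. x \<in> carrier (A (Suc k)) \<Longrightarrow> dB k (a (Suc k) x) = a k (dA k x)"
      and b: "\<And>k. b k \<in> module_homs R (B k) (A k)" "\<And>x. x \<in> carrier (B 0) \<Longrightarrow> eA (b 0 x) = eB x"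
        "\<And>k x. x \<in> carrier (B (Suc k)) \<Longrightarrow> dA k (b (Suc k) x) = b k (dB k x)"
    for A :: "nat \<Rightarrow> ('a, 'x) module" and B :: "nat \<Rightarrow> ('a, 'y) module" and dA dB eA eB a b
  proof -
    interpret M: left_module R M by (rule M)
    note A' = projective_resolutionD[OF A] and B' = projective_resolutionD[OF B]
    note al = module_homs_linear[OF a(1)] and bl = module_homs_linear[OF b(1)]
    define u where "u = (\<lambda>k x. x \<ominus>\<^bsub>A k\<^esub> b k (a k x))"
    have ba: "b k (a k x) \<in> carrier (A k)" if "x \<in> carrier (A k)" for k x
      using that linear_map_closed[OF al] linear_map_closed[OF bl] by blast
    have u1: "linear_map R (A k) (A k) (u k)" for k
      unfolding u_def
      by (rule linear_map_diff[OF A'(2) linear_map_id linear_map_compose[OF al bl]])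
    have u2: "eA (u 0 x) = \<zero>\<^bsub>M\<^esub>" if x: "x \<in> carrier (A 0)" for x
    proof -
      have "eA (u 0 x) = eA x \<ominus>\<^bsub>M\<^esub> eA (b 0 (a 0 x))"
        unfolding u_def by (rule linear_map_minus(2)[OF A'(2) M A'(4) x ba[OF x]])
      then show ?thesis
        using b(2) a(2) linear_map_closed[OF al x] linear_map_closed[OF A'(4) x] x
        by (simp add: M.minus_eq_zero_iff)
    qed
    have u3: "dA k (u (Suc k) x) = u k (dA k x)" if x: "x \<in> carrier (A (Suc k))" for k x
    proof -
      have "dA k (u (Suc k) x) = dA k x \<ominus>\<^bsub>A k\<^esub> dA k (b (Suc k) (a (Suc k) x))"
        unfolding u_def by (rule linear_map_minus(2)[OF A'(2) A'(2) A'(3) x ba[OF x]])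
      then show ?thesis
        using b(3)[OF linear_map_closed[OF al x]] a(3)[OF x] by (simp add: u_def)
    qed
    show ?thesis
      by (rule comparison_homotopy[OF M A A u1 u2 u3]) (auto simp: u_def)
  qed
  obtain f where f: "\<And>k. f k \<in> module_homs R (P k) (Q k)"
    "\<And>x. x \<in> carrier (P 0) \<Longrightarrow> e' (f 0 x) = e x"
    "\<And>k x. x \<in> carrier (P (Suc k)) \<Longrightarrow> d' k (f (Suc k) x) = f k (d k x)"
    using comparison_map[OF M P Q] by blast
  obtain g where g: "\<And>k. g k \<in> module_homs R (Q k) (P k)"
    "\<And>x. x \<in> carrier (Q 0) \<Longrightarrow> e (g 0 x) = e' x"
    "\<And>k x. x \<in> carrier (Q (Suc k)) \<Longrightarrow> d k (g (Suc k) x) = g k (d' k x)"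
    using comparison_map[OF M Q P] by blast
  show thesis
    using homotopy[OF P Q f g] homotopy[OF Q P g f] that[OF f(1) g(1) _ _ f(3) g(3)] by blast
qed

section \<open>Complex algebras, tensor products and homology of complexes\<close>

subsection \<open>Complex algebras and their modules\<close>

lemma complex_field_simps [simp]:
  "carrier complex_field = UNIV" "a \<oplus>\<^bsub>complex_field\<^esub> b = a + b" "a \<otimes>\<^bsub>complex_field\<^esub> b = a * b"
  "\<zero>\<^bsub>complex_field\<^esub> = 0" "\<one>\<^bsub>complex_field\<^esub> = 1"
  by (simp_all add: ring_of_type_algebra_def)

lemma ring_complex_field: "ring complex_field"
  by (rule ring_from_type_algebra)

lemma module_complex_field_iff: "module complex_field V \<longleftrightarrow> left_module complex_field V"
  using cring_from_type_algebra[where 'a = complex] cring.axioms(1)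
  by (auto simp: module_def left_module_def module_axioms_def left_module_axioms_def)

lemma vector_space_isoI:
  assumes "module_iso complex_field V W"
  shows "vector_space_iso V W"
proof -
  obtain f where f: "left_module complex_field V" "left_module complex_field W"
      "linear_map complex_field V W f" "bij_betw f (carrier V) (carrier W)"
    using assms by (auto simp: module_iso_def)
  then have "restrict f (carrier V) \<in> module_homs complex_field V W"
    "bij_betw (restrict f (carrier V)) (carrier V) (carrier W)"
    by (auto intro: restrict_in_module_homs cong: bij_betw_cong)
  then show ?thesis using f unfolding vector_space_iso_def module_complex_field_iff by blast
qed

definition complex_algebra :: "(complex, 'a) module \<Rightarrow> bool"
  where "complex_algebra A \<longleftrightarrow> ring A \<and> left_module complex_field A \<and>
    (\<forall>c. \<forall>a\<in>carrier A. \<forall>b\<in>carrier A.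
      (c \<odot>\<^bsub>A\<^esub> a) \<otimes>\<^bsub>A\<^esub> b = c \<odot>\<^bsub>A\<^esub> (a \<otimes>\<^bsub>A\<^esub> b) \<and> a \<otimes>\<^bsub>A\<^esub> (c \<odot>\<^bsub>A\<^esub> b) = c \<odot>\<^bsub>A\<^esub> (a \<otimes>\<^bsub>A\<^esub> b))"

lemma opposite_simps [simp]:
  "carrier (opposite A) = carrier A" "a \<otimes>\<^bsub>opposite A\<^esub> b = b \<otimes>\<^bsub>A\<^esub> a" "\<one>\<^bsub>opposite A\<^esub> = \<one>\<^bsub>A\<^esub>"
  "\<zero>\<^bsub>opposite A\<^esub> = \<zero>\<^bsub>A\<^esub>" "a \<oplus>\<^bsub>opposite A\<^esub> b = a \<oplus>\<^bsub>A\<^esub> b" "c \<odot>\<^bsub>opposite A\<^esub> a = c \<odot>\<^bsub>A\<^esub> a"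
  by (simp_all add: opposite_def)

lemma abelian_group_cong:
  assumes "abelian_group G" "carrier H = carrier G" "\<zero>\<^bsub>H\<^esub> = \<zero>\<^bsub>G\<^esub>" "\<And>x y. x \<oplus>\<^bsub>H\<^esub> y = x \<oplus>\<^bsub>G\<^esub> y"
  shows "abelian_group H"
proof -
  interpret G: abelian_group G by fact
  show ?thesis
    by (rule abelian_groupI) (auto simp: assms(2-4) G.a_ac intro: bexI[of _ "\<ominus>\<^bsub>G\<^esub> _"] G.l_neg)
qed

lemma complex_algebra_opposite:
  assumes "complex_algebra A"
  shows "complex_algebra (opposite A)"
proof -
  interpret A: ring A using assms by (simp add: complex_algebra_def)
  interpret V: left_module complex_field A using assms by (simp add: complex_algebra_def)
  have ab: "abelian_group (opposite A)"
    by (rule abelian_group_cong[OF A.abelian_group_axioms]) simp_all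
  have "ring (opposite A)"
    by (rule ringI[OF ab]) (auto intro!: monoidI simp: A.m_assoc A.l_distr A.r_distr)
  moreover have "left_module complex_field (opposite A)"
    using ab ring_complex_field
    by (auto simp: left_module_def left_module_axioms_def V.lsmult_l_distr V.lsmult_r_distr
      V.lsmult_assoc[simplified] V.lsmult_one[simplified] V.lsmult_closed[simplified]
      V.lsmult_l_distr[simplified])
  ultimately show ?thesis
    using assms by (simp add: complex_algebra_def)
qed

text \<open>A module over a complex algebra seen as a vector space, \<open>c\<close> acting as c
  times the unit, as in \<open>hom_space\<close> and \<open>tensor_relations\<close>. It serves
  right modules as well, by \<open>restrict_scalars_opposite\<close>.\<close>

definition restrict_scalars :: "(complex, 'a) module \<Rightarrow> ('a, 'n) module \<Rightarrow> (complex, 'n) module"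
  where "restrict_scalars A N =
    \<lparr>carrier = carrier N, monoid.mult = undefined, monoid.one = undefined,
     ring.zero = \<zero>\<^bsub>N\<^esub>, ring.add = (\<lambda>x y. x \<oplus>\<^bsub>N\<^esub> y),
     module.smult = (\<lambda>c x. (c \<odot>\<^bsub>A\<^esub> \<one>\<^bsub>A\<^esub>) \<odot>\<^bsub>N\<^esub> x)\<rparr>"

lemma restrict_scalars_simps [simp]:
  "carrier (restrict_scalars A N) = carrier N" "\<zero>\<^bsub>restrict_scalars A N\<^esub> = \<zero>\<^bsub>N\<^esub>"
  "x \<oplus>\<^bsub>restrict_scalars A N\<^esub> y = x \<oplus>\<^bsub>N\<^esub> y" "c \<odot>\<^bsub>restrict_scalars A N\<^esub> x = (c \<odot>\<^bsub>A\<^esub> \<one>\<^bsub>A\<^esub>) \<odot>\<^bsub>N\<^esub> x"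
  by (simp_all add: restrict_scalars_def)

lemma finsum_restrict_scalars [simp]: "finsum (restrict_scalars A N) f S = finsum N f S"
  by (simp add: finsum_def finprod_def restrict_scalars_def)

locale calgebra =
  fixes A :: "(complex, 'a) module"
  assumes alg: "complex_algebra A"
begin

sublocale A: ring A using alg by (simp add: complex_algebra_def)
sublocale V: left_module complex_field A
  rewrites "carrier complex_field = UNIV" and "a \<oplus>\<^bsub>complex_field\<^esub> b = a + b"
    and "a \<otimes>\<^bsub>complex_field\<^esub> b = a * b" and "\<zero>\<^bsub>complex_field\<^esub> = 0" and "\<one>\<^bsub>complex_field\<^esub> = 1"
  using alg by (simp_all add: complex_algebra_def)

lemma smult_mult:
  "a \<in> carrier A \<Longrightarrow> b \<in> carrier A \<Longrightarrow> (c \<odot>\<^bsub>A\<^esub> a) \<otimes>\<^bsub>A\<^esub> b = c \<odot>\<^bsub>A\<^esub> (a \<otimes>\<^bsub>A\<^esub> b)"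
  "a \<in> carrier A \<Longrightarrow> b \<in> carrier A \<Longrightarrow> a \<otimes>\<^bsub>A\<^esub> (c \<odot>\<^bsub>A\<^esub> b) = c \<odot>\<^bsub>A\<^esub> (a \<otimes>\<^bsub>A\<^esub> b)"
  using alg by (simp_all add: complex_algebra_def)

abbreviation scal :: "complex \<Rightarrow> 'a" where "scal c \<equiv> c \<odot>\<^bsub>A\<^esub> \<one>\<^bsub>A\<^esub>"

lemma scal_closed [simp]: "scal c \<in> carrier A"
  using V.lsmult_closed by simp

lemma scal_mult: "a \<in> carrier A \<Longrightarrow> scal c \<otimes>\<^bsub>A\<^esub> a = c \<odot>\<^bsub>A\<^esub> a" "a \<in> carrier A \<Longrightarrow> a \<otimes>\<^bsub>A\<^esub> scal c = c \<odot>\<^bsub>A\<^esub> a"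
  by (simp_all add: smult_mult)

lemma scal_central: "a \<in> carrier A \<Longrightarrow> scal c \<otimes>\<^bsub>A\<^esub> a = a \<otimes>\<^bsub>A\<^esub> scal c"
  by (simp add: scal_mult)

lemma left_module_restrict_scalars:
  assumes "left_module A N"
  shows "left_module complex_field (restrict_scalars A N)"
proof -
  interpret N: left_module A N by fact
  have "abelian_group (restrict_scalars A N)"
    by (rule abelian_group_cong[OF N.M.abelian_group_axioms]) simp_all
  moreover have "left_module_axioms complex_field (restrict_scalars A N)"
    using V.lsmult_l_distr[of _ _ "\<one>\<^bsub>A\<^esub>"] V.lsmult_assoc[of _ _ "\<one>\<^bsub>A\<^esub>"]
    by unfold_locales
      (auto simp: N.lsmult_l_distr N.lsmult_r_distr scal_mult(1) simp flip: N.lsmult_assoc)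
  ultimately show ?thesis
    using ring_complex_field by (simp add: left_module_def)
qed

end

lemma restrict_scalars_opposite [simp]: "restrict_scalars (opposite A) N = restrict_scalars A N"
  by (simp add: restrict_scalars_def)

subsection \<open>Tensor products\<close>

lemma lin_span_submodule:
  assumes "left_module complex_field V" "S \<subseteq> carrier V"
  shows "submodule (lin_span V S) complex_field V" "S \<subseteq> lin_span V S"
proof -
  interpret V: left_module complex_field V by fact
  have c: "submodule (carrier V) complex_field V"
    by (rule V.submodule_leftI) (use V.lsmult_closed in auto)
  show "submodule (lin_span V S) complex_field V"
  proof (rule V.submodule_leftI)
    show "lin_span V S \<subseteq> carrier V" using c assms(2) by (auto simp: lin_span_def)
  next
    show "a \<odot>\<^bsub>V\<^esub> x \<in> lin_span V S" if "x \<in> lin_span V S" for a x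
      using that V.submodule_leftD(6) by (auto simp: lin_span_def)
  qed (auto simp: lin_span_def dest: V.submodule_leftD)
  show "S \<subseteq> lin_span V S" by (auto simp: lin_span_def)
qed

lemma lin_span_least: "submodule W complex_field V \<Longrightarrow> S \<subseteq> W \<Longrightarrow> lin_span V S \<subseteq> W"
  by (auto simp: lin_span_def)

lemma basis_vec_complex [simp]: "basis_vec complex_field = single"
  by (auto simp: basis_vec_def single_def fun_eq_iff)

lemma single_closed: "x \<in> I \<Longrightarrow> single x \<in> carrier (free_module complex_field I)"
  using basis_vec_closed[OF ring_complex_field, of x I] by simp

lemma push_forward_finite:
  assumes "finite S" "{x. f x \<noteq> 0} \<subseteq> S"
  shows "push_forward h f y = (\<Sum>x | x \<in> S \<and> h x = y. f x)"
  unfolding push_forward_def by (rule sum.mono_neutral_left) (use assms in auto)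

lemma push_forward_linear:
  assumes "\<And>x. x \<in> I \<Longrightarrow> h x \<in> J"
  shows "linear_map complex_field (free_module complex_field I) (free_module complex_field J) (push_forward h)"
proof (rule linear_mapI)
  fix f g c
  assume f: "f \<in> carrier (free_module complex_field I)"
  then have fin: "finite {x. f x \<noteq> 0}" by (simp add: free_module_simps)
  have nz: "\<exists>x. f x \<noteq> 0 \<and> h x = y" if "push_forward h f y \<noteq> 0" for y
  proof (rule ccontr)
    assume "\<not> (\<exists>x. f x \<noteq> 0 \<and> h x = y)"
    then have "{x. f x \<noteq> 0 \<and> h x = y} = {}" by blast
    with that show False by (simp add: push_forward_def)
  qed
  have "push_forward h f y = 0" if "y \<notin> J" for y
    using nz[of y] that f assms by (auto simp: free_module_simps)
  moreover have "{y. push_forward h f y \<noteq> 0} \<subseteq> h ` {x. f x \<noteq> 0}"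
    using nz by auto
  then have "finite {y. push_forward h f y \<noteq> 0}"
    by (rule finite_subset) (use fin in simp)
  ultimately show "push_forward h f \<in> carrier (free_module complex_field J)"
    by (simp add: free_module_simps)
  show "push_forward h (c \<odot>\<^bsub>free_module complex_field I\<^esub> f)
      = c \<odot>\<^bsub>free_module complex_field J\<^esub> push_forward h f"
    using fin push_forward_finite[of "{x. f x \<noteq> 0}" "\<lambda>x. c * f x" h] push_forward_finite[of "{x. f x \<noteq> 0}" f h]
    by (auto simp: free_module_simps fun_eq_iff sum_distrib_left)
  assume g: "g \<in> carrier (free_module complex_field I)"
  define S where "S = {x. f x \<noteq> 0} \<union> {x. g x \<noteq> 0}"
  have S: "finite S" "{x. f x \<noteq> 0} \<subseteq> S" "{x. g x \<noteq> 0} \<subseteq> S" "{x. f x + g x \<noteq> 0} \<subseteq> S"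
    using fin g by (auto simp: S_def free_module_simps)
  show "push_forward h (f \<oplus>\<^bsub>free_module complex_field I\<^esub> g)
      = push_forward h f \<oplus>\<^bsub>free_module complex_field J\<^esub> push_forward h g"
    using push_forward_finite[OF S(1,2), of h] push_forward_finite[OF S(1,3), of h]
      push_forward_finite[OF S(1,4), of h]
    by (simp add: free_module_simps fun_eq_iff sum.distrib)
qed

lemma push_forward_single: "push_forward h (single x) = single (h x)"
proof
  fix y
  have "{z. single x z \<noteq> 0 \<and> h z = y} = (if h x = y then {x} else {})"
    by (auto simp: single_def)
  then show "push_forward h (single x) y = single (h x) y"
    by (auto simp: push_forward_def single_def)
qed

definition pure_tensor ::
  "(complex, 'a) module \<Rightarrow> ('a, 'n) module \<Rightarrow> ('a, 'm) module \<Rightarrow> 'n \<Rightarrow> 'm \<Rightarrow> ('n \<times> 'm \<Rightarrow> complex) set"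
  where "pure_tensor A N M n m =
    tensor_relations A N M +>\<^bsub>free_module complex_field (carrier N \<times> carrier M)\<^esub> single (n, m)"

locale tensor_modules = calgebra A for A :: "(complex, 'a) module" +
  fixes N :: "('a, 'n) module" and M :: "('a, 'm) module"
  assumes right: "left_module (opposite A) N" and left: "left_module A M"
begin

sublocale N: left_module "opposite A" N by (rule right)
sublocale M: left_module A M by (rule left)

abbreviation "free_pairs \<equiv> free_module complex_field (carrier N \<times> carrier M)"

lemma free_pairs: "left_module complex_field free_pairs"
  by (rule left_module_free_module[OF ring_complex_field])

sublocale F: left_module complex_field free_pairs by (rule free_pairs)

lemma tensor_relations:
  "submodule (tensor_relations A N M) complex_field free_pairs"
  "n \<in> carrier N \<Longrightarrow> n' \<in> carrier N \<Longrightarrow> m \<in> carrier M \<Longrightarrow>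
    single (n \<oplus>\<^bsub>N\<^esub> n', m) \<ominus>\<^bsub>free_pairs\<^esub> (single (n, m) \<oplus>\<^bsub>free_pairs\<^esub> single (n', m)) \<in> tensor_relations A N M"
  "n \<in> carrier N \<Longrightarrow> m \<in> carrier M \<Longrightarrow> m' \<in> carrier M \<Longrightarrow>
    single (n, m \<oplus>\<^bsub>M\<^esub> m') \<ominus>\<^bsub>free_pairs\<^esub> (single (n, m) \<oplus>\<^bsub>free_pairs\<^esub> single (n, m')) \<in> tensor_relations A N M"
  "a \<in> carrier A \<Longrightarrow> n \<in> carrier N \<Longrightarrow> m \<in> carrier M \<Longrightarrow>
    single (a \<odot>\<^bsub>N\<^esub> n, m) \<ominus>\<^bsub>free_pairs\<^esub> single (n, a \<odot>\<^bsub>M\<^esub> m) \<in> tensor_relations A N M"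
  "n \<in> carrier N \<Longrightarrow> m \<in> carrier M \<Longrightarrow>
    single (scal c \<odot>\<^bsub>N\<^esub> n, m) \<ominus>\<^bsub>free_pairs\<^esub> c \<odot>\<^bsub>free_pairs\<^esub> single (n, m) \<in> tensor_relations A N M"
proof -
  define S where "S = ({single (n \<oplus>\<^bsub>N\<^esub> n', m) \<ominus>\<^bsub>free_pairs\<^esub> (single (n, m) \<oplus>\<^bsub>free_pairs\<^esub> single (n', m)) | n n' m.
        n \<in> carrier N \<and> n' \<in> carrier N \<and> m \<in> carrier M} \<union>
     {single (n, m \<oplus>\<^bsub>M\<^esub> m') \<ominus>\<^bsub>free_pairs\<^esub> (single (n, m) \<oplus>\<^bsub>free_pairs\<^esub> single (n, m')) | n m m'.
        n \<in> carrier N \<and> m \<in> carrier M \<and> m' \<in> carrier M} \<union>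
     {single (a \<odot>\<^bsub>N\<^esub> n, m) \<ominus>\<^bsub>free_pairs\<^esub> single (n, a \<odot>\<^bsub>M\<^esub> m) | a n m.
        a \<in> carrier A \<and> n \<in> carrier N \<and> m \<in> carrier M} \<union>
     {single (scal c \<odot>\<^bsub>N\<^esub> n, m) \<ominus>\<^bsub>free_pairs\<^esub> c \<odot>\<^bsub>free_pairs\<^esub> single (n, m) | c n m.
        n \<in> carrier N \<and> m \<in> carrier M})"
  have eq: "tensor_relations A N M = lin_span free_pairs S"
    by (simp add: tensor_relations_def S_def Let_def)
  have N: "a \<odot>\<^bsub>N\<^esub> n \<in> carrier N" if "a \<in> carrier A" "n \<in> carrier N" for a n
    using N.lsmult_closed that by simp
  have "S \<subseteq> carrier free_pairs"
    unfolding S_def using N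
    by (auto intro!: F.M.minus_closed F.M.a_closed F.lsmult_closed single_closed)
  note span = lin_span_submodule[OF free_pairs this, folded eq]
  show "submodule (tensor_relations A N M) complex_field free_pairs" by (rule span(1))
  show "n \<in> carrier N \<Longrightarrow> n' \<in> carrier N \<Longrightarrow> m \<in> carrier M \<Longrightarrow>
    single (n \<oplus>\<^bsub>N\<^esub> n', m) \<ominus>\<^bsub>free_pairs\<^esub> (single (n, m) \<oplus>\<^bsub>free_pairs\<^esub> single (n', m)) \<in> tensor_relations A N M"
  "n \<in> carrier N \<Longrightarrow> m \<in> carrier M \<Longrightarrow> m' \<in> carrier M \<Longrightarrow>
    single (n, m \<oplus>\<^bsub>M\<^esub> m') \<ominus>\<^bsub>free_pairs\<^esub> (single (n, m) \<oplus>\<^bsub>free_pairs\<^esub> single (n, m')) \<in> tensor_relations A N M"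
  "a \<in> carrier A \<Longrightarrow> n \<in> carrier N \<Longrightarrow> m \<in> carrier M \<Longrightarrow>
    single (a \<odot>\<^bsub>N\<^esub> n, m) \<ominus>\<^bsub>free_pairs\<^esub> single (n, a \<odot>\<^bsub>M\<^esub> m) \<in> tensor_relations A N M"
  "n \<in> carrier N \<Longrightarrow> m \<in> carrier M \<Longrightarrow>
    single (scal c \<odot>\<^bsub>N\<^esub> n, m) \<ominus>\<^bsub>free_pairs\<^esub> c \<odot>\<^bsub>free_pairs\<^esub> single (n, m) \<in> tensor_relations A N M"
    by (rule subsetD[OF span(2)], unfold S_def, blast)+
qed

lemma left_module_tensor: "left_module complex_field (tensor_product A N M)"
  unfolding tensor_product_def by (rule left_module_quot[OF free_pairs tensor_relations(1)])

lemma pure_tensor_simps: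
  assumes n: "n \<in> carrier N" and m: "m \<in> carrier M"
  shows pure_tensor_closed: "pure_tensor A N M n m \<in> carrier (tensor_product A N M)"
    and pure_tensor_add_right: "m' \<in> carrier M \<Longrightarrow> pure_tensor A N M n (m \<oplus>\<^bsub>M\<^esub> m')
      = pure_tensor A N M n m \<oplus>\<^bsub>tensor_product A N M\<^esub> pure_tensor A N M n m'"
    and pure_tensor_add_left: "n' \<in> carrier N \<Longrightarrow> pure_tensor A N M (n \<oplus>\<^bsub>N\<^esub> n') m
      = pure_tensor A N M n m \<oplus>\<^bsub>tensor_product A N M\<^esub> pure_tensor A N M n' m"
    and pure_tensor_balanced: "a \<in> carrier A \<Longrightarrow>
      pure_tensor A N M (a \<odot>\<^bsub>N\<^esub> n) m = pure_tensor A N M n (a \<odot>\<^bsub>M\<^esub> m)"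
    and pure_tensor_scal: "pure_tensor A N M (scal c \<odot>\<^bsub>N\<^esub> n) m
      = c \<odot>\<^bsub>tensor_product A N M\<^esub> pure_tensor A N M n m"
proof -
  have N: "a \<odot>\<^bsub>N\<^esub> n \<in> carrier N" if "a \<in> carrier A" "n \<in> carrier N" for a n
    using N.lsmult_closed that by simp
  note quot = quot_module_add[OF free_pairs tensor_relations(1)]
    quot_module_smult[OF free_pairs tensor_relations(1)]
  have cl: "single (n, m) \<in> carrier free_pairs" if "n \<in> carrier N" "m \<in> carrier M" for n m
    using that by (simp add: single_closed)
  note eq = coset_eq_iff[OF free_pairs tensor_relations(1)]
  note c = n m cl F.M.a_closed F.lsmult_closed N
  show "pure_tensor A N M n m \<in> carrier (tensor_product A N M)"
    using c by (simp add: pure_tensor_def tensor_product_def quot_module_simps)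
  show "pure_tensor A N M n (m \<oplus>\<^bsub>M\<^esub> m')
      = pure_tensor A N M n m \<oplus>\<^bsub>tensor_product A N M\<^esub> pure_tensor A N M n m'" if "m' \<in> carrier M"
    using that c tensor_relations(3) by (simp add: pure_tensor_def tensor_product_def quot eq)
  show "pure_tensor A N M (n \<oplus>\<^bsub>N\<^esub> n') m
      = pure_tensor A N M n m \<oplus>\<^bsub>tensor_product A N M\<^esub> pure_tensor A N M n' m" if "n' \<in> carrier N"
    using that c tensor_relations(2) by (simp add: pure_tensor_def tensor_product_def quot eq)
  show "pure_tensor A N M (a \<odot>\<^bsub>N\<^esub> n) m = pure_tensor A N M n (a \<odot>\<^bsub>M\<^esub> m)" if "a \<in> carrier A"
    using that c tensor_relations(4) by (simp add: pure_tensor_def eq)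
  show "pure_tensor A N M (scal c \<odot>\<^bsub>N\<^esub> n) m = c \<odot>\<^bsub>tensor_product A N M\<^esub> pure_tensor A N M n m" for c
    using c tensor_relations(5) by (simp add: pure_tensor_def tensor_product_def quot eq)
qed

text \<open>The pure tensors are the cosets of the basis vectors \<open>single (n, m)\<close>. Every
  identity between maps out of a tensor product is checked on pure tensors through this.\<close>

lemma tensor_map_ext:
  assumes W: "left_module complex_field W"
    and f: "linear_map complex_field (tensor_product A N M) W f"
    and g: "linear_map complex_field (tensor_product A N M) W g"
    and eq: "\<And>n m. n \<in> carrier N \<Longrightarrow> m \<in> carrier M \<Longrightarrow> f (pure_tensor A N M n m) = g (pure_tensor A N M n m)"
    and z: "z \<in> carrier (tensor_product A N M)"
  shows "f z = g z"
proof -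
  note lc = linear_map_coset[OF free_pairs tensor_relations(1), folded tensor_product_def]
  obtain x where x: "x \<in> carrier free_pairs" "z = tensor_relations A N M +>\<^bsub>free_pairs\<^esub> x"
    using z by (auto simp: tensor_product_def quot_module_simps)
  show ?thesis
    unfolding x(2)
    by (rule free_module_map_eq[OF ring_complex_field W linear_map_compose[OF lc f]
        linear_map_compose[OF lc g] _ x(1)])
      (use eq in \<open>auto simp: pure_tensor_def\<close>)
qed

text \<open>The linear extension of \<open>b\<close> to formal combinations has a subspace as
  kernel, so only the generators of \<open>tensor_relations\<close> must lie in it, and these
  express the identities assumed of \<open>b\<close>.\<close>

lemma tensor_universal:
  assumes W: "left_module complex_field W"
    and cl: "\<And>n m. n \<in> carrier N \<Longrightarrow> m \<in> carrier M \<Longrightarrow> b n m \<in> carrier W"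
    and add_left: "\<And>n n' m. n \<in> carrier N \<Longrightarrow> n' \<in> carrier N \<Longrightarrow> m \<in> carrier M \<Longrightarrow>
      b (n \<oplus>\<^bsub>N\<^esub> n') m = b n m \<oplus>\<^bsub>W\<^esub> b n' m"
    and add_right: "\<And>n m m'. n \<in> carrier N \<Longrightarrow> m \<in> carrier M \<Longrightarrow> m' \<in> carrier M \<Longrightarrow>
      b n (m \<oplus>\<^bsub>M\<^esub> m') = b n m \<oplus>\<^bsub>W\<^esub> b n m'"
    and balanced: "\<And>a n m. a \<in> carrier A \<Longrightarrow> n \<in> carrier N \<Longrightarrow> m \<in> carrier M \<Longrightarrow>
      b (a \<odot>\<^bsub>N\<^esub> n) m = b n (a \<odot>\<^bsub>M\<^esub> m)"
    and scal: "\<And>c n m. n \<in> carrier N \<Longrightarrow> m \<in> carrier M \<Longrightarrow> b (scal c \<odot>\<^bsub>N\<^esub> n) m = c \<odot>\<^bsub>W\<^esub> b n m"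
  obtains f where "linear_map complex_field (tensor_product A N M) W f"
    and "\<And>n m. n \<in> carrier N \<Longrightarrow> m \<in> carrier M \<Longrightarrow> f (pure_tensor A N M n m) = b n m"
proof -
  interpret W: left_module complex_field W by fact
  have N: "a \<odot>\<^bsub>N\<^esub> n \<in> carrier N" if "a \<in> carrier A" "n \<in> carrier N" for a n
    using N.lsmult_closed that by simp
  obtain h where h: "h \<in> module_homs complex_field free_pairs W"
      "\<And>p. p \<in> carrier N \<times> carrier M \<Longrightarrow> h (single p) = b (fst p) (snd p)"
    by (rule free_module_hom[OF W, of "\<lambda>p. b (fst p) (snd p)" "carrier N \<times> carrier M"])
      (use cl in auto)
  note hl = module_homs_linear[OF h(1)]
  note hm = linear_map_minus(2)[OF free_pairs W hl]
  let ?K = "{x \<in> carrier free_pairs. h x = \<zero>\<^bsub>W\<^esub>}"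
  have "tensor_relations A N M \<subseteq> ?K"
    unfolding tensor_relations_def Let_def
    by (rule lin_span_least[OF linear_map_kernel_submodule[OF free_pairs W hl]])
      (auto intro!: F.M.minus_closed F.M.a_closed F.lsmult_closed single_closed
        simp: N hm linear_map_add[OF hl] linear_map_smult[OF hl] single_closed h(2) cl W.minus_eq_zero_iff
          add_left add_right scal W.lsmult_closed[simplified] F.lsmult_closed[simplified]
        simp flip: balanced)
  then obtain g where g: "linear_map complex_field (tensor_product A N M) W g"
      "\<And>x. x \<in> carrier free_pairs \<Longrightarrow> g (tensor_relations A N M +>\<^bsub>free_pairs\<^esub> x) = h x"
    unfolding tensor_product_def
    using quot_module_factor[OF free_pairs tensor_relations(1) W hl] by blast
  then show thesis
    by (intro that[of g]) (auto simp: pure_tensor_def single_closed h(2))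
qed

end

text \<open>Linearity is not visible in the union that defines \<open>tensor_map\<close>. The map
  agrees with the one supplied by the universal property, because both come from linear maps on
  formal combinations with the same values on basis vectors.\<close>

lemma tensor_map_linear:
  assumes "tensor_modules A N M" "tensor_modules A N M'" "linear_map A M M' g"
  shows "linear_map complex_field (tensor_product A N M) (tensor_product A N M') (tensor_map A N M' g)"
    and "n \<in> carrier N \<Longrightarrow> m \<in> carrier M \<Longrightarrow>
      tensor_map A N M' g (pure_tensor A N M n m) = pure_tensor A N M' n (g m)"
proof -
  interpret M: tensor_modules A N M by fact
  interpret M': tensor_modules A N M' by fact
  note gc = linear_map_closed[OF assms(3)]
  obtain f where f: "linear_map complex_field (tensor_product A N M) (tensor_product A N M') f"
      "\<And>n m. n \<in> carrier N \<Longrightarrow> m \<in> carrier M \<Longrightarrow> f (pure_tensor A N M n m) = pure_tensor A N M' n (g m)"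
    by (rule M.tensor_universal[OF M'.left_module_tensor, of "\<lambda>n m. pure_tensor A N M' n (g m)"])
      (simp_all add: gc linear_map_add[OF assms(3)] linear_map_smult[OF assms(3)]
        M'.pure_tensor_closed M'.pure_tensor_add_left M'.pure_tensor_add_right M'.pure_tensor_scal
        flip: M'.pure_tensor_balanced)
  let ?c = "\<lambda>x. tensor_relations A N M +>\<^bsub>M.free_pairs\<^esub> x"
  let ?c' = "\<lambda>x. tensor_relations A N M' +>\<^bsub>M'.free_pairs\<^esub> x"
  let ?p = "push_forward (map_prod id g)"
  have p: "linear_map complex_field M.free_pairs M'.free_pairs ?p"
    by (rule push_forward_linear) (auto simp: gc)
  note lc = linear_map_coset[OF M.free_pairs M.tensor_relations(1), folded tensor_product_def]
  note lc' = linear_map_coset[OF M'.free_pairs M'.tensor_relations(1), folded tensor_product_def]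
  have fp: "f (?c x) = ?c' (?p x)" if "x \<in> carrier M.free_pairs" for x
    by (rule free_module_map_eq[OF ring_complex_field M'.left_module_tensor
        linear_map_compose[OF lc f(1)] linear_map_compose[OF p lc'] _ that])
      (use f(2) in \<open>auto simp: pure_tensor_def push_forward_single\<close>)
  have tf: "tensor_map A N M' g z = f z" if z: "z \<in> carrier (tensor_product A N M)" for z
  proof -
    obtain x where x: "x \<in> carrier M.free_pairs" "z = ?c x"
      using z by (auto simp: tensor_product_def quot_module_simps)
    have "?c' (?p y) = ?c' (?p x)" if "y \<in> carrier M.free_pairs" "y \<ominus>\<^bsub>M.free_pairs\<^esub> x \<in> tensor_relations A N M" for y
      using fp[OF that(1)] fp[OF x(1)] that x(1)
        coset_eq_iff[OF M.free_pairs M.tensor_relations(1), of y x] by simp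
    from quot_module_UN[OF M.free_pairs M.tensor_relations(1) x(1), of "\<lambda>y. ?c' (?p y)", OF this]
    show ?thesis by (simp add: tensor_map_def x(2) fp[OF x(1)])
  qed
  show "linear_map complex_field (tensor_product A N M) (tensor_product A N M') (tensor_map A N M' g)"
    using linear_map_cong[OF M.left_module_tensor, of "tensor_map A N M' g" f] tf f(1) by blast
  show "n \<in> carrier N \<Longrightarrow> m \<in> carrier M \<Longrightarrow>
      tensor_map A N M' g (pure_tensor A N M n m) = pure_tensor A N M' n (g m)"
    by (simp add: tf f(2) M.pure_tensor_closed)
qed

subsection \<open>Homotopy equivalences of complexes\<close>

text \<open>Cycles are encoded by shrinking the carrier of a record. Differences in the shrunken
  record must be identified with those in the ambient module before \<open>module_iso_quot\<close>
  can be applied.\<close>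

lemma module_iso_subquot:
  assumes V: "left_module R V" and Z: "submodule Z R V" and B: "submodule B R V" "B \<subseteq> Z"
    and W: "left_module R W" and Z': "submodule Z' R W" and B': "submodule B' R W" "B' \<subseteq> Z'"
    and f: "linear_map R V W f" "\<And>x. x \<in> Z \<Longrightarrow> f x \<in> Z'" "\<And>x. x \<in> B \<Longrightarrow> f x \<in> B'"
    and g: "linear_map R W V g" "\<And>x. x \<in> Z' \<Longrightarrow> g x \<in> Z" "\<And>x. x \<in> B' \<Longrightarrow> g x \<in> B"
    and gf: "\<And>x. x \<in> Z \<Longrightarrow> x \<ominus>\<^bsub>V\<^esub> g (f x) \<in> B"
    and fg: "\<And>x. x \<in> Z' \<Longrightarrow> x \<ominus>\<^bsub>W\<^esub> f (g x) \<in> B'"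
  shows "module_iso R (quot_module (V\<lparr>carrier := Z\<rparr>) B) (quot_module (W\<lparr>carrier := Z'\<rparr>) B')"
proof -
  have sub: "left_module R (A\<lparr>carrier := H\<rparr>) \<and> submodule K R (A\<lparr>carrier := H\<rparr>) \<and>
      H \<subseteq> carrier A \<and> (\<forall>x\<in>H. \<forall>y\<in>H. x \<ominus>\<^bsub>A\<lparr>carrier := H\<rparr>\<^esub> y = x \<ominus>\<^bsub>A\<^esub> y)"
    if A: "left_module R A" and H: "submodule H R A" and K: "submodule K R A" "K \<subseteq> H"
    for A :: "('a, 'x, 'y) module_scheme" and H K
  proof -
    interpret A: left_module R A by (rule A)
    interpret H: left_module R "A\<lparr>carrier := H\<rparr>" by (rule A.left_module_sub[OF H])
    note HD = A.submodule_leftD[OF H] and KD = A.submodule_leftD[OF K(1)]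
    have "\<ominus>\<^bsub>A\<lparr>carrier := H\<rparr>\<^esub> y = \<ominus>\<^bsub>A\<^esub> y" if "y \<in> H" for y
      by (rule H.M.minus_equality) (use HD that in \<open>auto simp: A.M.l_neg\<close>)
    moreover have "submodule K R (A\<lparr>carrier := H\<rparr>)"
      by (rule H.submodule_leftI) (use KD K(2) in auto)
    ultimately show ?thesis using HD(1) H.left_module_axioms by (simp add: a_minus_def)
  qed
  note sV = sub[OF V Z B] and sW = sub[OF W Z' B']
  have ext: "linear_map R (V\<lparr>carrier := Z\<rparr>) (W\<lparr>carrier := Z'\<rparr>) f"
    "linear_map R (W\<lparr>carrier := Z'\<rparr>) (V\<lparr>carrier := Z\<rparr>) g"
    using f g sV sW by (auto simp: linear_map_def Pi_iff subset_eq)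
  show ?thesis
    by (rule module_iso_quot[OF _ _ _ _ ext(1) _ ext(2)]) (use sV sW f g gf fg in auto)
qed

lemma homology_iso:
  assumes V: "\<And>k. left_module complex_field (V k)" and W: "\<And>k. left_module complex_field (W k)"
    and d: "\<And>k. linear_map complex_field (V (Suc k)) (V k) (d k)"
    and d': "\<And>k. linear_map complex_field (W (Suc k)) (W k) (d' k)"
    and dd: "\<And>k x. x \<in> carrier (V (Suc (Suc k))) \<Longrightarrow> d k (d (Suc k) x) = \<zero>\<^bsub>V k\<^esub>"
    and dd': "\<And>k x. x \<in> carrier (W (Suc (Suc k))) \<Longrightarrow> d' k (d' (Suc k) x) = \<zero>\<^bsub>W k\<^esub>"
    and f: "\<And>k. linear_map complex_field (V k) (W k) (f k)"
    and g: "\<And>k. linear_map complex_field (W k) (V k) (g k)"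
    and fd: "\<And>k x. x \<in> carrier (V (Suc k)) \<Longrightarrow> d' k (f (Suc k) x) = f k (d k x)"
    and gd: "\<And>k x. x \<in> carrier (W (Suc k)) \<Longrightarrow> d k (g (Suc k) x) = g k (d' k x)"
    and s: "\<And>k. linear_map complex_field (V k) (V (Suc k)) (s k)"
    and t: "\<And>k. linear_map complex_field (W k) (W (Suc k)) (t k)"
    and gf0: "\<And>x. x \<in> carrier (V 0) \<Longrightarrow> x \<ominus>\<^bsub>V 0\<^esub> g 0 (f 0 x) = d 0 (s 0 x)"
    and gf: "\<And>k x. x \<in> carrier (V (Suc k)) \<Longrightarrow>
      x \<ominus>\<^bsub>V (Suc k)\<^esub> g (Suc k) (f (Suc k) x) = d (Suc k) (s (Suc k) x) \<oplus>\<^bsub>V (Suc k)\<^esub> s k (d k x)"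
    and fg0: "\<And>x. x \<in> carrier (W 0) \<Longrightarrow> x \<ominus>\<^bsub>W 0\<^esub> f 0 (g 0 x) = d' 0 (t 0 x)"
    and fg: "\<And>k x. x \<in> carrier (W (Suc k)) \<Longrightarrow>
      x \<ominus>\<^bsub>W (Suc k)\<^esub> f (Suc k) (g (Suc k) x) = d' (Suc k) (t (Suc k) x) \<oplus>\<^bsub>W (Suc k)\<^esub> t k (d' k x)"
  shows "module_iso complex_field (homology V d k) (homology W d' k)"
proof -
  have cyc: "submodule {x \<in> carrier (A k). case k of 0 \<Rightarrow> True | Suc j \<Rightarrow> dA j x = \<zero>\<^bsub>A j\<^esub>} complex_field (A k)"
    if A: "\<And>k. left_module complex_field (A k)"
      and dA: "\<And>k. linear_map complex_field (A (Suc k)) (A k) (dA k)"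
    for A :: "nat \<Rightarrow> (complex, 'x) module" and dA
  proof (cases k)
    case 0
    interpret A: left_module complex_field "A k" by (rule A)
    show ?thesis
      using 0 A.submodule_leftI[of "carrier (A k)"] A.lsmult_closed A.M.zero_closed A.M.a_closed by auto
  next
    case (Suc j)
    then show ?thesis using linear_map_kernel_submodule[OF A A dA] by simp
  qed
  interpret V: left_module complex_field "V k" by (rule V)
  interpret W: left_module complex_field "W k" by (rule W)
  note z = linear_map_zero[OF V W f] linear_map_zero[OF W V g]
    linear_map_zero[OF V V s] linear_map_zero[OF W W t]
  show ?thesis
    unfolding homology_def
  proof (rule module_iso_subquot[OF V cyc[of V d, OF V d] linear_map_image_submodule[OF V V d] _
      W cyc[of W d', OF W d'] linear_map_image_submodule[OF W W d'] _ f _ _ g])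
    show "x \<ominus>\<^bsub>V k\<^esub> g k (f k x) \<in> d k ` carrier (V (Suc k))"
      if x: "x \<in> {x \<in> carrier (V k). case k of 0 \<Rightarrow> True | Suc j \<Rightarrow> d j x = \<zero>\<^bsub>V j\<^esub>}" for x
    proof (cases k)
      case 0
      then show ?thesis using gf0 x linear_map_closed[OF s] by auto
    next
      case (Suc j)
      \<comment> \<open>As \<open>x\<close> is a cycle, the other term of the homotopy formula
        vanishes.\<close>
      then have "x \<ominus>\<^bsub>V k\<^esub> g k (f k x) = d k (s k x)"
        using gf[of x j] x z(3) linear_map_closed[OF d linear_map_closed[OF s, of x k]] V.M.r_zero by auto
      then show ?thesis using x linear_map_closed[OF s] by auto
    qed
    show "x \<ominus>\<^bsub>W k\<^esub> f k (g k x) \<in> d' k ` carrier (W (Suc k))"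
      if x: "x \<in> {x \<in> carrier (W k). case k of 0 \<Rightarrow> True | Suc j \<Rightarrow> d' j x = \<zero>\<^bsub>W j\<^esub>}" for x
    proof (cases k)
      case 0
      then show ?thesis using fg0 x linear_map_closed[OF t] by auto
    next
      case (Suc j)
      then have "x \<ominus>\<^bsub>W k\<^esub> f k (g k x) = d' k (t k x)"
        using fg[of x j] x z(4) linear_map_closed[OF d' linear_map_closed[OF t, of x k]] W.M.r_zero by auto
      then show ?thesis using x linear_map_closed[OF t] by auto
    qed
    show "f k x \<in> d' k ` carrier (W (Suc k))" if "x \<in> d k ` carrier (V (Suc k))" for x
      using that fd[symmetric] linear_map_closed[OF f] by auto
    show "g k x \<in> d k ` carrier (V (Suc k))" if "x \<in> d' k ` carrier (W (Suc k))" for x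
      using that gd[symmetric] linear_map_closed[OF g] by auto
    show "f k x \<in> {x \<in> carrier (W k). case k of 0 \<Rightarrow> True | Suc j \<Rightarrow> d' j x = \<zero>\<^bsub>W j\<^esub>}"
      if "x \<in> {x \<in> carrier (V k). case k of 0 \<Rightarrow> True | Suc j \<Rightarrow> d j x = \<zero>\<^bsub>V j\<^esub>}" for x
      using that linear_map_closed[OF f] z(1) by (cases k) (auto simp: fd)
    show "g k x \<in> {x \<in> carrier (V k). case k of 0 \<Rightarrow> True | Suc j \<Rightarrow> d j x = \<zero>\<^bsub>V j\<^esub>}"
      if "x \<in> {x \<in> carrier (W k). case k of 0 \<Rightarrow> True | Suc j \<Rightarrow> d' j x = \<zero>\<^bsub>W j\<^esub>}" for x
      using that linear_map_closed[OF g] z(2) by (cases k) (auto simp: gd)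
    show "d k ` carrier (V (Suc k)) \<subseteq> {x \<in> carrier (V k). case k of 0 \<Rightarrow> True | Suc j \<Rightarrow> d j x = \<zero>\<^bsub>V j\<^esub>}"
      using linear_map_closed[OF d] by (cases k) (auto simp: dd)
    show "d' k ` carrier (W (Suc k)) \<subseteq> {x \<in> carrier (W k). case k of 0 \<Rightarrow> True | Suc j \<Rightarrow> d' j x = \<zero>\<^bsub>W j\<^esub>}"
      using linear_map_closed[OF d'] by (cases k) (auto simp: dd')
  qed
qed

lemma cohomology_iso:
  assumes V: "\<And>k. left_module complex_field (V k)" and W: "\<And>k. left_module complex_field (W k)"
    and d: "\<And>k. linear_map complex_field (V k) (V (Suc k)) (d k)"
    and d': "\<And>k. linear_map complex_field (W k) (W (Suc k)) (d' k)"
    and dd: "\<And>k x. x \<in> carrier (V k) \<Longrightarrow> d (Suc k) (d k x) = \<zero>\<^bsub>V (Suc (Suc k))\<^esub>"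
    and dd': "\<And>k x. x \<in> carrier (W k) \<Longrightarrow> d' (Suc k) (d' k x) = \<zero>\<^bsub>W (Suc (Suc k))\<^esub>"
    and f: "\<And>k. linear_map complex_field (V k) (W k) (f k)"
    and g: "\<And>k. linear_map complex_field (W k) (V k) (g k)"
    and fd: "\<And>k x. x \<in> carrier (V k) \<Longrightarrow> d' k (f k x) = f (Suc k) (d k x)"
    and gd: "\<And>k x. x \<in> carrier (W k) \<Longrightarrow> d k (g k x) = g (Suc k) (d' k x)"
    and s: "\<And>k. linear_map complex_field (V (Suc k)) (V k) (s k)"
    and t: "\<And>k. linear_map complex_field (W (Suc k)) (W k) (t k)"
    and gf0: "\<And>x. x \<in> carrier (V 0) \<Longrightarrow> x \<ominus>\<^bsub>V 0\<^esub> g 0 (f 0 x) = s 0 (d 0 x)"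
    and gf: "\<And>k x. x \<in> carrier (V (Suc k)) \<Longrightarrow>
      x \<ominus>\<^bsub>V (Suc k)\<^esub> g (Suc k) (f (Suc k) x) = s (Suc k) (d (Suc k) x) \<oplus>\<^bsub>V (Suc k)\<^esub> d k (s k x)"
    and fg0: "\<And>x. x \<in> carrier (W 0) \<Longrightarrow> x \<ominus>\<^bsub>W 0\<^esub> f 0 (g 0 x) = t 0 (d' 0 x)"
    and fg: "\<And>k x. x \<in> carrier (W (Suc k)) \<Longrightarrow>
      x \<ominus>\<^bsub>W (Suc k)\<^esub> f (Suc k) (g (Suc k) x) = t (Suc k) (d' (Suc k) x) \<oplus>\<^bsub>W (Suc k)\<^esub> d' k (t k x)"
  shows "module_iso complex_field (cohomology V d k) (cohomology W d' k)"
proof -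
  have bd: "submodule (case k of 0 \<Rightarrow> {\<zero>\<^bsub>A 0\<^esub>} | Suc j \<Rightarrow> dA j ` carrier (A j)) complex_field (A k)"
    if A: "\<And>k. left_module complex_field (A k)"
      and dA: "\<And>k. linear_map complex_field (A k) (A (Suc k)) (dA k)"
    for A :: "nat \<Rightarrow> (complex, 'x) module" and dA
  proof (cases k)
    case 0
    interpret A: left_module complex_field "A 0" by (rule A)
    show ?thesis
      using 0 A.submodule_leftI[of "{\<zero>\<^bsub>A 0\<^esub>}"] A.M.zero_closed A.M.l_zero A.lsmult_r_null by auto
  next
    case (Suc j)
    then show ?thesis using linear_map_image_submodule[OF A A dA] by simp
  qed
  interpret V: left_module complex_field "V k" by (rule V)
  interpret W: left_module complex_field "W k" by (rule W)
  note z = linear_map_zero[OF V W f] linear_map_zero[OF W V g]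
    linear_map_zero[OF V V s] linear_map_zero[OF W W t] linear_map_zero[OF V V d] linear_map_zero[OF W W d']
  have zc: "\<zero>\<^bsub>V j\<^esub> \<in> carrier (V j)" "\<zero>\<^bsub>W j\<^esub> \<in> carrier (W j)" for j
    using V[of j] W[of j] by (simp_all add: left_module_def abelian_group_def abelian_monoid.zero_closed)
  show ?thesis
    unfolding cohomology_def
  proof (rule module_iso_subquot[OF V linear_map_kernel_submodule[OF V V d] bd[of V d, OF V d] _
      W linear_map_kernel_submodule[OF W W d'] bd[of W d', OF W d'] _ f _ _ g])
    show "x \<ominus>\<^bsub>V k\<^esub> g k (f k x) \<in> (case k of 0 \<Rightarrow> {\<zero>\<^bsub>V 0\<^esub>} | Suc j \<Rightarrow> d j ` carrier (V j))"
      if x: "x \<in> {x \<in> carrier (V k). d k x = \<zero>\<^bsub>V (Suc k)\<^esub>}" for x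
    proof (cases k)
      case 0
      then show ?thesis using gf0 x z(3) by auto
    next
      case (Suc j)
      then have "x \<ominus>\<^bsub>V k\<^esub> g k (f k x) = d j (s j x)"
        using gf[of x j] x z(3) linear_map_closed[OF d linear_map_closed[OF s, of x j]] V.M.l_zero by auto
      then show ?thesis using Suc x linear_map_closed[OF s, of x j] by auto
    qed
    show "x \<ominus>\<^bsub>W k\<^esub> f k (g k x) \<in> (case k of 0 \<Rightarrow> {\<zero>\<^bsub>W 0\<^esub>} | Suc j \<Rightarrow> d' j ` carrier (W j))"
      if x: "x \<in> {x \<in> carrier (W k). d' k x = \<zero>\<^bsub>W (Suc k)\<^esub>}" for x
    proof (cases k)
      case 0
      then show ?thesis using fg0 x z(4) by auto
    next
      case (Suc j)
      then have "x \<ominus>\<^bsub>W k\<^esub> f k (g k x) = d' j (t j x)"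
        using fg[of x j] x z(4) linear_map_closed[OF d' linear_map_closed[OF t, of x j]] W.M.l_zero by auto
      then show ?thesis using Suc x linear_map_closed[OF t, of x j] by auto
    qed
    show "f k x \<in> (case k of 0 \<Rightarrow> {\<zero>\<^bsub>W 0\<^esub>} | Suc j \<Rightarrow> d' j ` carrier (W j))"
      if "x \<in> (case k of 0 \<Rightarrow> {\<zero>\<^bsub>V 0\<^esub>} | Suc j \<Rightarrow> d j ` carrier (V j))" for x
      using that fd[symmetric] linear_map_closed[OF f] z by (auto split: nat.splits)
    show "g k x \<in> (case k of 0 \<Rightarrow> {\<zero>\<^bsub>V 0\<^esub>} | Suc j \<Rightarrow> d j ` carrier (V j))"
      if "x \<in> (case k of 0 \<Rightarrow> {\<zero>\<^bsub>W 0\<^esub>} | Suc j \<Rightarrow> d' j ` carrier (W j))" for x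
      using that gd[symmetric] linear_map_closed[OF g] z by (auto split: nat.splits)
    show "(case k of 0 \<Rightarrow> {\<zero>\<^bsub>V 0\<^esub>} | Suc j \<Rightarrow> d j ` carrier (V j)) \<subseteq> {x \<in> carrier (V k). d k x = \<zero>\<^bsub>V (Suc k)\<^esub>}"
      using dd z zc linear_map_closed[OF d] by (auto split: nat.splits)
    show "(case k of 0 \<Rightarrow> {\<zero>\<^bsub>W 0\<^esub>} | Suc j \<Rightarrow> d' j ` carrier (W j)) \<subseteq> {x \<in> carrier (W k). d' k x = \<zero>\<^bsub>W (Suc k)\<^esub>}"
      using dd' z zc linear_map_closed[OF d'] by (auto split: nat.splits)
  qed (use fd gd z linear_map_closed[OF f] linear_map_closed[OF g] in auto)
qed

section \<open>Tor and Ext from a resolution by free modules of finite rank\<close>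

subsection \<open>Finite powers of a module\<close>

text \<open>For finite \<open>I\<close> this is at once the tensor product of \<open>N\<close> with
  the free module on \<open>I\<close> and the space of homomorphisms from that free module to
  \<open>N\<close>. Hence both sides of the duality are computed in spaces of the same
  shape.\<close>

definition power_module ::
  "(complex, 'a) module \<Rightarrow> ('a, 'n) module \<Rightarrow> 'i set \<Rightarrow> (complex, 'i \<Rightarrow> 'n) module"
  where "power_module A N I =
    \<lparr>carrier = {x. (\<forall>i\<in>I. x i \<in> carrier N) \<and> (\<forall>i. i \<notin> I \<longrightarrow> x i = \<zero>\<^bsub>N\<^esub>)},
     monoid.mult = undefined, monoid.one = undefined,
     ring.zero = (\<lambda>i. \<zero>\<^bsub>N\<^esub>), ring.add = (\<lambda>x y i. x i \<oplus>\<^bsub>N\<^esub> y i),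
     module.smult = (\<lambda>c x i. (c \<odot>\<^bsub>A\<^esub> \<one>\<^bsub>A\<^esub>) \<odot>\<^bsub>N\<^esub> x i)\<rparr>"

lemma power_module_simps:
  "x \<in> carrier (power_module A N I) \<longleftrightarrow> (\<forall>i\<in>I. x i \<in> carrier N) \<and> (\<forall>i. i \<notin> I \<longrightarrow> x i = \<zero>\<^bsub>N\<^esub>)"
  "\<zero>\<^bsub>power_module A N I\<^esub> = (\<lambda>i. \<zero>\<^bsub>N\<^esub>)"
  "x \<oplus>\<^bsub>power_module A N I\<^esub> y = (\<lambda>i. x i \<oplus>\<^bsub>N\<^esub> y i)"
  "c \<odot>\<^bsub>power_module A N I\<^esub> x = (\<lambda>i. (c \<odot>\<^bsub>A\<^esub> \<one>\<^bsub>A\<^esub>) \<odot>\<^bsub>N\<^esub> x i)"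
  by (simp_all add: power_module_def)

lemma power_module_opposite [simp]: "power_module (opposite A) N I = power_module A N I"
  by (simp add: power_module_def)

context calgebra
begin

lemma left_module_power:
  assumes "left_module A N"
  shows "left_module complex_field (power_module A N I)"
proof -
  interpret N: left_module A N by fact
  interpret S: left_module complex_field "restrict_scalars A N"
    by (rule left_module_restrict_scalars) fact
  let ?P = "power_module A N I"
  have val: "x i \<in> carrier N" if "x \<in> carrier ?P" for x i
    using that by (cases "i \<in> I") (auto simp: power_module_simps)
  have ab: "abelian_group ?P"
  proof (rule abelian_groupI)
    show "\<exists>y\<in>carrier ?P. y \<oplus>\<^bsub>?P\<^esub> x = \<zero>\<^bsub>?P\<^esub>" if "x \<in> carrier ?P" for x
      by (rule bexI[of _ "\<lambda>i. \<ominus>\<^bsub>N\<^esub> x i"])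
        (use that val[OF that] N.M.add.inv_one in \<open>auto simp: power_module_simps N.M.l_neg\<close>)
    fix x y z assume x: "x \<in> carrier ?P" and y: "y \<in> carrier ?P"
    show "x \<oplus>\<^bsub>?P\<^esub> y \<in> carrier ?P" using x y by (simp add: power_module_simps)
    show "x \<oplus>\<^bsub>?P\<^esub> y = y \<oplus>\<^bsub>?P\<^esub> x"
      using val[OF x] val[OF y] by (simp add: power_module_simps(3) N.M.a_comm)
    show "\<zero>\<^bsub>?P\<^esub> \<oplus>\<^bsub>?P\<^esub> x = x" using val[OF x] by (simp add: power_module_simps(2,3))
    assume z: "z \<in> carrier ?P"
    show "x \<oplus>\<^bsub>?P\<^esub> y \<oplus>\<^bsub>?P\<^esub> z = x \<oplus>\<^bsub>?P\<^esub> (y \<oplus>\<^bsub>?P\<^esub> z)"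
      using val[OF x] val[OF y] val[OF z] by (simp add: power_module_simps(3) N.M.a_assoc)
  qed (simp add: power_module_simps)
  show ?thesis
    unfolding left_module_def left_module_axioms_def
  proof (intro conjI allI impI ab ring_complex_field)
    fix a b x y
    assume x: "x \<in> carrier ?P" and y: "y \<in> carrier ?P"
    show "a \<odot>\<^bsub>?P\<^esub> x \<in> carrier ?P"
      using x by (auto simp: power_module_simps N.lsmult_r_null)
    show "(a \<oplus>\<^bsub>complex_field\<^esub> b) \<odot>\<^bsub>?P\<^esub> x = a \<odot>\<^bsub>?P\<^esub> x \<oplus>\<^bsub>?P\<^esub> b \<odot>\<^bsub>?P\<^esub> x"
      using val[OF x] S.lsmult_l_distr by (auto simp: power_module_simps fun_eq_iff)
    show "a \<odot>\<^bsub>?P\<^esub> (x \<oplus>\<^bsub>?P\<^esub> y) = a \<odot>\<^bsub>?P\<^esub> x \<oplus>\<^bsub>?P\<^esub> a \<odot>\<^bsub>?P\<^esub> y"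
      using val[OF x] val[OF y] S.lsmult_r_distr by (auto simp: power_module_simps fun_eq_iff)
    show "(a \<otimes>\<^bsub>complex_field\<^esub> b) \<odot>\<^bsub>?P\<^esub> x = a \<odot>\<^bsub>?P\<^esub> (b \<odot>\<^bsub>?P\<^esub> x)"
      using val[OF x] S.lsmult_assoc by (auto simp: power_module_simps fun_eq_iff)
    show "\<one>\<^bsub>complex_field\<^esub> \<odot>\<^bsub>?P\<^esub> x = x"
      using val[OF x] S.lsmult_one by (auto simp: power_module_simps fun_eq_iff)
  qed
qed

end

lemma finsum_power_module:
  assumes "left_module complex_field (power_module A N I)" "left_module complex_field (restrict_scalars A N)"
    and "f \<in> S \<rightarrow> carrier (power_module A N I)"
  shows "(\<Oplus>\<^bsub>power_module A N I\<^esub>s\<in>S. f s) i = (\<Oplus>\<^bsub>N\<^esub>s\<in>S. f s i)"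
proof -
  interpret N: left_module complex_field "restrict_scalars A N" by fact
  have "linear_map complex_field (power_module A N I) (restrict_scalars A N) (\<lambda>x. x i)"
    using N.M.zero_closed by (cases "i \<in> I") (auto intro!: linear_mapI simp: power_module_simps)
  from linear_map_finsum[OF assms(1,2) this assms(3)] show ?thesis by simp
qed

subsection \<open>Maps out of free modules of finite rank\<close>

definition lin_comb :: "('a, 'm, 's) module_scheme \<Rightarrow> 'i set \<Rightarrow> ('i \<Rightarrow> 'm) \<Rightarrow> ('i \<Rightarrow> 'a) \<Rightarrow> 'm"
  where "lin_comb Y I m x = (\<Oplus>\<^bsub>Y\<^esub>i\<in>I. x i \<odot>\<^bsub>Y\<^esub> m i)"

lemma lin_comb_linear:
  assumes "ring R" "left_module R Y" "m \<in> I \<rightarrow> carrier Y"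
  shows "linear_map R (free_module R I) Y (lin_comb Y I m)"
proof -
  interpret Y: left_module R Y by fact
  note val = free_module_val[OF assms(1)]
  note m = funcset_mem[OF assms(3)]
  show ?thesis
  proof (rule linear_mapI)
    fix x y a assume x: "x \<in> carrier (free_module R I)"
    show "lin_comb Y I m x \<in> carrier Y"
      unfolding lin_comb_def using val[OF x] m by (auto intro!: Y.M.finsum_closed)
    show "lin_comb Y I m (a \<odot>\<^bsub>free_module R I\<^esub> x) = a \<odot>\<^bsub>Y\<^esub> lin_comb Y I m x" if a: "a \<in> carrier R"
      unfolding lin_comb_def free_module_simps using val[OF x] m a
      by (subst Y.lsmult_finsum) (auto simp: Y.lsmult_assoc intro!: Y.M.finsum_cong')
    assume y: "y \<in> carrier (free_module R I)"
    show "lin_comb Y I m (x \<oplus>\<^bsub>free_module R I\<^esub> y) = lin_comb Y I m x \<oplus>\<^bsub>Y\<^esub> lin_comb Y I m y"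
    proof -
      have "lin_comb Y I m (x \<oplus>\<^bsub>free_module R I\<^esub> y)
          = (\<Oplus>\<^bsub>Y\<^esub>i\<in>I. x i \<odot>\<^bsub>Y\<^esub> m i \<oplus>\<^bsub>Y\<^esub> y i \<odot>\<^bsub>Y\<^esub> m i)"
        unfolding lin_comb_def free_module_simps
        by (rule Y.M.finsum_cong') (use val[OF x] val[OF y] m in \<open>auto simp: Y.lsmult_l_distr\<close>)
      also have "\<dots> = lin_comb Y I m x \<oplus>\<^bsub>Y\<^esub> lin_comb Y I m y"
        unfolding lin_comb_def by (rule Y.M.finsum_addf) (use val[OF x] val[OF y] m in auto)
      finally show ?thesis .
    qed
  qed
qed

lemma lin_comb_basis:
  assumes "left_module R Y" "m \<in> I \<rightarrow> carrier Y" "finite I" "i \<in> I"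
  shows "lin_comb Y I m (basis_vec R i) = m i"
proof -
  interpret Y: left_module R Y by fact
  note m = funcset_mem[OF assms(2)]
  have "lin_comb Y I m (basis_vec R i) = (\<Oplus>\<^bsub>Y\<^esub>j\<in>I. if i = j then m j else \<zero>\<^bsub>Y\<^esub>)"
    unfolding lin_comb_def basis_vec_def
    by (rule Y.M.finsum_cong') (use m in \<open>auto simp: Y.lsmult_l_null\<close>)
  also have "\<dots> = m i"
    by (rule Y.M.finsum_singleton) (use assms m in auto)
  finally show ?thesis .
qed

lemma lin_comb_expand:
  assumes R: "ring R" and Y: "left_module R Y" and f: "linear_map R (free_module R I) Y f"
    and I: "finite I" and x: "x \<in> carrier (free_module R I)"
  shows "f x = lin_comb Y I (\<lambda>i. f (basis_vec R i)) x"
proof -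
  have m: "(\<lambda>i. f (basis_vec R i)) \<in> I \<rightarrow> carrier Y"
    using linear_map_closed[OF f basis_vec_closed[OF R]] by simp
  show ?thesis
    by (rule free_module_map_eq[OF R Y f lin_comb_linear[OF R Y m] _ x])
      (simp add: lin_comb_basis[OF Y m I])
qed

subsection \<open>Tor from a finite free resolution\<close>

text \<open>The tensor n \<otimes> x in coordinates; for a right module \<open>N\<close> the entry
  at \<open>i\<close> is n times \<open>x i\<close>.\<close>

definition pairing :: "('a, 'n) module \<Rightarrow> 'n \<Rightarrow> ('i \<Rightarrow> 'a) \<Rightarrow> 'i \<Rightarrow> 'n"
  where "pairing N n x = (\<lambda>i. x i \<odot>\<^bsub>N\<^esub> n)"

text \<open>The map id \<otimes> t in these coordinates, \<open>t (basis_vec A i) j\<close> being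
  the matrix of \<open>t\<close>.\<close>

definition power_map ::
  "(complex, 'a) module \<Rightarrow> ('a, 'n) module \<Rightarrow> 'i set \<Rightarrow> (('i \<Rightarrow> 'a) \<Rightarrow> 'j \<Rightarrow> 'a) \<Rightarrow> ('i \<Rightarrow> 'n) \<Rightarrow> 'j \<Rightarrow> 'n"
  where "power_map A N I t x = (\<lambda>j. \<Oplus>\<^bsub>N\<^esub>i\<in>I. t (basis_vec A i) j \<odot>\<^bsub>N\<^esub> x i)"

locale right_module = calgebra A for A :: "(complex, 'a) module" +
  fixes N :: "('a, 'n) module"
  assumes right: "left_module (opposite A) N"
begin

sublocale N: left_module "opposite A" N by (rule right)

lemma N_smult_closed [simp]: "a \<in> carrier A \<Longrightarrow> n \<in> carrier N \<Longrightarrow> a \<odot>\<^bsub>N\<^esub> n \<in> carrier N"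
  using N.lsmult_closed by simp

lemma N_distr:
  "a \<in> carrier A \<Longrightarrow> b \<in> carrier A \<Longrightarrow> n \<in> carrier N \<Longrightarrow> (a \<oplus>\<^bsub>A\<^esub> b) \<odot>\<^bsub>N\<^esub> n = a \<odot>\<^bsub>N\<^esub> n \<oplus>\<^bsub>N\<^esub> b \<odot>\<^bsub>N\<^esub> n"
  "a \<in> carrier A \<Longrightarrow> n \<in> carrier N \<Longrightarrow> n' \<in> carrier N \<Longrightarrow> a \<odot>\<^bsub>N\<^esub> (n \<oplus>\<^bsub>N\<^esub> n') = a \<odot>\<^bsub>N\<^esub> n \<oplus>\<^bsub>N\<^esub> a \<odot>\<^bsub>N\<^esub> n'"
  using N.lsmult_l_distr N.lsmult_r_distr by simp_all

lemma N_assoc: "a \<in> carrier A \<Longrightarrow> b \<in> carrier A \<Longrightarrow> n \<in> carrier N \<Longrightarrow> (a \<otimes>\<^bsub>A\<^esub> b) \<odot>\<^bsub>N\<^esub> n = b \<odot>\<^bsub>N\<^esub> (a \<odot>\<^bsub>N\<^esub> n)"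
  using N.lsmult_assoc[of b a n] by simp

lemma N_simps [simp]: "n \<in> carrier N \<Longrightarrow> \<one>\<^bsub>A\<^esub> \<odot>\<^bsub>N\<^esub> n = n" "n \<in> carrier N \<Longrightarrow> \<zero>\<^bsub>A\<^esub> \<odot>\<^bsub>N\<^esub> n = \<zero>\<^bsub>N\<^esub>"
  "a \<in> carrier A \<Longrightarrow> a \<odot>\<^bsub>N\<^esub> \<zero>\<^bsub>N\<^esub> = \<zero>\<^bsub>N\<^esub>"
  using N.lsmult_one N.lsmult_l_null N.lsmult_r_null by simp_all

lemma N_scal_commute:
  "a \<in> carrier A \<Longrightarrow> n \<in> carrier N \<Longrightarrow> scal c \<odot>\<^bsub>N\<^esub> (a \<odot>\<^bsub>N\<^esub> n) = a \<odot>\<^bsub>N\<^esub> (scal c \<odot>\<^bsub>N\<^esub> n)"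
  using scal_central[of a c] by (simp flip: N_assoc)

lemma left_module_restrict_right: "left_module complex_field (restrict_scalars A N)"
proof -
  interpret op: calgebra "opposite A" by (rule calgebra.intro) (rule complex_algebra_opposite[OF alg])
  show ?thesis using op.left_module_restrict_scalars[OF right] by simp
qed

lemma left_module_power_right: "left_module complex_field (power_module A N I)"
proof -
  interpret op: calgebra "opposite A" by (rule calgebra.intro) (rule complex_algebra_opposite[OF alg])
  show ?thesis using op.left_module_power[OF right] by simp
qed

lemma power_module_val: "x \<in> carrier (power_module A N I) \<Longrightarrow> x i \<in> carrier N"
  by (cases "i \<in> I") (auto simp: power_module_simps)

lemma pairing_closed:
  "n \<in> carrier N \<Longrightarrow> x \<in> carrier (free_module A I) \<Longrightarrow> pairing N n x \<in> carrier (power_module A N I)"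
  by (auto simp: pairing_def power_module_simps free_module_simps)

lemma pairing_smult:
  assumes "n \<in> carrier N" "x \<in> carrier (free_module A I)" "a \<in> carrier A"
  shows "pairing N n (a \<odot>\<^bsub>free_module A I\<^esub> x) = pairing N (a \<odot>\<^bsub>N\<^esub> n) x"
  using assms free_module_val[OF A.ring_axioms assms(2)] by (simp add: pairing_def free_module_simps N_assoc)

lemma pairing_add:
  assumes "n \<in> carrier N" "x \<in> carrier (free_module A I)" "y \<in> carrier (free_module A I)"
  shows "pairing N n (x \<oplus>\<^bsub>free_module A I\<^esub> y) = pairing N n x \<oplus>\<^bsub>power_module A N I\<^esub> pairing N n y"
  using assms(1) free_module_val[OF A.ring_axioms assms(2)] free_module_val[OF A.ring_axioms assms(3)]
  by (simp add: pairing_def free_module_simps(3) power_module_simps(3) N_distr)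

lemma pairing_zero: "n \<in> carrier N \<Longrightarrow> pairing N n \<zero>\<^bsub>free_module A I\<^esub> = \<zero>\<^bsub>power_module A N I\<^esub>"
  by (simp add: pairing_def free_module_simps power_module_simps)

lemma power_map_linear:
  assumes t: "linear_map A (free_module A I) (free_module A J) t"
  shows "linear_map complex_field (power_module A N I) (power_module A N J) (power_map A N I t)"
proof (rule linear_mapI)
  interpret S: left_module complex_field "restrict_scalars A N" by (rule left_module_restrict_right)
  have tb: "t (basis_vec A i) \<in> carrier (free_module A J)" if "i \<in> I" for i
    using linear_map_closed[OF t basis_vec_closed[OF A.ring_axioms that]] .
  note tv = free_module_val[OF A.ring_axioms tb]
  fix x y c assume x: "x \<in> carrier (power_module A N I)"
  note xv = power_module_val[OF x]
  have "(\<Oplus>\<^bsub>N\<^esub>i\<in>I. t (basis_vec A i) j \<odot>\<^bsub>N\<^esub> x i) = \<zero>\<^bsub>N\<^esub>" if "j \<notin> J" for j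
  proof -
    have "t (basis_vec A i) j \<odot>\<^bsub>N\<^esub> x i = \<zero>\<^bsub>N\<^esub>" if "i \<in> I" for i
      using tb[OF that] \<open>j \<notin> J\<close> xv by (simp add: free_module_simps)
    then show ?thesis by (rule N.M.add.finprod_one_eqI)
  qed
  then show "power_map A N I t x \<in> carrier (power_module A N J)"
    using tv xv by (auto simp: power_map_def power_module_simps intro!: N.M.finsum_closed)
  show "power_map A N I t (c \<odot>\<^bsub>power_module A N I\<^esub> x) = c \<odot>\<^bsub>power_module A N J\<^esub> power_map A N I t x"
  proof
    fix j
    have "scal c \<odot>\<^bsub>N\<^esub> (\<Oplus>\<^bsub>N\<^esub>i\<in>I. t (basis_vec A i) j \<odot>\<^bsub>N\<^esub> x i)
        = (\<Oplus>\<^bsub>N\<^esub>i\<in>I. scal c \<odot>\<^bsub>N\<^esub> (t (basis_vec A i) j \<odot>\<^bsub>N\<^esub> x i))"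
      by (rule N.lsmult_finsum) (use tv xv in auto)
    also have "\<dots> = (\<Oplus>\<^bsub>N\<^esub>i\<in>I. t (basis_vec A i) j \<odot>\<^bsub>N\<^esub> (scal c \<odot>\<^bsub>N\<^esub> x i))"
      by (rule N.M.finsum_cong') (use tv xv N_scal_commute in auto)
    finally show "power_map A N I t (c \<odot>\<^bsub>power_module A N I\<^esub> x) j
        = (c \<odot>\<^bsub>power_module A N J\<^esub> power_map A N I t x) j"
      by (simp add: power_map_def power_module_simps)
  qed
  assume y: "y \<in> carrier (power_module A N I)"
  note yv = power_module_val[OF y]
  show "power_map A N I t (x \<oplus>\<^bsub>power_module A N I\<^esub> y)
      = power_map A N I t x \<oplus>\<^bsub>power_module A N J\<^esub> power_map A N I t y"
  proof
    fix j
    have "(\<Oplus>\<^bsub>N\<^esub>i\<in>I. t (basis_vec A i) j \<odot>\<^bsub>N\<^esub> (x i \<oplus>\<^bsub>N\<^esub> y i))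
        = (\<Oplus>\<^bsub>N\<^esub>i\<in>I. t (basis_vec A i) j \<odot>\<^bsub>N\<^esub> x i \<oplus>\<^bsub>N\<^esub> t (basis_vec A i) j \<odot>\<^bsub>N\<^esub> y i)"
      by (rule N.M.finsum_cong') (use tv xv yv N_distr in auto)
    also have "\<dots> = (\<Oplus>\<^bsub>N\<^esub>i\<in>I. t (basis_vec A i) j \<odot>\<^bsub>N\<^esub> x i) \<oplus>\<^bsub>N\<^esub> (\<Oplus>\<^bsub>N\<^esub>i\<in>I. t (basis_vec A i) j \<odot>\<^bsub>N\<^esub> y i)"
      by (rule N.M.finsum_addf) (use tv xv yv in auto)
    finally show "power_map A N I t (x \<oplus>\<^bsub>power_module A N I\<^esub> y) j
        = (power_map A N I t x \<oplus>\<^bsub>power_module A N J\<^esub> power_map A N I t y) j"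
      by (simp add: power_map_def power_module_simps)
  qed
qed

text \<open>This justifies reading \<open>power_map\<close> as id \<otimes> t. By additivity in
  \<open>x\<close> only multiples of basis vectors need attention.\<close>

lemma power_map_pairing:
  assumes t: "linear_map A (free_module A I) (free_module A J) t" and I: "finite I"
    and n: "n \<in> carrier N" and x: "x \<in> carrier (free_module A I)"
  shows "power_map A N I t (pairing N n x) = pairing N n (t x)"
  using A.ring_axioms x
proof (induction rule: free_module_induct)
  note FI = left_module_free_module[OF A.ring_axioms, of I] and FJ = left_module_free_module[OF A.ring_axioms, of J]
  note P = left_module_power_right
  note pl = power_map_linear[OF t]
  {
    case zero
    show ?case
      using linear_map_zero[OF P P pl] linear_map_zero[OF FI FJ t] n
      by (simp add: pairing_zero[of n])
  next
    case (step x i a)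
    then have x: "x \<in> carrier (free_module A I)" and i: "i \<in> I" and a: "a \<in> carrier A" by auto
    have b: "basis_vec A i \<in> carrier (free_module A I)" by (rule basis_vec_closed[OF A.ring_axioms i])
    have ab: "a \<odot>\<^bsub>free_module A I\<^esub> basis_vec A i \<in> carrier (free_module A I)"
      using left_module.lsmult_closed[OF FI a b] .
    note tb = linear_map_closed[OF t b]
    \<comment> \<open>As n \<otimes> a e_i = n a \<otimes> e_i, the basis vector itself suffices,
      with \<open>n\<close> replaced by \<open>?n\<close>.\<close>
    let ?n = "a \<odot>\<^bsub>N\<^esub> n"
    have an: "?n \<in> carrier N" using a n by simp
    have basis: "power_map A N I t (pairing N ?n (basis_vec A i)) = pairing N ?n (t (basis_vec A i))"
    proof
      fix j
      have tv: "t (basis_vec A k) j \<in> carrier A" if "k \<in> I" for k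
        by (rule free_module_val[OF A.ring_axioms linear_map_closed[OF t basis_vec_closed[OF A.ring_axioms that]]])
      have "power_map A N I t (pairing N ?n (basis_vec A i)) j
          = (\<Oplus>\<^bsub>N\<^esub>k\<in>I. if i = k then t (basis_vec A k) j \<odot>\<^bsub>N\<^esub> ?n else \<zero>\<^bsub>N\<^esub>)"
        unfolding power_map_def pairing_def
        by (rule N.M.finsum_cong') (use tv an in \<open>auto simp: basis_vec_def\<close>)
      also have "\<dots> = t (basis_vec A i) j \<odot>\<^bsub>N\<^esub> ?n"
        by (rule N.M.finsum_singleton) (use i I tv an in auto)
      finally show "power_map A N I t (pairing N ?n (basis_vec A i)) j = pairing N ?n (t (basis_vec A i)) j"
        by (simp add: pairing_def)
    qed
    show ?case
      using step.IH linear_map_closed[OF t x] left_module.lsmult_closed[OF FJ a tb]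
      by (simp add: pairing_add[OF n x ab] linear_map_add[OF pl] pairing_closed[OF n x] pairing_closed[OF an b]
        linear_map_add[OF t x ab] linear_map_smult[OF t a b] pairing_add[OF n]
        pairing_smult[OF n b a] basis pairing_smult[OF n tb a])
  }
qed

text \<open>The counterpart of \<open>tensor_map_ext\<close>: an element is the sum of the pairings
  of its entries with the basis vectors, a finite sum.\<close>

lemma power_module_ext:
  assumes I: "finite I" and W: "left_module complex_field W"
    and f: "linear_map complex_field (power_module A N I) W f"
    and g: "linear_map complex_field (power_module A N I) W g"
    and eq: "\<And>n i. n \<in> carrier N \<Longrightarrow> i \<in> I \<Longrightarrow> f (pairing N n (basis_vec A i)) = g (pairing N n (basis_vec A i))"
    and x: "x \<in> carrier (power_module A N I)"
  shows "f x = g x"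
proof -
  interpret W: left_module complex_field W by fact
  note xv = power_module_val[OF x]
  have cl: "(\<lambda>i. pairing N (x i) (basis_vec A i)) \<in> I \<rightarrow> carrier (power_module A N I)"
    by (intro Pi_I pairing_closed xv basis_vec_closed[OF A.ring_axioms])
  have "x = (\<Oplus>\<^bsub>power_module A N I\<^esub>i\<in>I. pairing N (x i) (basis_vec A i))"
  proof
    fix j
    have "(\<Oplus>\<^bsub>power_module A N I\<^esub>i\<in>I. pairing N (x i) (basis_vec A i)) j
        = (\<Oplus>\<^bsub>N\<^esub>i\<in>I. pairing N (x i) (basis_vec A i) j)"
      by (rule finsum_power_module[OF left_module_power_right left_module_restrict_right cl])
    also have "\<dots> = (\<Oplus>\<^bsub>N\<^esub>i\<in>I. if j = i then x i else \<zero>\<^bsub>N\<^esub>)"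
      by (rule N.M.finsum_cong') (use xv in \<open>auto simp: pairing_def basis_vec_def\<close>)
    also have "\<dots> = x j"
    proof (cases "j \<in> I")
      case True
      then show ?thesis by (intro N.M.finsum_singleton) (use I xv in auto)
    next
      case False
      then have "(\<Oplus>\<^bsub>N\<^esub>i\<in>I. if j = i then x i else \<zero>\<^bsub>N\<^esub>) = \<zero>\<^bsub>N\<^esub>"
        by (intro N.M.add.finprod_one_eqI) auto
      then show ?thesis using False x by (simp add: power_module_simps)
    qed
    finally show "x j = (\<Oplus>\<^bsub>power_module A N I\<^esub>i\<in>I. pairing N (x i) (basis_vec A i)) j" by simp
  qed
  moreover have "f (\<Oplus>\<^bsub>power_module A N I\<^esub>i\<in>I. pairing N (x i) (basis_vec A i))
      = g (\<Oplus>\<^bsub>power_module A N I\<^esub>i\<in>I. pairing N (x i) (basis_vec A i))"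
    unfolding linear_map_finsum[OF left_module_power_right W f cl] linear_map_finsum[OF left_module_power_right W g cl]
    using eq[OF xv] linear_map_closed[OF g] cl by (intro W.M.finsum_cong') auto
  ultimately show ?thesis by simp
qed

text \<open>The \<open>k\<close>-th power of \<open>N\<close> represents the tensor product of \<open>N\<close> with the free module of
  rank \<open>k\<close>; the two maps below are mutually inverse up to the given maps \<open>f\<close> and \<open>g\<close>.\<close>

lemma tensor_to_power:
  assumes M: "left_module A M" and f: "linear_map A M (free_module A I) f"
  obtains h where "linear_map complex_field (tensor_product A N M) (power_module A N I) h"
    and "\<And>n m. n \<in> carrier N \<Longrightarrow> m \<in> carrier M \<Longrightarrow> h (pure_tensor A N M n m) = pairing N n (f m)"
proof -
  interpret T: tensor_modules A N M
    using calgebra_axioms right M by (simp add: tensor_modules_def tensor_modules_axioms_def)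
  note fc = linear_map_closed[OF f]
  show thesis
  proof (rule T.tensor_universal[OF left_module_power_right, of "\<lambda>n m. pairing N n (f m)" I])
    fix n n' m assume "n \<in> carrier N" "n' \<in> carrier N" "m \<in> carrier M"
    then show "pairing N (n \<oplus>\<^bsub>N\<^esub> n') (f m) = pairing N n (f m) \<oplus>\<^bsub>power_module A N I\<^esub> pairing N n' (f m)"
      using free_module_val[OF A.ring_axioms fc] by (simp add: pairing_def power_module_simps(3) N_distr)
  next
    fix a n m assume "a \<in> carrier A" "n \<in> carrier N" "m \<in> carrier M"
    then show "pairing N (a \<odot>\<^bsub>N\<^esub> n) (f m) = pairing N n (f (a \<odot>\<^bsub>M\<^esub> m))"
      using pairing_smult[OF _ fc] by (simp add: linear_map_smult[OF f])
  next
    fix c n m assume "n \<in> carrier N" "m \<in> carrier M"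
    then show "pairing N (scal c \<odot>\<^bsub>N\<^esub> n) (f m) = c \<odot>\<^bsub>power_module A N I\<^esub> pairing N n (f m)"
      using free_module_val[OF A.ring_axioms fc] by (simp add: pairing_def power_module_simps(4) N_scal_commute)
  qed (use fc in \<open>auto simp: pairing_closed pairing_add linear_map_add[OF f] intro: that\<close>)
qed

lemma power_to_tensor:
  assumes M: "left_module A M" and g: "linear_map A (free_module A I) M g" and I: "finite I"
  obtains h where "linear_map complex_field (power_module A N I) (tensor_product A N M) h"
    and "\<And>n x. n \<in> carrier N \<Longrightarrow> x \<in> carrier (free_module A I) \<Longrightarrow> h (pairing N n x) = pure_tensor A N M n (g x)"
proof -
  interpret T: tensor_modules A N M
    using calgebra_axioms right M by (simp add: tensor_modules_def tensor_modules_axioms_def)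
  interpret TP: left_module complex_field "tensor_product A N M" by (rule T.left_module_tensor)
  have gb: "g (basis_vec A i) \<in> carrier M" if "i \<in> I" for i
    using linear_map_closed[OF g basis_vec_closed[OF A.ring_axioms that]] .
  define h where "h = (\<lambda>x. \<Oplus>\<^bsub>tensor_product A N M\<^esub>i\<in>I. pure_tensor A N M (x i) (g (basis_vec A i)))"
  have h: "linear_map complex_field (power_module A N I) (tensor_product A N M) h"
  proof (rule linear_mapI)
    fix x y c assume x: "x \<in> carrier (power_module A N I)"
    note xv = power_module_val[OF x]
    have cl: "(\<lambda>i. pure_tensor A N M (x i) (g (basis_vec A i))) \<in> I \<rightarrow> carrier (tensor_product A N M)"
      if "x \<in> carrier (power_module A N I)" for x
      using gb power_module_val[OF that] by (auto intro: T.pure_tensor_closed)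
    show "h x \<in> carrier (tensor_product A N M)"
      unfolding h_def by (rule TP.M.finsum_closed[OF cl[OF x]])
    show "h (c \<odot>\<^bsub>power_module A N I\<^esub> x) = c \<odot>\<^bsub>tensor_product A N M\<^esub> h x"
    proof -
      have "h (c \<odot>\<^bsub>power_module A N I\<^esub> x) = (\<Oplus>\<^bsub>tensor_product A N M\<^esub>i\<in>I.
          c \<odot>\<^bsub>tensor_product A N M\<^esub> pure_tensor A N M (x i) (g (basis_vec A i)))"
        unfolding h_def using gb xv
        by (intro TP.M.finsum_cong')
          (simp_all add: power_module_simps T.pure_tensor_scal T.pure_tensor_closed TP.lsmult_closed[simplified])
      also have "\<dots> = c \<odot>\<^bsub>tensor_product A N M\<^esub> h x"
        unfolding h_def by (rule TP.lsmult_finsum[symmetric]) (use cl[OF x] in simp_all)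
      finally show ?thesis .
    qed
    assume y: "y \<in> carrier (power_module A N I)"
    note yv = power_module_val[OF y]
    have "h (x \<oplus>\<^bsub>power_module A N I\<^esub> y) = (\<Oplus>\<^bsub>tensor_product A N M\<^esub>i\<in>I.
      pure_tensor A N M (x i) (g (basis_vec A i)) \<oplus>\<^bsub>tensor_product A N M\<^esub> pure_tensor A N M (y i) (g (basis_vec A i)))"
      unfolding h_def using gb xv yv
      by (intro TP.M.finsum_cong') (auto simp: power_module_simps T.pure_tensor_add_left T.pure_tensor_closed)
    also have "\<dots> = h x \<oplus>\<^bsub>tensor_product A N M\<^esub> h y"
      unfolding h_def by (rule TP.M.finsum_addf[OF cl[OF x] cl[OF y]])
    finally show "h (x \<oplus>\<^bsub>power_module A N I\<^esub> y) = h x \<oplus>\<^bsub>tensor_product A N M\<^esub> h y" .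
  qed
  have "h (pairing N n x) = pure_tensor A N M n (g x)" if n: "n \<in> carrier N" and x: "x \<in> carrier (free_module A I)" for n x
  proof -
    note xv = free_module_val[OF A.ring_axioms x]
    interpret MS: left_module complex_field "restrict_scalars A M" by (rule left_module_restrict_scalars[OF M])
    have pl: "linear_map complex_field (restrict_scalars A M) (tensor_product A N M) (pure_tensor A N M n)"
      by (rule linear_mapI)
        (use n T.pure_tensor_scal T.pure_tensor_balanced in \<open>simp_all add: T.pure_tensor_closed T.pure_tensor_add_right\<close>)
    have "g x = (\<Oplus>\<^bsub>M\<^esub>i\<in>I. x i \<odot>\<^bsub>M\<^esub> g (basis_vec A i))"
      using lin_comb_expand[OF A.ring_axioms M g I x] by (simp add: lin_comb_def)
    then have "pure_tensor A N M n (g x)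
        = (\<Oplus>\<^bsub>tensor_product A N M\<^esub>i\<in>I. pure_tensor A N M n (x i \<odot>\<^bsub>M\<^esub> g (basis_vec A i)))"
      using linear_map_finsum[OF MS.left_module_axioms T.left_module_tensor pl,
          of "\<lambda>i. x i \<odot>\<^bsub>M\<^esub> g (basis_vec A i)" I] xv gb by simp
    also have "\<dots> = h (pairing N n x)"
      unfolding h_def pairing_def using n xv gb
      by (intro TP.M.finsum_cong') (auto simp: T.pure_tensor_balanced T.pure_tensor_closed)
    finally show ?thesis by simp
  qed
  with h show thesis by (rule that)
qed

text \<open>\<open>P\<close> is to be the resolution picked in the definition of \<open>Tor\<close>.
  The maps \<phi> and \<psi> combine the comparison maps with the passage to coordinates, so that a
  single homotopy equivalence has to be checked, on pure tensors on one side and on pairings on the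
  other.\<close>

lemma tensor_homology_iso:
  fixes P :: "nat \<Rightarrow> ('a, 'p) module" and I :: "nat \<Rightarrow> 'i set"
  assumes M: "left_module A M" and P: "projective_resolution A M P d e"
    and Q: "projective_resolution A M (\<lambda>k. free_module A (I k)) d' e'" and I: "\<And>k. finite (I k)"
  shows "module_iso complex_field
    (homology (\<lambda>k. tensor_product A N (P k)) (\<lambda>k. tensor_map A N (P k) (d k)) k)
    (homology (\<lambda>k. power_module A N (I k)) (\<lambda>k. power_map A N (I (Suc k)) (d' k)) k)"
proof -
  note P' = projective_resolutionD[OF P] and Q' = projective_resolutionD[OF Q]
  obtain f g s t where fg: "\<And>k. f k \<in> module_homs A (P k) (free_module A (I k))"
      "\<And>k. g k \<in> module_homs A (free_module A (I k)) (P k)"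
    and st: "\<And>k. s k \<in> module_homs A (P k) (P (Suc k))"
      "\<And>k. t k \<in> module_homs A (free_module A (I k)) (free_module A (I (Suc k)))"
    and fd: "\<And>k x. x \<in> carrier (P (Suc k)) \<Longrightarrow> d' k (f (Suc k) x) = f k (d k x)"
    and gd: "\<And>k x. x \<in> carrier (free_module A (I (Suc k))) \<Longrightarrow> d k (g (Suc k) x) = g k (d' k x)"
    and gf0: "\<And>x. x \<in> carrier (P 0) \<Longrightarrow> x \<ominus>\<^bsub>P 0\<^esub> g 0 (f 0 x) = d 0 (s 0 x)"
    and gf: "\<And>k x. x \<in> carrier (P (Suc k)) \<Longrightarrow>
      x \<ominus>\<^bsub>P (Suc k)\<^esub> g (Suc k) (f (Suc k) x) = d (Suc k) (s (Suc k) x) \<oplus>\<^bsub>P (Suc k)\<^esub> s k (d k x)"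
    and fg0: "\<And>x. x \<in> carrier (free_module A (I 0)) \<Longrightarrow> x \<ominus>\<^bsub>free_module A (I 0)\<^esub> f 0 (g 0 x) = d' 0 (t 0 x)"
    and fg': "\<And>k x. x \<in> carrier (free_module A (I (Suc k))) \<Longrightarrow>
      x \<ominus>\<^bsub>free_module A (I (Suc k))\<^esub> f (Suc k) (g (Suc k) x)
        = d' (Suc k) (t (Suc k) x) \<oplus>\<^bsub>free_module A (I (Suc k))\<^esub> t k (d' k x)"
    by (rule resolutions_homotopy_equivalent[OF M P Q]) (rule that, assumption+)
  note f = module_homs_linear[OF fg(1)] and g = module_homs_linear[OF fg(2)]
    and s = module_homs_linear[OF st(1)] and t = module_homs_linear[OF st(2)]
  let ?T = "\<lambda>k. tensor_product A N (P k)" and ?C = "\<lambda>k. power_module A N (I k)"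
  let ?d = "\<lambda>k. tensor_map A N (P k) (d k)" and ?d' = "\<lambda>k. power_map A N (I (Suc k)) (d' k)"
  let ?s = "\<lambda>k. tensor_map A N (P (Suc k)) (s k)" and ?t = "\<lambda>k. power_map A N (I k) (t k)"
  have T: "tensor_modules A N (P k)" for k
    using calgebra_axioms right P'(2) by (simp add: tensor_modules_def tensor_modules_axioms_def)
  note Tm = tensor_modules.left_module_tensor[OF T] and Cm = left_module_power_right
  note d_lin = tensor_map_linear[OF T T P'(3)] and s_lin = tensor_map_linear[OF T T s]
  note d'_lin = power_map_linear[OF Q'(3)] and t_lin = power_map_linear[OF t]
  note d'_pair = power_map_pairing[OF Q'(3) I] and t_pair = power_map_pairing[OF t I]
  note tmext = tensor_modules.tensor_map_ext[OF T] and pext = power_module_ext[OF I]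
  note pt = tensor_modules.pure_tensor_closed[OF T]
  have "\<forall>k. \<exists>h. linear_map complex_field (?T k) (?C k) h \<and>
      (\<forall>n\<in>carrier N. \<forall>m\<in>carrier (P k). h (pure_tensor A N (P k) n m) = pairing N n (f k m))"
    using tensor_to_power[OF P'(2) f] by metis
  then obtain \<phi> where \<phi>: "\<And>k. linear_map complex_field (?T k) (?C k) (\<phi> k)"
    "\<And>k n m. n \<in> carrier N \<Longrightarrow> m \<in> carrier (P k) \<Longrightarrow> \<phi> k (pure_tensor A N (P k) n m) = pairing N n (f k m)"
    by metis
  have "\<forall>k. \<exists>h. linear_map complex_field (?C k) (?T k) h \<and>
      (\<forall>n\<in>carrier N. \<forall>x\<in>carrier (free_module A (I k)). h (pairing N n x) = pure_tensor A N (P k) n (g k x))"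
    using power_to_tensor[OF P'(2) g I] by metis
  then obtain \<psi> where \<psi>: "\<And>k. linear_map complex_field (?C k) (?T k) (\<psi> k)"
    "\<And>k n x. n \<in> carrier N \<Longrightarrow> x \<in> carrier (free_module A (I k)) \<Longrightarrow>
      \<psi> k (pairing N n x) = pure_tensor A N (P k) n (g k x)"
    by metis
  note c = linear_map_closed[OF f] linear_map_closed[OF g] linear_map_closed[OF s] linear_map_closed[OF t]
    linear_map_closed[OF P'(3)] linear_map_closed[OF Q'(3)]
  note b = basis_vec_closed[OF A.ring_axioms]
  have pt_lin: "linear_map complex_field (restrict_scalars A (P k)) (?T k) (pure_tensor A N (P k) n)"
    if "n \<in> carrier N" for k n
    by (rule linear_mapI)
      (use that tensor_modules.pure_tensor_simps(4,5)[OF T] in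
        \<open>simp_all add: tensor_modules.pure_tensor_simps(1,2)[OF T]\<close>)
  have pt_minus: "pure_tensor A N (P k) n (x \<ominus>\<^bsub>P k\<^esub> y) = pure_tensor A N (P k) n x \<ominus>\<^bsub>?T k\<^esub> pure_tensor A N (P k) n y"
    if "n \<in> carrier N" "x \<in> carrier (P k)" "y \<in> carrier (P k)" for k n x y
  proof -
    interpret Pk: left_module A "P k" by (rule P')
    have "\<ominus>\<^bsub>restrict_scalars A (P k)\<^esub> y = \<ominus>\<^bsub>P k\<^esub> y"
      by (simp add: a_inv_def m_inv_def restrict_scalars_def)
    then show ?thesis
      using linear_map_minus(2)[OF left_module_restrict_scalars[OF P'(2)] Tm pt_lin[OF that(1)], of x k y] that
      by (simp add: a_minus_def)
  qed
  have pr_minus: "pairing N n (x \<ominus>\<^bsub>free_module A J\<^esub> y) = pairing N n x \<ominus>\<^bsub>power_module A N J\<^esub> pairing N n y"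
    if n: "n \<in> carrier N" and x: "x \<in> carrier (free_module A J)" and y: "y \<in> carrier (free_module A J)" for n x y and J :: "'i set"
  proof -
    interpret F: left_module A "free_module A J" by (rule left_module_free_module[OF A.ring_axioms])
    interpret C: left_module complex_field "power_module A N J" by (rule Cm)
    have "pairing N n (\<ominus>\<^bsub>free_module A J\<^esub> y) \<oplus>\<^bsub>power_module A N J\<^esub> pairing N n y = \<zero>\<^bsub>power_module A N J\<^esub>"
      using pairing_add[OF n _ y, of "\<ominus>\<^bsub>free_module A J\<^esub> y"] y n by (simp add: F.M.l_neg pairing_zero)
    then have "\<ominus>\<^bsub>power_module A N J\<^esub> pairing N n y = pairing N n (\<ominus>\<^bsub>free_module A J\<^esub> y)"
      using n y by (intro C.M.minus_equality pairing_closed) auto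
    then show ?thesis using n x y by (simp add: a_minus_def pairing_add)
  qed
  show ?thesis
  proof (rule homology_iso[where V = ?T and W = ?C and d = ?d and d' = ?d' and f = \<phi> and g = \<psi>
        and s = ?s and t = ?t, OF Tm Cm d_lin(1) d'_lin _ _ \<phi>(1) \<psi>(1) _ _ s_lin(1) t_lin])
    fix k
    show "?d k (?d (Suc k) x) = \<zero>\<^bsub>?T k\<^esub>" if x: "x \<in> carrier (?T (Suc (Suc k)))" for x
    proof (rule tmext[OF Tm linear_map_compose[OF d_lin(1) d_lin(1)] _ _ x])
      interpret TP: left_module complex_field "?T k" by (rule Tm)
      show "linear_map complex_field (?T (Suc (Suc k))) (?T k) (\<lambda>_. \<zero>\<^bsub>?T k\<^esub>)"
        by (rule linear_mapI) (auto simp: TP.lsmult_r_null)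
      interpret Pk: left_module A "P k" by (rule P')
      have "pure_tensor A N (P k) n \<zero>\<^bsub>P k\<^esub> = \<zero>\<^bsub>?T k\<^esub>" if "n \<in> carrier N" for n
        using linear_map_zero[OF left_module_restrict_scalars[OF P'(2)] Tm pt_lin[OF that]] by simp
      then show "?d k (?d (Suc k) (pure_tensor A N (P (Suc (Suc k))) n m)) = \<zero>\<^bsub>?T k\<^esub>"
        if "n \<in> carrier N" "m \<in> carrier (P (Suc (Suc k)))" for n m
        using that by (simp add: d_lin(2) c P'(6))
    qed
    show "?d' k (?d' (Suc k) x) = \<zero>\<^bsub>?C k\<^esub>" if x: "x \<in> carrier (?C (Suc (Suc k)))" for x
    proof (rule pext[OF Cm linear_map_compose[OF d'_lin d'_lin] _ _ x])
      interpret C: left_module complex_field "?C k" by (rule Cm)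
      show "linear_map complex_field (?C (Suc (Suc k))) (?C k) (\<lambda>_. \<zero>\<^bsub>?C k\<^esub>)"
        by (rule linear_mapI) (auto simp: C.lsmult_r_null)
      show "?d' k (?d' (Suc k) (pairing N n (basis_vec A i))) = \<zero>\<^bsub>?C k\<^esub>"
        if "n \<in> carrier N" "i \<in> I (Suc (Suc k))" for n i
        using that by (simp add: d'_pair c Q'(6) b pairing_zero)
    qed
    show "?d' k (\<phi> (Suc k) x) = \<phi> k (?d k x)" if x: "x \<in> carrier (?T (Suc k))" for x
      by (rule tmext[OF Cm linear_map_compose[OF \<phi>(1) d'_lin] linear_map_compose[OF d_lin(1) \<phi>(1)] _ x])
        (simp add: \<phi>(2) d_lin(2) d'_pair c fd)
    show "?d k (\<psi> (Suc k) x) = \<psi> k (?d' k x)" if x: "x \<in> carrier (?C (Suc k))" for x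
      by (rule pext[OF Tm linear_map_compose[OF \<psi>(1) d_lin(1)] linear_map_compose[OF d'_lin \<psi>(1)] _ x])
        (simp add: \<psi>(2) d_lin(2) d'_pair c b gd)
    show "x \<ominus>\<^bsub>?T 0\<^esub> \<psi> 0 (\<phi> 0 x) = ?d 0 (?s 0 x)" if x: "x \<in> carrier (?T 0)" for x
      by (rule tmext[OF Tm linear_map_diff[OF Tm linear_map_id linear_map_compose[OF \<phi>(1) \<psi>(1)]]
            linear_map_compose[OF s_lin(1) d_lin(1)] _ x])
        (simp add: \<phi>(2) \<psi>(2) d_lin(2) s_lin(2) c flip: pt_minus gf0)
    show "x \<ominus>\<^bsub>?T (Suc k)\<^esub> \<psi> (Suc k) (\<phi> (Suc k) x) = ?d (Suc k) (?s (Suc k) x) \<oplus>\<^bsub>?T (Suc k)\<^esub> ?s k (?d k x)"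
      if x: "x \<in> carrier (?T (Suc k))" for x
      by (rule tmext[OF Tm linear_map_diff[OF Tm linear_map_id linear_map_compose[OF \<phi>(1) \<psi>(1)]]
            linear_map_plus[OF Tm linear_map_compose[OF s_lin(1) d_lin(1)] linear_map_compose[OF d_lin(1) s_lin(1)]] _ x])
        (simp add: \<phi>(2) \<psi>(2) d_lin(2) s_lin(2) c gf flip: pt_minus tensor_modules.pure_tensor_add_right[OF T])
    show "x \<ominus>\<^bsub>?C 0\<^esub> \<phi> 0 (\<psi> 0 x) = ?d' 0 (?t 0 x)" if x: "x \<in> carrier (?C 0)" for x
      by (rule pext[OF Cm linear_map_diff[OF Cm linear_map_id linear_map_compose[OF \<psi>(1) \<phi>(1)]]
            linear_map_compose[OF t_lin d'_lin] _ x])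
        (simp add: \<phi>(2) \<psi>(2) d'_pair t_pair c b flip: pr_minus fg0)
    show "x \<ominus>\<^bsub>?C (Suc k)\<^esub> \<phi> (Suc k) (\<psi> (Suc k) x) = ?d' (Suc k) (?t (Suc k) x) \<oplus>\<^bsub>?C (Suc k)\<^esub> ?t k (?d' k x)"
      if x: "x \<in> carrier (?C (Suc k))" for x
      by (rule pext[OF Cm linear_map_diff[OF Cm linear_map_id linear_map_compose[OF \<psi>(1) \<phi>(1)]]
            linear_map_plus[OF Cm linear_map_compose[OF t_lin d'_lin] linear_map_compose[OF d'_lin t_lin]] _ x])
        (simp add: \<phi>(2) \<psi>(2) d'_pair t_pair c b fg' flip: pr_minus pairing_add)
  qed
qed

end

subsection \<open>Ext from a finite free resolution\<close>

lemma hom_space_simps: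
  "carrier (hom_space A M N) = module_homs A M N"
  "\<zero>\<^bsub>hom_space A M N\<^esub> = (\<lambda>x\<in>carrier M. \<zero>\<^bsub>N\<^esub>)"
  "f \<oplus>\<^bsub>hom_space A M N\<^esub> g = (\<lambda>x\<in>carrier M. f x \<oplus>\<^bsub>N\<^esub> g x)"
  "c \<odot>\<^bsub>hom_space A M N\<^esub> f = (\<lambda>x\<in>carrier M. (c \<odot>\<^bsub>A\<^esub> \<one>\<^bsub>A\<^esub>) \<odot>\<^bsub>N\<^esub> f x)"
  by (simp_all add: hom_space_def)

lemma module_homs_eqI:
  assumes "f \<in> module_homs R M N" "g \<in> module_homs R M N" "\<And>x. x \<in> carrier M \<Longrightarrow> f x = g x"
  shows "f = g"
  using assms by (auto simp: module_homs_iff intro: extensionalityI)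

text \<open>A homomorphism out of a free module is recorded by its values \<open>m\<close> on the
  basis. In this encoding, \<open>copower_map\<close> is precomposition with \<open>t\<close>, as
  \<open>lin_comb_copower\<close> shows.\<close>

definition copower_map ::
  "('a, 'n) module \<Rightarrow> ('a, 'r) ring_scheme \<Rightarrow> 'i set \<Rightarrow> 'j set \<Rightarrow> (('j \<Rightarrow> 'a) \<Rightarrow> 'i \<Rightarrow> 'a) \<Rightarrow> ('i \<Rightarrow> 'n) \<Rightarrow> 'j \<Rightarrow> 'n"
  where "copower_map Y R I J t m = (\<lambda>j. if j \<in> J then lin_comb Y I m (t (basis_vec R j)) else \<zero>\<^bsub>Y\<^esub>)"

locale coefficient_module = calgebra A for A :: "(complex, 'a) module" +
  fixes Y :: "('a, 'n) module"
  assumes coeff: "left_module A Y"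
begin

sublocale Y: left_module A Y by (rule coeff)
sublocale YS: left_module complex_field "restrict_scalars A Y" by (rule left_module_restrict_scalars[OF coeff])

lemma scal_commute: "a \<in> carrier A \<Longrightarrow> y \<in> carrier Y \<Longrightarrow> scal c \<odot>\<^bsub>Y\<^esub> (a \<odot>\<^bsub>Y\<^esub> y) = a \<odot>\<^bsub>Y\<^esub> (scal c \<odot>\<^bsub>Y\<^esub> y)"
  using scal_central[of a c] by (simp flip: Y.lsmult_assoc)

lemma left_module_hom_space:
  assumes "left_module A M"
  shows "left_module complex_field (hom_space A M Y)"
proof -
  interpret M: left_module A M by fact
  let ?H = "hom_space A M Y"
  note lin = module_homs_linear
  note cl = linear_map_closed[OF module_homs_linear]
  have add: "f \<oplus>\<^bsub>?H\<^esub> g \<in> carrier ?H" if "f \<in> carrier ?H" "g \<in> carrier ?H" for f g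
    using that restrict_in_module_homs[OF assms linear_map_plus[OF coeff lin lin]]
    by (simp add: hom_space_simps)
  have neg: "(\<lambda>x\<in>carrier M. \<ominus>\<^bsub>Y\<^esub> f x) \<in> carrier ?H" if "f \<in> carrier ?H" for f
    using that restrict_in_module_homs[OF assms linear_map_uminus[OF coeff lin]]
    by (simp add: hom_space_simps)
  have zero: "\<zero>\<^bsub>?H\<^esub> \<in> carrier ?H"
    unfolding hom_space_simps
    by (rule restrict_in_module_homs[OF assms linear_mapI]) (auto simp: Y.lsmult_r_null)
  have smult: "c \<odot>\<^bsub>?H\<^esub> f \<in> carrier ?H" if f: "f \<in> carrier ?H" for c f
    unfolding hom_space_simps
  proof (rule restrict_in_module_homs[OF assms linear_mapI])
    fix x y a assume x: "x \<in> carrier M"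
    have fl: "linear_map A M Y f" using f by (simp add: hom_space_simps lin)
    note fc = linear_map_closed[OF fl]
    show "scal c \<odot>\<^bsub>Y\<^esub> f x \<in> carrier Y" using fc[OF x] by simp
    show "y \<in> carrier M \<Longrightarrow> scal c \<odot>\<^bsub>Y\<^esub> f (x \<oplus>\<^bsub>M\<^esub> y) = scal c \<odot>\<^bsub>Y\<^esub> f x \<oplus>\<^bsub>Y\<^esub> scal c \<odot>\<^bsub>Y\<^esub> f y"
      using fc x by (simp add: linear_map_add[OF fl] Y.lsmult_r_distr)
    show "a \<in> carrier A \<Longrightarrow> scal c \<odot>\<^bsub>Y\<^esub> f (a \<odot>\<^bsub>M\<^esub> x) = a \<odot>\<^bsub>Y\<^esub> (scal c \<odot>\<^bsub>Y\<^esub> f x)"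
      using fc x by (simp add: linear_map_smult[OF fl] scal_commute)
  qed
  have ext: "f = g" if "f \<in> carrier ?H" "g \<in> carrier ?H" "\<And>x. x \<in> carrier M \<Longrightarrow> f x = g x" for f g
    using that module_homs_eqI[of f A M Y g] by (simp add: hom_space_simps)
  have val: "f x \<in> carrier Y" if "f \<in> carrier ?H" "x \<in> carrier M" for f x
    using that cl[of f A M Y x] by (simp add: hom_space_simps)
  have ab: "abelian_group ?H"
  proof (rule abelian_groupI)
    fix f g h assume f: "f \<in> carrier ?H"
    show "\<exists>g\<in>carrier ?H. g \<oplus>\<^bsub>?H\<^esub> f = \<zero>\<^bsub>?H\<^esub>"
      by (rule bexI[OF _ neg[OF f]], rule ext[OF add[OF neg[OF f] f] zero])
        (use val[OF f] in \<open>simp add: hom_space_simps Y.M.l_neg\<close>)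
    show "\<zero>\<^bsub>?H\<^esub> \<oplus>\<^bsub>?H\<^esub> f = f"
      by (rule ext[OF add[OF zero f] f]) (use val[OF f] in \<open>simp add: hom_space_simps\<close>)
    assume g: "g \<in> carrier ?H"
    show "f \<oplus>\<^bsub>?H\<^esub> g = g \<oplus>\<^bsub>?H\<^esub> f"
      by (rule ext[OF add[OF f g] add[OF g f]]) (use val[OF f] val[OF g] in \<open>simp add: hom_space_simps Y.M.a_comm\<close>)
    assume h: "h \<in> carrier ?H"
    show "f \<oplus>\<^bsub>?H\<^esub> g \<oplus>\<^bsub>?H\<^esub> h = f \<oplus>\<^bsub>?H\<^esub> (g \<oplus>\<^bsub>?H\<^esub> h)"
      by (rule ext[OF add[OF add[OF f g] h] add[OF f add[OF g h]]])
        (use val[OF f] val[OF g] val[OF h] in \<open>simp add: hom_space_simps Y.M.a_assoc\<close>)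
  qed (use add zero in auto)
  show ?thesis
    unfolding left_module_def left_module_axioms_def
  proof (intro conjI allI impI ab ring_complex_field)
    fix a b f g assume f: "f \<in> carrier ?H"
    show "a \<odot>\<^bsub>?H\<^esub> f \<in> carrier ?H" by (rule smult[OF f])
    show "(a \<oplus>\<^bsub>complex_field\<^esub> b) \<odot>\<^bsub>?H\<^esub> f = a \<odot>\<^bsub>?H\<^esub> f \<oplus>\<^bsub>?H\<^esub> b \<odot>\<^bsub>?H\<^esub> f"
      by (rule ext[OF smult[OF f] add[OF smult[OF f] smult[OF f]]])
        (use val[OF f] YS.lsmult_l_distr in \<open>simp add: hom_space_simps\<close>)
    show "(a \<otimes>\<^bsub>complex_field\<^esub> b) \<odot>\<^bsub>?H\<^esub> f = a \<odot>\<^bsub>?H\<^esub> (b \<odot>\<^bsub>?H\<^esub> f)"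
      by (rule ext[OF smult[OF f] smult[OF smult[OF f]]])
        (use val[OF f] YS.lsmult_assoc in \<open>simp add: hom_space_simps\<close>)
    show "\<one>\<^bsub>complex_field\<^esub> \<odot>\<^bsub>?H\<^esub> f = f"
      by (rule ext[OF smult[OF f] f]) (use val[OF f] YS.lsmult_one in \<open>simp add: hom_space_simps\<close>)
    assume g: "g \<in> carrier ?H"
    show "a \<odot>\<^bsub>?H\<^esub> (f \<oplus>\<^bsub>?H\<^esub> g) = a \<odot>\<^bsub>?H\<^esub> f \<oplus>\<^bsub>?H\<^esub> a \<odot>\<^bsub>?H\<^esub> g"
      by (rule ext[OF smult[OF add[OF f g]] add[OF smult[OF f] smult[OF g]]])
        (use val[OF f] val[OF g] YS.lsmult_r_distr in \<open>simp add: hom_space_simps\<close>)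
  qed
qed

lemma hom_space_eval_linear:
  "x \<in> carrier M \<Longrightarrow> linear_map complex_field (hom_space A M Y) (restrict_scalars A Y) (\<lambda>f. f x)"
  by (rule linear_mapI) (auto simp: hom_space_simps module_homs_def)

lemma hom_space_minus:
  assumes "left_module A M" "f \<in> carrier (hom_space A M Y)" "g \<in> carrier (hom_space A M Y)" "x \<in> carrier M"
  shows "(f \<ominus>\<^bsub>hom_space A M Y\<^esub> g) x = f x \<ominus>\<^bsub>Y\<^esub> g x"
proof -
  have "\<ominus>\<^bsub>restrict_scalars A Y\<^esub> y = \<ominus>\<^bsub>Y\<^esub> y" for y
    by (simp add: a_inv_def m_inv_def restrict_scalars_def)
  then show ?thesis
    using linear_map_minus(2)[OF left_module_hom_space[OF assms(1)] YS.left_module_axioms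
      hom_space_eval_linear[OF assms(4)] assms(2,3)] by (simp add: a_minus_def)
qed

lemma compose_linear:
  assumes M: "left_module A M" and M': "left_module A M'" and h: "linear_map A M M' h"
  shows "linear_map complex_field (hom_space A M' Y) (hom_space A M Y) (\<lambda>f. compose (carrier M) f h)"
proof (rule linear_mapI)
  interpret M: left_module A M by (rule M)
  interpret M': left_module A M' by (rule M')
  note hc = linear_map_closed[OF h]
  show cl: "compose (carrier M) f h \<in> carrier (hom_space A M Y)" if "f \<in> carrier (hom_space A M' Y)" for f
    using restrict_in_module_homs[OF M linear_map_compose[OF h module_homs_linear]] that
    by (simp add: compose_def hom_space_simps)
  show "compose (carrier M) (f \<oplus>\<^bsub>hom_space A M' Y\<^esub> g) h
      = compose (carrier M) f h \<oplus>\<^bsub>hom_space A M Y\<^esub> compose (carrier M) g h" for f g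
    by (rule ext) (use hc in \<open>auto simp: hom_space_simps compose_def\<close>)
  show "compose (carrier M) (c \<odot>\<^bsub>hom_space A M' Y\<^esub> f) h
      = c \<odot>\<^bsub>hom_space A M Y\<^esub> compose (carrier M) f h" for c f
    by (rule ext) (use hc in \<open>auto simp: hom_space_simps compose_def\<close>)
qed

lemma power_val: "m \<in> carrier (power_module A Y I) \<Longrightarrow> m i \<in> carrier Y"
  by (cases "i \<in> I") (auto simp: power_module_simps)

lemma lin_comb_power_linear:
  assumes "x \<in> carrier (free_module A I)"
  shows "linear_map complex_field (power_module A Y I) (restrict_scalars A Y) (\<lambda>m. lin_comb Y I m x)"
proof (rule linear_mapI)
  note xv = free_module_val[OF A.ring_axioms assms]
  fix m m' c assume m: "m \<in> carrier (power_module A Y I)"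
  note mv = power_val[OF m]
  show "lin_comb Y I m x \<in> carrier (restrict_scalars A Y)"
    unfolding lin_comb_def using xv mv by (auto intro!: Y.M.finsum_closed)
  have "(\<Oplus>\<^bsub>Y\<^esub>i\<in>I. x i \<odot>\<^bsub>Y\<^esub> (scal c \<odot>\<^bsub>Y\<^esub> m i)) = (\<Oplus>\<^bsub>Y\<^esub>i\<in>I. scal c \<odot>\<^bsub>Y\<^esub> (x i \<odot>\<^bsub>Y\<^esub> m i))"
    by (rule Y.M.finsum_cong') (use xv mv scal_commute in auto)
  also have "\<dots> = scal c \<odot>\<^bsub>Y\<^esub> (\<Oplus>\<^bsub>Y\<^esub>i\<in>I. x i \<odot>\<^bsub>Y\<^esub> m i)"
    by (rule Y.lsmult_finsum[symmetric]) (use xv mv in auto)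
  finally show "lin_comb Y I (c \<odot>\<^bsub>power_module A Y I\<^esub> m) x = c \<odot>\<^bsub>restrict_scalars A Y\<^esub> lin_comb Y I m x"
    by (simp add: lin_comb_def power_module_simps)
  assume m': "m' \<in> carrier (power_module A Y I)"
  note mv' = power_val[OF m']
  have "(\<Oplus>\<^bsub>Y\<^esub>i\<in>I. x i \<odot>\<^bsub>Y\<^esub> (m i \<oplus>\<^bsub>Y\<^esub> m' i)) = (\<Oplus>\<^bsub>Y\<^esub>i\<in>I. x i \<odot>\<^bsub>Y\<^esub> m i \<oplus>\<^bsub>Y\<^esub> x i \<odot>\<^bsub>Y\<^esub> m' i)"
    by (rule Y.M.finsum_cong') (use xv mv mv' Y.lsmult_r_distr in auto)
  also have "\<dots> = (\<Oplus>\<^bsub>Y\<^esub>i\<in>I. x i \<odot>\<^bsub>Y\<^esub> m i) \<oplus>\<^bsub>Y\<^esub> (\<Oplus>\<^bsub>Y\<^esub>i\<in>I. x i \<odot>\<^bsub>Y\<^esub> m' i)"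
    by (rule Y.M.finsum_addf) (use xv mv mv' in auto)
  finally show "lin_comb Y I (m \<oplus>\<^bsub>power_module A Y I\<^esub> m') x
      = lin_comb Y I m x \<oplus>\<^bsub>restrict_scalars A Y\<^esub> lin_comb Y I m' x"
    by (simp add: lin_comb_def power_module_simps)
qed

lemma copower_map_linear:
  assumes t: "linear_map A (free_module A J) (free_module A I) t"
  shows "linear_map complex_field (power_module A Y I) (power_module A Y J) (copower_map Y A I J t)"
proof (rule linear_mapI)
  note l = lin_comb_power_linear[OF linear_map_closed[OF t basis_vec_closed[OF A.ring_axioms]]]
  show "copower_map Y A I J t m \<in> carrier (power_module A Y J)" if "m \<in> carrier (power_module A Y I)" for m
    using linear_map_closed[OF l that] by (auto simp: copower_map_def power_module_simps)
  show "copower_map Y A I J t (m \<oplus>\<^bsub>power_module A Y I\<^esub> m')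
      = copower_map Y A I J t m \<oplus>\<^bsub>power_module A Y J\<^esub> copower_map Y A I J t m'"
    if "m \<in> carrier (power_module A Y I)" "m' \<in> carrier (power_module A Y I)" for m m'
    using linear_map_add[OF l that] by (auto simp: copower_map_def power_module_simps(3) fun_eq_iff)
  show "copower_map Y A I J t (c \<odot>\<^bsub>power_module A Y I\<^esub> m) = c \<odot>\<^bsub>power_module A Y J\<^esub> copower_map Y A I J t m"
    if "m \<in> carrier (power_module A Y I)" for c m
    using linear_map_smult[OF l _ that] by (auto simp: copower_map_def power_module_simps(4) fun_eq_iff Y.lsmult_r_null)
qed

lemma lin_comb_copower:
  assumes t: "linear_map A (free_module A J) (free_module A I) t" and J: "finite J"
    and m: "m \<in> carrier (power_module A Y I)" and x: "x \<in> carrier (free_module A J)"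
  shows "lin_comb Y J (copower_map Y A I J t m) x = lin_comb Y I m (t x)"
proof (rule free_module_map_eq[OF A.ring_axioms coeff _ _ _ x])
  have m': "m \<in> I \<rightarrow> carrier Y" using m by (auto simp: power_module_simps)
  have tm: "copower_map Y A I J t m \<in> J \<rightarrow> carrier Y"
    using linear_map_closed[OF copower_map_linear[OF t] m] by (auto simp: power_module_simps)
  show "linear_map A (free_module A J) Y (lin_comb Y J (copower_map Y A I J t m))"
    by (rule lin_comb_linear[OF A.ring_axioms coeff tm])
  show "linear_map A (free_module A J) Y (\<lambda>x. lin_comb Y I m (t x))"
    by (rule linear_map_compose[OF t lin_comb_linear[OF A.ring_axioms coeff m']])
  show "lin_comb Y J (copower_map Y A I J t m) (basis_vec A j) = lin_comb Y I m (t (basis_vec A j))"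
    if "j \<in> J" for j
    using lin_comb_basis[OF coeff tm J that] that by (simp add: copower_map_def)
qed

lemma hom_cohomology_iso:
  fixes P :: "nat \<Rightarrow> ('a, 'p) module" and I :: "nat \<Rightarrow> 'i set"
  assumes M: "left_module A M" and P: "projective_resolution A M P d e"
    and Q: "projective_resolution A M (\<lambda>k. free_module A (I k)) d' e'" and I: "\<And>k. finite (I k)"
  shows "module_iso complex_field
    (cohomology (\<lambda>k. hom_space A (P k) Y) (\<lambda>k h. compose (carrier (P (Suc k))) h (d k)) k)
    (cohomology (\<lambda>k. power_module A Y (I k)) (\<lambda>k. copower_map Y A (I k) (I (Suc k)) (d' k)) k)"
proof -
  note P' = projective_resolutionD[OF P] and Q' = projective_resolutionD[OF Q]
  obtain f g s t where fg: "\<And>k. f k \<in> module_homs A (P k) (free_module A (I k))"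
      "\<And>k. g k \<in> module_homs A (free_module A (I k)) (P k)"
    and st: "\<And>k. s k \<in> module_homs A (P k) (P (Suc k))"
      "\<And>k. t k \<in> module_homs A (free_module A (I k)) (free_module A (I (Suc k)))"
    and fd: "\<And>k x. x \<in> carrier (P (Suc k)) \<Longrightarrow> d' k (f (Suc k) x) = f k (d k x)"
    and gd: "\<And>k x. x \<in> carrier (free_module A (I (Suc k))) \<Longrightarrow> d k (g (Suc k) x) = g k (d' k x)"
    and gf0: "\<And>x. x \<in> carrier (P 0) \<Longrightarrow> x \<ominus>\<^bsub>P 0\<^esub> g 0 (f 0 x) = d 0 (s 0 x)"
    and gf: "\<And>k x. x \<in> carrier (P (Suc k)) \<Longrightarrow>
      x \<ominus>\<^bsub>P (Suc k)\<^esub> g (Suc k) (f (Suc k) x) = d (Suc k) (s (Suc k) x) \<oplus>\<^bsub>P (Suc k)\<^esub> s k (d k x)"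
    and fg0: "\<And>x. x \<in> carrier (free_module A (I 0)) \<Longrightarrow> x \<ominus>\<^bsub>free_module A (I 0)\<^esub> f 0 (g 0 x) = d' 0 (t 0 x)"
    and fg': "\<And>k x. x \<in> carrier (free_module A (I (Suc k))) \<Longrightarrow>
      x \<ominus>\<^bsub>free_module A (I (Suc k))\<^esub> f (Suc k) (g (Suc k) x)
        = d' (Suc k) (t (Suc k) x) \<oplus>\<^bsub>free_module A (I (Suc k))\<^esub> t k (d' k x)"
    by (rule resolutions_homotopy_equivalent[OF M P Q]) (rule that, assumption+)
  note f = module_homs_linear[OF fg(1)] and g = module_homs_linear[OF fg(2)]
    and s = module_homs_linear[OF st(1)] and t = module_homs_linear[OF st(2)]
  let ?H = "\<lambda>k. hom_space A (P k) Y" and ?D = "\<lambda>k. power_module A Y (I k)"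
  let ?d = "\<lambda>k h. compose (carrier (P (Suc k))) h (d k)" and ?d' = "\<lambda>k. copower_map Y A (I k) (I (Suc k)) (d' k)"
  let ?s = "\<lambda>k h. compose (carrier (P k)) h (s k)" and ?t = "\<lambda>k. copower_map Y A (I (Suc k)) (I k) (t k)"
  \<comment> \<open>Contravariance interchanges the comparison maps: \<phi> evaluates
    \<open>h\<close> after \<open>g\<close> on the basis, \<psi> precomposes with \<open>f\<close>.
    The homotopies likewise act by precomposition.\<close>
  define \<phi> where "\<phi> = (\<lambda>k h i. if i \<in> I k then h (g k (basis_vec A i)) else \<zero>\<^bsub>Y\<^esub>)"
  define \<psi> where "\<psi> = (\<lambda>k m. \<lambda>p\<in>carrier (P k). lin_comb Y (I k) m (f k p))"
  note Hm = left_module_hom_space[OF P'(2)] and Dm = left_module_power[OF coeff]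
  note d_lin = compose_linear[OF P'(2) P'(2) P'(3)] and s_lin = compose_linear[OF P'(2) P'(2) s]
  note d'_lin = copower_map_linear[OF Q'(3)] and t_lin = copower_map_linear[OF t]
  note b = basis_vec_closed[OF A.ring_axioms]
  note c = linear_map_closed[OF f] linear_map_closed[OF g] linear_map_closed[OF s] linear_map_closed[OF t]
    linear_map_closed[OF P'(3)] linear_map_closed[OF Q'(3)] b
  have Hl: "linear_map A (P k) Y h" if "h \<in> carrier (?H k)" for k h
    using that by (simp add: hom_space_simps module_homs_linear)
  have hc: "h x \<in> carrier Y" if "h \<in> carrier (?H k)" "x \<in> carrier (P k)" for k h x
    using linear_map_closed[OF Hl[OF that(1)] that(2)] .
  have \<phi>: "linear_map complex_field (?H k) (?D k) (\<phi> k)" for k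
    by (rule linear_mapI)
      (auto simp: \<phi>_def power_module_simps hom_space_simps(2-) fun_eq_iff hc c Y.lsmult_r_null)
  have m': "m \<in> I k \<rightarrow> carrier Y" if "m \<in> carrier (?D k)" for m k
    using that by (auto simp: power_module_simps)
  note ll = lin_comb_linear[OF A.ring_axioms coeff m']
  have \<psi>: "linear_map complex_field (?D k) (?H k) (\<psi> k)" for k
  proof (rule linear_mapI)
    show "\<psi> k m \<in> carrier (?H k)" if "m \<in> carrier (?D k)" for m
      unfolding hom_space_simps \<psi>_def
      by (rule restrict_in_module_homs[OF P'(2) linear_map_compose[OF f ll[OF that]]])
    note l = lin_comb_power_linear[OF linear_map_closed[OF f]]
    show "\<psi> k (m \<oplus>\<^bsub>?D k\<^esub> m') = \<psi> k m \<oplus>\<^bsub>?H k\<^esub> \<psi> k m'" if "m \<in> carrier (?D k)" "m' \<in> carrier (?D k)" for m m'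
      using linear_map_add[OF l that] by (auto simp: \<psi>_def hom_space_simps fun_eq_iff)
    show "\<psi> k (a \<odot>\<^bsub>?D k\<^esub> m) = a \<odot>\<^bsub>?H k\<^esub> \<psi> k m" if "m \<in> carrier (?D k)" for a m
      using linear_map_smult[OF l _ that] by (auto simp: \<psi>_def hom_space_simps fun_eq_iff)
  qed
  have \<phi>lc: "lin_comb Y (I k) (\<phi> k h) x = h (g k x)" if h: "h \<in> carrier (?H k)" and x: "x \<in> carrier (free_module A (I k))" for k h x
  proof (rule free_module_map_eq[OF A.ring_axioms coeff ll[OF linear_map_closed[OF \<phi> h]] linear_map_compose[OF g Hl[OF h]] _ x])
    show "lin_comb Y (I k) (\<phi> k h) (basis_vec A i) = h (g k (basis_vec A i))" if "i \<in> I k" for i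
      using lin_comb_basis[OF coeff m'[OF linear_map_closed[OF \<phi> h]] I that] that by (simp add: \<phi>_def)
  qed
  have \<psi>v: "\<psi> k m p = lin_comb Y (I k) m (f k p)" if "p \<in> carrier (P k)" for k m p
    using that by (simp add: \<psi>_def)
  have lb: "lin_comb Y (I k) m (basis_vec A i) = m i" if "m \<in> carrier (?D k)" "i \<in> I k" for k m i
    by (rule lin_comb_basis[OF coeff m'[OF that(1)] I that(2)])
  have Hext: "h = h'" if "h \<in> carrier (?H k)" "h' \<in> carrier (?H k)" "\<And>x. x \<in> carrier (P k) \<Longrightarrow> h x = h' x" for k h h'
    using that module_homs_eqI[of h A "P k" Y h'] by (simp add: hom_space_simps)
  have Dext: "m = m'" if "m \<in> carrier (?D k)" "m' \<in> carrier (?D k)" "\<And>i. i \<in> I k \<Longrightarrow> m i = m' i" for k m m'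
  proof
    show "m i = m' i" for i using that by (cases "i \<in> I k") (auto simp: power_module_simps)
  qed
  have Dminus: "(m \<ominus>\<^bsub>?D k\<^esub> m') i = m i \<ominus>\<^bsub>Y\<^esub> m' i" if "m \<in> carrier (?D k)" "m' \<in> carrier (?D k)" "i \<in> I k" for k m m' i
  proof -
    have "\<ominus>\<^bsub>restrict_scalars A Y\<^esub> y = \<ominus>\<^bsub>Y\<^esub> y" for y
      by (simp add: a_inv_def m_inv_def restrict_scalars_def)
    moreover have "linear_map complex_field (?D k) (restrict_scalars A Y) (\<lambda>m. m i)"
      using that(3) by (auto intro!: linear_mapI simp: power_module_simps)
    ultimately show ?thesis
      using linear_map_minus(2)[OF Dm YS.left_module_axioms _ that(1,2), of "\<lambda>m. m i"] by (simp add: a_minus_def)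
  qed
  note lcd = lin_comb_copower[OF Q'(3) I] and lct = lin_comb_copower[OF t I]
  have Fm: "left_module A (free_module A J)" for J :: "'i set" by (rule left_module_free_module[OF A.ring_axioms])
  have H_closed: "x \<in> carrier (?H k) \<Longrightarrow> y \<in> carrier (?H k) \<Longrightarrow> x \<ominus>\<^bsub>?H k\<^esub> y \<in> carrier (?H k)"
    "x \<in> carrier (?H k) \<Longrightarrow> y \<in> carrier (?H k) \<Longrightarrow> x \<oplus>\<^bsub>?H k\<^esub> y \<in> carrier (?H k)"
    "\<zero>\<^bsub>?H k\<^esub> \<in> carrier (?H k)" for x y k
  proof -
    interpret H: left_module complex_field "?H k" by (rule Hm)
    show "x \<in> carrier (?H k) \<Longrightarrow> y \<in> carrier (?H k) \<Longrightarrow> x \<ominus>\<^bsub>?H k\<^esub> y \<in> carrier (?H k)"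
      "x \<in> carrier (?H k) \<Longrightarrow> y \<in> carrier (?H k) \<Longrightarrow> x \<oplus>\<^bsub>?H k\<^esub> y \<in> carrier (?H k)"
      "\<zero>\<^bsub>?H k\<^esub> \<in> carrier (?H k)" by simp_all
  qed
  have D_closed: "x \<in> carrier (?D k) \<Longrightarrow> y \<in> carrier (?D k) \<Longrightarrow> x \<ominus>\<^bsub>?D k\<^esub> y \<in> carrier (?D k)"
    "x \<in> carrier (?D k) \<Longrightarrow> y \<in> carrier (?D k) \<Longrightarrow> x \<oplus>\<^bsub>?D k\<^esub> y \<in> carrier (?D k)"
    "\<zero>\<^bsub>?D k\<^esub> \<in> carrier (?D k)" for x y k
  proof -
    interpret D: left_module complex_field "?D k" by (rule Dm)
    show "x \<in> carrier (?D k) \<Longrightarrow> y \<in> carrier (?D k) \<Longrightarrow> x \<ominus>\<^bsub>?D k\<^esub> y \<in> carrier (?D k)"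
      "x \<in> carrier (?D k) \<Longrightarrow> y \<in> carrier (?D k) \<Longrightarrow> x \<oplus>\<^bsub>?D k\<^esub> y \<in> carrier (?D k)"
      "\<zero>\<^bsub>?D k\<^esub> \<in> carrier (?D k)" by simp_all
  qed
  note lc = linear_map_closed[OF \<phi>] linear_map_closed[OF \<psi>] linear_map_closed[OF d_lin] linear_map_closed[OF d'_lin]
    linear_map_closed[OF s_lin] linear_map_closed[OF t_lin] H_closed D_closed
  show ?thesis
  proof (rule cohomology_iso[where V = ?H and W = ?D and d = ?d and d' = ?d' and f = \<phi> and g = \<psi>
        and s = ?s and t = ?t, OF Hm Dm d_lin d'_lin _ _ \<phi> \<psi> _ _ s_lin t_lin])
    fix k h m
    show "?d (Suc k) (?d k h) = \<zero>\<^bsub>?H (Suc (Suc k))\<^esub>" if h: "h \<in> carrier (?H k)"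
      by (rule Hext[OF lc(3)[OF lc(3)[OF h]] H_closed(3)])
        (use linear_map_zero[OF P'(2) coeff Hl[OF h]] in \<open>simp add: compose_def hom_space_simps c P'(6)\<close>)
    show "?d' (Suc k) (?d' k m) = \<zero>\<^bsub>?D (Suc (Suc k))\<^esub>" if m: "m \<in> carrier (?D k)"
    proof (rule Dext[OF lc(4)[OF lc(4)[OF m]] D_closed(3)])
      fix i assume i: "i \<in> I (Suc (Suc k))"
      have "?d' (Suc k) (?d' k m) i = lin_comb Y (I (Suc k)) (?d' k m) (d' (Suc k) (basis_vec A i))"
        using i by (simp add: copower_map_def[of Y A "I (Suc k)"])
      also have "\<dots> = lin_comb Y (I k) m (d' k (d' (Suc k) (basis_vec A i)))"
        by (rule lcd[OF m linear_map_closed[OF Q'(3) b[OF i]]])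
      also have "\<dots> = \<zero>\<^bsub>Y\<^esub>"
        using Q'(6)[OF b[OF i]] linear_map_zero[OF Fm coeff ll[OF m]] by simp
      finally show "?d' (Suc k) (?d' k m) i = \<zero>\<^bsub>?D (Suc (Suc k))\<^esub> i" by (simp add: power_module_simps)
    qed
    show "?d' k (\<phi> k h) = \<phi> (Suc k) (?d k h)" if h: "h \<in> carrier (?H k)"
      by (rule Dext[OF lc(4)[OF lc(1)[OF h]] lc(1)[OF lc(3)[OF h]]])
        (simp add: copower_map_def \<phi>lc[OF h] c, simp add: \<phi>_def compose_def c gd)
    show "?d k (\<psi> k m) = \<psi> (Suc k) (?d' k m)" if m: "m \<in> carrier (?D k)"
      by (rule Hext[OF lc(3)[OF lc(2)[OF m]] lc(2)[OF lc(4)[OF m]]])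
        (simp add: compose_def \<psi>v c lcd[OF m] fd)
    show "h \<ominus>\<^bsub>?H 0\<^esub> \<psi> 0 (\<phi> 0 h) = ?s 0 (?d 0 h)" if h: "h \<in> carrier (?H 0)"
    proof (rule Hext[OF lc(7)[OF h lc(2)[OF lc(1)[OF h]]] lc(5)[OF lc(3)[OF h]]])
      fix p assume p: "p \<in> carrier (P 0)"
      show "(h \<ominus>\<^bsub>?H 0\<^esub> \<psi> 0 (\<phi> 0 h)) p = ?s 0 (?d 0 h) p"
        using hom_space_minus[OF P'(2) h lc(2)[OF lc(1)[OF h]] p] p
          linear_map_minus(2)[OF P'(2) coeff Hl[OF h] p, of "g 0 (f 0 p)"]
        by (simp add: \<psi>v \<phi>lc[OF h] c gf0 compose_def)
    qed
    show "h \<ominus>\<^bsub>?H (Suc k)\<^esub> \<psi> (Suc k) (\<phi> (Suc k) h) = ?s (Suc k) (?d (Suc k) h) \<oplus>\<^bsub>?H (Suc k)\<^esub> ?d k (?s k h)"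
      if h: "h \<in> carrier (?H (Suc k))"
    proof (rule Hext[OF lc(7)[OF h lc(2)[OF lc(1)[OF h]]] lc(8)[OF lc(5)[OF lc(3)[OF h]] lc(3)[OF lc(5)[OF h]]]])
      fix p assume p: "p \<in> carrier (P (Suc k))"
      show "(h \<ominus>\<^bsub>?H (Suc k)\<^esub> \<psi> (Suc k) (\<phi> (Suc k) h)) p
          = (?s (Suc k) (?d (Suc k) h) \<oplus>\<^bsub>?H (Suc k)\<^esub> ?d k (?s k h)) p"
        using hom_space_minus[OF P'(2) h lc(2)[OF lc(1)[OF h]] p] p
          linear_map_minus(2)[OF P'(2) coeff Hl[OF h] p, of "g (Suc k) (f (Suc k) p)"]
        by (simp add: \<psi>v \<phi>lc[OF h] c gf compose_def hom_space_simps(3) linear_map_add[OF Hl[OF h]])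
    qed
    show "m \<ominus>\<^bsub>?D 0\<^esub> \<phi> 0 (\<psi> 0 m) = ?t 0 (?d' 0 m)" if m: "m \<in> carrier (?D 0)"
    proof (rule Dext[OF lc(10)[OF m lc(1)[OF lc(2)[OF m]]] lc(6)[OF lc(4)[OF m]]])
      fix i assume i: "i \<in> I 0"
      have "?t 0 (?d' 0 m) i = lin_comb Y (I 0) m (d' 0 (t 0 (basis_vec A i)))"
        using i lcd[OF m linear_map_closed[OF t b[OF i]]] by (simp add: copower_map_def[of Y A "I (Suc 0)"])
      then show "(m \<ominus>\<^bsub>?D 0\<^esub> \<phi> 0 (\<psi> 0 m)) i = ?t 0 (?d' 0 m) i"
        using Dminus[OF m lc(1)[OF lc(2)[OF m]] i] i lb[OF m i] fg0[OF b[OF i]]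
          linear_map_minus(2)[OF Fm coeff ll[OF m] b[OF i], of "f 0 (g 0 (basis_vec A i))"]
        by (simp add: \<phi>_def \<psi>v c)
    qed
    show "m \<ominus>\<^bsub>?D (Suc k)\<^esub> \<phi> (Suc k) (\<psi> (Suc k) m) = ?t (Suc k) (?d' (Suc k) m) \<oplus>\<^bsub>?D (Suc k)\<^esub> ?d' k (?t k m)"
      if m: "m \<in> carrier (?D (Suc k))"
    proof (rule Dext[OF lc(10)[OF m lc(1)[OF lc(2)[OF m]]] lc(11)[OF lc(6)[OF lc(4)[OF m]] lc(4)[OF lc(6)[OF m]]]])
      fix i assume i: "i \<in> I (Suc k)"
      have 1: "?t (Suc k) (?d' (Suc k) m) i = lin_comb Y (I (Suc k)) m (d' (Suc k) (t (Suc k) (basis_vec A i)))"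
        using i lcd[OF m linear_map_closed[OF t b[OF i]]] by (simp add: copower_map_def[of Y A "I (Suc (Suc k))"])
      have 2: "?d' k (?t k m) i = lin_comb Y (I (Suc k)) m (t k (d' k (basis_vec A i)))"
        using i lct[OF m linear_map_closed[OF Q'(3) b[OF i]]] by (simp add: copower_map_def[of Y A "I k"])
      show "(m \<ominus>\<^bsub>?D (Suc k)\<^esub> \<phi> (Suc k) (\<psi> (Suc k) m)) i
          = (?t (Suc k) (?d' (Suc k) m) \<oplus>\<^bsub>?D (Suc k)\<^esub> ?d' k (?t k m)) i"
        using Dminus[OF m lc(1)[OF lc(2)[OF m]] i] i lb[OF m i] fg'[OF b[OF i]] 1 2
          linear_map_minus(2)[OF Fm coeff ll[OF m] b[OF i], of "f (Suc k) (g (Suc k) (basis_vec A i))"]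
        by (simp add: \<phi>_def \<psi>v c power_module_simps(3) linear_map_add[OF ll[OF m]])
    qed
  qed
qed

end

section \<open>Algebras given by generators and relations, and how they act\<close>

subsection \<open>Monoid algebras\<close>

lemma monoid_algebra_simps:
  "carrier (monoid_algebra G) = carrier (free_module complex_field (carrier G))"
  "\<zero>\<^bsub>monoid_algebra G\<^esub> = \<zero>\<^bsub>free_module complex_field (carrier G)\<^esub>"
  "f \<oplus>\<^bsub>monoid_algebra G\<^esub> g = f \<oplus>\<^bsub>free_module complex_field (carrier G)\<^esub> g"
  "c \<odot>\<^bsub>monoid_algebra G\<^esub> f = c \<odot>\<^bsub>free_module complex_field (carrier G)\<^esub> f"
  "\<one>\<^bsub>monoid_algebra G\<^esub> = single \<one>\<^bsub>G\<^esub>"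
  by (simp_all add: monoid_algebra_def)

lemma carrier_monoid_algebra:
  "f \<in> carrier (monoid_algebra G) \<longleftrightarrow> (\<forall>x. x \<notin> carrier G \<longrightarrow> f x = 0) \<and> finite {x. f x \<noteq> 0}"
  by (auto simp: monoid_algebra_simps free_module_simps)

text \<open>Sums over pairs with a prescribed product are awkward to rearrange. Paired with an
  arbitrary function, the convolution product becomes an iterated sum
  (\<open>evaluate_mult\<close>), and its associativity reduces to that of the monoid inside the
  evaluations.\<close>

definition evaluate :: "('x \<Rightarrow> complex) \<Rightarrow> ('x \<Rightarrow> complex) \<Rightarrow> complex"
  where "evaluate f \<phi> = (\<Sum>a | f a \<noteq> 0. f a * \<phi> a)"

lemma evaluate_finite:
  "finite S \<Longrightarrow> {a. f a \<noteq> 0} \<subseteq> S \<Longrightarrow> evaluate f \<phi> = (\<Sum>a\<in>S. f a * \<phi> a)"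
  unfolding evaluate_def by (rule sum.mono_neutral_left) auto

lemma evaluate_cong: "(\<And>a. f a \<noteq> 0 \<Longrightarrow> \<phi> a = \<psi> a) \<Longrightarrow> evaluate f \<phi> = evaluate f \<psi>"
  unfolding evaluate_def by (rule sum.cong) auto

lemma monoid_algebra_mult:
  assumes f: "finite {a. f a \<noteq> 0}" and g: "finite {b. g b \<noteq> 0}"
  shows "(f \<otimes>\<^bsub>monoid_algebra G\<^esub> g) x = evaluate f (\<lambda>a. evaluate g (\<lambda>b. if a \<otimes>\<^bsub>G\<^esub> b = x then 1 else 0))"
proof -
  have "(f \<otimes>\<^bsub>monoid_algebra G\<^esub> g) x = (\<Sum>(a, b) | f a \<noteq> 0 \<and> g b \<noteq> 0 \<and> a \<otimes>\<^bsub>G\<^esub> b = x. f a * g b)"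
    by (simp add: monoid_algebra_def)
  also have "\<dots> = (\<Sum>(a, b) \<in> {a. f a \<noteq> 0} \<times> {b. g b \<noteq> 0}. f a * (g b * (if a \<otimes>\<^bsub>G\<^esub> b = x then 1 else 0)))"
    by (rule sum.mono_neutral_cong_left) (use f g in \<open>auto split: if_splits\<close>)
  also have "\<dots> = evaluate f (\<lambda>a. evaluate g (\<lambda>b. if a \<otimes>\<^bsub>G\<^esub> b = x then 1 else 0))"
    unfolding evaluate_def sum_distrib_left by (rule sum.cartesian_product[symmetric])
  finally show ?thesis .
qed

lemma monoid_algebra_mult_support:
  assumes f: "finite {a. f a \<noteq> 0}" and g: "finite {b. g b \<noteq> 0}"
  shows "{x. (f \<otimes>\<^bsub>monoid_algebra G\<^esub> g) x \<noteq> 0} \<subseteq> (\<lambda>(a, b). a \<otimes>\<^bsub>G\<^esub> b) ` ({a. f a \<noteq> 0} \<times> {b. g b \<noteq> 0})"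
proof
  fix x assume x: "x \<in> {x. (f \<otimes>\<^bsub>monoid_algebra G\<^esub> g) x \<noteq> 0}"
  show "x \<in> (\<lambda>(a, b). a \<otimes>\<^bsub>G\<^esub> b) ` ({a. f a \<noteq> 0} \<times> {b. g b \<noteq> 0})"
  proof (rule ccontr)
    assume "x \<notin> (\<lambda>(a, b). a \<otimes>\<^bsub>G\<^esub> b) ` ({a. f a \<noteq> 0} \<times> {b. g b \<noteq> 0})"
    then have "evaluate f (\<lambda>a. evaluate g (\<lambda>b. if a \<otimes>\<^bsub>G\<^esub> b = x then 1 else 0)) = evaluate f (\<lambda>a. evaluate g (\<lambda>b. 0))"
      by (intro evaluate_cong) auto
    then show False using x monoid_algebra_mult[OF f g, of G x] by (simp add: evaluate_def)
  qed
qed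

lemma evaluate_mult:
  assumes f: "finite {a. f a \<noteq> 0}" and g: "finite {b. g b \<noteq> 0}"
  shows "evaluate (f \<otimes>\<^bsub>monoid_algebra G\<^esub> g) \<phi> = evaluate f (\<lambda>a. evaluate g (\<lambda>b. \<phi> (a \<otimes>\<^bsub>G\<^esub> b)))"
proof -
  let ?A = "{a. f a \<noteq> 0}" and ?B = "{b. g b \<noteq> 0}"
  let ?Z = "(\<lambda>(a, b). a \<otimes>\<^bsub>G\<^esub> b) ` (?A \<times> ?B)"
  have Z: "finite ?Z" using f g by simp
  have "evaluate (f \<otimes>\<^bsub>monoid_algebra G\<^esub> g) \<phi> = (\<Sum>x\<in>?Z. (f \<otimes>\<^bsub>monoid_algebra G\<^esub> g) x * \<phi> x)"
    by (rule evaluate_finite[OF Z monoid_algebra_mult_support[OF f g]])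
  also have "\<dots> = (\<Sum>x\<in>?Z. \<Sum>a\<in>?A. \<Sum>b\<in>?B. f a * (g b * (if a \<otimes>\<^bsub>G\<^esub> b = x then \<phi> x else 0)))"
    unfolding monoid_algebra_mult[OF f g] evaluate_def sum_distrib_left sum_distrib_right
    by (intro sum.cong) auto
  \<comment> \<open>With the sum over \<open>x\<close> innermost, a pair contributes only through
    the one value of \<open>x\<close> that is its product.\<close>
  also have "\<dots> = (\<Sum>a\<in>?A. \<Sum>b\<in>?B. \<Sum>x\<in>?Z. f a * (g b * (if a \<otimes>\<^bsub>G\<^esub> b = x then \<phi> x else 0)))"
    by (subst sum.swap, rule sum.cong[OF refl], rule sum.swap)
  also have "\<dots> = (\<Sum>a\<in>?A. \<Sum>b\<in>?B. f a * (g b * \<phi> (a \<otimes>\<^bsub>G\<^esub> b)))"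
  proof (intro sum.cong refl)
    fix a b assume ab: "a \<in> ?A" "b \<in> ?B"
    have "(\<Sum>x\<in>?Z. f a * (g b * (if a \<otimes>\<^bsub>G\<^esub> b = x then \<phi> x else 0)))
        = (\<Sum>x\<in>?Z. if a \<otimes>\<^bsub>G\<^esub> b = x then f a * (g b * \<phi> x) else 0)"
      by (rule sum.cong) auto
    also have "\<dots> = f a * (g b * \<phi> (a \<otimes>\<^bsub>G\<^esub> b))"
      using Z ab by (subst sum.delta') auto
    finally show "(\<Sum>x\<in>?Z. f a * (g b * (if a \<otimes>\<^bsub>G\<^esub> b = x then \<phi> x else 0)))
        = f a * (g b * \<phi> (a \<otimes>\<^bsub>G\<^esub> b))" .
  qed
  also have "\<dots> = evaluate f (\<lambda>a. evaluate g (\<lambda>b. \<phi> (a \<otimes>\<^bsub>G\<^esub> b)))"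
    by (simp add: evaluate_def sum_distrib_left)
  finally show ?thesis .
qed

lemma evaluate_add:
  assumes "finite {a. f a \<noteq> 0}" "finite {a. g a \<noteq> 0}"
  shows "evaluate (\<lambda>a. f a + g a) \<phi> = evaluate f \<phi> + evaluate g \<phi>"
proof -
  let ?S = "{a. f a \<noteq> 0} \<union> {a. g a \<noteq> 0}"
  have "evaluate (\<lambda>a. f a + g a) \<phi> = (\<Sum>a\<in>?S. (f a + g a) * \<phi> a)"
    by (rule evaluate_finite) (use assms in auto)
  also have "\<dots> = evaluate f \<phi> + evaluate g \<phi>"
    using evaluate_finite[of ?S f \<phi>] evaluate_finite[of ?S g \<phi>] assms
    by (simp add: distrib_right sum.distrib)
  finally show ?thesis .
qed

lemma evaluate_add_right: "evaluate f (\<lambda>a. \<phi> a + \<psi> a) = evaluate f \<phi> + evaluate f \<psi>"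
  by (simp add: evaluate_def distrib_left sum.distrib)

lemma evaluate_scale_right: "evaluate f (\<lambda>a. c * \<phi> a) = c * evaluate f \<phi>"
  by (simp add: evaluate_def sum_distrib_left mult_ac)

lemma evaluate_scale: "finite {a. f a \<noteq> 0} \<Longrightarrow> evaluate (\<lambda>a. c * f a) \<phi> = c * evaluate f \<phi>"
  by (cases "c = 0") (simp_all add: evaluate_def sum_distrib_left mult_ac)

lemma evaluate_single: "evaluate (single a) \<phi> = \<phi> a"
  by (simp add: evaluate_def single_def)

lemma finite_single: "finite {x. single a x \<noteq> 0}"
  by (simp add: single_def)

lemma complex_algebra_monoid_algebra:
  assumes "Group.monoid G"
  shows "complex_algebra (monoid_algebra G)"
proof -
  interpret G: Group.monoid G by fact
  let ?F = "monoid_algebra G"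
  interpret L: left_module complex_field "free_module complex_field (carrier G)"
    by (rule left_module_free_module[OF ring_complex_field])
  have ab: "abelian_group ?F"
    by (rule abelian_group_cong[OF L.M.abelian_group_axioms]) (simp_all add: monoid_algebra_simps)
  have lm: "left_module complex_field ?F"
    using ab L.left_module_axioms by (simp add: left_module_def left_module_axioms_def monoid_algebra_simps)
  have fin: "finite {x. f x \<noteq> 0}" if "f \<in> carrier ?F" for f
    using that by (simp add: carrier_monoid_algebra)
  have car: "x \<in> carrier G" if "f \<in> carrier ?F" "f x \<noteq> 0" for f x
    using that by (auto simp: carrier_monoid_algebra)
  have cl: "f \<otimes>\<^bsub>?F\<^esub> g \<in> carrier ?F" if f: "f \<in> carrier ?F" and g: "g \<in> carrier ?F" for f g
  proof -
    have "{x. (f \<otimes>\<^bsub>?F\<^esub> g) x \<noteq> 0} \<subseteq> carrier G"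
      using monoid_algebra_mult_support[OF fin[OF f] fin[OF g], of G] car[OF f] car[OF g] by fastforce
    then show ?thesis
      using finite_subset[OF monoid_algebra_mult_support[OF fin[OF f] fin[OF g], of G]] fin[OF f] fin[OF g]
      by (auto simp: carrier_monoid_algebra)
  qed
  note m = monoid_algebra_mult[OF fin fin]
  have one: "\<one>\<^bsub>?F\<^esub> \<in> carrier ?F"
    by (auto simp: carrier_monoid_algebra monoid_algebra_simps(5) single_def)
  have ev_id: "evaluate f (\<lambda>a. if a = x then 1 else 0) = f x" if "f \<in> carrier ?F" for f x
  proof -
    have "evaluate f (\<lambda>a. if a = x then 1 else 0) = (\<Sum>a | f a \<noteq> 0. if a = x then f a else 0)"
      unfolding evaluate_def by (rule sum.cong) auto
    also have "\<dots> = f x" using fin[OF that] by simp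
    finally show ?thesis .
  qed
  have "Group.monoid ?F"
  proof (rule monoidI)
    fix f g h assume f: "f \<in> carrier ?F"
    show "\<one>\<^bsub>?F\<^esub> \<otimes>\<^bsub>?F\<^esub> f = f"
    proof
      fix x
      have "(\<one>\<^bsub>?F\<^esub> \<otimes>\<^bsub>?F\<^esub> f) x = evaluate f (\<lambda>b. if \<one>\<^bsub>G\<^esub> \<otimes>\<^bsub>G\<^esub> b = x then 1 else 0)"
        unfolding m[OF one f] by (simp add: monoid_algebra_simps(5) evaluate_single)
      also have "\<dots> = evaluate f (\<lambda>a. if a = x then 1 else 0)"
        by (rule evaluate_cong) (use car[OF f] in simp)
      finally show "(\<one>\<^bsub>?F\<^esub> \<otimes>\<^bsub>?F\<^esub> f) x = f x" by (simp add: ev_id[OF f])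
    qed
    show "f \<otimes>\<^bsub>?F\<^esub> \<one>\<^bsub>?F\<^esub> = f"
    proof
      fix x
      have "(f \<otimes>\<^bsub>?F\<^esub> \<one>\<^bsub>?F\<^esub>) x = evaluate f (\<lambda>a. if a \<otimes>\<^bsub>G\<^esub> \<one>\<^bsub>G\<^esub> = x then 1 else 0)"
        unfolding m[OF f one] by (simp add: monoid_algebra_simps(5) evaluate_single)
      also have "\<dots> = evaluate f (\<lambda>a. if a = x then 1 else 0)"
        by (rule evaluate_cong) (use car[OF f] in simp)
      finally show "(f \<otimes>\<^bsub>?F\<^esub> \<one>\<^bsub>?F\<^esub>) x = f x" by (simp add: ev_id[OF f])
    qed
    assume g: "g \<in> carrier ?F"
    show "f \<otimes>\<^bsub>?F\<^esub> g \<in> carrier ?F" by (rule cl[OF f g])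
    assume h: "h \<in> carrier ?F"
    show "f \<otimes>\<^bsub>?F\<^esub> g \<otimes>\<^bsub>?F\<^esub> h = f \<otimes>\<^bsub>?F\<^esub> (g \<otimes>\<^bsub>?F\<^esub> h)"
    proof
      fix x
      show "(f \<otimes>\<^bsub>?F\<^esub> g \<otimes>\<^bsub>?F\<^esub> h) x = (f \<otimes>\<^bsub>?F\<^esub> (g \<otimes>\<^bsub>?F\<^esub> h)) x"
        unfolding m[OF cl[OF f g] h] m[OF f cl[OF g h]] evaluate_mult[OF fin[OF f] fin[OF g]]
          evaluate_mult[OF fin[OF g] fin[OF h]]
        by (intro evaluate_cong) (use car[OF f] car[OF g] car[OF h] in \<open>simp add: G.m_assoc\<close>)
    qed
  qed (rule one)
  moreover have "(f \<oplus>\<^bsub>?F\<^esub> g) \<otimes>\<^bsub>?F\<^esub> h = f \<otimes>\<^bsub>?F\<^esub> h \<oplus>\<^bsub>?F\<^esub> g \<otimes>\<^bsub>?F\<^esub> h"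
    and "h \<otimes>\<^bsub>?F\<^esub> (f \<oplus>\<^bsub>?F\<^esub> g) = h \<otimes>\<^bsub>?F\<^esub> f \<oplus>\<^bsub>?F\<^esub> h \<otimes>\<^bsub>?F\<^esub> g"
    if f: "f \<in> carrier ?F" and g: "g \<in> carrier ?F" and h: "h \<in> carrier ?F" for f g h
  proof -
    have fg: "f \<oplus>\<^bsub>?F\<^esub> g \<in> carrier ?F" using ab f g by (simp add: abelian_group_def abelian_monoid.a_closed)
    have eq: "f \<oplus>\<^bsub>?F\<^esub> g = (\<lambda>x. f x + g x)" by (simp add: monoid_algebra_simps free_module_simps)
    show "(f \<oplus>\<^bsub>?F\<^esub> g) \<otimes>\<^bsub>?F\<^esub> h = f \<otimes>\<^bsub>?F\<^esub> h \<oplus>\<^bsub>?F\<^esub> g \<otimes>\<^bsub>?F\<^esub> h"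
      unfolding monoid_algebra_simps(3)[of G "f \<otimes>\<^bsub>?F\<^esub> h"] free_module_simps(3)
      by (rule ext) (simp add: m[OF fg h] m[OF f h] m[OF g h], simp add: eq evaluate_add fin[OF f] fin[OF g])
    show "h \<otimes>\<^bsub>?F\<^esub> (f \<oplus>\<^bsub>?F\<^esub> g) = h \<otimes>\<^bsub>?F\<^esub> f \<oplus>\<^bsub>?F\<^esub> h \<otimes>\<^bsub>?F\<^esub> g"
      unfolding monoid_algebra_simps(3)[of G "h \<otimes>\<^bsub>?F\<^esub> f"] free_module_simps(3)
      by (rule ext) (simp add: m[OF h fg] m[OF h f] m[OF h g],
          simp add: eq evaluate_add fin[OF f] fin[OF g] evaluate_add_right)
  qed
  moreover have "(c \<odot>\<^bsub>?F\<^esub> f) \<otimes>\<^bsub>?F\<^esub> g = c \<odot>\<^bsub>?F\<^esub> (f \<otimes>\<^bsub>?F\<^esub> g)"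
    and "f \<otimes>\<^bsub>?F\<^esub> (c \<odot>\<^bsub>?F\<^esub> g) = c \<odot>\<^bsub>?F\<^esub> (f \<otimes>\<^bsub>?F\<^esub> g)"
    if f: "f \<in> carrier ?F" and g: "g \<in> carrier ?F" for c f g
  proof -
    have cf: "c \<odot>\<^bsub>?F\<^esub> f \<in> carrier ?F" if "f \<in> carrier ?F" for f
      using left_module.lsmult_closed[OF lm, of c f] that by simp
    have eq: "c \<odot>\<^bsub>?F\<^esub> f = (\<lambda>x. c * f x)" for f by (simp add: monoid_algebra_simps free_module_simps)
    show "(c \<odot>\<^bsub>?F\<^esub> f) \<otimes>\<^bsub>?F\<^esub> g = c \<odot>\<^bsub>?F\<^esub> (f \<otimes>\<^bsub>?F\<^esub> g)"
      unfolding eq[of "f \<otimes>\<^bsub>?F\<^esub> g"]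
      by (rule ext) (simp add: m[OF cf[OF f] g] m[OF f g], simp add: eq evaluate_scale fin[OF f])
    show "f \<otimes>\<^bsub>?F\<^esub> (c \<odot>\<^bsub>?F\<^esub> g) = c \<odot>\<^bsub>?F\<^esub> (f \<otimes>\<^bsub>?F\<^esub> g)"
      unfolding eq[of "f \<otimes>\<^bsub>?F\<^esub> g"]
      by (rule ext) (simp add: m[OF f cf[OF g]] m[OF f g], simp add: eq evaluate_scale fin[OF g] evaluate_scale_right)
  qed
  ultimately show ?thesis
    using ab lm by (auto simp: complex_algebra_def intro!: ringI)
qed

lemma monoid_algebra_single_mult:
  "single a \<otimes>\<^bsub>monoid_algebra G\<^esub> single b = single (a \<otimes>\<^bsub>G\<^esub> b)"
  unfolding fun_eq_iff monoid_algebra_mult[OF finite_single finite_single] evaluate_single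
  by (simp add: single_def)

lemma single_in_monoid_algebra: "x \<in> carrier G \<Longrightarrow> single x \<in> carrier (monoid_algebra G)"
  by (simp add: monoid_algebra_simps single_closed)

lemma monoid_algebra_induct [consumes 1, case_names zero step]:
  assumes "f \<in> carrier (monoid_algebra G)" "P \<zero>\<^bsub>monoid_algebra G\<^esub>"
    and "\<And>f x c. f \<in> carrier (monoid_algebra G) \<Longrightarrow> P f \<Longrightarrow> x \<in> carrier G \<Longrightarrow>
      P (f \<oplus>\<^bsub>monoid_algebra G\<^esub> c \<odot>\<^bsub>monoid_algebra G\<^esub> single x)"
  shows "P f"
  using ring_complex_field assms(1)[unfolded monoid_algebra_simps]
  by (induction rule: free_module_induct) (use assms(2,3) in \<open>simp_all add: monoid_algebra_simps\<close>)

subsection \<open>Quotient algebras\<close>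

text \<open>A scalar acts as multiplication by a multiple of the unit, so an ideal absorbs
  it.\<close>

lemma ideal_submodule:
  assumes "complex_algebra F" "ideal I F"
  shows "submodule I complex_field F"
proof -
  interpret F: calgebra F by (rule calgebra.intro) fact
  interpret I: ideal I F by fact
  show ?thesis
  proof (rule F.V.submodule_leftI)
    show "c \<odot>\<^bsub>F\<^esub> x \<in> I" if "x \<in> I" for c x
      using I.I_l_closed[OF that F.scal_closed[of c]] F.scal_mult(1)[of x c] I.a_Hcarr[OF that] by simp
  qed (auto intro: I.a_Hcarr)
qed

lemma quot_algebra:
  assumes F: "complex_algebra F" and I: "ideal I F"
  shows complex_algebra_quot: "complex_algebra (quot_module F I)"
    and quot_algebra_mult: "x \<in> carrier F \<Longrightarrow> y \<in> carrier F \<Longrightarrow>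
      (I +>\<^bsub>F\<^esub> x) \<otimes>\<^bsub>quot_module F I\<^esub> (I +>\<^bsub>F\<^esub> y) = I +>\<^bsub>F\<^esub> (x \<otimes>\<^bsub>F\<^esub> y)"
    and quot_algebra_one: "\<one>\<^bsub>quot_module F I\<^esub> = I +>\<^bsub>F\<^esub> \<one>\<^bsub>F\<^esub>"
proof -
  interpret F: calgebra F by (rule calgebra.intro) fact
  interpret I: ideal I F by fact
  let ?Q = "quot_module F I"
  have L: "left_module complex_field F" using F by (simp add: complex_algebra_def)
  note S = ideal_submodule[OF F I]
  show one: "\<one>\<^bsub>?Q\<^esub> = I +>\<^bsub>F\<^esub> \<one>\<^bsub>F\<^esub>"
    by (simp add: quot_module_def FactRing_def)
  show mult: "(I +>\<^bsub>F\<^esub> x) \<otimes>\<^bsub>?Q\<^esub> (I +>\<^bsub>F\<^esub> y) = I +>\<^bsub>F\<^esub> (x \<otimes>\<^bsub>F\<^esub> y)"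
    if "x \<in> carrier F" "y \<in> carrier F" for x y
    using I.rcoset_mult_add[OF that] by (simp add: quot_module_def FactRing_def)
  note simps = quot_module_simps(1) quot_module_add[OF L S] quot_module_smult[OF L S] mult one
  have lm: "left_module complex_field ?Q" by (rule left_module_quot[OF L S])
  then have ab: "abelian_group ?Q" by (simp add: left_module_def)
  have "ring ?Q"
    by (rule ringI[OF ab monoidI]) (auto simp: simps F.A.m_assoc F.A.l_distr F.A.r_distr)
  then show "complex_algebra ?Q"
    using lm by (auto simp: complex_algebra_def simps F.smult_mult F.V.lsmult_closed[simplified])
qed

subsection \<open>Modules over quotients of monoid algebras\<close>

definition operator_sum :: "('n, 'm) ring_scheme \<Rightarrow> (complex \<Rightarrow> 'x \<Rightarrow> 'n \<Rightarrow> 'n) \<Rightarrow> ('x \<Rightarrow> complex) \<Rightarrow> 'n \<Rightarrow> 'n"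
  where "operator_sum N T f n = (\<Oplus>\<^bsub>N\<^esub>p\<in>{p. f p \<noteq> 0}. T (f p) p n)"

text \<open>\<open>T c p\<close> is the operator of c times p. The scalar is an argument because
  \<open>N\<close> has no scalar multiplication of its own: \<open>env_left\<close> and
  \<open>env_right\<close> absorb it into an element of the algebra. The locale serves four actions:
  the left and right ones of the enveloping algebra on a bimodule, and those of the free algebra on
  the Koszul complex.\<close>

locale monoid_operators =
  fixes G :: "('x, 'g) monoid_scheme" and N :: "('n, 'm) ring_scheme" and T :: "complex \<Rightarrow> 'x \<Rightarrow> 'n \<Rightarrow> 'n"
  assumes monoid: "Group.monoid G" and group: "abelian_group N"
    and T_closed [simp]: "\<And>c p n. p \<in> carrier G \<Longrightarrow> n \<in> carrier N \<Longrightarrow> T c p n \<in> carrier N"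
    and T_add_scalar: "\<And>c c' p n. p \<in> carrier G \<Longrightarrow> n \<in> carrier N \<Longrightarrow> T (c + c') p n = T c p n \<oplus>\<^bsub>N\<^esub> T c' p n"
    and T_add: "\<And>c p n n'. p \<in> carrier G \<Longrightarrow> n \<in> carrier N \<Longrightarrow> n' \<in> carrier N \<Longrightarrow>
      T c p (n \<oplus>\<^bsub>N\<^esub> n') = T c p n \<oplus>\<^bsub>N\<^esub> T c p n'"
begin

abbreviation "F \<equiv> monoid_algebra G"
abbreviation "act \<equiv> operator_sum N T"

sublocale G: Group.monoid G by (rule monoid)
sublocale N: abelian_group N by (rule group)
sublocale F: calgebra F by (rule calgebra.intro) (rule complex_algebra_monoid_algebra[OF monoid])

lemma T_zero [simp]: "p \<in> carrier G \<Longrightarrow> n \<in> carrier N \<Longrightarrow> T 0 p n = \<zero>\<^bsub>N\<^esub>"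
  using T_add_scalar[of p n 0 0] N.add.r_cancel_one'[of "T 0 p n" "T 0 p n"] by simp

lemma act_finite:
  assumes f: "f \<in> carrier F" and n: "n \<in> carrier N"
    and S: "finite S" "{p. f p \<noteq> 0} \<subseteq> S" "S \<subseteq> carrier G"
  shows "act f n = (\<Oplus>\<^bsub>N\<^esub>p\<in>S. T (f p) p n)"
  unfolding operator_sum_def
  by (rule N.add.finprod_mono_neutral_cong_left) (use assms in auto)

lemma F_supp: "f \<in> carrier F \<Longrightarrow> finite {p. f p \<noteq> 0}" "f \<in> carrier F \<Longrightarrow> {p. f p \<noteq> 0} \<subseteq> carrier G"
  by (auto simp: carrier_monoid_algebra)

lemma act_closed [simp]: "f \<in> carrier F \<Longrightarrow> n \<in> carrier N \<Longrightarrow> act f n \<in> carrier N"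
  unfolding operator_sum_def using F_supp(2)[of f] by (intro N.finsum_closed) auto

lemma act_add:
  assumes f: "f \<in> carrier F" and g: "g \<in> carrier F" and n: "n \<in> carrier N"
  shows "act (f \<oplus>\<^bsub>F\<^esub> g) n = act f n \<oplus>\<^bsub>N\<^esub> act g n"
proof -
  let ?S = "{p. f p \<noteq> 0} \<union> {p. g p \<noteq> 0}"
  have eq: "f \<oplus>\<^bsub>F\<^esub> g = (\<lambda>x. f x + g x)" by (simp add: monoid_algebra_simps free_module_simps)
  have S: "finite ?S" "?S \<subseteq> carrier G" using F_supp f g by auto
  have "act (f \<oplus>\<^bsub>F\<^esub> g) n = (\<Oplus>\<^bsub>N\<^esub>p\<in>?S. T ((f \<oplus>\<^bsub>F\<^esub> g) p) p n)"
    by (rule act_finite[OF F.A.a_closed[OF f g] n S(1) _ S(2)]) (auto simp: eq)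
  also have "\<dots> = (\<Oplus>\<^bsub>N\<^esub>p\<in>?S. T (f p) p n \<oplus>\<^bsub>N\<^esub> T (g p) p n)"
    unfolding eq by (rule N.finsum_cong') (use S n in \<open>auto simp: T_add_scalar subset_iff\<close>)
  also have "\<dots> = (\<Oplus>\<^bsub>N\<^esub>p\<in>?S. T (f p) p n) \<oplus>\<^bsub>N\<^esub> (\<Oplus>\<^bsub>N\<^esub>p\<in>?S. T (g p) p n)"
    by (rule N.finsum_addf) (use S n in auto)
  finally show ?thesis
    using act_finite[OF f n S(1) _ S(2)] act_finite[OF g n S(1) _ S(2)] by auto
qed

lemma act_add_right:
  assumes f: "f \<in> carrier F" and n: "n \<in> carrier N" "n' \<in> carrier N"
  shows "act f (n \<oplus>\<^bsub>N\<^esub> n') = act f n \<oplus>\<^bsub>N\<^esub> act f n'"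
proof -
  have "act f (n \<oplus>\<^bsub>N\<^esub> n') = (\<Oplus>\<^bsub>N\<^esub>p\<in>{p. f p \<noteq> 0}. T (f p) p n \<oplus>\<^bsub>N\<^esub> T (f p) p n')"
    unfolding operator_sum_def by (rule N.finsum_cong') (use F_supp[OF f] n in \<open>auto simp: T_add subset_iff\<close>)
  also have "\<dots> = act f n \<oplus>\<^bsub>N\<^esub> act f n'"
    unfolding operator_sum_def by (rule N.finsum_addf) (use F_supp[OF f] n in auto)
  finally show ?thesis .
qed

lemma act_zero_left [simp]: "act \<zero>\<^bsub>F\<^esub> n = \<zero>\<^bsub>N\<^esub>"
  by (simp add: operator_sum_def monoid_algebra_simps free_module_simps)

lemma act_zero_right [simp]: "f \<in> carrier F \<Longrightarrow> act f \<zero>\<^bsub>N\<^esub> = \<zero>\<^bsub>N\<^esub>"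
  using act_add_right[of f "\<zero>\<^bsub>N\<^esub>" "\<zero>\<^bsub>N\<^esub>"] N.add.r_cancel_one'[of "act f \<zero>\<^bsub>N\<^esub>" "act f \<zero>\<^bsub>N\<^esub>"] by simp

lemma act_uminus: "f \<in> carrier F \<Longrightarrow> n \<in> carrier N \<Longrightarrow> act (\<ominus>\<^bsub>F\<^esub> f) n = \<ominus>\<^bsub>N\<^esub> act f n"
  using act_add[of "\<ominus>\<^bsub>F\<^esub> f" f n] by (intro N.minus_equality[symmetric]) (simp_all add: F.A.l_neg)

lemma act_minus: "f \<in> carrier F \<Longrightarrow> g \<in> carrier F \<Longrightarrow> n \<in> carrier N \<Longrightarrow> act (f \<ominus>\<^bsub>F\<^esub> g) n = act f n \<ominus>\<^bsub>N\<^esub> act g n"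
  by (simp add: F.A.minus_eq N.minus_eq act_add act_uminus)

lemma scaled_closed: "p \<in> carrier G \<Longrightarrow> c \<odot>\<^bsub>F\<^esub> single p \<in> carrier F"
  using F.V.lsmult_closed[of c] by (simp add: single_in_monoid_algebra)

lemma act_basis:
  assumes "p \<in> carrier G" "n \<in> carrier N"
  shows "act (c \<odot>\<^bsub>F\<^esub> single p) n = T c p n"
proof -
  have "act (c \<odot>\<^bsub>F\<^esub> single p) n = (\<Oplus>\<^bsub>N\<^esub>q\<in>{p}. T ((c \<odot>\<^bsub>F\<^esub> single p) q) q n)"
    by (rule act_finite[OF scaled_closed])
      (use assms in \<open>auto simp: monoid_algebra_simps free_module_simps single_def split: if_splits\<close>)
  also have "\<dots> = T c p n"
    using assms by (simp add: monoid_algebra_simps free_module_simps single_def)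
  finally show ?thesis .
qed

lemma act_single: "p \<in> carrier G \<Longrightarrow> n \<in> carrier N \<Longrightarrow> act (single p) n = T 1 p n"
  using act_basis[of p n 1] F.V.lsmult_one[of "single p"] single_in_monoid_algebra[of p G] by simp

lemma scaled_mult: "p \<in> carrier G \<Longrightarrow> q \<in> carrier G \<Longrightarrow>
    (c \<odot>\<^bsub>F\<^esub> single p) \<otimes>\<^bsub>F\<^esub> (c' \<odot>\<^bsub>F\<^esub> single q) = (c * c') \<odot>\<^bsub>F\<^esub> single (p \<otimes>\<^bsub>G\<^esub> q)"
  using F.V.lsmult_assoc[of c c' "single (p \<otimes>\<^bsub>G\<^esub> q)"]
    F.smult_mult(1)[of "single p" "c' \<odot>\<^bsub>F\<^esub> single q" c] F.smult_mult(2)[of "single p" "single q" c']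
  by (simp add: scaled_closed single_in_monoid_algebra monoid_algebra_single_mult)

text \<open>Both sides are additive in \<open>f\<close> and in \<open>g\<close>, so the law extends
  from scaled basis elements. \<open>act_mult_opposite\<close> is the version for right
  actions.\<close>

lemma act_mult:
  assumes law: "\<And>c c' p q n. p \<in> carrier G \<Longrightarrow> q \<in> carrier G \<Longrightarrow> n \<in> carrier N \<Longrightarrow>
      T (c * c') (p \<otimes>\<^bsub>G\<^esub> q) n = T c p (T c' q n)"
    and f: "f \<in> carrier F" and g: "g \<in> carrier F" and n: "n \<in> carrier N"
  shows "act (f \<otimes>\<^bsub>F\<^esub> g) n = act f (act g n)"
  using f
proof (induction f rule: monoid_algebra_induct)
  case zero
  then show ?case using g n by simp
next
  case (step f p c)
  have "act ((c \<odot>\<^bsub>F\<^esub> single p) \<otimes>\<^bsub>F\<^esub> g) n = T c p (act g n)"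
    using g
  proof (induction g rule: monoid_algebra_induct)
    case zero
    have "T c p \<zero>\<^bsub>N\<^esub> = \<zero>\<^bsub>N\<^esub>"
      using act_basis[OF step(2), of "\<zero>\<^bsub>N\<^esub>" c] scaled_closed[OF step(2)] by simp
    then show ?case using n scaled_closed[OF step(2)] by simp
  next
    case (step g q c')
    then show ?case
      using n scaled_closed \<open>p \<in> carrier G\<close>
      by (simp add: F.A.r_distr act_add act_basis scaled_mult law T_add)
  qed
  then show ?case
    using step g n scaled_closed by (simp add: F.A.l_distr act_add act_basis)
qed

lemma act_mult_opposite:
  assumes law: "\<And>c c' p q n. p \<in> carrier G \<Longrightarrow> q \<in> carrier G \<Longrightarrow> n \<in> carrier N \<Longrightarrow>
      T (c * c') (p \<otimes>\<^bsub>G\<^esub> q) n = T c' q (T c p n)"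
    and f: "f \<in> carrier F" and g: "g \<in> carrier F" and n: "n \<in> carrier N"
  shows "act (f \<otimes>\<^bsub>F\<^esub> g) n = act g (act f n)"
  using f
proof (induction f rule: monoid_algebra_induct)
  case zero
  then show ?case using g n by simp
next
  case (step f p c)
  have "act ((c \<odot>\<^bsub>F\<^esub> single p) \<otimes>\<^bsub>F\<^esub> g) n = act g (T c p n)"
    using g
  proof (induction g rule: monoid_algebra_induct)
    case zero
    then show ?case using n scaled_closed[OF step(2)] by simp
  next
    case (step g q c')
    then show ?case
      using n scaled_closed \<open>p \<in> carrier G\<close>
      by (simp add: F.A.r_distr act_add act_basis scaled_mult law)
  qed
  then show ?case
    using step g n scaled_closed by (simp add: F.A.l_distr act_add act_basis act_add_right)
qed

definition "annihilator = {f \<in> carrier F. \<forall>n\<in>carrier N. act f n = \<zero>\<^bsub>N\<^esub>}"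

text \<open>The disjuncts are left and right actions. The annihilator being a two-sided ideal, it
  contains the ideal generated by any relations that act as zero; this is how actions descend to
  quotients.\<close>

lemma annihilator_ideal:
  assumes "(\<forall>f\<in>carrier F. \<forall>g\<in>carrier F. \<forall>n\<in>carrier N. act (f \<otimes>\<^bsub>F\<^esub> g) n = act f (act g n)) \<or>
    (\<forall>f\<in>carrier F. \<forall>g\<in>carrier F. \<forall>n\<in>carrier N. act (f \<otimes>\<^bsub>F\<^esub> g) n = act g (act f n))"
  shows "ideal annihilator F"
proof (rule idealI[OF F.A.ring_axioms])
  show "subgroup annihilator (add_monoid F)"
    by unfold_locales (auto simp: annihilator_def act_add act_uminus simp flip: a_inv_def)
  show "g \<otimes>\<^bsub>F\<^esub> f \<in> annihilator" "f \<otimes>\<^bsub>F\<^esub> g \<in> annihilator"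
    if "f \<in> annihilator" "g \<in> carrier F" for f g
    using assms that by (auto simp: annihilator_def)
qed

text \<open>Built field by field like \<open>env_left\<close> and \<open>env_right\<close>, so that
  these are instances of it by mere unfolding (\<open>env_left_eq\<close>,
  \<open>env_right_eq\<close>).\<close>

definition "quotient_record =
  \<lparr>carrier = carrier N, monoid.mult = monoid.mult N, monoid.one = monoid.one N, ring.zero = ring.zero N, ring.add = ring.add N,
   module.smult = (\<lambda>Y n. act (SOME f. f \<in> Y) n)\<rparr>"

lemma quotient_record_simps [simp]:
  "carrier quotient_record = carrier N" "\<zero>\<^bsub>quotient_record\<^esub> = \<zero>\<^bsub>N\<^esub>"
  "x \<oplus>\<^bsub>quotient_record\<^esub> y = x \<oplus>\<^bsub>N\<^esub> y" "Y \<odot>\<^bsub>quotient_record\<^esub> x = act (SOME f. f \<in> Y) x"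
  by (simp_all add: quotient_record_def)

lemma abelian_group_quotient_record: "abelian_group quotient_record"
  by (rule abelian_group_cong[OF group]) simp_all

text \<open>Two representatives of a coset differ by an element of \<open>I\<close>, which acts as
  zero; the arbitrary choice made by \<open>SOME\<close> is therefore harmless.\<close>

lemma act_some:
  assumes I: "ideal I F" "I \<subseteq> annihilator" and f: "f \<in> carrier F" and n: "n \<in> carrier N"
  shows "act (SOME g. g \<in> I +>\<^bsub>F\<^esub> f) n = act f n"
proof -
  have L: "left_module complex_field F" using F.alg by (simp add: complex_algebra_def)
  note S = ideal_submodule[OF F.alg I(1)]
  have "(SOME g. g \<in> I +>\<^bsub>F\<^esub> f) \<in> I +>\<^bsub>F\<^esub> f"
    using someI[of "\<lambda>g. g \<in> I +>\<^bsub>F\<^esub> f", OF coset_self[OF L S f]] .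
  then have g: "(SOME g. g \<in> I +>\<^bsub>F\<^esub> f) \<in> carrier F" "(SOME g. g \<in> I +>\<^bsub>F\<^esub> f) \<ominus>\<^bsub>F\<^esub> f \<in> I"
    using mem_coset_iff[OF L S f] by auto
  then have "act (SOME g. g \<in> I +>\<^bsub>F\<^esub> f) n \<ominus>\<^bsub>N\<^esub> act f n = \<zero>\<^bsub>N\<^esub>"
    using I(2) n act_minus[OF g(1) f n] by (auto simp: annihilator_def)
  then show ?thesis
    using g(1) f n by (metis N.a_inv_closed N.minus_eq N.minus_minus N.minus_equality act_closed)
qed

lemma quotient_record_module:
  assumes I: "ideal I F" "I \<subseteq> annihilator"
    and one: "\<And>n. n \<in> carrier N \<Longrightarrow> T 1 \<one>\<^bsub>G\<^esub> n = n"
  shows "(\<And>f g n. f \<in> carrier F \<Longrightarrow> g \<in> carrier F \<Longrightarrow> n \<in> carrier N \<Longrightarrow> act (f \<otimes>\<^bsub>F\<^esub> g) n = act f (act g n)) \<Longrightarrow>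
      left_module (quot_module F I) quotient_record"
    and "(\<And>f g n. f \<in> carrier F \<Longrightarrow> g \<in> carrier F \<Longrightarrow> n \<in> carrier N \<Longrightarrow> act (f \<otimes>\<^bsub>F\<^esub> g) n = act g (act f n)) \<Longrightarrow>
      left_module (opposite (quot_module F I)) quotient_record"
proof -
  have L: "left_module complex_field F" using F.alg by (simp add: complex_algebra_def)
  note S = ideal_submodule[OF F.alg I(1)]
  note Q = quot_algebra[OF F.alg I(1)]
  note simps = quot_module_simps(1) quot_module_add[OF L S] Q(2,3) act_some[OF I]
  have act1: "act \<one>\<^bsub>F\<^esub> n = n" if "n \<in> carrier N" for n
    using act_single[OF G.one_closed that] one[OF that] by (simp add: monoid_algebra_simps(5))
  have r: "ring (quot_module F I)" "ring (opposite (quot_module F I))"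
    using Q(1) complex_algebra_opposite[OF Q(1)] by (auto simp: complex_algebra_def)
  show "left_module (quot_module F I) quotient_record"
    if "\<And>f g n. f \<in> carrier F \<Longrightarrow> g \<in> carrier F \<Longrightarrow> n \<in> carrier N \<Longrightarrow> act (f \<otimes>\<^bsub>F\<^esub> g) n = act f (act g n)"
    unfolding left_module_def left_module_axioms_def
    by (intro conjI allI impI r abelian_group_quotient_record)
      (auto simp: simps that act1 act_add act_add_right)
  show "left_module (opposite (quot_module F I)) quotient_record"
    if "\<And>f g n. f \<in> carrier F \<Longrightarrow> g \<in> carrier F \<Longrightarrow> n \<in> carrier N \<Longrightarrow> act (f \<otimes>\<^bsub>F\<^esub> g) n = act g (act f n)"
    unfolding left_module_def left_module_axioms_def
    by (intro conjI allI impI r abelian_group_quotient_record)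
      (auto simp: simps that act1 act_add act_add_right)
qed

end

section \<open>Bimodules as modules over the enveloping algebra\<close>

subsection \<open>The enveloping algebra and its modules\<close>

definition tensor_rels :: "(complex, 'u) module \<Rightarrow> ('u \<times> 'u \<Rightarrow> complex) set"
  where "tensor_rels U = (let F = monoid_algebra (U \<times>\<times> opposite U) in
    ({single (a \<oplus>\<^bsub>U\<^esub> a', b) \<ominus>\<^bsub>F\<^esub> (single (a, b) \<oplus>\<^bsub>F\<^esub> single (a', b)) | a a' b.
        a \<in> carrier U \<and> a' \<in> carrier U \<and> b \<in> carrier U} \<union>
     {single (a, b \<oplus>\<^bsub>U\<^esub> b') \<ominus>\<^bsub>F\<^esub> (single (a, b) \<oplus>\<^bsub>F\<^esub> single (a, b')) | a b b'.
        a \<in> carrier U \<and> b \<in> carrier U \<and> b' \<in> carrier U} \<union>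
     {single (c \<odot>\<^bsub>U\<^esub> a, b) \<ominus>\<^bsub>F\<^esub> c \<odot>\<^bsub>F\<^esub> single (a, b) | c a b.
        a \<in> carrier U \<and> b \<in> carrier U} \<union>
     {single (a, c \<odot>\<^bsub>U\<^esub> b) \<ominus>\<^bsub>F\<^esub> c \<odot>\<^bsub>F\<^esub> single (a, b) | c a b.
        a \<in> carrier U \<and> b \<in> carrier U}))"

text \<open>The class of a \<otimes> b in the enveloping algebra.\<close>

definition tens :: "(complex, 'u) module \<Rightarrow> 'u \<Rightarrow> 'u \<Rightarrow> ('u \<times> 'u \<Rightarrow> complex) set"
  where "tens U a b = Idl\<^bsub>monoid_algebra (U \<times>\<times> opposite U)\<^esub> (tensor_rels U)
    +>\<^bsub>monoid_algebra (U \<times>\<times> opposite U)\<^esub> single (a, b)"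

lemma enveloping_algebra_eq:
  "enveloping_algebra U = quot_module (monoid_algebra (U \<times>\<times> opposite U))
    (Idl\<^bsub>monoid_algebra (U \<times>\<times> opposite U)\<^esub> (tensor_rels U))"
  by (simp add: enveloping_algebra_def tensor_algebra_def tensor_rels_def Let_def)

locale env = calgebra U for U :: "(complex, 'u) module"
begin

abbreviation "GU \<equiv> U \<times>\<times> opposite U"
abbreviation "FU \<equiv> monoid_algebra GU"
abbreviation "E \<equiv> enveloping_algebra U"
abbreviation "JU \<equiv> Idl\<^bsub>FU\<^esub> (tensor_rels U)"

lemma GU_simps [simp]:
  "carrier GU = carrier U \<times> carrier U" "(a, b) \<otimes>\<^bsub>GU\<^esub> (a', b') = (a \<otimes>\<^bsub>U\<^esub> a', b' \<otimes>\<^bsub>U\<^esub> b)"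
  "\<one>\<^bsub>GU\<^esub> = (\<one>\<^bsub>U\<^esub>, \<one>\<^bsub>U\<^esub>)"
  by (simp_all add: DirProd_def)

lemma GU_monoid: "Group.monoid GU"
  by (rule monoidI) (auto simp: A.m_assoc)

sublocale FU: calgebra FU by (rule calgebra.intro) (rule complex_algebra_monoid_algebra[OF GU_monoid])

lemma FU_single [simp]: "a \<in> carrier U \<Longrightarrow> b \<in> carrier U \<Longrightarrow> single (a, b) \<in> carrier FU"
  by (rule single_in_monoid_algebra) simp

lemma smult_product:
  "a \<in> carrier U \<Longrightarrow> b \<in> carrier U \<Longrightarrow> (c * c') \<odot>\<^bsub>U\<^esub> (a \<otimes>\<^bsub>U\<^esub> b) = (c \<odot>\<^bsub>U\<^esub> a) \<otimes>\<^bsub>U\<^esub> (c' \<odot>\<^bsub>U\<^esub> b)"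
  using smult_mult(1)[of a "c' \<odot>\<^bsub>U\<^esub> b" c] smult_mult(2)[of a b c'] V.lsmult_assoc[of c c' "a \<otimes>\<^bsub>U\<^esub> b"] by simp

lemma tensor_rels_closed: "tensor_rels U \<subseteq> carrier FU"
  unfolding tensor_rels_def Let_def by (auto intro!: FU.A.minus_closed FU.A.a_closed)

lemma JU_ideal: "ideal JU FU"
  by (rule FU.A.genideal_ideal[OF tensor_rels_closed])

lemma FU_module: "left_module complex_field FU"
  using FU.alg by (simp add: complex_algebra_def)

lemma JU_submodule: "submodule JU complex_field FU"
  by (rule ideal_submodule[OF FU.alg JU_ideal])

lemma env_algebra: "complex_algebra E"
  unfolding enveloping_algebra_eq by (rule complex_algebra_quot[OF FU.alg JU_ideal])

sublocale E: calgebra E by (rule calgebra.intro) (rule env_algebra)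

lemma tens_closed [simp]: "a \<in> carrier U \<Longrightarrow> b \<in> carrier U \<Longrightarrow> tens U a b \<in> carrier E"
  unfolding enveloping_algebra_eq tens_def by (simp add: quot_module_simps)

lemma tens_one: "\<one>\<^bsub>E\<^esub> = tens U \<one>\<^bsub>U\<^esub> \<one>\<^bsub>U\<^esub>"
  unfolding enveloping_algebra_eq tens_def
  by (simp add: quot_algebra_one[OF FU.alg JU_ideal] monoid_algebra_simps)

lemma tensor_rels_eq:
  "f \<ominus>\<^bsub>FU\<^esub> g \<in> tensor_rels U \<Longrightarrow> f \<in> carrier FU \<Longrightarrow> g \<in> carrier FU \<Longrightarrow> JU +>\<^bsub>FU\<^esub> f = JU +>\<^bsub>FU\<^esub> g"
  using FU.A.genideal_self[OF tensor_rels_closed] coset_eq_iff[OF FU_module JU_submodule] by blast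

lemma tensor_rels_mem:
  assumes "a \<in> carrier U" "b \<in> carrier U"
  shows "a' \<in> carrier U \<Longrightarrow> single (a \<oplus>\<^bsub>U\<^esub> a', b) \<ominus>\<^bsub>FU\<^esub> (single (a, b) \<oplus>\<^bsub>FU\<^esub> single (a', b)) \<in> tensor_rels U"
    and "b' \<in> carrier U \<Longrightarrow> single (a, b \<oplus>\<^bsub>U\<^esub> b') \<ominus>\<^bsub>FU\<^esub> (single (a, b) \<oplus>\<^bsub>FU\<^esub> single (a, b')) \<in> tensor_rels U"
    and "single (c \<odot>\<^bsub>U\<^esub> a, b) \<ominus>\<^bsub>FU\<^esub> c \<odot>\<^bsub>FU\<^esub> single (a, b) \<in> tensor_rels U"
    and "single (a, c \<odot>\<^bsub>U\<^esub> b) \<ominus>\<^bsub>FU\<^esub> c \<odot>\<^bsub>FU\<^esub> single (a, b) \<in> tensor_rels U"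
  unfolding tensor_rels_def Let_def using assms by blast+

lemma tens_add_left:
  assumes "a \<in> carrier U" "a' \<in> carrier U" "b \<in> carrier U"
  shows "tens U (a \<oplus>\<^bsub>U\<^esub> a') b = tens U a b \<oplus>\<^bsub>E\<^esub> tens U a' b"
  using assms unfolding enveloping_algebra_eq tens_def
  by (subst quot_module_add[OF FU_module JU_submodule])
    (simp_all add: tensor_rels_eq tensor_rels_mem)

lemma tens_add_right:
  assumes "a \<in> carrier U" "b \<in> carrier U" "b' \<in> carrier U"
  shows "tens U a (b \<oplus>\<^bsub>U\<^esub> b') = tens U a b \<oplus>\<^bsub>E\<^esub> tens U a b'"
  using assms unfolding enveloping_algebra_eq tens_def
  by (subst quot_module_add[OF FU_module JU_submodule])
    (simp_all add: tensor_rels_eq tensor_rels_mem)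

lemma tens_smult:
  assumes "a \<in> carrier U" "b \<in> carrier U"
  shows "c \<odot>\<^bsub>E\<^esub> tens U a b = tens U (c \<odot>\<^bsub>U\<^esub> a) b" "c \<odot>\<^bsub>E\<^esub> tens U a b = tens U a (c \<odot>\<^bsub>U\<^esub> b)"
proof -
  have "c \<odot>\<^bsub>E\<^esub> tens U a b = JU +>\<^bsub>FU\<^esub> (c \<odot>\<^bsub>FU\<^esub> single (a, b))"
    using assms unfolding enveloping_algebra_eq tens_def
    by (subst quot_module_smult[OF FU_module JU_submodule]) auto
  moreover have "JU +>\<^bsub>FU\<^esub> single (c \<odot>\<^bsub>U\<^esub> a, b) = JU +>\<^bsub>FU\<^esub> (c \<odot>\<^bsub>FU\<^esub> single (a, b))"
    "JU +>\<^bsub>FU\<^esub> single (a, c \<odot>\<^bsub>U\<^esub> b) = JU +>\<^bsub>FU\<^esub> (c \<odot>\<^bsub>FU\<^esub> single (a, b))"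
    using assms by (simp_all add: tensor_rels_eq tensor_rels_mem)
  ultimately show "c \<odot>\<^bsub>E\<^esub> tens U a b = tens U (c \<odot>\<^bsub>U\<^esub> a) b" "c \<odot>\<^bsub>E\<^esub> tens U a b = tens U a (c \<odot>\<^bsub>U\<^esub> b)"
    by (simp_all add: tens_def)
qed

text \<open>Zero and scalar multiples have no cases of their own, being absorbed by pure tensors: 0
  = 0 \<otimes> 0 and c (a \<otimes> b) = (c a) \<otimes> b.\<close>

lemma env_induct [consumes 1, case_names tens add]:
  assumes z: "z \<in> carrier E"
    and tens: "\<And>a b. a \<in> carrier U \<Longrightarrow> b \<in> carrier U \<Longrightarrow> P (tens U a b)"
    and add: "\<And>x y. x \<in> carrier E \<Longrightarrow> y \<in> carrier E \<Longrightarrow> P x \<Longrightarrow> P y \<Longrightarrow> P (x \<oplus>\<^bsub>E\<^esub> y)"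
  shows "P z"
proof -
  have "P (JU +>\<^bsub>FU\<^esub> f)" if "f \<in> carrier FU" for f
    using that
  proof (induction f rule: monoid_algebra_induct)
    case zero
    have "tens U \<zero>\<^bsub>U\<^esub> \<zero>\<^bsub>U\<^esub> \<oplus>\<^bsub>E\<^esub> tens U \<zero>\<^bsub>U\<^esub> \<zero>\<^bsub>U\<^esub> = tens U \<zero>\<^bsub>U\<^esub> \<zero>\<^bsub>U\<^esub>"
      using tens_add_left[of "\<zero>\<^bsub>U\<^esub>" "\<zero>\<^bsub>U\<^esub>" "\<zero>\<^bsub>U\<^esub>"] by simp
    then have "tens U \<zero>\<^bsub>U\<^esub> \<zero>\<^bsub>U\<^esub> = \<zero>\<^bsub>E\<^esub>"
      using E.A.add.r_cancel_one'[of "tens U \<zero>\<^bsub>U\<^esub> \<zero>\<^bsub>U\<^esub>" "tens U \<zero>\<^bsub>U\<^esub> \<zero>\<^bsub>U\<^esub>"] by simp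
    then have "JU +>\<^bsub>FU\<^esub> \<zero>\<^bsub>FU\<^esub> = tens U \<zero>\<^bsub>U\<^esub> \<zero>\<^bsub>U\<^esub>"
      using quot_module_zero[OF FU_module JU_submodule] by (simp add: enveloping_algebra_eq)
    then show ?case using tens[of "\<zero>\<^bsub>U\<^esub>" "\<zero>\<^bsub>U\<^esub>"] by simp
  next
    case (step f p c)
    obtain a b where p: "p = (a, b)" "a \<in> carrier U" "b \<in> carrier U" using step by auto
    have "JU +>\<^bsub>FU\<^esub> (c \<odot>\<^bsub>FU\<^esub> single p) = tens U (c \<odot>\<^bsub>U\<^esub> a) b"
      using tens_smult(1)[OF p(2,3), of c] p
        quot_module_smult[OF FU_module JU_submodule, of c "single (a, b)"]
      by (simp add: enveloping_algebra_eq tens_def)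
    moreover have "JU +>\<^bsub>FU\<^esub> (f \<oplus>\<^bsub>FU\<^esub> c \<odot>\<^bsub>FU\<^esub> single p) = (JU +>\<^bsub>FU\<^esub> f) \<oplus>\<^bsub>E\<^esub> (JU +>\<^bsub>FU\<^esub> (c \<odot>\<^bsub>FU\<^esub> single p))"
      unfolding enveloping_algebra_eq
      by (rule quot_module_add[OF FU_module JU_submodule, symmetric]) (use step p in auto)
    moreover have "JU +>\<^bsub>FU\<^esub> f \<in> carrier E"
      using step by (simp add: enveloping_algebra_eq quot_module_simps)
    ultimately show ?case
      using step p tens add by simp
  qed
  then show ?thesis
    using z unfolding enveloping_algebra_eq quot_module_simps by blast
qed

end

text \<open>\<open>scal_act\<close> demands that scalars act alike on both sides; otherwise the
  relation (c a) \<otimes> b = a \<otimes> (c b) would not be respected.\<close>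

locale bimod = env U for U :: "(complex, 'u) module" +
  fixes N :: "('u, 'b) bimodule"
  assumes group: "abelian_group N"
    and left_closed [simp]: "\<And>a n. a \<in> carrier U \<Longrightarrow> n \<in> carrier N \<Longrightarrow> left_act N a n \<in> carrier N"
    and right_closed [simp]: "\<And>a n. a \<in> carrier U \<Longrightarrow> n \<in> carrier N \<Longrightarrow> right_act N n a \<in> carrier N"
    and left_add: "\<And>a n n'. a \<in> carrier U \<Longrightarrow> n \<in> carrier N \<Longrightarrow> n' \<in> carrier N \<Longrightarrow>
      left_act N a (n \<oplus>\<^bsub>N\<^esub> n') = left_act N a n \<oplus>\<^bsub>N\<^esub> left_act N a n'"
    and right_add: "\<And>a n n'. a \<in> carrier U \<Longrightarrow> n \<in> carrier N \<Longrightarrow> n' \<in> carrier N \<Longrightarrow>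
      right_act N (n \<oplus>\<^bsub>N\<^esub> n') a = right_act N n a \<oplus>\<^bsub>N\<^esub> right_act N n' a"
    and left_add_scalar: "\<And>a a' n. a \<in> carrier U \<Longrightarrow> a' \<in> carrier U \<Longrightarrow> n \<in> carrier N \<Longrightarrow>
      left_act N (a \<oplus>\<^bsub>U\<^esub> a') n = left_act N a n \<oplus>\<^bsub>N\<^esub> left_act N a' n"
    and right_add_scalar: "\<And>a a' n. a \<in> carrier U \<Longrightarrow> a' \<in> carrier U \<Longrightarrow> n \<in> carrier N \<Longrightarrow>
      right_act N n (a \<oplus>\<^bsub>U\<^esub> a') = right_act N n a \<oplus>\<^bsub>N\<^esub> right_act N n a'"
    and left_mult: "\<And>a a' n. a \<in> carrier U \<Longrightarrow> a' \<in> carrier U \<Longrightarrow> n \<in> carrier N \<Longrightarrow>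
      left_act N (a \<otimes>\<^bsub>U\<^esub> a') n = left_act N a (left_act N a' n)"
    and right_mult: "\<And>a a' n. a \<in> carrier U \<Longrightarrow> a' \<in> carrier U \<Longrightarrow> n \<in> carrier N \<Longrightarrow>
      right_act N n (a \<otimes>\<^bsub>U\<^esub> a') = right_act N (right_act N n a) a'"
    and left_one [simp]: "\<And>n. n \<in> carrier N \<Longrightarrow> left_act N \<one>\<^bsub>U\<^esub> n = n"
    and right_one [simp]: "\<And>n. n \<in> carrier N \<Longrightarrow> right_act N n \<one>\<^bsub>U\<^esub> = n"
    and left_right: "\<And>a b n. a \<in> carrier U \<Longrightarrow> b \<in> carrier U \<Longrightarrow> n \<in> carrier N \<Longrightarrow>
      left_act N a (right_act N n b) = right_act N (left_act N a n) b"
    and scal_act: "\<And>c n. n \<in> carrier N \<Longrightarrow> left_act N (scal c) n = right_act N n (scal c)"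
begin

sublocale N: abelian_group N by (rule group)

lemma smult_act:
  assumes "a \<in> carrier U" "n \<in> carrier N"
  shows "left_act N (c \<odot>\<^bsub>U\<^esub> a) n = left_act N a (left_act N (scal c) n)"
    and "right_act N n (c \<odot>\<^bsub>U\<^esub> a) = right_act N (left_act N (scal c) n) a"
    and "right_act N n (c \<odot>\<^bsub>U\<^esub> a) = left_act N (scal c) (right_act N n a)"
    and "left_act N (c \<odot>\<^bsub>U\<^esub> a) n = left_act N (scal c) (left_act N a n)"
proof -
  have "left_act N (c \<odot>\<^bsub>U\<^esub> a) n = left_act N (a \<otimes>\<^bsub>U\<^esub> scal c) n" using assms by (simp add: scal_mult)
  then show "left_act N (c \<odot>\<^bsub>U\<^esub> a) n = left_act N a (left_act N (scal c) n)" using assms by (simp add: left_mult del: scal_mult)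
  have "left_act N (c \<odot>\<^bsub>U\<^esub> a) n = left_act N (scal c \<otimes>\<^bsub>U\<^esub> a) n" using assms by (simp add: scal_mult)
  then show "left_act N (c \<odot>\<^bsub>U\<^esub> a) n = left_act N (scal c) (left_act N a n)" using assms by (simp add: left_mult)
  have "right_act N n (c \<odot>\<^bsub>U\<^esub> a) = right_act N n (scal c \<otimes>\<^bsub>U\<^esub> a)" using assms by (simp add: scal_mult)
  then show "right_act N n (c \<odot>\<^bsub>U\<^esub> a) = right_act N (left_act N (scal c) n) a"
    using assms by (simp add: right_mult scal_act)
  then show "right_act N n (c \<odot>\<^bsub>U\<^esub> a) = left_act N (scal c) (right_act N n a)" using assms by (simp add: left_right)
qed

sublocale L: monoid_operators GU N "\<lambda>c p n. left_act N (c \<odot>\<^bsub>U\<^esub> fst p) (right_act N n (snd p))"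
  by unfold_locales
    (auto simp: V.lsmult_l_distr left_add_scalar right_add left_add GU_monoid A.m_assoc)

sublocale R: monoid_operators GU N "\<lambda>c p n. left_act N (snd p) (right_act N n (c \<odot>\<^bsub>U\<^esub> fst p))"
  by unfold_locales
    (auto simp: V.lsmult_l_distr right_add_scalar right_add left_add GU_monoid A.m_assoc)

lemma L_mult:
  assumes "f \<in> carrier FU" "g \<in> carrier FU" "n \<in> carrier N"
  shows "L.act (f \<otimes>\<^bsub>FU\<^esub> g) n = L.act f (L.act g n)"
proof (rule L.act_mult[OF _ assms])
  fix c c' p q n assume "p \<in> carrier GU" "q \<in> carrier GU" and n: "n \<in> carrier N"
  then obtain a b a' b' where p: "p = (a, b)" "q = (a', b')" "a \<in> carrier U" "b \<in> carrier U" "a' \<in> carrier U" "b' \<in> carrier U"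
    by auto
  show "left_act N ((c * c') \<odot>\<^bsub>U\<^esub> fst (p \<otimes>\<^bsub>GU\<^esub> q)) (right_act N n (snd (p \<otimes>\<^bsub>GU\<^esub> q)))
      = left_act N (c \<odot>\<^bsub>U\<^esub> fst p) (right_act N (left_act N (c' \<odot>\<^bsub>U\<^esub> fst q) (right_act N n (snd q))) (snd p))"
    using p n by (simp add: smult_product left_mult right_mult left_right)
qed

lemma R_mult:
  assumes "f \<in> carrier FU" "g \<in> carrier FU" "n \<in> carrier N"
  shows "R.act (f \<otimes>\<^bsub>FU\<^esub> g) n = R.act g (R.act f n)"
proof (rule R.act_mult_opposite[OF _ assms])
  fix c c' p q n assume "p \<in> carrier GU" "q \<in> carrier GU" and n: "n \<in> carrier N"
  then obtain a b a' b' where p: "p = (a, b)" "q = (a', b')" "a \<in> carrier U" "b \<in> carrier U" "a' \<in> carrier U" "b' \<in> carrier U"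
    by auto
  show "left_act N (snd (p \<otimes>\<^bsub>GU\<^esub> q)) (right_act N n ((c * c') \<odot>\<^bsub>U\<^esub> fst (p \<otimes>\<^bsub>GU\<^esub> q)))
      = left_act N (snd q) (right_act N (left_act N (snd p) (right_act N n (c \<odot>\<^bsub>U\<^esub> fst p))) (c' \<odot>\<^bsub>U\<^esub> fst q))"
    using p n by (simp add: smult_product left_mult right_mult left_right)
qed

text \<open>By the bimodule axioms each generator of the tensor relations acts as zero in both
  actions, and \<open>annihilator_ideal\<close> extends this to the ideal. Hence
  \<open>env_left\<close> and \<open>env_right\<close> do not depend on representatives.\<close>

lemma JU_annihilates: "JU \<subseteq> L.annihilator" "JU \<subseteq> R.annihilator"
proof -
  have minus: "x \<ominus>\<^bsub>N\<^esub> x = \<zero>\<^bsub>N\<^esub>" if "x \<in> carrier N" for x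
    using that by (simp add: N.minus_eq N.r_neg)
  have one: "1 \<odot>\<^bsub>U\<^esub> a = a" if "a \<in> carrier U" for a
    using that V.lsmult_one by simp
  have sc: "left_act N (c \<odot>\<^bsub>U\<^esub> a) (right_act N n b) = left_act N a (right_act N n (c \<odot>\<^bsub>U\<^esub> b))"
    if "a \<in> carrier U" "b \<in> carrier U" "n \<in> carrier N" for a b c n
    using that smult_act(1)[of a "right_act N n b" c] smult_act(3)[of b n c] by simp
  have "single (a \<oplus>\<^bsub>U\<^esub> a', b) \<ominus>\<^bsub>FU\<^esub> (single (a, b) \<oplus>\<^bsub>FU\<^esub> single (a', b)) \<in> L.annihilator"
    "single (b, a \<oplus>\<^bsub>U\<^esub> a') \<ominus>\<^bsub>FU\<^esub> (single (b, a) \<oplus>\<^bsub>FU\<^esub> single (b, a')) \<in> L.annihilator"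
    if "a \<in> carrier U" "a' \<in> carrier U" "b \<in> carrier U" for a a' b
    using that
    by (simp_all add: L.annihilator_def L.act_minus L.act_add L.act_single one left_add_scalar
      right_add_scalar left_add minus)
  moreover have "single (c \<odot>\<^bsub>U\<^esub> a, b) \<ominus>\<^bsub>FU\<^esub> c \<odot>\<^bsub>FU\<^esub> single (a, b) \<in> L.annihilator"
    "single (a, c \<odot>\<^bsub>U\<^esub> b) \<ominus>\<^bsub>FU\<^esub> c \<odot>\<^bsub>FU\<^esub> single (a, b) \<in> L.annihilator"
    if "a \<in> carrier U" "b \<in> carrier U" for a b c
    using that
    by (simp_all add: L.annihilator_def L.act_minus L.act_basis L.act_single one minus sc)
  ultimately have "tensor_rels U \<subseteq> L.annihilator"
    unfolding tensor_rels_def Let_def by (intro Un_least subsetI; elim CollectE exE conjE; simp only:)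
  then show "JU \<subseteq> L.annihilator"
    by (rule FU.A.genideal_minimal[OF L.annihilator_ideal, rotated]) (use L_mult in auto)
  have "single (a \<oplus>\<^bsub>U\<^esub> a', b) \<ominus>\<^bsub>FU\<^esub> (single (a, b) \<oplus>\<^bsub>FU\<^esub> single (a', b)) \<in> R.annihilator"
    "single (b, a \<oplus>\<^bsub>U\<^esub> a') \<ominus>\<^bsub>FU\<^esub> (single (b, a) \<oplus>\<^bsub>FU\<^esub> single (b, a')) \<in> R.annihilator"
    if "a \<in> carrier U" "a' \<in> carrier U" "b \<in> carrier U" for a a' b
    using that
    by (simp_all add: R.annihilator_def R.act_minus R.act_add R.act_single one left_add_scalar
      right_add_scalar left_add minus)
  moreover have "single (c \<odot>\<^bsub>U\<^esub> a, b) \<ominus>\<^bsub>FU\<^esub> c \<odot>\<^bsub>FU\<^esub> single (a, b) \<in> R.annihilator"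
    "single (a, c \<odot>\<^bsub>U\<^esub> b) \<ominus>\<^bsub>FU\<^esub> c \<odot>\<^bsub>FU\<^esub> single (a, b) \<in> R.annihilator"
    if "a \<in> carrier U" "b \<in> carrier U" for a b c
    using that
    by (simp_all add: R.annihilator_def R.act_minus R.act_basis R.act_single one minus sc)
  ultimately have "tensor_rels U \<subseteq> R.annihilator"
    unfolding tensor_rels_def Let_def by (intro Un_least subsetI; elim CollectE exE conjE; simp only:)
  then show "JU \<subseteq> R.annihilator"
    by (rule FU.A.genideal_minimal[OF R.annihilator_ideal, rotated]) (use R_mult in auto)
qed

lemma env_left_eq: "env_left U N = L.quotient_record"
  by (simp add: env_left_def L.quotient_record_def operator_sum_def Let_def)

lemma env_right_eq: "env_right U N = R.quotient_record"
  by (simp add: env_right_def R.quotient_record_def operator_sum_def Let_def)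

lemma env_left_simps [simp]:
  "carrier (env_left U N) = carrier N" "\<zero>\<^bsub>env_left U N\<^esub> = \<zero>\<^bsub>N\<^esub>" "x \<oplus>\<^bsub>env_left U N\<^esub> y = x \<oplus>\<^bsub>N\<^esub> y"
  by (simp_all add: env_left_eq)

lemma env_right_simps [simp]:
  "carrier (env_right U N) = carrier N" "\<zero>\<^bsub>env_right U N\<^esub> = \<zero>\<^bsub>N\<^esub>" "x \<oplus>\<^bsub>env_right U N\<^esub> y = x \<oplus>\<^bsub>N\<^esub> y"
  by (simp_all add: env_right_eq)

lemma left_module_env_left: "left_module E (env_left U N)"
  unfolding enveloping_algebra_eq env_left_eq
  by (rule L.quotient_record_module(1)[OF JU_ideal JU_annihilates(1) _ L_mult])
    (simp add: V.lsmult_one)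

lemma left_module_env_right: "left_module (opposite E) (env_right U N)"
  unfolding enveloping_algebra_eq env_right_eq
  by (rule R.quotient_record_module(2)[OF JU_ideal JU_annihilates(2) _ R_mult])
    (simp add: V.lsmult_one)

lemma env_left_tens:
  "a \<in> carrier U \<Longrightarrow> b \<in> carrier U \<Longrightarrow> n \<in> carrier N \<Longrightarrow> tens U a b \<odot>\<^bsub>env_left U N\<^esub> n = left_act N a (right_act N n b)"
  by (simp add: env_left_eq tens_def L.act_some[OF JU_ideal JU_annihilates(1)] L.act_single V.lsmult_one)

lemma env_right_tens:
  "a \<in> carrier U \<Longrightarrow> b \<in> carrier U \<Longrightarrow> n \<in> carrier N \<Longrightarrow> tens U a b \<odot>\<^bsub>env_right U N\<^esub> n = left_act N b (right_act N n a)"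
  by (simp add: env_right_eq tens_def R.act_some[OF JU_ideal JU_annihilates(2)] R.act_single V.lsmult_one)

end

section \<open>The Koszul complex in normalised coordinates and its exactness\<close>

subsection \<open>Linear maps between spaces of finitely supported functions\<close>

abbreviation pm :: "'b \<Rightarrow> complex \<Rightarrow> 'b \<Rightarrow>\<^sub>0 complex"
  where "pm \<equiv> Poly_Mapping.single"

abbreviation keys :: "('b \<Rightarrow>\<^sub>0 complex) \<Rightarrow> 'b set"
  where "keys \<equiv> Poly_Mapping.keys"

abbreviation lookup :: "('b \<Rightarrow>\<^sub>0 complex) \<Rightarrow> 'b \<Rightarrow> complex"
  where "lookup \<equiv> Poly_Mapping.lookup"

definition smul :: "complex \<Rightarrow> ('b \<Rightarrow>\<^sub>0 complex) \<Rightarrow> 'b \<Rightarrow>\<^sub>0 complex"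
  where "smul c p = Poly_Mapping.map ((*) c) p"

lemma lookup_smul [simp]: "lookup (smul c p) b = c * lookup p b"
  by (simp add: smul_def Poly_Mapping.map.rep_eq when_def)

lemma smul_simps [simp]:
  "smul 0 p = 0" "smul 1 p = p" "smul c 0 = 0" "smul c (smul d p) = smul (c * d) p"
  "smul c (pm b d) = pm b (c * d)" "smul (- 1) p = - p"
  by (auto intro!: poly_mapping_eqI simp: lookup_single when_def)

lemma smul_distrib:
  "smul c (p + q) = smul c p + smul c q" "smul (c + d) p = smul c p + smul d p"
  "smul c (p - q) = smul c p - smul c q" "smul c (- p) = - smul c p" "smul (- c) p = - smul c p"
  by (auto intro!: poly_mapping_eqI simp: lookup_add lookup_minus algebra_simps)

lemma smul_sum: "smul c (sum f S) = (\<Sum>i\<in>S. smul c (f i))"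
  by (induction S rule: infinite_finite_induct) (auto simp: smul_distrib)

lemma keys_smul: "keys (smul c p) \<subseteq> keys p"
  by (auto simp: in_keys_iff)

text \<open>Linear extension from the basis. Chains are finitely supported functions on a whole
  type, where addition is total and simplifies well; the range of their supports is controlled
  separately through \<open>keys\<close>.\<close>

definition lin :: "('b \<Rightarrow> 'c \<Rightarrow>\<^sub>0 complex) \<Rightarrow> ('b \<Rightarrow>\<^sub>0 complex) \<Rightarrow> 'c \<Rightarrow>\<^sub>0 complex"
  where "lin F p = (\<Sum>b\<in>keys p. smul (lookup p b) (F b))"

lemma lin_superset: "finite S \<Longrightarrow> keys p \<subseteq> S \<Longrightarrow> lin F p = (\<Sum>b\<in>S. smul (lookup p b) (F b))"
  unfolding lin_def by (rule sum.mono_neutral_left) (auto simp: in_keys_iff)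

lemma lin_zero [simp]: "lin F 0 = 0"
  by (simp add: lin_def)

lemma lin_add: "lin F (p + q) = lin F p + lin F q"
proof -
  have "finite (keys p \<union> keys q)" "keys (p + q) \<subseteq> keys p \<union> keys q"
    using Poly_Mapping.keys_add[of p q] by auto
  then show ?thesis
    by (simp add: lin_superset[of "keys p \<union> keys q"] lookup_add smul_distrib sum.distrib)
qed

lemma lin_smul: "lin F (smul c p) = smul c (lin F p)"
  by (subst lin_superset[OF _ keys_smul]) (auto simp: lin_def smul_sum)

lemma lin_pm [simp]: "lin F (pm b c) = smul c (F b)"
  by (subst lin_superset[of "{b}"]) auto

lemma lin_uminus: "lin F (- p) = - lin F p"
  using lin_smul[of F "- 1" p] by simp

lemma lin_diff: "lin F (p - q) = lin F p - lin F q"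
  using lin_add[of F p "- q"] by (simp add: lin_uminus)

lemma lin_sum: "lin F (sum f S) = (\<Sum>i\<in>S. lin F (f i))"
  by (induction S rule: infinite_finite_induct) (auto simp: lin_add)

lemma lin_cong: "(\<And>b. b \<in> keys p \<Longrightarrow> F b = G b) \<Longrightarrow> lin F p = lin G p"
  unfolding lin_def by (rule sum.cong) auto

lemma lin_lin: "lin G (lin F p) = lin (\<lambda>b. lin G (F b)) p"
  by (simp add: lin_def[of F] lin_def[of "\<lambda>b. lin G (F b)"] lin_sum lin_smul)

lemma lin_fun:
  "lin (\<lambda>b. F b + G b) p = lin F p + lin G p" "lin (\<lambda>b. F b - G b) p = lin F p - lin G p"
  "lin (\<lambda>b. smul c (F b)) p = smul c (lin F p)" "lin (\<lambda>b. 0) p = 0"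
  by (simp_all add: lin_def smul_distrib sum.distrib sum_subtractf smul_sum mult.commute)

lemma lin_id: "lin (\<lambda>b. pm b 1) p = p"
proof (rule poly_mapping_eqI)
  fix k
  have "lookup (lin (\<lambda>b. pm b 1) p) k = (\<Sum>b\<in>keys p. if b = k then lookup p k else 0)"
    by (auto simp: lin_def lookup_sum lookup_single when_def intro!: sum.cong)
  also have "\<dots> = lookup p k" by (auto simp: in_keys_iff)
  finally show "lookup (lin (\<lambda>b. pm b 1) p) k = lookup p k" .
qed

lemma keys_sum: "keys (sum f S) \<subseteq> (\<Union>i\<in>S. keys (f i))"
proof (induction S rule: infinite_finite_induct)
  case (insert i S)
  then show ?case using Poly_Mapping.keys_add[of "f i" "sum f S"] by auto
qed auto

lemma keys_lin: "keys (lin F p) \<subseteq> (\<Union>b\<in>keys p. keys (F b))"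
  unfolding lin_def using keys_sum[of "\<lambda>b. smul (lookup p b) (F b)" "keys p"] keys_smul by fastforce

lemma keys_lin_subset: "keys p \<subseteq> S \<Longrightarrow> (\<And>b. b \<in> S \<Longrightarrow> keys (F b) \<subseteq> T) \<Longrightarrow> keys (lin F p) \<subseteq> T"
  using keys_lin[of F p] by blast

lemma keys_diff: "keys (p - q) \<subseteq> keys p \<union> keys q"
  using Poly_Mapping.keys_add[of p "- q"] by (auto simp: in_keys_iff)

lemma keys_empty: "keys p \<subseteq> {} \<Longrightarrow> p = 0"
  by (rule poly_mapping_eqI) (auto simp: in_keys_iff)

lemma pm_induct [consumes 1, case_names zero step]:
  assumes "keys p \<subseteq> S" "P 0"
    and step: "\<And>p b c. keys p \<subseteq> S \<Longrightarrow> P p \<Longrightarrow> b \<in> S \<Longrightarrow> P (p + pm b c)"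
  shows "P p"
proof -
  have *: "keys (\<Sum>b\<in>A. pm b (lookup p b)) \<subseteq> S \<and> P (\<Sum>b\<in>A. pm b (lookup p b))" if "A \<subseteq> S" for A
    using that
  proof (induction A rule: infinite_finite_induct)
    case (insert b A)
    then show ?case
      using step[of "\<Sum>b\<in>A. pm b (lookup p b)" b "lookup p b"]
        Poly_Mapping.keys_add[of "\<Sum>b\<in>A. pm b (lookup p b)" "pm b (lookup p b)"]
      by (auto simp: add.commute split: if_splits)
  qed (use assms in auto)
  have "(\<Sum>b\<in>keys p. pm b (lookup p b)) = p"
    using lin_id[of p] by (simp add: lin_def)
  with *[OF assms(1)] show ?thesis by simp
qed

subsection \<open>Bicharacters\<close>

locale bicharacter =
  fixes q :: "nat \<Rightarrow> nat \<Rightarrow> complex"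
  assumes q_nonzero: "q i j \<noteq> 0"
begin

text \<open>The bimultiplicative extension of \<open>q\<close> to multisets. Bimultiplicativity
  makes it a 2-cocycle, which is what lets the normalised monomials multiply associatively.\<close>

definition chi :: "nat multiset \<Rightarrow> nat multiset \<Rightarrow> complex"
  where "chi A B = (\<Prod>i\<in>#A. \<Prod>j\<in>#B. q i j)"

lemma chi_empty [simp]: "chi {#} B = 1" "chi A {#} = 1"
  by (simp_all add: chi_def)

lemma chi_add: "chi (A + A') B = chi A B * chi A' B" "chi A (B + B') = chi A B * chi A B'"
  by (simp_all add: chi_def prod_mset.distrib)

lemma chi_add_mset: "chi (add_mset i A) B = chi {#i#} B * chi A B" "chi A (add_mset j B) = chi A {#j#} * chi A B"
  using chi_add[of "{#i#}" A B] chi_add(2)[of A "{#j#}" B] by simp_all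

lemma chi_nonzero [simp]: "chi A B \<noteq> 0"
  by (induction A; induction B; auto simp: chi_def q_nonzero prod_mset_zero_iff)

subsection \<open>The Koszul complex\<close>

text \<open>The basis element \<open>(\<alpha>, I, \<beta>)\<close> stands for the normalised product of \<open>u\<^sub>\<alpha>\<close>, the exterior
  monomial \<open>e\<^sub>I\<close> and \<open>u\<^sub>\<beta>\<close>. With this normalisation the differential does not involve the
  commutation parameters, which only enter the two actions below.\<close>

definition shift_left :: "nat multiset \<Rightarrow> (nat multiset \<times> nat set \<times> nat multiset \<Rightarrow>\<^sub>0 complex) \<Rightarrow>
    (nat multiset \<times> nat set \<times> nat multiset \<Rightarrow>\<^sub>0 complex)"
  where "shift_left \<gamma> = lin (\<lambda>(\<alpha>, I, \<beta>). pm (\<alpha> + \<gamma>, I, \<beta>) (chi \<gamma> (\<alpha> + mset_set I + \<beta>)))"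

definition shift_right :: "nat multiset \<Rightarrow> (nat multiset \<times> nat set \<times> nat multiset \<Rightarrow>\<^sub>0 complex) \<Rightarrow>
    (nat multiset \<times> nat set \<times> nat multiset \<Rightarrow>\<^sub>0 complex)"
  where "shift_right \<gamma> = lin (\<lambda>(\<alpha>, I, \<beta>). pm (\<alpha>, I, \<beta> + \<gamma>) (chi (\<alpha> + mset_set I + \<beta>) \<gamma>))"

text \<open>The factor of the outer shift sees the total multidegree, which the inner shift has
  raised by \<delta>; bimultiplicativity splits off \<open>chi \<gamma> \<delta>\<close>.\<close>

lemma shift_left_mult: "shift_left \<gamma> (shift_left \<delta> k) = smul (chi \<gamma> \<delta>) (shift_left (\<gamma> + \<delta>) k)"
  unfolding shift_left_def lin_lin lin_fun(3)[symmetric]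
  by (rule lin_cong) (auto simp: chi_add ac_simps)

lemma shift_right_mult: "shift_right \<delta> (shift_right \<gamma> k) = smul (chi \<gamma> \<delta>) (shift_right (\<gamma> + \<delta>) k)"
  unfolding shift_right_def lin_lin lin_fun(3)[symmetric]
  by (rule lin_cong) (auto simp: chi_add ac_simps)

text \<open>Whichever shift comes second meets the multidegree raised by the first, and in both
  orders the extra factor is \<open>chi \<gamma> \<delta>\<close>.\<close>

lemma shift_commute: "shift_left \<gamma> (shift_right \<delta> k) = shift_right \<delta> (shift_left \<gamma> k)"
  unfolding shift_right_def shift_left_def lin_lin
  by (rule lin_cong) (auto simp: chi_add ac_simps)

lemma shift_zero [simp]: "shift_left {#} k = k" "shift_right {#} k = k"
proof -
  have "(\<lambda>(\<alpha>, I, \<beta>). pm (\<alpha>, I, \<beta>) 1) = (\<lambda>b :: nat multiset \<times> nat set \<times> nat multiset. pm b 1)" by auto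
  then show "shift_left {#} k = k" "shift_right {#} k = k"
    by (simp_all add: shift_left_def shift_right_def lin_id)
qed

end

text \<open>The exterior sign of moving e_i to the front of e_I.\<close>

definition eps :: "nat \<Rightarrow> nat set \<Rightarrow> complex"
  where "eps i I = (- 1) ^ card {j \<in> I. j < i}"

lemma eps_square [simp]: "eps i I * eps i I = 1"
  by (simp add: eps_def flip: power_mult_distrib)

lemma eps_nonzero [simp]: "eps i I \<noteq> 0"
  by (simp add: eps_def)

lemma eps_remove:
  assumes "finite I" "i \<in> I"
  shows "eps j (I - {i}) = (if i < j then - eps j I else eps j I)"
proof (cases "i < j")
  case True
  then have "{k \<in> I. k < j} = insert i {k \<in> I - {i}. k < j}" using assms by auto
  then have "card {k \<in> I. k < j} = Suc (card {k \<in> I - {i}. k < j})" using assms by simp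
  then show ?thesis using True by (simp add: eps_def)
next
  case False
  then have "{k \<in> I. k < j} = {k \<in> I - {i}. k < j}" by auto
  then show ?thesis using False by (simp add: eps_def)
qed

lemma eps_insert:
  assumes "finite I" "i \<notin> I"
  shows "eps j (insert i I) = (if i < j then - eps j I else eps j I)"
  using eps_remove[of "insert i I" i j] assms by (auto split: if_splits)

text \<open>\<open>dx\<close> and \<open>dy\<close> are the halves of the differential, which
  replace e_I by v_i e_(I - {i}) and by e_(I - {i}) v_i, in normalised form. An infinite
  \<open>I\<close> contributes zero by the convention for infinite sums.\<close>

definition dx :: "nat multiset \<times> nat set \<times> nat multiset \<Rightarrow> nat multiset \<times> nat set \<times> nat multiset \<Rightarrow>\<^sub>0 complex"
  where "dx = (\<lambda>(\<alpha>, I, \<beta>). \<Sum>i\<in>I. pm (add_mset i \<alpha>, I - {i}, \<beta>) (eps i I))"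

definition dy :: "nat multiset \<times> nat set \<times> nat multiset \<Rightarrow> nat multiset \<times> nat set \<times> nat multiset \<Rightarrow>\<^sub>0 complex"
  where "dy = (\<lambda>(\<alpha>, I, \<beta>). \<Sum>i\<in>I. pm (\<alpha>, I - {i}, add_mset i \<beta>) (eps i I))"

definition koszul :: "(nat multiset \<times> nat set \<times> nat multiset \<Rightarrow>\<^sub>0 complex) \<Rightarrow> nat multiset \<times> nat set \<times> nat multiset \<Rightarrow>\<^sub>0 complex"
  where "koszul k = lin dx k - lin dy k"

lemma koszul_add: "koszul (p + p') = koszul p + koszul p'"
  by (simp add: koszul_def lin_add)

lemma koszul_smul: "koszul (smul c p) = smul c (koszul p)"
  by (simp add: koszul_def lin_smul smul_distrib)

text \<open>The factor of a shift depends only on the total multidegree \<alpha> + I + \<beta>, and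
  both halves of the differential preserve it: they move an index from I to \<alpha> or to
  \<beta>.\<close>

lemma (in bicharacter) koszul_shift:
  "koszul (shift_left \<gamma> k) = shift_left \<gamma> (koszul k)"
  "koszul (shift_right \<gamma> k) = shift_right \<gamma> (koszul k)"
proof -
  have m: "mset_set I = add_mset i (mset_set (I - {i}))" if "i \<in> I" "finite I" for I :: "nat set" and i
    using that by (simp add: mset_set.remove)
  \<comment> \<open>Both sums vanish when \<open>I\<close> is infinite, so the removal of
    \<open>i\<close> from \<open>mset_set I\<close> is only needed for finite
    \<open>I\<close>.\<close>
  have inf: "(\<Sum>i\<in>I. f i) = (\<Sum>i\<in>I. g i)" if "\<And>i. finite I \<Longrightarrow> i \<in> I \<Longrightarrow> f i = g i" for I and f g :: "nat \<Rightarrow> 'z::comm_monoid_add"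
    using that by (cases "finite I") (auto intro!: sum.cong)
  have "lin dx (shift_left \<gamma> k) = shift_left \<gamma> (lin dx k)" "lin dy (shift_left \<gamma> k) = shift_left \<gamma> (lin dy k)"
    unfolding shift_left_def lin_lin
    by (rule lin_cong; auto simp: dx_def dy_def lin_sum smul_sum intro!: inf; simp add: m ac_simps)+
  then show "koszul (shift_left \<gamma> k) = shift_left \<gamma> (koszul k)"
    by (simp add: koszul_def shift_left_def lin_diff)
  have "lin dx (shift_right \<gamma> k) = shift_right \<gamma> (lin dx k)" "lin dy (shift_right \<gamma> k) = shift_right \<gamma> (lin dy k)"
    unfolding shift_right_def lin_lin
    by (rule lin_cong; auto simp: dx_def dy_def lin_sum smul_sum intro!: inf; simp add: m ac_simps)+
  then show "koszul (shift_right \<gamma> k) = shift_right \<gamma> (koszul k)"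
    by (simp add: koszul_def shift_right_def lin_diff)
qed

text \<open>\<open>koszul\<close> sends e_I to the signed sum of (x_i - y_i) e_(I - {i}), where x_i
  and y_i raise \<alpha> and \<beta> by i. These multiplications commute, whereas removing i and j
  in the two orders gives opposite signs.\<close>

lemma koszul_koszul: "koszul (koszul k) = 0"
proof -
  define s where "s = (\<lambda>i (\<alpha>, J :: nat set, \<beta> :: nat multiset). pm (add_mset i \<alpha>, J, \<beta>) 1 - pm (\<alpha>, J, add_mset i \<beta>) 1)"
  define db where "db = (\<lambda>(\<alpha>, I, \<beta>). \<Sum>i\<in>I. smul (eps i I) (s i (\<alpha>, I - {i}, \<beta>)))"
  have k: "koszul = lin db"
  proof
    fix p
    have "(\<lambda>b. dx b - dy b) = db"
      by (auto simp: dx_def dy_def db_def s_def smul_distrib sum_subtractf fun_eq_iff)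
    then show "koszul p = lin db p" by (simp add: koszul_def flip: lin_fun(2))
  qed
  have "lin db (db b) = 0" for b
  proof -
    obtain \<alpha> I \<beta> where b: "b = (\<alpha>, I, \<beta>)" by (cases b)
    show ?thesis
    proof (cases "finite I")
      case False
      then show ?thesis by (simp add: b db_def)
    next
      case I: True
      define S where "S = (\<lambda>i j. lin (s j) (s i (\<alpha>, I - {i} - {j}, \<beta>)))"
      have sym: "S i j = S j i" for i j
      proof -
        have "I - {i} - {j} = I - {j} - {i}" by auto
        then show ?thesis by (simp add: S_def s_def lin_diff add_mset_commute[of i j])
      qed
      let ?T = "\<Sum>i\<in>I. \<Sum>j\<in>I - {i}. smul (eps i I * eps j (I - {i})) (S i j)"
      have "lin db (s i (\<alpha>, I - {i}, \<beta>)) = (\<Sum>j\<in>I - {i}. smul (eps j (I - {i})) (S i j))" for i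
      proof -
        have sv: "s i (\<alpha>, J, \<beta>) = pm (add_mset i \<alpha>, J, \<beta>) 1 - pm (\<alpha>, J, add_mset i \<beta>) 1" for i \<alpha> J \<beta>
          by (simp add: s_def)
        have dbv: "db (\<alpha>, J, \<beta>) = (\<Sum>i\<in>J. smul (eps i J) (s i (\<alpha>, J - {i}, \<beta>)))" for \<alpha> J \<beta>
          by (simp add: db_def)
        have "S i j = s j (add_mset i \<alpha>, I - {i} - {j}, \<beta>) - s j (\<alpha>, I - {i} - {j}, add_mset i \<beta>)" for j
          unfolding S_def sv[of i] lin_diff by simp
        then show ?thesis
          unfolding sv[of i] lin_diff by (simp add: dbv smul_distrib sum_subtractf)
      qed
      then have "lin db (\<Sum>i\<in>I. smul (eps i I) (s i (\<alpha>, I - {i}, \<beta>))) = ?T"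
        by (simp add: lin_sum lin_smul smul_sum)
      then have T: "lin db (db b) = ?T" by (simp add: b db_def)
      have "?T = (\<Sum>(i, j)\<in>Sigma I (\<lambda>i. I - {i}). smul (eps i I * eps j (I - {i})) (S i j))"
        using I by (subst sum.Sigma) auto
      also have "\<dots> = (\<Sum>(j, i)\<in>Sigma I (\<lambda>i. I - {i}). smul (eps i I * eps j (I - {i})) (S i j))"
        by (rule sum.reindex_bij_witness[of _ "\<lambda>(i, j). (j, i)" "\<lambda>(i, j). (j, i)"]) auto
      also have "\<dots> = (\<Sum>(i, j)\<in>Sigma I (\<lambda>i. I - {i}). - smul (eps i I * eps j (I - {i})) (S i j))"
      proof (rule sum.cong[OF refl])
        fix p assume "p \<in> Sigma I (\<lambda>i. I - {i})"
        then obtain i j where p: "p = (i, j)" "i \<in> I" "j \<in> I" "j \<noteq> i" by auto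
        then have "smul (eps j I * eps i (I - {j})) (S j i) = - smul (eps i I * eps j (I - {i})) (S i j)"
          using I sym[of i j] by (cases "i < j") (auto simp: eps_remove smul_distrib mult.commute[of "eps j I"])
        then show "(case p of (j, i) \<Rightarrow> smul (eps i I * eps j (I - {i})) (S i j))
            = (case p of (i, j) \<Rightarrow> - smul (eps i I * eps j (I - {i})) (S i j))" by (simp add: p)
      qed
      also have "\<dots> = - ?T"
        using I by (subst sum.Sigma) (auto simp: sum_negf case_prod_unfold)
      finally have "?T = - ?T" .
      \<comment> \<open>Characteristic zero, applied coefficient by coefficient.\<close>
      have "?T = 0"
      proof (rule poly_mapping_eqI)
        fix k
        have "lookup ?T k = - lookup ?T k" using arg_cong[OF \<open>?T = - ?T\<close>, of "\<lambda>p. lookup p k"] by simp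
        then show "lookup ?T k = lookup 0 k" by simp
      qed
      with T show ?thesis by simp
    qed
  qed
  then show ?thesis by (simp add: k lin_lin lin_fun)
qed

subsection \<open>Exactness of the Koszul complex\<close>

text \<open>A contracting homotopy for \<open>dx\<close> alone; the term \<open>dy\<close> of the differential lowers the
  weight \<open>|\<alpha>| + |I|\<close>, which the homotopy and \<open>dx\<close> preserve.\<close>

definition contraction :: "nat multiset \<times> nat set \<times> nat multiset \<Rightarrow> nat multiset \<times> nat set \<times> nat multiset \<Rightarrow>\<^sub>0 complex"
  where "contraction = (\<lambda>(\<alpha>, I, \<beta>). let S = set_mset \<alpha> \<union> I; m = Min S in
    if S = {} \<or> m \<in> I then 0 else pm (\<alpha> - {#m#}, insert m I, \<beta>) 1)"

text \<open>The least index m occurring in \<alpha> or I is the same for all terms of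
  \<open>dx\<close> and \<open>contraction\<close>, so the homotopy works in the single variable m.
  If m lies in I, only the term of \<open>dx\<close> that removes m survives; otherwise m is moved
  from \<alpha> into I. As m is least, its own sign is 1, and putting it into I reverses the signs
  of all other indices, which cancels the remaining terms.\<close>

lemma contraction_homotopy:
  assumes I: "finite I" and ne: "set_mset \<alpha> \<union> I \<noteq> {}"
  shows "lin dx (contraction (\<alpha>, I, \<beta>)) + lin contraction (dx (\<alpha>, I, \<beta>)) = pm (\<alpha>, I, \<beta>) 1"
proof -
  define S where "S = set_mset \<alpha> \<union> I"
  define m where "m = Min S"
  have S: "finite S" "S \<noteq> {}" using I ne by (auto simp: S_def)
  have m: "m \<in> S" "\<And>j. j \<in> S \<Longrightarrow> m \<le> j" using S by (auto simp: m_def)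
  have eps_m: "eps m J = 1" if "J \<subseteq> S" for J
  proof -
    have "{j \<in> J. j < m} = {}" using that m(2) by (auto simp: not_less)
    then show ?thesis by (simp only: eps_def card.empty power_0)
  qed
  have Min_m: "Min T = m" if "T \<subseteq> S" "m \<in> T" for T
    using that m(2) S(1) by (intro Min_eqI) (auto intro: finite_subset)
  have homv: "contraction (\<alpha>', J, \<beta>) = (if m \<in> J then 0 else pm (\<alpha>' - {#m#}, insert m J, \<beta>) 1)"
    if "set_mset \<alpha>' \<union> J \<subseteq> S" "m \<in> set_mset \<alpha>' \<union> J" for \<alpha>' J
    using Min_m[OF that] that(2) by (auto simp: contraction_def Let_def)
  have sub: "set_mset (add_mset i \<alpha>) \<union> (I - {i}) \<subseteq> S" if "i \<in> I" for i using that by (auto simp: S_def)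
  have dx: "dx (\<alpha>, I, \<beta>) = (\<Sum>i\<in>I. pm (add_mset i \<alpha>, I - {i}, \<beta>) (eps i I))" by (simp add: dx_def)
  show ?thesis
  proof (cases "m \<in> I")
    case True
    have h0: "contraction (add_mset i \<alpha>, I - {i}, \<beta>) = (if i = m then pm (\<alpha>, I, \<beta>) 1 else 0)" if "i \<in> I" for i
      using homv[OF sub[OF that]] True by (auto simp: insert_absorb)
    have "lin contraction (dx (\<alpha>, I, \<beta>)) = (\<Sum>i\<in>I. smul (eps i I) (contraction (add_mset i \<alpha>, I - {i}, \<beta>)))"
      by (simp add: dx lin_sum)
    also have "\<dots> = (\<Sum>i\<in>I. if i = m then pm (\<alpha>, I, \<beta>) 1 else 0)"
      by (rule sum.cong) (auto simp: h0 eps_m S_def)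
    finally show ?thesis
      using True I homv[of \<alpha> I] by (simp add: S_def)
  next
    case False
    then have ma: "m \<in># \<alpha>" using m(1) by (auto simp: S_def)
    have h: "contraction (\<alpha>, I, \<beta>) = pm (\<alpha> - {#m#}, insert m I, \<beta>) 1"
      using homv[of \<alpha> I] False ma by (simp add: S_def)
    have "lin dx (contraction (\<alpha>, I, \<beta>)) = (\<Sum>i\<in>insert m I. pm (add_mset i (\<alpha> - {#m#}), insert m I - {i}, \<beta>) (eps i (insert m I)))"
      by (simp add: h dx_def)
    also have "\<dots> = pm (\<alpha>, I, \<beta>) 1 + (\<Sum>i\<in>I. pm (add_mset i (\<alpha> - {#m#}), insert m I - {i}, \<beta>) (eps i (insert m I)))"
      using I False ma by (simp add: eps_m S_def)
    also have "(\<Sum>i\<in>I. pm (add_mset i (\<alpha> - {#m#}), insert m I - {i}, \<beta>) (eps i (insert m I)))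
        = - lin contraction (dx (\<alpha>, I, \<beta>))"
    proof -
      have "pm (add_mset i (\<alpha> - {#m#}), insert m I - {i}, \<beta>) (eps i (insert m I))
          = - smul (eps i I) (contraction (add_mset i \<alpha>, I - {i}, \<beta>))" if i: "i \<in> I" for i
      proof -
        have "m < i" using m(2)[of i] i False by (cases "m = i") (auto simp: S_def)
        then have "eps i (insert m I) = - eps i I" using eps_insert[OF I False] by simp
        moreover have "contraction (add_mset i \<alpha>, I - {i}, \<beta>) = pm (add_mset i \<alpha> - {#m#}, insert m (I - {i}), \<beta>) 1"
          using homv[OF sub[OF i]] False ma by simp
        moreover have "add_mset i \<alpha> - {#m#} = add_mset i (\<alpha> - {#m#})" using ma by simp
        moreover have "insert m (I - {i}) = insert m I - {i}" using \<open>m < i\<close> by auto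
        ultimately show ?thesis by (simp add: single_uminus)
      qed
      then show ?thesis by (simp add: dx lin_sum sum_negf)
    qed
    finally show ?thesis by simp
  qed
qed

text \<open>Degree \<open>k\<close> with weight |\<alpha>| + |I| below \<open>w\<close>. The strict
  bound makes level 0 empty, the base of the inductions on \<open>w\<close>. The multiset \<beta>,
  which \<open>dy\<close> enlarges, has no bound on its size.\<close>

definition basis_set :: "nat set \<Rightarrow> nat \<Rightarrow> nat \<Rightarrow> (nat multiset \<times> nat set \<times> nat multiset) set"
  where "basis_set V k w = {(\<alpha>, I, \<beta>). set_mset \<alpha> \<subseteq> V \<and> I \<subseteq> V \<and> set_mset \<beta> \<subseteq> V \<and> card I = k \<and> size \<alpha> + card I < w}"

context
  fixes V :: "nat set"
  assumes V: "finite V"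
begin

lemma dx_keys:
  assumes "b \<in> basis_set V (Suc k) w"
  shows "keys (dx b) \<subseteq> basis_set V k w"
proof -
  obtain \<alpha> I \<beta> where b: "b = (\<alpha>, I, \<beta>)" by (cases b)
  have I: "finite I" using assms V by (auto simp: b basis_set_def intro: finite_subset)
  have "(add_mset i \<alpha>, I - {i}, \<beta>) \<in> basis_set V k w" if "i \<in> I" for i
    using assms that I by (auto simp: b basis_set_def card_Diff_singleton)
  then show ?thesis
    using keys_sum[of "\<lambda>i. pm (add_mset i \<alpha>, I - {i}, \<beta>) (eps i I)" I] by (auto simp: b dx_def)
qed

lemma dy_keys:
  assumes "b \<in> basis_set V (Suc k) (Suc w)"
  shows "keys (dy b) \<subseteq> basis_set V k w"
proof -
  obtain \<alpha> I \<beta> where b: "b = (\<alpha>, I, \<beta>)" by (cases b)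
  have I: "finite I" using assms V by (auto simp: b basis_set_def intro: finite_subset)
  have "(\<alpha>, I - {i}, add_mset i \<beta>) \<in> basis_set V k w" if "i \<in> I" for i
    using assms that I by (auto simp: b basis_set_def card_Diff_singleton)
  then show ?thesis
    using keys_sum[of "\<lambda>i. pm (\<alpha>, I - {i}, add_mset i \<beta>) (eps i I)" I] by (auto simp: b dy_def)
qed

lemma contraction_keys:
  assumes "b \<in> basis_set V k w"
  shows "keys (contraction b) \<subseteq> basis_set V (Suc k) w"
proof -
  obtain \<alpha> I \<beta> where b: "b = (\<alpha>, I, \<beta>)" by (cases b)
  let ?S = "set_mset \<alpha> \<union> I"
  have I: "finite I" using assms V by (auto simp: b basis_set_def intro: finite_subset)
  have "(\<alpha> - {#Min ?S#}, insert (Min ?S) I, \<beta>) \<in> basis_set V (Suc k) w" if "?S \<noteq> {}" "Min ?S \<notin> I"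
  proof -
    have "Min ?S \<in> ?S" using I that by (intro Min_in) auto
    then have a: "Min ?S \<in># \<alpha>" using that(2) by auto
    then have "size \<alpha> = Suc (size (\<alpha> - {#Min ?S#}))" by (metis Suc_pred' size_Diff_singleton nonempty_has_size multi_member_last empty_iff set_mset_empty)
    then show ?thesis
      using assms a that(2) I by (auto simp: b basis_set_def dest: in_diffD)
  qed
  then show ?thesis by (auto simp: b contraction_def Let_def)
qed

text \<open>\<open>contraction\<close> contracts \<open>dx\<close> except on \<open>r\<close>, the
  part where \<alpha> and I are empty. As the differential is \<open>dx\<close> minus
  \<open>dy\<close>, each remaining error term contains one \<open>dy\<close> and so has lower
  weight.\<close>

lemma homotopy_identity:
  assumes z: "keys z \<subseteq> basis_set V k w"
  defines "r \<equiv> lin (\<lambda>b. if fst b = {#} \<and> fst (snd b) = {} then pm b 1 else 0) z"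
  shows "z - koszul (lin contraction z) - lin contraction (koszul z) = r + lin dy (lin contraction z) + lin contraction (lin dy z)"
proof -
  have "lin dx (lin contraction z) + lin contraction (lin dx z) = lin (\<lambda>b. lin dx (contraction b) + lin contraction (dx b)) z"
    by (simp add: lin_lin lin_fun)
  also have "\<dots> = lin (\<lambda>b. pm b 1 - (if fst b = {#} \<and> fst (snd b) = {} then pm b 1 else 0)) z"
  proof (rule lin_cong)
    fix b assume "b \<in> keys z"
    with z have "b \<in> basis_set V k w" by blast
    then obtain \<alpha> I \<beta> where b: "b = (\<alpha>, I, \<beta>)" "finite I"
      by (cases b) (auto simp: basis_set_def intro: finite_subset[OF _ V])
    show "lin dx (contraction b) + lin contraction (dx b) = pm b 1 - (if fst b = {#} \<and> fst (snd b) = {} then pm b 1 else 0)"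
    proof (cases "set_mset \<alpha> \<union> I = {}")
      case True
      then show ?thesis by (simp add: b contraction_def dx_def)
    next
      case False
      then show ?thesis using contraction_homotopy[OF b(2) False, of \<beta>] by (auto simp: b(1))
    qed
  qed
  also have "\<dots> = z - r" by (simp add: lin_fun lin_id r_def)
  finally show ?thesis by (simp add: koszul_def lin_diff algebra_simps)
qed

text \<open>Subtracting the boundary of \<open>lin contraction z\<close> leaves a cycle of smaller
  weight, to which the induction hypothesis applies. In positive degree I is nonempty, so the
  exceptional part of \<open>homotopy_identity\<close> vanishes.\<close>

lemma koszul_exact:
  assumes "keys z \<subseteq> basis_set V (Suc k) w" "koszul z = 0"
  shows "\<exists>y. keys y \<subseteq> basis_set V (Suc (Suc k)) w \<and> koszul y = z"
  using assms
proof (induction w arbitrary: z)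
  case 0
  moreover have "basis_set V j 0 = {}" for j by (auto simp: basis_set_def)
  ultimately have "z = 0" by (intro keys_empty) simp
  then show ?case by (intro exI[of _ 0]) (simp add: koszul_def)
next
  case (Suc w)
  define z' where "z' = lin dy (lin contraction z) + lin contraction (lin dy z)"
  have r0: "lin (\<lambda>b. if fst b = {#} \<and> fst (snd b) = {} then pm b 1 else 0) z = 0"
  proof -
    have "lin (\<lambda>b. if fst b = {#} \<and> fst (snd b) = {} then pm b 1 else 0) z = lin (\<lambda>b. 0) z"
      by (rule lin_cong) (use Suc.prems(1) in \<open>auto simp: basis_set_def\<close>)
    then show ?thesis by (simp add: lin_fun)
  qed
  have z': "z' = z - koszul (lin contraction z)"
    using homotopy_identity[OF Suc.prems(1)] Suc.prems(2) r0 by (simp add: z'_def)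
  have hz: "keys (lin contraction z) \<subseteq> basis_set V (Suc (Suc k)) (Suc w)"
    by (rule keys_lin_subset[OF Suc.prems(1) contraction_keys])
  have "keys z' \<subseteq> basis_set V (Suc k) w"
  proof -
    have 1: "keys (lin dy (lin contraction z)) \<subseteq> basis_set V (Suc k) w"
      by (rule keys_lin_subset[OF hz]) (rule dy_keys)
    have "keys (lin dy z) \<subseteq> basis_set V k w"
      by (rule keys_lin_subset[OF Suc.prems(1)]) (rule dy_keys)
    then have "keys (lin contraction (lin dy z)) \<subseteq> basis_set V (Suc k) w"
      by (rule keys_lin_subset) (rule contraction_keys)
    with 1 show ?thesis
      unfolding z'_def using Poly_Mapping.keys_add[of "lin dy (lin contraction z)" "lin contraction (lin dy z)"] by auto
  qed
  moreover have "koszul z' = 0"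
    using Suc.prems(2) koszul_koszul koszul_add[of z "- koszul (lin contraction z)"] koszul_smul[of "- 1" "koszul (lin contraction z)"]
    by (simp add: z')
  ultimately obtain y where y: "keys y \<subseteq> basis_set V (Suc (Suc k)) w" "koszul y = z'"
    using Suc.IH by blast
  have "basis_set V (Suc (Suc k)) w \<subseteq> basis_set V (Suc (Suc k)) (Suc w)" by (auto simp: basis_set_def)
  then have "keys (y + lin contraction z) \<subseteq> basis_set V (Suc (Suc k)) (Suc w)"
    using y(1) hz Poly_Mapping.keys_add[of y "lin contraction z"] by blast
  moreover have "koszul (y + lin contraction z) = z" using y(2) by (simp add: koszul_add z')
  ultimately show ?case by blast
qed

text \<open>The same induction in degree 0, where the exceptional part survives: modulo boundaries
  all variables can be moved to the right. \<open>collapse_inj\<close> later shows that nothing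
  further is identified.\<close>

lemma koszul_reduce:
  assumes "keys z \<subseteq> basis_set V 0 w"
  shows "\<exists>y. keys y \<subseteq> basis_set V 1 w \<and> keys (z - koszul y) \<subseteq> {({#}, {}, \<beta>) |\<beta>. set_mset \<beta> \<subseteq> V}"
  using assms
proof (induction w arbitrary: z)
  case 0
  moreover have "basis_set V j 0 = {}" for j by (auto simp: basis_set_def)
  ultimately have "z = 0" by (intro keys_empty) simp
  then show ?case by (intro exI[of _ 0]) (simp add: koszul_def)
next
  case (Suc w)
  let ?R = "{({#}, {}, \<beta>) |\<beta>. set_mset \<beta> \<subseteq> V} :: (nat multiset \<times> nat set \<times> nat multiset) set"
  define r where "r = lin (\<lambda>b. if fst b = {#} \<and> fst (snd b) = {} then pm b 1 else 0) z"
  have "I = {}" if "(\<alpha>, I, \<beta>) \<in> keys z" for \<alpha> I \<beta>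
  proof -
    have "I \<subseteq> V" "card I = 0" using that Suc.prems by (auto simp: basis_set_def)
    then show ?thesis using finite_subset[OF _ V, of I] by simp
  qed
  then have "lin dx z = lin (\<lambda>_. 0) z" "lin dy z = lin (\<lambda>_. 0) z"
    by (auto intro!: lin_cong simp: dx_def dy_def intro!: sum.neutral)
  then have d0: "lin dx z = 0" "lin dy z = 0" by (simp_all add: lin_fun)
  have hz: "keys (lin contraction z) \<subseteq> basis_set V 1 (Suc w)"
    using keys_lin_subset[OF Suc.prems contraction_keys] by simp
  have eq: "z - koszul (lin contraction z) = r + lin dy (lin contraction z)"
    using homotopy_identity[OF Suc.prems] d0 by (simp add: koszul_def r_def)
  have "keys r \<subseteq> ?R"
    unfolding r_def by (rule keys_lin_subset[OF Suc.prems]) (auto simp: basis_set_def split: if_splits)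
  moreover have "keys (lin dy (lin contraction z)) \<subseteq> basis_set V 0 w"
    by (rule keys_lin_subset[OF hz[unfolded One_nat_def]]) (rule dy_keys)
  then obtain y where y: "keys y \<subseteq> basis_set V 1 w" "keys (lin dy (lin contraction z) - koszul y) \<subseteq> ?R"
    using Suc.IH by blast
  moreover have "z - koszul (lin contraction z + y) = r + (lin dy (lin contraction z) - koszul y)"
    using eq by (simp add: koszul_add algebra_simps)
  ultimately have "keys (z - koszul (lin contraction z + y)) \<subseteq> ?R"
    using Poly_Mapping.keys_add[of r "lin dy (lin contraction z) - koszul y"] by auto
  moreover have "basis_set V 1 w \<subseteq> basis_set V 1 (Suc w)" by (auto simp: basis_set_def)
  then have "keys (lin contraction z + y) \<subseteq> basis_set V 1 (Suc w)"
    using y(1) hz Poly_Mapping.keys_add[of "lin contraction z" y] by blast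
  ultimately show ?case by blast
qed

end

section \<open>Quantum affine space: normal forms and the action on the Koszul complex\<close>

subsection \<open>Quantum affine spaces\<close>

text \<open>The product of \<open>q\<close> over all pairs of letters in their order, by which a
  word differs from its normalised monomial (\<open>cls_eq_mono\<close>).\<close>

primrec (in bicharacter) word_coeff :: "nat list \<Rightarrow> complex"
  where "word_coeff [] = 1"
  | "word_coeff (i # w) = chi {#i#} (mset w) * word_coeff w"

context bicharacter
begin

lemma word_coeff_append: "word_coeff (v @ w) = word_coeff v * word_coeff w * chi (mset v) (mset w)"
  by (induction v) (simp_all add: chi_add chi_add_mset(1)[of _ "mset _"])

lemma word_coeff_nonzero [simp]: "word_coeff w \<noteq> 0"
  by (induction w) simp_all

end

lemma free_monoid_simps [simp]:
  "carrier (free_monoid Y) = lists Y" "v \<otimes>\<^bsub>free_monoid Y\<^esub> w = v @ w" "\<one>\<^bsub>free_monoid Y\<^esub> = []"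
  by (simp_all add: free_monoid_def)

lemma free_monoid_monoid: "Group.monoid (free_monoid Y)"
  by (rule monoidI) auto

locale quantum =
  fixes n :: nat and Q :: "nat \<Rightarrow> nat \<Rightarrow> complex"
  assumes Q_nonzero: "\<And>i j. i \<in> {1..n} \<Longrightarrow> j \<in> {1..n} \<Longrightarrow> Q i j \<noteq> 0"
    and Q_skew: "mult_skew_symmetric n Q"
begin

text \<open>The choice of \<open>q\<close> matters only through \<open>q i j = Q i j * q j i\<close>: words divided by their
  \<open>word_coeff\<close> then depend on the multiset of letters only.\<close>

definition q :: "nat \<Rightarrow> nat \<Rightarrow> complex"
  where "q i j = (if i \<in> {1..n} \<and> j \<in> {1..n} \<and> j < i then Q i j else 1)"

sublocale bicharacter q
  by unfold_locales (auto simp: q_def Q_nonzero)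

lemma q_Q: "i \<in> {1..n} \<Longrightarrow> j \<in> {1..n} \<Longrightarrow> q i j = Q i j * q j i"
  using Q_skew by (cases i j rule: linorder_cases) (auto simp: q_def mult_skew_symmetric_def)

definition V :: "nat set" where "V = {1..n}"

lemma finite_V [simp]: "finite V"
  by (simp add: V_def)

abbreviation "U \<equiv> quantum_space n Q"
abbreviation "FM \<equiv> free_monoid V"
abbreviation "J \<equiv> quantum_relations n Q"

definition koszul_basis :: "(nat multiset \<times> nat set \<times> nat multiset) set"
  where "koszul_basis = {(\<alpha>, I, \<beta>). set_mset \<alpha> \<subseteq> V \<and> I \<subseteq> V \<and> set_mset \<beta> \<subseteq> V}"

definition koszul_group :: "(nat multiset \<times> nat set \<times> nat multiset \<Rightarrow>\<^sub>0 complex) ring"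
  where "koszul_group = \<lparr>carrier = {p. keys p \<subseteq> koszul_basis}, monoid.mult = undefined, monoid.one = undefined,
    ring.zero = 0, ring.add = (+)\<rparr>"

lemma koszul_group_simps [simp]:
  "p \<in> carrier koszul_group \<longleftrightarrow> keys p \<subseteq> koszul_basis" "\<zero>\<^bsub>koszul_group\<^esub> = 0" "p \<oplus>\<^bsub>koszul_group\<^esub> p' = p + p'"
  by (simp_all add: koszul_group_def)

lemma keys_add_subset: "keys p \<subseteq> S \<Longrightarrow> keys p' \<subseteq> S \<Longrightarrow> keys (p + p') \<subseteq> S"
  using Poly_Mapping.keys_add[of p p'] by auto

lemma keys_smul_subset: "keys p \<subseteq> S \<Longrightarrow> keys (smul c p) \<subseteq> S"
  using keys_smul[of c p] by auto

lemma abelian_group_koszul: "abelian_group koszul_group"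
proof (rule abelian_groupI)
  show "\<exists>p'\<in>carrier koszul_group. p' \<oplus>\<^bsub>koszul_group\<^esub> p = \<zero>\<^bsub>koszul_group\<^esub>" if "p \<in> carrier koszul_group" for p
    using that keys_smul_subset[of p koszul_basis "- 1"] by (intro bexI[of _ "- p"]) auto
qed (auto simp: keys_add_subset add_ac)

lemma koszul_keys_closed [simp]:
  "set_mset \<gamma> \<subseteq> V \<Longrightarrow> keys p \<subseteq> koszul_basis \<Longrightarrow> keys (shift_left \<gamma> p) \<subseteq> koszul_basis"
  "set_mset \<gamma> \<subseteq> V \<Longrightarrow> keys p \<subseteq> koszul_basis \<Longrightarrow> keys (shift_right \<gamma> p) \<subseteq> koszul_basis"
  "keys p \<subseteq> koszul_basis \<Longrightarrow> keys (smul c p) \<subseteq> koszul_basis"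
  unfolding shift_left_def shift_right_def
  by (auto intro!: keys_smul_subset dest!: subsetD[OF keys_lin] simp: koszul_basis_def split: if_splits)
    fastforce+

lemma shift_add: "shift_left \<gamma> (p + p') = shift_left \<gamma> p + shift_left \<gamma> p'"
  "shift_right \<gamma> (p + p') = shift_right \<gamma> p + shift_right \<gamma> p'"
  by (simp_all add: shift_left_def shift_right_def lin_add)

lemma shift_smul: "shift_left \<gamma> (smul c p) = smul c (shift_left \<gamma> p)"
  "shift_right \<gamma> (smul c p) = smul c (shift_right \<gamma> p)"
  by (simp_all add: shift_left_def shift_right_def lin_smul)

lemma words: "w \<in> lists V \<Longrightarrow> set_mset (mset w) \<subseteq> V"
  by auto

text \<open>Composing the shifts by single letters produces exactly the factor
  \<open>word_coeff\<close>, so the action is forced by that of the generators. Compatibility with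
  concatenation is \<open>word_coeff_append\<close>, for \<open>KR\<close> as well.\<close>

sublocale KL: monoid_operators FM koszul_group "\<lambda>c w p. smul (c * word_coeff w) (shift_left (mset w) p)"
  by (rule monoid_operators.intro[OF free_monoid_monoid abelian_group_koszul])
    (use words in \<open>simp_all add: smul_distrib distrib_right shift_add\<close>)

sublocale KR: monoid_operators FM koszul_group "\<lambda>c w p. smul (c * word_coeff w) (shift_right (mset w) p)"
  by (rule monoid_operators.intro[OF free_monoid_monoid abelian_group_koszul])
    (use words in \<open>simp_all add: smul_distrib distrib_right shift_add\<close>)

lemma KL_mult:
  assumes "f \<in> carrier KL.F" "g \<in> carrier KL.F" "p \<in> carrier koszul_group"
  shows "KL.act (f \<otimes>\<^bsub>KL.F\<^esub> g) p = KL.act f (KL.act g p)"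
  by (rule KL.act_mult[OF _ assms])
    (simp add: shift_smul shift_left_mult word_coeff_append ac_simps)

lemma KR_mult:
  assumes "f \<in> carrier KL.F" "g \<in> carrier KL.F" "p \<in> carrier koszul_group"
  shows "KR.act (f \<otimes>\<^bsub>KL.F\<^esub> g) p = KR.act g (KR.act f p)"
  by (rule KR.act_mult_opposite[OF _ assms])
    (simp add: shift_smul shift_right_mult word_coeff_append ac_simps)

definition rels :: "(nat list \<Rightarrow> complex) set"
  where "rels = {single [i, j] \<ominus>\<^bsub>KL.F\<^esub> Q i j \<odot>\<^bsub>KL.F\<^esub> single [j, i] | i j. i \<in> V \<and> j \<in> V}"

lemma J_eq: "J = Idl\<^bsub>KL.F\<^esub> rels"
  by (simp add: quantum_relations_def rels_def V_def Let_def)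

lemma U_eq: "U = quot_module KL.F J"
  by (simp add: quantum_space_def V_def)

lemma word_single [simp]: "w \<in> lists V \<Longrightarrow> single w \<in> carrier KL.F"
  by (rule single_in_monoid_algebra) simp

lemma rels_closed: "rels \<subseteq> carrier KL.F"
  unfolding rels_def by (auto intro!: KL.F.A.minus_closed KL.scaled_closed)

lemma J_ideal: "ideal J KL.F"
  unfolding J_eq by (rule KL.F.A.genideal_ideal[OF rels_closed])

lemma J_submodule: "submodule J complex_field KL.F"
  by (rule ideal_submodule[OF KL.F.alg J_ideal])

lemma F_module: "left_module complex_field KL.F"
  using KL.F.alg by (simp add: complex_algebra_def)

text \<open>The words \<open>[i, j]\<close> and \<open>[j, i]\<close> shift by the same multiset,
  and by \<open>q_Q\<close> their coefficients differ by the factor \<open>Q i j\<close>; so the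
  defining relations of \<open>U\<close> act as zero from both sides.\<close>

lemma J_annihilates: "J \<subseteq> KL.annihilator" "J \<subseteq> KR.annihilator"
proof -
  have m: "k \<ominus>\<^bsub>koszul_group\<^esub> k = 0" if "keys k \<subseteq> koszul_basis" for k
    using that KL.N.r_neg[of k] by (simp add: a_minus_def)
  have "single [i, j] \<ominus>\<^bsub>KL.F\<^esub> Q i j \<odot>\<^bsub>KL.F\<^esub> single [j, i] \<in> KL.annihilator"
    "single [i, j] \<ominus>\<^bsub>KL.F\<^esub> Q i j \<odot>\<^bsub>KL.F\<^esub> single [j, i] \<in> KR.annihilator"
    if ij: "i \<in> V" "j \<in> V" for i j
  proof -
    have w: "[i, j] \<in> lists V" "[j, i] \<in> lists V" using ij by auto
    have c: "word_coeff [i, j] = Q i j * word_coeff [j, i]"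
      using q_Q[of i j] ij by (simp add: V_def chi_def)
    have e: "mset [i, j] = mset [j, i]" by simp
    have g: "single [i, j] \<ominus>\<^bsub>KL.F\<^esub> Q i j \<odot>\<^bsub>KL.F\<^esub> single [j, i] \<in> carrier KL.F"
      using w by (intro KL.F.A.minus_closed KL.scaled_closed word_single) auto
    have "KL.act (single [i, j] \<ominus>\<^bsub>KL.F\<^esub> Q i j \<odot>\<^bsub>KL.F\<^esub> single [j, i]) p = 0"
      if p: "p \<in> carrier koszul_group" for p
    proof -
      have "KL.act (single [i, j]) p = smul (word_coeff [i, j]) (shift_left (mset [i, j]) p)"
        using KL.act_single[of "[i, j]" p] w p by simp
      moreover have "KL.act (Q i j \<odot>\<^bsub>KL.F\<^esub> single [j, i]) p = smul (word_coeff [i, j]) (shift_left (mset [i, j]) p)"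
        unfolding c e using KL.act_basis[of "[j, i]" p "Q i j"] w p by simp
      moreover have "keys (smul (word_coeff [i, j]) (shift_left (mset [i, j]) p)) \<subseteq> koszul_basis"
        using p words[OF w(1)] by simp
      ultimately show ?thesis
        using KL.act_minus[OF word_single[OF w(1)] KL.scaled_closed p, of "[j, i]" "Q i j"] w m by simp
    qed
    then show "single [i, j] \<ominus>\<^bsub>KL.F\<^esub> Q i j \<odot>\<^bsub>KL.F\<^esub> single [j, i] \<in> KL.annihilator"
      using g by (simp add: KL.annihilator_def)
    have "KR.act (single [i, j] \<ominus>\<^bsub>KL.F\<^esub> Q i j \<odot>\<^bsub>KL.F\<^esub> single [j, i]) p = 0"
      if p: "p \<in> carrier koszul_group" for p
    proof -
      have "KR.act (single [i, j]) p = smul (word_coeff [i, j]) (shift_right (mset [i, j]) p)"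
        using KR.act_single[of "[i, j]" p] w p by simp
      moreover have "KR.act (Q i j \<odot>\<^bsub>KL.F\<^esub> single [j, i]) p = smul (word_coeff [i, j]) (shift_right (mset [i, j]) p)"
        unfolding c e using KR.act_basis[of "[j, i]" p "Q i j"] w p by simp
      moreover have "keys (smul (word_coeff [i, j]) (shift_right (mset [i, j]) p)) \<subseteq> koszul_basis"
        using p words[OF w(1)] by simp
      ultimately show ?thesis
        using KR.act_minus[OF word_single[OF w(1)] KL.scaled_closed p, of "[j, i]" "Q i j"] w m by simp
    qed
    then show "single [i, j] \<ominus>\<^bsub>KL.F\<^esub> Q i j \<odot>\<^bsub>KL.F\<^esub> single [j, i] \<in> KR.annihilator"
      using g by (simp add: KR.annihilator_def)
  qed
  then have "rels \<subseteq> KL.annihilator" "rels \<subseteq> KR.annihilator" by (auto simp: rels_def)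
  then show "J \<subseteq> KL.annihilator" "J \<subseteq> KR.annihilator"
    unfolding J_eq
    using KL.F.A.genideal_minimal[OF KL.annihilator_ideal] KL.F.A.genideal_minimal[OF KR.annihilator_ideal]
    by (simp_all add: KL_mult KR_mult)
qed

lemma U_algebra: "complex_algebra U"
  unfolding U_eq by (rule complex_algebra_quot[OF KL.F.alg J_ideal])

sublocale env U
  by (rule env.intro) (rule calgebra.intro[OF U_algebra])

definition koszul_bimodule :: "((nat list \<Rightarrow> complex) set, nat multiset \<times> nat set \<times> nat multiset \<Rightarrow>\<^sub>0 complex) bimodule"
  where "koszul_bimodule = \<lparr>carrier = {p. keys p \<subseteq> koszul_basis}, monoid.mult = undefined, monoid.one = undefined,
    ring.zero = 0, ring.add = (+),
    left_act = (\<lambda>u p. KL.act (SOME f. f \<in> u) p), right_act = (\<lambda>p u. KR.act (SOME f. f \<in> u) p)\<rparr>"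

lemma koszul_bimodule_simps [simp]:
  "p \<in> carrier koszul_bimodule \<longleftrightarrow> keys p \<subseteq> koszul_basis" "\<zero>\<^bsub>koszul_bimodule\<^esub> = 0"
  "p \<oplus>\<^bsub>koszul_bimodule\<^esub> p' = p + p'"
  by (simp_all add: koszul_bimodule_def)

lemma left_act_eq: "left_act koszul_bimodule u p = u \<odot>\<^bsub>KL.quotient_record\<^esub> p"
  and right_act_eq: "right_act koszul_bimodule p u = u \<odot>\<^bsub>KR.quotient_record\<^esub> p"
  by (simp_all add: koszul_bimodule_def)

lemma koszul_left_module: "left_module U KL.quotient_record"
  unfolding U_eq by (rule KL.quotient_record_module(1)[OF J_ideal J_annihilates(1) _ KL_mult]) simp

lemma koszul_right_module: "left_module (opposite U) KR.quotient_record"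
  unfolding U_eq by (rule KR.quotient_record_module(2)[OF J_ideal J_annihilates(2) _ KR_mult]) simp

definition cls :: "nat list \<Rightarrow> (nat list \<Rightarrow> complex) set"
  where "cls w = J +>\<^bsub>KL.F\<^esub> single w"

lemma cls_closed [simp]: "w \<in> lists V \<Longrightarrow> cls w \<in> carrier U"
  by (simp add: U_eq quot_module_simps cls_def)

lemma cls_mult: "v \<in> lists V \<Longrightarrow> w \<in> lists V \<Longrightarrow> cls v \<otimes>\<^bsub>U\<^esub> cls w = cls (v @ w)"
  unfolding U_eq cls_def by (simp add: quot_algebra_mult[OF KL.F.alg J_ideal] monoid_algebra_single_mult)

lemma cls_empty: "cls [] = \<one>\<^bsub>U\<^esub>"
  unfolding U_eq cls_def by (simp add: quot_algebra_one[OF KL.F.alg J_ideal] monoid_algebra_simps)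

lemma cls_smult: "w \<in> lists V \<Longrightarrow> c \<odot>\<^bsub>U\<^esub> cls w = J +>\<^bsub>KL.F\<^esub> (c \<odot>\<^bsub>KL.F\<^esub> single w)"
  unfolding U_eq cls_def by (simp add: quot_module_smult[OF F_module J_submodule])

lemma cls_swap: "i \<in> V \<Longrightarrow> j \<in> V \<Longrightarrow> cls [i, j] = Q i j \<odot>\<^bsub>U\<^esub> cls [j, i]"
proof -
  assume ij: "i \<in> V" "j \<in> V"
  then have "single [i, j] \<ominus>\<^bsub>KL.F\<^esub> Q i j \<odot>\<^bsub>KL.F\<^esub> single [j, i] \<in> J"
    unfolding J_eq using KL.F.A.genideal_self[OF rels_closed] by (auto simp: rels_def)
  then show ?thesis
    using ij by (simp add: cls_smult) (simp add: cls_def coset_eq_iff[OF F_module J_submodule] KL.scaled_closed)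
qed

lemma act_cls:
  assumes "w \<in> lists V" "keys p \<subseteq> koszul_basis"
  shows "left_act koszul_bimodule (c \<odot>\<^bsub>U\<^esub> cls w) p = smul (c * word_coeff w) (shift_left (mset w) p)"
    and "right_act koszul_bimodule p (c \<odot>\<^bsub>U\<^esub> cls w) = smul (c * word_coeff w) (shift_right (mset w) p)"
  using assms
  by (simp_all add: left_act_eq right_act_eq cls_smult KL.act_some[OF J_ideal J_annihilates(1)]
    KR.act_some[OF J_ideal J_annihilates(2)] KL.scaled_closed KL.act_basis KR.act_basis)

lemma U_word_induct [consumes 1, case_names word add]:
  assumes u: "u \<in> carrier U"
    and word: "\<And>c w. w \<in> lists V \<Longrightarrow> P (c \<odot>\<^bsub>U\<^esub> cls w)"
    and add: "\<And>x y. x \<in> carrier U \<Longrightarrow> y \<in> carrier U \<Longrightarrow> P x \<Longrightarrow> P y \<Longrightarrow> P (x \<oplus>\<^bsub>U\<^esub> y)"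
  shows "P u"
proof -
  have "P (J +>\<^bsub>KL.F\<^esub> f)" if "f \<in> carrier KL.F" for f
    using that
  proof (induction f rule: monoid_algebra_induct)
    case zero
    have "0 \<odot>\<^bsub>U\<^esub> cls [] = \<zero>\<^bsub>U\<^esub>" using V.lsmult_l_null[of "cls []"] by simp
    then have "J +>\<^bsub>KL.F\<^esub> \<zero>\<^bsub>KL.F\<^esub> = 0 \<odot>\<^bsub>U\<^esub> cls []"
      using quot_module_zero[OF F_module J_submodule] by (simp add: U_eq)
    then show ?case using word[of "[]" 0] by simp
  next
    case (step f w c)
    have "J +>\<^bsub>KL.F\<^esub> (f \<oplus>\<^bsub>KL.F\<^esub> c \<odot>\<^bsub>KL.F\<^esub> single w) = (J +>\<^bsub>KL.F\<^esub> f) \<oplus>\<^bsub>U\<^esub> c \<odot>\<^bsub>U\<^esub> cls w"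
      using step cls_smult[of w c] unfolding U_eq
      by (simp add: quot_module_add[OF F_module J_submodule] KL.scaled_closed)
    moreover have "J +>\<^bsub>KL.F\<^esub> f \<in> carrier U"
      using step by (simp add: U_eq quot_module_simps)
    ultimately show ?case
      using step word add by simp
  qed
  then show ?thesis
    using u unfolding U_eq quot_module_simps by blast
qed

subsection \<open>Ordered monomials\<close>

definition norm_word :: "nat list \<Rightarrow> (nat list \<Rightarrow> complex) set"
  where "norm_word w = (1 / word_coeff w) \<odot>\<^bsub>U\<^esub> cls w"

text \<open>The normalised ordered monomial u_\<alpha>; sorting merely selects one word with these
  letters.\<close>

definition monomial :: "nat multiset \<Rightarrow> (nat list \<Rightarrow> complex) set"
  where "monomial \<alpha> = norm_word (sorted_list_of_multiset \<alpha>)"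

lemma norm_word_closed [simp]: "w \<in> lists V \<Longrightarrow> norm_word w \<in> carrier U"
  by (simp add: norm_word_def)

lemma sorted_word: "set_mset \<alpha> \<subseteq> V \<Longrightarrow> sorted_list_of_multiset \<alpha> \<in> lists V"
  by (auto simp: in_lists_conv_set)

lemma mono_closed [simp]: "set_mset \<alpha> \<subseteq> V \<Longrightarrow> monomial \<alpha> \<in> carrier U"
  by (simp add: monomial_def sorted_word del: in_lists_conv_set)

lemma cls_norm_word: "w \<in> lists V \<Longrightarrow> cls w = word_coeff w \<odot>\<^bsub>U\<^esub> norm_word w"
  using V.lsmult_assoc[of "word_coeff w" "1 / word_coeff w" "cls w"] V.lsmult_one[of "cls w"]
  by (simp add: norm_word_def)

lemma norm_word_Cons:
  assumes "i \<in> V" "w \<in> lists V"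
  shows "norm_word (i # w) = (1 / chi {#i#} (mset w)) \<odot>\<^bsub>U\<^esub> (cls [i] \<otimes>\<^bsub>U\<^esub> norm_word w)"
proof -
  have i: "[i] \<in> lists V" using assms by simp
  have "cls [i] \<otimes>\<^bsub>U\<^esub> norm_word w = (1 / word_coeff w) \<odot>\<^bsub>U\<^esub> cls (i # w)"
    using smult_mult(2)[OF cls_closed[OF i] cls_closed[OF assms(2)], of "1 / word_coeff w"] cls_mult[OF i assms(2)]
    by (simp add: norm_word_def)
  then show ?thesis
    using V.lsmult_assoc[of "1 / chi {#i#} (mset w)" "1 / word_coeff w" "cls (i # w)"] assms
    by (simp add: norm_word_def)
qed

text \<open>The change of \<open>word_coeff\<close> cancels the commutation factor, because
  \<open>q i j = Q i j * q j i\<close>; this is the purpose of \<open>q\<close>.\<close>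

lemma norm_word_swap:
  assumes "i \<in> V" "j \<in> V" "w \<in> lists V"
  shows "norm_word (i # j # w) = norm_word (j # i # w)"
proof -
  have ij: "[i, j] \<in> lists V" "[j, i] \<in> lists V" "j # i # w \<in> lists V" using assms by auto
  have "cls (i # j # w) = cls [i, j] \<otimes>\<^bsub>U\<^esub> cls w" using cls_mult[OF ij(1) assms(3)] by simp
  also have "\<dots> = Q i j \<odot>\<^bsub>U\<^esub> cls (j # i # w)"
    using cls_swap[OF assms(1,2)] smult_mult(1)[OF cls_closed[OF ij(2)] cls_closed[OF assms(3)], of "Q i j"]
      cls_mult[OF ij(2) assms(3)] by simp
  finally have "norm_word (i # j # w) = (1 / word_coeff (i # j # w) * Q i j) \<odot>\<^bsub>U\<^esub> cls (j # i # w)"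
    using V.lsmult_assoc[of "1 / word_coeff (i # j # w)" "Q i j" "cls (j # i # w)"] ij(3) cls_closed[OF ij(3)]
    by (simp add: norm_word_def)
  moreover have "1 / word_coeff (i # j # w) * Q i j = 1 / word_coeff (j # i # w)"
  proof -
    have "chi {#i#} {#j#} = Q i j * chi {#j#} {#i#}" using q_Q[of i j] assms by (simp add: chi_def V_def)
    moreover have "Q i j \<noteq> 0" using Q_nonzero assms by (simp add: V_def)
    ultimately show ?thesis by (simp add: chi_add_mset(2)[of _ _ "mset w"] field_simps)
  qed
  ultimately show ?thesis by (simp add: norm_word_def)
qed

text \<open>Insertion sort by swaps at the head: \<open>norm_word_Cons\<close> carries an equality
  between words with the same letters past a leading letter.\<close>

lemma norm_word_insort:
  assumes "i \<in> V" "w \<in> lists V"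
  shows "norm_word (i # w) = norm_word (insort i w)"
  using assms(2)
proof (induction w)
  case Nil
  then show ?case by simp
next
  case (Cons j w)
  then have j: "j \<in> V" "w \<in> lists V" by auto
  have iw: "i # w \<in> lists V" "insort i w \<in> lists V" using assms(1) j by (auto simp: in_lists_conv_set set_insort_key)
  show ?case
  proof (cases "i \<le> j")
    case False
    have "norm_word (i # j # w) = norm_word (j # i # w)" by (rule norm_word_swap[OF assms(1) j])
    also have "\<dots> = norm_word (j # insort i w)"
      unfolding norm_word_Cons[OF j(1) iw(1)] norm_word_Cons[OF j(1) iw(2)] using Cons.IH j by simp
    finally show ?thesis using False by simp
  qed simp
qed

lemma norm_word_sort: "w \<in> lists V \<Longrightarrow> norm_word w = norm_word (sort w)"
proof (induction w)
  case (Cons i w)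
  then have i: "i \<in> V" "w \<in> lists V" "sort w \<in> lists V" by (auto simp: in_lists_conv_set)
  show ?case
    using Cons.IH[OF i(2)] norm_word_insort[OF i(1,3)]
    by (simp add: norm_word_Cons[OF i(1,2)] norm_word_Cons[OF i(1,3)] del: in_lists_conv_set)
qed simp

lemma cls_eq_mono: "w \<in> lists V \<Longrightarrow> cls w = word_coeff w \<odot>\<^bsub>U\<^esub> monomial (mset w)"
  using cls_norm_word[of w] norm_word_sort[of w] by (simp add: monomial_def)

text \<open>Sorting the words shows that the ordered monomials span; their independence can be read
  off from \<open>tens_ext_gen\<close>.\<close>

lemma U_induct [consumes 1, case_names monomial add]:
  assumes u: "u \<in> carrier U"
    and monomial: "\<And>c \<alpha>. set_mset \<alpha> \<subseteq> V \<Longrightarrow> P (c \<odot>\<^bsub>U\<^esub> monomial \<alpha>)"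
    and add: "\<And>x y. x \<in> carrier U \<Longrightarrow> y \<in> carrier U \<Longrightarrow> P x \<Longrightarrow> P y \<Longrightarrow> P (x \<oplus>\<^bsub>U\<^esub> y)"
  shows "P u"
  using u
proof (induction rule: U_word_induct)
  case (word c w)
  then have "c \<odot>\<^bsub>U\<^esub> cls w = (c * word_coeff w) \<odot>\<^bsub>U\<^esub> monomial (mset w)"
    using V.lsmult_assoc[of c "word_coeff w" "monomial (mset w)"] words[of w] by (simp add: cls_eq_mono)
  then show ?case using monomial[of "mset w"] words[OF word] by simp
qed (rule add)

lemma act_mono:
  assumes "set_mset \<alpha> \<subseteq> V" "keys p \<subseteq> koszul_basis"
  shows "left_act koszul_bimodule (c \<odot>\<^bsub>U\<^esub> monomial \<alpha>) p = smul c (shift_left \<alpha> p)"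
    and "right_act koszul_bimodule p (c \<odot>\<^bsub>U\<^esub> monomial \<alpha>) = smul c (shift_right \<alpha> p)"
proof -
  let ?s = "sorted_list_of_multiset \<alpha>"
  have s: "?s \<in> lists V" by (rule sorted_word[OF assms(1)])
  have "c \<odot>\<^bsub>U\<^esub> monomial \<alpha> = (c * (1 / word_coeff ?s)) \<odot>\<^bsub>U\<^esub> cls ?s"
    using V.lsmult_assoc[of c "1 / word_coeff ?s" "cls ?s"] cls_closed[OF s] by (simp add: monomial_def norm_word_def)
  then show "left_act koszul_bimodule (c \<odot>\<^bsub>U\<^esub> monomial \<alpha>) p = smul c (shift_left \<alpha> p)"
    "right_act koszul_bimodule p (c \<odot>\<^bsub>U\<^esub> monomial \<alpha>) = smul c (shift_right \<alpha> p)"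
    using act_cls[OF s assms(2)] by simp_all
qed

lemma scal_mono: "scal c = c \<odot>\<^bsub>U\<^esub> monomial {#}"
  by (simp add: monomial_def norm_word_def cls_empty)

text \<open>The module axioms on each side are inherited from \<open>KL\<close> and
  \<open>KR\<close>. What remains is the agreement of the scalars and the commutation of the two
  actions, both checked on monomials, the latter by \<open>shift_commute\<close>.\<close>

sublocale K: bimod U koszul_bimodule
proof (rule bimod.intro[OF env_axioms bimod_axioms.intro])
  interpret KLm: left_module U KL.quotient_record by (rule koszul_left_module)
  interpret KRm: left_module "opposite U" KR.quotient_record by (rule koszul_right_module)
  show "abelian_group koszul_bimodule"
    by (rule abelian_group_cong[OF abelian_group_koszul]) (auto simp: koszul_bimodule_def koszul_group_def)
  have car: "p \<in> carrier KL.quotient_record \<longleftrightarrow> keys p \<subseteq> koszul_basis" "p \<in> carrier KR.quotient_record \<longleftrightarrow> keys p \<subseteq> koszul_basis" for p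
    by simp_all
  fix a b p p'
  assume p: "p \<in> carrier koszul_bimodule"
  then have kp: "p \<in> carrier KL.quotient_record" "p \<in> carrier KR.quotient_record" by simp_all
  show "left_act koszul_bimodule \<one>\<^bsub>U\<^esub> p = p" unfolding left_act_eq using KLm.lsmult_one[OF kp(1)] .
  show "right_act koszul_bimodule p \<one>\<^bsub>U\<^esub> = p" unfolding right_act_eq using KRm.lsmult_one[OF kp(2)] by simp
  show "left_act koszul_bimodule (scal c) p = right_act koszul_bimodule p (scal c)" for c
    using p by (simp add: scal_mono act_mono)
  assume a: "a \<in> carrier U"
  then have a': "a \<in> carrier (opposite U)" by simp
  have L: "left_act koszul_bimodule a p \<in> carrier koszul_bimodule" if "a \<in> carrier U" "p \<in> carrier koszul_bimodule" for a p
    using KLm.lsmult_closed[of a p] that unfolding left_act_eq by simp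
  have R: "right_act koszul_bimodule p a \<in> carrier koszul_bimodule" if "a \<in> carrier U" "p \<in> carrier koszul_bimodule" for a p
    using KRm.lsmult_closed[of a p] that unfolding right_act_eq by simp
  show "left_act koszul_bimodule a p \<in> carrier koszul_bimodule" by (rule L[OF a p])
  show "right_act koszul_bimodule p a \<in> carrier koszul_bimodule" by (rule R[OF a p])
  have Ladd: "left_act koszul_bimodule a (p \<oplus>\<^bsub>koszul_bimodule\<^esub> p') = left_act koszul_bimodule a p \<oplus>\<^bsub>koszul_bimodule\<^esub> left_act koszul_bimodule a p'"
    if "a \<in> carrier U" "p \<in> carrier koszul_bimodule" "p' \<in> carrier koszul_bimodule" for a p p'
    unfolding left_act_eq using KLm.lsmult_r_distr[of a p p'] that by simp
  have Radd: "right_act koszul_bimodule (p \<oplus>\<^bsub>koszul_bimodule\<^esub> p') a = right_act koszul_bimodule p a \<oplus>\<^bsub>koszul_bimodule\<^esub> right_act koszul_bimodule p' a"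
    if "a \<in> carrier U" "p \<in> carrier koszul_bimodule" "p' \<in> carrier koszul_bimodule" for a p p'
    unfolding right_act_eq using KRm.lsmult_r_distr[of a p p'] that by simp
  show "p' \<in> carrier koszul_bimodule \<Longrightarrow> left_act koszul_bimodule a (p \<oplus>\<^bsub>koszul_bimodule\<^esub> p') = left_act koszul_bimodule a p \<oplus>\<^bsub>koszul_bimodule\<^esub> left_act koszul_bimodule a p'"
    by (rule Ladd[OF a p])
  show "p' \<in> carrier koszul_bimodule \<Longrightarrow> right_act koszul_bimodule (p \<oplus>\<^bsub>koszul_bimodule\<^esub> p') a = right_act koszul_bimodule p a \<oplus>\<^bsub>koszul_bimodule\<^esub> right_act koszul_bimodule p' a"
    by (rule Radd[OF a p])
  assume b: "b \<in> carrier U"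
  have Ladds: "left_act koszul_bimodule (a \<oplus>\<^bsub>U\<^esub> b) p = left_act koszul_bimodule a p \<oplus>\<^bsub>koszul_bimodule\<^esub> left_act koszul_bimodule b p"
    if "a \<in> carrier U" "b \<in> carrier U" "p \<in> carrier koszul_bimodule" for a b p
    unfolding left_act_eq using KLm.lsmult_l_distr[of a b p] that by simp
  have Radds: "right_act koszul_bimodule p (a \<oplus>\<^bsub>U\<^esub> b) = right_act koszul_bimodule p a \<oplus>\<^bsub>koszul_bimodule\<^esub> right_act koszul_bimodule p b"
    if "a \<in> carrier U" "b \<in> carrier U" "p \<in> carrier koszul_bimodule" for a b p
    unfolding right_act_eq using KRm.lsmult_l_distr[of a b p] that by simp
  show "left_act koszul_bimodule (a \<oplus>\<^bsub>U\<^esub> b) p = left_act koszul_bimodule a p \<oplus>\<^bsub>koszul_bimodule\<^esub> left_act koszul_bimodule b p"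
    by (rule Ladds[OF a b p])
  show "right_act koszul_bimodule p (a \<oplus>\<^bsub>U\<^esub> b) = right_act koszul_bimodule p a \<oplus>\<^bsub>koszul_bimodule\<^esub> right_act koszul_bimodule p b"
    by (rule Radds[OF a b p])
  show "left_act koszul_bimodule (a \<otimes>\<^bsub>U\<^esub> b) p = left_act koszul_bimodule a (left_act koszul_bimodule b p)"
    unfolding left_act_eq using KLm.lsmult_assoc[OF a b kp(1)] .
  show "right_act koszul_bimodule p (a \<otimes>\<^bsub>U\<^esub> b) = right_act koszul_bimodule (right_act koszul_bimodule p a) b"
    unfolding right_act_eq using KRm.lsmult_assoc[of b a p] a b kp by simp
  show "left_act koszul_bimodule a (right_act koszul_bimodule p b) = right_act koszul_bimodule (left_act koszul_bimodule a p) b"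
    using a
  proof (induction a rule: U_induct)
    case (monomial c \<alpha>)
    show ?case
      using b
    proof (induction b rule: U_induct)
      case (monomial d \<beta>)
      then show ?case
        using p \<open>set_mset \<alpha> \<subseteq> V\<close> by (simp add: act_mono shift_smul shift_commute mult.commute)
    next
      case (add x y)
      have "c \<odot>\<^bsub>U\<^esub> monomial \<alpha> \<in> carrier U" using monomial by simp
      then show ?case
        using add p L R by (simp only: Radds Ladd)
    qed
  next
    case (add x y)
    then show ?case using p b L R by (simp only: Ladds Radd)
  qed
qed

end

lemma bimod_twisted:
  assumes U: "complex_algebra U" and s: "s \<in> ring_hom U U"
    and sc: "\<And>c a. a \<in> carrier U \<Longrightarrow> s (c \<odot>\<^bsub>U\<^esub> a) = c \<odot>\<^bsub>U\<^esub> s a"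
  shows "bimod U (twisted_bimodule s U)"
proof -
  interpret env U by (rule env.intro) (rule calgebra.intro[OF U])
  have cl: "s a \<in> carrier U" if "a \<in> carrier U" for a using ring_hom_closed[OF s that] .
  have ab: "abelian_group (twisted_bimodule s U)"
    by (rule abelian_group_cong[OF A.abelian_group_axioms]) (simp_all add: twisted_bimodule_def)
  show ?thesis
    by (rule bimod.intro[OF env_axioms bimod_axioms.intro[OF ab]])
      (simp_all add: twisted_bimodule_def cl A.m_assoc A.l_distr A.r_distr ring_hom_add[OF s] ring_hom_mult[OF s]
        ring_hom_one[OF s] sc scal_mult)
qed

lemma bimod_regular:
  assumes U: "complex_algebra U"
  shows "bimod U (regular_bimodule U)"
  by (rule bimod_twisted[OF U]) (auto simp: ring_hom_def)

section \<open>The Koszul resolution over the enveloping algebra\<close>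

context quantum
begin

subsection \<open>The Koszul resolution\<close>

definition ext_gen :: "nat set \<Rightarrow> nat multiset \<times> nat set \<times> nat multiset \<Rightarrow>\<^sub>0 complex"
  where "ext_gen I = pm ({#}, I, {#}) 1"

definition ind :: "nat \<Rightarrow> nat set set"
  where "ind k = {I. I \<subseteq> V \<and> card I = k}"

abbreviation "KM \<equiv> env_left U koszul_bimodule"
abbreviation "UM \<equiv> env_left U (regular_bimodule U)"
abbreviation "FE k \<equiv> free_module E (ind k)"
abbreviation "gen i \<equiv> cls [i]"

text \<open>The values of \<^const>\<open>chi\<close> come from the passage between the normalised basis of the Koszul
  complex and its basis \<^term>\<open>ext_gen\<close> over the enveloping algebra.\<close>

definition koszul_coeff :: "nat \<Rightarrow> nat set \<Rightarrow> ((nat list \<Rightarrow> complex) set \<times> (nat list \<Rightarrow> complex) set \<Rightarrow> complex) set"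
  where "koszul_coeff i I =
    tens U ((eps i I / chi {#i#} (mset_set (I - {i}))) \<odot>\<^bsub>U\<^esub> gen i) \<one>\<^bsub>U\<^esub> \<oplus>\<^bsub>E\<^esub>
    tens U \<one>\<^bsub>U\<^esub> ((- eps i I / chi (mset_set (I - {i})) {#i#}) \<odot>\<^bsub>U\<^esub> gen i)"

definition koszul_boundary :: "nat \<Rightarrow> nat set \<Rightarrow> nat set \<Rightarrow> ((nat list \<Rightarrow> complex) set \<times> (nat list \<Rightarrow> complex) set \<Rightarrow> complex) set"
  where "koszul_boundary k I = (\<Oplus>\<^bsub>FE k\<^esub>i\<in>I. koszul_coeff i I \<odot>\<^bsub>FE k\<^esub> basis_vec E (I - {i}))"

definition koszul_diff where
  "koszul_diff k = (\<lambda>x\<in>carrier (FE (Suc k)). lin_comb (FE k) (ind (Suc k)) (koszul_boundary k) x)"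

definition koszul_aug where
  "koszul_aug = (\<lambda>x\<in>carrier (FE 0). lin_comb UM (ind 0) (\<lambda>_. \<one>\<^bsub>U\<^esub>) x)"

text \<open>Maps the degree \<open>k\<close> term of the resolution isomorphically onto the chains
  supported in \<open>chain_basis k\<close> (\<open>theta_keys\<close>, \<open>theta_surj\<close>,
  \<open>theta_inj\<close>); exactness is transported along it.\<close>

definition theta where
  "theta k = lin_comb KM (ind k) ext_gen"

lemma finite_ind [simp]: "finite (ind k)"
proof -
  have "ind k \<subseteq> Pow V" by (auto simp: ind_def)
  then show ?thesis by (rule finite_subset) simp
qed

lemma ind_finite: "I \<in> ind k \<Longrightarrow> finite I"
  by (auto simp: ind_def intro: finite_subset[OF _ finite_V])

lemma ind_remove: "I \<in> ind (Suc k) \<Longrightarrow> i \<in> I \<Longrightarrow> I - {i} \<in> ind k"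
  using ind_finite[of I "Suc k"] by (auto simp: ind_def)

lemma ind_0: "ind 0 = {{}}"
  using finite_subset[OF _ finite_V] by (auto simp: ind_def)

lemma ring_E: "ring E"
  by (rule E.A.ring_axioms)

lemma FE_module: "left_module E (FE k)"
  by (rule left_module_free_module[OF ring_E])

lemma KM_module: "left_module E KM"
  by (rule K.left_module_env_left)

sublocale reg: bimod U "regular_bimodule U"
  by (rule bimod_regular[OF U_algebra])

lemma UM_module: "left_module E UM"
  by (rule reg.left_module_env_left)

lemma regular_simps [simp]: "carrier (regular_bimodule U) = carrier U"
  "left_act (regular_bimodule U) a b = a \<otimes>\<^bsub>U\<^esub> b" "right_act (regular_bimodule U) a b = a \<otimes>\<^bsub>U\<^esub> b"
  "\<zero>\<^bsub>regular_bimodule U\<^esub> = \<zero>\<^bsub>U\<^esub>" "x \<oplus>\<^bsub>regular_bimodule U\<^esub> y = x \<oplus>\<^bsub>U\<^esub> y"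
  by (simp_all add: twisted_bimodule_def)

lemma koszul_coeff_closed [simp]: "i \<in> V \<Longrightarrow> koszul_coeff i I \<in> carrier E"
  by (simp add: koszul_coeff_def)

lemma koszul_boundary_closed: "I \<in> ind (Suc k) \<Longrightarrow> koszul_boundary k I \<in> carrier (FE k)"
proof -
  interpret FEk: left_module E "FE k" by (rule FE_module)
  assume I: "I \<in> ind (Suc k)"
  then have "i \<in> V" if "i \<in> I" for i using that by (auto simp: ind_def)
  then show ?thesis
    unfolding koszul_boundary_def using ind_remove[OF I]
    by (auto intro!: FEk.M.finsum_closed FEk.lsmult_closed basis_vec_closed[OF ring_E])
qed

lemma koszul_diff_lin:
  "linear_map E (FE (Suc k)) (FE k) (lin_comb (FE k) (ind (Suc k)) (koszul_boundary k))"
  by (rule lin_comb_linear[OF ring_E FE_module]) (use koszul_boundary_closed in auto)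

lemma koszul_diff_hom: "koszul_diff k \<in> module_homs E (FE (Suc k)) (FE k)"
  unfolding koszul_diff_def by (rule restrict_in_module_homs[OF FE_module koszul_diff_lin])

lemma koszul_diff_basis: "I \<in> ind (Suc k) \<Longrightarrow> koszul_diff k (basis_vec E I) = koszul_boundary k I"
  unfolding koszul_diff_def
  using lin_comb_basis[OF FE_module, of "koszul_boundary k" "ind (Suc k)" k I] koszul_boundary_closed
    basis_vec_closed[OF ring_E, of I "ind (Suc k)"] by auto

lemma koszul_aug_hom: "koszul_aug \<in> module_homs E (FE 0) UM"
  unfolding koszul_aug_def
  by (rule restrict_in_module_homs[OF FE_module lin_comb_linear[OF ring_E UM_module]]) simp

lemma koszul_aug_basis: "koszul_aug (basis_vec E {}) = \<one>\<^bsub>U\<^esub>"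
  unfolding koszul_aug_def
  using lin_comb_basis[OF UM_module, of "\<lambda>_. \<one>\<^bsub>U\<^esub>" "ind 0" "{}"] basis_vec_closed[OF ring_E, of "{}" "ind 0"]
  by (simp add: ind_0)

lemma ext_gen_closed: "I \<in> ind k \<Longrightarrow> ext_gen I \<in> carrier KM"
  by (auto simp: ext_gen_def ind_def koszul_basis_def)

lemma theta_lin: "linear_map E (FE k) KM (theta k)"
  unfolding theta_def by (rule lin_comb_linear[OF ring_E KM_module]) (use ext_gen_closed in auto)

lemma theta_basis: "I \<in> ind k \<Longrightarrow> theta k (basis_vec E I) = ext_gen I"
  unfolding theta_def using lin_comb_basis[OF KM_module, of ext_gen "ind k" I] ext_gen_closed by auto

lemma KM_tens:
  "a \<in> carrier U \<Longrightarrow> b \<in> carrier U \<Longrightarrow> keys p \<subseteq> koszul_basis \<Longrightarrow>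
    tens U a b \<odot>\<^bsub>KM\<^esub> p = left_act koszul_bimodule a (right_act koszul_bimodule p b)"
  by (rule K.env_left_tens) simp_all

lemma KM_tens_mono:
  assumes "set_mset \<alpha> \<subseteq> V" "set_mset \<beta> \<subseteq> V" "keys p \<subseteq> koszul_basis"
  shows "tens U (c \<odot>\<^bsub>U\<^esub> monomial \<alpha>) (d \<odot>\<^bsub>U\<^esub> monomial \<beta>) \<odot>\<^bsub>KM\<^esub> p = smul (c * d) (shift_left \<alpha> (shift_right \<beta> p))"
  using assms by (simp add: KM_tens act_mono shift_smul)

lemma keys_subset_koszul: "keys (koszul p) \<subseteq> koszul_basis" if "keys p \<subseteq> koszul_basis"
proof -
  have "keys (dx b) \<subseteq> koszul_basis \<and> keys (dy b) \<subseteq> koszul_basis" if "b \<in> koszul_basis" for b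
  proof -
    obtain \<alpha> I \<beta> where b: "b = (\<alpha>, I, \<beta>)" by (cases b)
    have "(add_mset i \<alpha>, I - {i}, \<beta>) \<in> koszul_basis \<and> (\<alpha>, I - {i}, add_mset i \<beta>) \<in> koszul_basis" if "i \<in> I" for i
      using \<open>b \<in> koszul_basis\<close> that by (auto simp: b koszul_basis_def)
    then show ?thesis
      using keys_sum[of "\<lambda>i. pm (add_mset i \<alpha>, I - {i}, \<beta>) (eps i I)" I]
        keys_sum[of "\<lambda>i. pm (\<alpha>, I - {i}, add_mset i \<beta>) (eps i I)" I]
      by (auto simp: b dx_def dy_def)
  qed
  then show ?thesis
    using keys_lin_subset[OF that, of dx koszul_basis] keys_lin_subset[OF that, of dy koszul_basis]
      keys_diff[of "lin dx p" "lin dy p"]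
    unfolding koszul_def by auto
qed

lemma env_monomial_induct [consumes 1, case_names monomial add]:
  assumes z: "z \<in> carrier E"
    and monomial: "\<And>\<alpha> \<beta> c d. set_mset \<alpha> \<subseteq> V \<Longrightarrow> set_mset \<beta> \<subseteq> V \<Longrightarrow>
      P (tens U (c \<odot>\<^bsub>U\<^esub> monomial \<alpha>) (d \<odot>\<^bsub>U\<^esub> monomial \<beta>))"
    and add: "\<And>x y. x \<in> carrier E \<Longrightarrow> y \<in> carrier E \<Longrightarrow> P x \<Longrightarrow> P y \<Longrightarrow> P (x \<oplus>\<^bsub>E\<^esub> y)"
  shows "P z"
  using z
proof (induction z rule: env_induct)
  case (tens a b)
  show ?case
    using tens(1)
  proof (induction a rule: U_induct)
    case (monomial c \<alpha>)
    show ?case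
      using tens(2)
    proof (induction b rule: U_induct)
      case (monomial d \<beta>)
      then show ?case using assms(2)[OF \<open>set_mset \<alpha> \<subseteq> V\<close>] by blast
    next
      case (add x y)
      then show ?case
        using monomial assms(3) by (simp add: tens_add_right)
    qed
  next
    case (add x y)
    then show ?case using tens(2) assms(3) by (simp add: tens_add_left)
  qed
qed (rule add)

lemma KM_add_left: "x \<in> carrier E \<Longrightarrow> y \<in> carrier E \<Longrightarrow> keys p \<subseteq> koszul_basis \<Longrightarrow>
    (x \<oplus>\<^bsub>E\<^esub> y) \<odot>\<^bsub>KM\<^esub> p = x \<odot>\<^bsub>KM\<^esub> p + y \<odot>\<^bsub>KM\<^esub> p"
  using left_module.lsmult_l_distr[OF KM_module, of x y p] by simp

lemma KM_closed: "z \<in> carrier E \<Longrightarrow> keys p \<subseteq> koszul_basis \<Longrightarrow> keys (z \<odot>\<^bsub>KM\<^esub> p) \<subseteq> koszul_basis"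
  using left_module.lsmult_closed[OF KM_module, of z p] by simp

text \<open>Pure tensors of monomials, which act by shifts up to scalars, generate \<open>E\<close>
  additively, and shifts commute with the differential.\<close>

lemma koszul_linear: "linear_map E KM KM koszul"
proof (rule linear_mapI)
  fix z p assume z: "z \<in> carrier E" and "p \<in> carrier KM"
  then have p: "keys p \<subseteq> koszul_basis" by simp
  note kp = keys_subset_koszul[OF p]
  show "koszul (z \<odot>\<^bsub>KM\<^esub> p) = z \<odot>\<^bsub>KM\<^esub> koszul p"
    using z
  proof (induction z rule: env_monomial_induct)
    case (monomial \<alpha> \<beta> c d)
    then show ?case using p kp by (simp add: KM_tens_mono koszul_smul koszul_shift)
  next
    case (add x y)
    then show ?case using p kp by (simp add: KM_add_left koszul_add)
  qed
qed (auto simp: keys_subset_koszul koszul_add)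

lemma finsum_KM: "(\<And>i. i \<in> S \<Longrightarrow> keys (f i) \<subseteq> koszul_basis) \<Longrightarrow> finsum KM f S = sum f S"
proof (induction S rule: infinite_finite_induct)
  interpret KMm: left_module E KM by (rule KM_module)
  {
    case (infinite S)
    then show ?case by simp
  next
    case empty
    then show ?case by simp
  next
    case (insert i S)
    then show ?case by (subst KMm.M.finsum_insert) auto
  }
qed

lemma gen_monomial: "i \<in> V \<Longrightarrow> gen i = monomial {#i#}"
  using cls_eq_mono[of "[i]"] by simp

lemma one_monomial: "\<one>\<^bsub>U\<^esub> = 1 \<odot>\<^bsub>U\<^esub> monomial {#}"
  using scal_mono[of 1] by simp

lemma koszul_coeff_act:
  assumes "i \<in> V" "keys p \<subseteq> koszul_basis"
  shows "koszul_coeff i I \<odot>\<^bsub>KM\<^esub> p = smul (eps i I / chi {#i#} (mset_set (I - {i}))) (shift_left {#i#} p)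
    - smul (eps i I / chi (mset_set (I - {i})) {#i#}) (shift_right {#i#} p)"
proof -
  have "tens U (c \<odot>\<^bsub>U\<^esub> gen i) \<one>\<^bsub>U\<^esub> \<odot>\<^bsub>KM\<^esub> p = smul c (shift_left {#i#} p)"
    "tens U \<one>\<^bsub>U\<^esub> (c \<odot>\<^bsub>U\<^esub> gen i) \<odot>\<^bsub>KM\<^esub> p = smul c (shift_right {#i#} p)" for c
    using KM_tens_mono[of "{#i#}" "{#}" p c 1] KM_tens_mono[of "{#}" "{#i#}" p 1 c] assms
    by (simp_all add: gen_monomial flip: one_monomial)
  then show ?thesis
    using assms by (simp add: koszul_coeff_def KM_add_left smul_distrib del: one_monomial)
qed

text \<open>Shifting \<open>ext_gen (I - {i})\<close> by i on the left or right multiplies it by a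
  value of \<open>chi\<close>; the denominators in \<open>koszul_coeff\<close> are there to cancel
  it.\<close>

lemma koszul_ext_gen:
  assumes "I \<subseteq> V"
  shows "(\<Sum>i\<in>I. koszul_coeff i I \<odot>\<^bsub>KM\<^esub> ext_gen (I - {i})) = koszul (ext_gen I)"
proof -
  have "koszul_coeff i I \<odot>\<^bsub>KM\<^esub> ext_gen (I - {i})
      = pm ({#i#}, I - {i}, {#}) (eps i I) - pm ({#}, I - {i}, {#i#}) (eps i I)" if "i \<in> I" for i
    using that assms koszul_coeff_act[of i "ext_gen (I - {i})" I]
    by (auto simp: ext_gen_def koszul_basis_def shift_left_def shift_right_def)
  then show ?thesis
    by (simp add: koszul_def ext_gen_def dx_def dy_def sum_subtractf)
qed

text \<open>Both sides are \<open>E\<close>-linear, so the basis vectors suffice, where the claim is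
  \<open>koszul_ext_gen\<close>.\<close>

lemma theta_koszul_diff:
  assumes x: "x \<in> carrier (FE (Suc k))"
  shows "theta k (koszul_diff k x) = koszul (theta (Suc k) x)"
proof (rule free_module_map_eq[OF ring_E KM_module linear_map_compose[OF module_homs_linear[OF koszul_diff_hom] theta_lin]
      linear_map_compose[OF theta_lin koszul_linear] _ x])
  fix I assume I: "I \<in> ind (Suc k)"
  then have IV: "I \<subseteq> V" by (simp add: ind_def)
  then have b: "koszul_coeff i I \<in> carrier E" "basis_vec E (I - {i}) \<in> carrier (FE k)" if "i \<in> I" for i
    using that ind_remove[OF I that] basis_vec_closed[OF ring_E] by auto
  have e: "keys (ext_gen (I - {i})) \<subseteq> koszul_basis" for i
    using IV by (auto simp: ext_gen_def koszul_basis_def)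
  have "theta k (koszul_diff k (basis_vec E I)) = (\<Oplus>\<^bsub>KM\<^esub>i\<in>I. theta k (koszul_coeff i I \<odot>\<^bsub>FE k\<^esub> basis_vec E (I - {i})))"
    unfolding koszul_diff_basis[OF I] koszul_boundary_def
    by (rule linear_map_finsum[OF FE_module KM_module theta_lin])
      (use b left_module.lsmult_closed[OF FE_module] in auto)
  also have "\<dots> = (\<Oplus>\<^bsub>KM\<^esub>i\<in>I. koszul_coeff i I \<odot>\<^bsub>KM\<^esub> ext_gen (I - {i}))"
  proof (rule abelian_monoid.finsum_cong')
    show "abelian_monoid KM" using KM_module by (simp add: left_module_def abelian_group_def)
    show "(\<lambda>i. koszul_coeff i I \<odot>\<^bsub>KM\<^esub> ext_gen (I - {i})) \<in> I \<rightarrow> carrier KM"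
      using b e KM_closed by auto
    show "theta k (koszul_coeff i I \<odot>\<^bsub>FE k\<^esub> basis_vec E (I - {i})) = koszul_coeff i I \<odot>\<^bsub>KM\<^esub> ext_gen (I - {i})"
      if "i \<in> I" for i
      using linear_map_smult[OF theta_lin b[OF that]] theta_basis[OF ind_remove[OF I that]] by simp
  qed simp
  also have "\<dots> = (\<Sum>i\<in>I. koszul_coeff i I \<odot>\<^bsub>KM\<^esub> ext_gen (I - {i}))"
    by (rule finsum_KM) (use b e KM_closed in auto)
  also have "\<dots> = koszul (theta (Suc k) (basis_vec E I))"
    by (simp add: koszul_ext_gen[OF IV] theta_basis[OF I])
  finally show "theta k (koszul_diff k (basis_vec E I)) = koszul (theta (Suc k) (basis_vec E I))" .
qed

subsection \<open>Exactness of the Koszul resolution\<close>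

definition chain_basis :: "nat \<Rightarrow> (nat multiset \<times> nat set \<times> nat multiset) set"
  where "chain_basis k = {(\<alpha>, I, \<beta>). set_mset \<alpha> \<subseteq> V \<and> I \<in> ind k \<and> set_mset \<beta> \<subseteq> V}"

lemma basis_set_chain: "basis_set V k w \<subseteq> chain_basis k"
  by (auto simp: chain_basis_def basis_set_def ind_def)

text \<open>Finite support bounds the weight, so the results proved by induction on \<open>w\<close>
  apply to every chain.\<close>

lemma chain_basis_set:
  assumes "keys p \<subseteq> chain_basis k"
  obtains w where "keys p \<subseteq> basis_set V k w"
proof -
  have "finite ((\<lambda>b. size (fst b) + k) ` keys p)" by simp
  then obtain w where w: "\<forall>m\<in>(\<lambda>b. size (fst b) + k) ` keys p. m < w"
    unfolding finite_nat_set_iff_bounded by blast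
  have "keys p \<subseteq> basis_set V k w"
  proof
    fix b assume b: "b \<in> keys p"
    obtain \<alpha> I \<beta> where "b = (\<alpha>, I, \<beta>)" by (cases b)
    with b w assms show "b \<in> basis_set V k w"
      by (force simp: chain_basis_def basis_set_def ind_def)
  qed
  then show thesis by (rule that)
qed

text \<open>The factor between the product u_\<alpha> e_I u_\<beta> and the basis element (\<alpha>,
  I, \<beta>).\<close>

definition norm_coeff :: "nat multiset \<times> nat set \<times> nat multiset \<Rightarrow> complex"
  where "norm_coeff = (\<lambda>(\<alpha>, I, \<beta>). chi (mset_set I) \<beta> * chi \<alpha> (mset_set I + \<beta>))"

lemma norm_coeff_nonzero [simp]: "norm_coeff b \<noteq> 0"
  by (cases b) (simp add: norm_coeff_def)

lemma tens_ext_gen: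
  assumes "set_mset \<alpha> \<subseteq> V" "set_mset \<beta> \<subseteq> V" "I \<in> ind k"
  shows "tens U (c \<odot>\<^bsub>U\<^esub> monomial \<alpha>) (d \<odot>\<^bsub>U\<^esub> monomial \<beta>) \<odot>\<^bsub>KM\<^esub> ext_gen I = pm (\<alpha>, I, \<beta>) (c * d * norm_coeff (\<alpha>, I, \<beta>))"
proof -
  have "keys (ext_gen I) \<subseteq> koszul_basis" using ext_gen_closed[OF assms(3)] by simp
  then show ?thesis
    using assms by (simp add: KM_tens_mono) (simp add: ext_gen_def shift_left_def shift_right_def norm_coeff_def ac_simps)
qed

lemma theta_add: "x \<in> carrier (FE k) \<Longrightarrow> y \<in> carrier (FE k) \<Longrightarrow> theta k (x \<oplus>\<^bsub>FE k\<^esub> y) = theta k x + theta k y"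
  using linear_map_add[OF theta_lin] by simp

lemma theta_step:
  assumes "f \<in> carrier (FE k)" "I \<in> ind k" "a \<in> carrier E"
  shows "theta k (f \<oplus>\<^bsub>FE k\<^esub> a \<odot>\<^bsub>FE k\<^esub> basis_vec E I) = theta k f + a \<odot>\<^bsub>KM\<^esub> ext_gen I"
proof -
  have b: "basis_vec E I \<in> carrier (FE k)" by (rule basis_vec_closed[OF ring_E assms(2)])
  then have "a \<odot>\<^bsub>FE k\<^esub> basis_vec E I \<in> carrier (FE k)"
    using left_module.lsmult_closed[OF FE_module] assms by blast
  then show ?thesis
    using assms b by (simp add: theta_add linear_map_smult[OF theta_lin] theta_basis)
qed

lemma theta_zero: "theta k \<zero>\<^bsub>FE k\<^esub> = 0"
  using linear_map_zero[OF FE_module KM_module theta_lin] by simp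

lemma act_ext_gen_keys:
  assumes "z \<in> carrier E" "I \<in> ind k"
  shows "keys (z \<odot>\<^bsub>KM\<^esub> ext_gen I) \<subseteq> chain_basis k"
  using assms(1)
proof (induction z rule: env_monomial_induct)
  case (monomial \<alpha> \<beta> c d)
  then show ?case using assms(2) by (auto simp: tens_ext_gen chain_basis_def split: if_splits)
next
  case (add x y)
  moreover have "keys (ext_gen I) \<subseteq> koszul_basis" using ext_gen_closed[OF assms(2)] by simp
  ultimately show ?case by (simp add: KM_add_left keys_add_subset)
qed

lemma theta_keys:
  assumes "x \<in> carrier (FE k)"
  shows "keys (theta k x) \<subseteq> chain_basis k"
  using ring_E assms
proof (induction x rule: free_module_induct)
  case zero
  then show ?case unfolding theta_zero by simp
next
  case (step f I a)
  then show ?case by (simp add: theta_step act_ext_gen_keys keys_add_subset)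
qed

lemma theta_surj:
  assumes "keys p \<subseteq> chain_basis k"
  shows "\<exists>x\<in>carrier (FE k). theta k x = p"
  using assms
proof (induction p rule: pm_induct)
  case zero
  then show ?case
    using theta_zero left_module.axioms(2)[OF FE_module] abelian_group.axioms(1) abelian_monoid.zero_closed by blast
next
  case (step p b c)
  then obtain x where x: "x \<in> carrier (FE k)" "theta k x = p" by blast
  obtain \<alpha> I \<beta> where b: "b = (\<alpha>, I, \<beta>)" "set_mset \<alpha> \<subseteq> V" "set_mset \<beta> \<subseteq> V" "I \<in> ind k"
    using step by (auto simp: chain_basis_def)
  let ?t = "tens U ((c / norm_coeff b) \<odot>\<^bsub>U\<^esub> monomial \<alpha>) (1 \<odot>\<^bsub>U\<^esub> monomial \<beta>)"
  have t: "?t \<in> carrier E" using b by simp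
  interpret FEk: left_module E "FE k" by (rule FE_module)
  have "x \<oplus>\<^bsub>FE k\<^esub> ?t \<odot>\<^bsub>FE k\<^esub> basis_vec E I \<in> carrier (FE k)"
    by (rule FEk.M.a_closed[OF x(1) FEk.lsmult_closed[OF t basis_vec_closed[OF ring_E b(4)]]])
  moreover have "theta k (x \<oplus>\<^bsub>FE k\<^esub> ?t \<odot>\<^bsub>FE k\<^esub> basis_vec E I) = p + pm b c"
    using x t b theta_step[OF x(1) b(4) t] tens_ext_gen[OF b(2,3,4), of "c / norm_coeff b" 1] by simp
  ultimately show ?case by blast
qed

text \<open>The tensor that carries \<open>ext_gen I\<close> to the given basis element, and zero if
  that element belongs to another index set.\<close>

definition coord_tensor :: "nat set \<Rightarrow> nat multiset \<times> nat set \<times> nat multiset \<Rightarrow> ((nat list \<Rightarrow> complex) set \<times> (nat list \<Rightarrow> complex) set \<Rightarrow> complex) set"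
  where "coord_tensor I = (\<lambda>(\<alpha>, I', \<beta>).
    if I' = I \<and> (\<alpha>, I', \<beta>) \<in> koszul_basis
    then tens U ((1 / norm_coeff (\<alpha>, I, \<beta>)) \<odot>\<^bsub>U\<^esub> monomial \<alpha>) (monomial \<beta>) else \<zero>\<^bsub>E\<^esub>)"

text \<open>The component in \<open>E\<close> at the generator e_I: a left inverse of
  \<open>theta\<close>. As \<open>E\<close> is a quotient with no given basis, an explicit
  retraction is what proves independence of the generators over \<open>E\<close>.\<close>

definition coord :: "nat set \<Rightarrow> (nat multiset \<times> nat set \<times> nat multiset \<Rightarrow>\<^sub>0 complex) \<Rightarrow> ((nat list \<Rightarrow> complex) set \<times> (nat list \<Rightarrow> complex) set \<Rightarrow> complex) set"
  where "coord I p = (\<Oplus>\<^bsub>E\<^esub>b\<in>keys p. lookup p b \<odot>\<^bsub>E\<^esub> coord_tensor I b)"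

lemma coord_tensor_closed [simp]: "coord_tensor I b \<in> carrier E"
  by (cases b) (auto simp: coord_tensor_def koszul_basis_def)

lemma coord_superset:
  assumes "finite S" "keys p \<subseteq> S"
  shows "coord I p = (\<Oplus>\<^bsub>E\<^esub>b\<in>S. lookup p b \<odot>\<^bsub>E\<^esub> coord_tensor I b)"
  unfolding coord_def
  by (rule E.A.add.finprod_mono_neutral_cong_left) (use assms E.V.lsmult_l_null in \<open>auto simp: in_keys_iff\<close>)

lemma coord_add: "coord I (p + p') = coord I p \<oplus>\<^bsub>E\<^esub> coord I p'"
proof -
  let ?S = "keys p \<union> keys p'"
  have "coord I (p + p') = (\<Oplus>\<^bsub>E\<^esub>b\<in>?S. lookup p b \<odot>\<^bsub>E\<^esub> coord_tensor I b \<oplus>\<^bsub>E\<^esub> lookup p' b \<odot>\<^bsub>E\<^esub> coord_tensor I b)"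
    using Poly_Mapping.keys_add[of p p']
    by (subst coord_superset[of ?S]) (auto intro!: E.A.finsum_cong' simp: lookup_add E.V.lsmult_l_distr)
  also have "\<dots> = coord I p \<oplus>\<^bsub>E\<^esub> coord I p'"
    by (simp add: coord_superset[of ?S] E.A.finsum_addf)
  finally show ?thesis .
qed

lemma coord_pm: "coord I (pm b c) = c \<odot>\<^bsub>E\<^esub> coord_tensor I b"
  by (subst coord_superset[of "{b}"]) (auto simp: E.A.finsum_insert)

lemma coord_zero [simp]: "coord I 0 = \<zero>\<^bsub>E\<^esub>"
  by (simp add: coord_def)

text \<open>An element of \<open>E\<close> is recovered from its action on a single generator. On
  monomials the action introduces \<open>norm_coeff\<close>, which \<open>coord_tensor\<close>
  divides out; the general case is additive.\<close>

lemma coord_act: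
  assumes "z \<in> carrier E" "I' \<in> ind k"
  shows "coord I (z \<odot>\<^bsub>KM\<^esub> ext_gen I') = (if I = I' then z else \<zero>\<^bsub>E\<^esub>)"
  using assms(1)
proof (induction z rule: env_monomial_induct)
  case (monomial \<alpha> \<beta> c d)
  let ?b = "(\<alpha>, I', \<beta>)"
  have b: "?b \<in> koszul_basis" using monomial assms(2) by (auto simp: koszul_basis_def ind_def)
  have z: "c \<odot>\<^bsub>E\<^esub> \<zero>\<^bsub>E\<^esub> = \<zero>\<^bsub>E\<^esub>" for c using E.V.lsmult_r_null by simp
  have m: "monomial \<alpha> \<in> carrier U" "monomial \<beta> \<in> carrier U" using monomial by auto
  have "(c * d * norm_coeff ?b) \<odot>\<^bsub>E\<^esub> tens U ((1 / norm_coeff ?b) \<odot>\<^bsub>U\<^esub> monomial \<alpha>) (monomial \<beta>)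
      = tens U (c \<odot>\<^bsub>U\<^esub> monomial \<alpha>) (d \<odot>\<^bsub>U\<^esub> monomial \<beta>)"
  proof -
    have "tens U (c \<odot>\<^bsub>U\<^esub> monomial \<alpha>) (d \<odot>\<^bsub>U\<^esub> monomial \<beta>) = (c * d) \<odot>\<^bsub>E\<^esub> tens U (monomial \<alpha>) (monomial \<beta>)"
      using m E.V.lsmult_assoc[of d c "tens U (monomial \<alpha>) (monomial \<beta>)"] tens_smult(1)[of "monomial \<alpha>" "monomial \<beta>" c]
        tens_smult(2)[of "c \<odot>\<^bsub>U\<^esub> monomial \<alpha>" "monomial \<beta>" d] by (simp add: mult.commute)
    moreover have "tens U ((1 / norm_coeff ?b) \<odot>\<^bsub>U\<^esub> monomial \<alpha>) (monomial \<beta>) = (1 / norm_coeff ?b) \<odot>\<^bsub>E\<^esub> tens U (monomial \<alpha>) (monomial \<beta>)"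
      using m tens_smult(1)[of "monomial \<alpha>" "monomial \<beta>"] by simp
    ultimately show ?thesis
      using m E.V.lsmult_assoc[of "c * d * norm_coeff ?b" "1 / norm_coeff ?b" "tens U (monomial \<alpha>) (monomial \<beta>)"] by simp
  qed
  then show ?case
    using monomial assms(2) b z by (auto simp: tens_ext_gen coord_pm coord_tensor_def)
next
  case (add x y)
  moreover have "keys (ext_gen I') \<subseteq> koszul_basis" using ext_gen_closed[OF assms(2)] by simp
  ultimately show ?case by (simp add: KM_add_left coord_add)
qed

lemma coord_theta:
  assumes "x \<in> carrier (FE k)"
  shows "coord I (theta k x) = x I"
  using ring_E assms
proof (induction x rule: free_module_induct)
  case zero
  show ?case unfolding theta_zero by (simp add: free_module_simps)
next
  case (step f I' a)
  then show ?case
    using free_module_val[OF ring_E step.hyps(1), of I] theta_step[OF step.hyps]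
      coord_add[of I "theta k f" "a \<odot>\<^bsub>KM\<^esub> ext_gen I'"] coord_act[OF step.hyps(3,2), of I]
    by (cases "I = I'") (simp_all add: free_module_simps(3,4) basis_vec_def)
qed

lemma theta_inj:
  assumes "x \<in> carrier (FE k)" "y \<in> carrier (FE k)" "theta k x = theta k y"
  shows "x = y"
  using assms coord_theta by (metis ext)

lemma koszul_exact_chain:
  assumes "keys z \<subseteq> chain_basis (Suc k)" "koszul z = 0"
  shows "\<exists>y. keys y \<subseteq> chain_basis (Suc (Suc k)) \<and> koszul y = z"
proof -
  obtain w where "keys z \<subseteq> basis_set V (Suc k) w" using chain_basis_set[OF assms(1)] .
  from koszul_exact[OF finite_V this assms(2)]
  obtain y where "keys y \<subseteq> basis_set V (Suc (Suc k)) w" "koszul y = z" by blast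
  then show ?thesis using basis_set_chain[of "Suc (Suc k)" w] by blast
qed

lemma koszul_diff_closed: "x \<in> carrier (FE (Suc k)) \<Longrightarrow> koszul_diff k x \<in> carrier (FE k)"
  by (rule linear_map_closed[OF module_homs_linear[OF koszul_diff_hom]])

lemma FE_zero_closed: "\<zero>\<^bsub>FE k\<^esub> \<in> carrier (FE k)"
  using ring.ring_simprules(2)[OF ring_E] by (simp add: free_module_simps)

lemma koszul_diff_exact:
  "{x \<in> carrier (FE (Suc k)). koszul_diff k x = \<zero>\<^bsub>FE k\<^esub>} = koszul_diff (Suc k) ` carrier (FE (Suc (Suc k)))"
proof (intro equalityI subsetI)
  fix x assume "x \<in> {x \<in> carrier (FE (Suc k)). koszul_diff k x = \<zero>\<^bsub>FE k\<^esub>}"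
  then have x: "x \<in> carrier (FE (Suc k))" "koszul_diff k x = \<zero>\<^bsub>FE k\<^esub>" by auto
  then have "koszul (theta (Suc k) x) = 0" using theta_koszul_diff[OF x(1)] theta_zero by simp
  from koszul_exact_chain[OF theta_keys[OF x(1)] this] theta_surj
  obtain y where y: "y \<in> carrier (FE (Suc (Suc k)))" "koszul (theta (Suc (Suc k)) y) = theta (Suc k) x" by metis
  have "theta (Suc k) (koszul_diff (Suc k) y) = theta (Suc k) x"
    using theta_koszul_diff[OF y(1)] y(2) by simp
  from theta_inj[OF koszul_diff_closed[OF y(1)] x(1) this] y(1)
  show "x \<in> koszul_diff (Suc k) ` carrier (FE (Suc (Suc k)))" by blast
next
  fix x assume "x \<in> koszul_diff (Suc k) ` carrier (FE (Suc (Suc k)))"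
  then obtain y where y: "y \<in> carrier (FE (Suc (Suc k)))" "x = koszul_diff (Suc k) y" by blast
  have x: "x \<in> carrier (FE (Suc k))" using koszul_diff_closed[OF y(1)] y(2) by simp
  have "theta k (koszul_diff k x) = theta k \<zero>\<^bsub>FE k\<^esub>"
    using theta_koszul_diff[OF x] theta_koszul_diff[OF y(1)] y(2) koszul_koszul theta_zero by simp
  from theta_inj[OF koszul_diff_closed[OF x] FE_zero_closed this] x
  show "x \<in> {x \<in> carrier (FE (Suc k)). koszul_diff k x = \<zero>\<^bsub>FE k\<^esub>}" by blast
qed

text \<open>Identifies the variables of the two sides. In degree 0 it is the multiplication of
  \<open>U\<close> in normalised form, a product u being represented by u acting on
  \<open>ext_gen {}\<close> (\<open>collapse_act\<close>).\<close>

definition collapse :: "(nat multiset \<times> nat set \<times> nat multiset \<Rightarrow>\<^sub>0 complex) \<Rightarrow> nat multiset \<times> nat set \<times> nat multiset \<Rightarrow>\<^sub>0 complex"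
  where "collapse = lin (\<lambda>(\<alpha>, I, \<beta>). pm (\<alpha> + \<beta>, I, {#}) 1)"

text \<open>\<open>dx\<close> and \<open>dy\<close> move the same index with the same sign to
  different sides, which \<open>collapse\<close> no longer distinguishes.\<close>

lemma collapse_koszul: "keys z \<subseteq> chain_basis k \<Longrightarrow> collapse (koszul z) = 0"
proof -
  have "lin (\<lambda>(\<alpha>, I, \<beta>). pm (\<alpha> + \<beta>, I, {#}) 1) (dx b) = lin (\<lambda>(\<alpha>, I, \<beta>). pm (\<alpha> + \<beta>, I, {#}) 1) (dy b)" for b
    by (cases b) (simp add: dx_def dy_def lin_sum)
  from lin_cong[OF this] show ?thesis
    by (simp add: collapse_def koszul_def lin_diff lin_lin)
qed

lemma UM_one_module: "z \<in> carrier E \<Longrightarrow> z \<odot>\<^bsub>UM\<^esub> \<one>\<^bsub>U\<^esub> \<in> carrier U"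
  using left_module.lsmult_closed[OF UM_module, of z "\<one>\<^bsub>U\<^esub>"] by simp

lemma collapse_act:
  assumes "z \<in> carrier E"
  shows "collapse (z \<odot>\<^bsub>KM\<^esub> ext_gen {}) = left_act koszul_bimodule (z \<odot>\<^bsub>UM\<^esub> \<one>\<^bsub>U\<^esub>) (ext_gen {})"
proof -
  have e: "{} \<in> ind 0" "keys (ext_gen {}) \<subseteq> koszul_basis" using ext_gen_closed[of "{}" 0] by (simp_all add: ind_0)
  show ?thesis
    using assms
  proof (induction z rule: env_monomial_induct)
    case (monomial \<alpha> \<beta> c d)
    have "left_act koszul_bimodule ((c \<odot>\<^bsub>U\<^esub> monomial \<alpha>) \<otimes>\<^bsub>U\<^esub> (d \<odot>\<^bsub>U\<^esub> monomial \<beta>)) (ext_gen {})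
        = smul c (shift_left \<alpha> (smul d (shift_left \<beta> (ext_gen {}))))"
      using monomial e(2) by (subst K.left_mult) (simp_all add: act_mono)
    moreover have "tens U (c \<odot>\<^bsub>U\<^esub> monomial \<alpha>) (d \<odot>\<^bsub>U\<^esub> monomial \<beta>) \<odot>\<^bsub>UM\<^esub> \<one>\<^bsub>U\<^esub>
        = (c \<odot>\<^bsub>U\<^esub> monomial \<alpha>) \<otimes>\<^bsub>U\<^esub> (d \<odot>\<^bsub>U\<^esub> monomial \<beta>)"
      using monomial by (subst reg.env_left_tens) simp_all
    moreover have "smul c (shift_left \<alpha> (smul d (shift_left \<beta> (ext_gen {})))) = pm (\<alpha> + \<beta>, {}, {#}) (c * d * chi \<alpha> \<beta>)"
      by (simp add: ext_gen_def shift_left_def ac_simps)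
    ultimately show ?case
      using monomial e(1) by (simp add: tens_ext_gen collapse_def norm_coeff_def)
  next
    case (add x y)
    have "(x \<oplus>\<^bsub>E\<^esub> y) \<odot>\<^bsub>UM\<^esub> \<one>\<^bsub>U\<^esub> = x \<odot>\<^bsub>UM\<^esub> \<one>\<^bsub>U\<^esub> \<oplus>\<^bsub>U\<^esub> y \<odot>\<^bsub>UM\<^esub> \<one>\<^bsub>U\<^esub>"
      using left_module.lsmult_l_distr[OF UM_module, of x y "\<one>\<^bsub>U\<^esub>"] add by simp
    then show ?case
      using add e(2) UM_one_module by (simp add: KM_add_left collapse_def lin_add K.left_add_scalar)
  qed
qed

lemma koszul_aug_step:
  assumes "f \<in> carrier (FE 0)" "a \<in> carrier E"
  shows "koszul_aug (f \<oplus>\<^bsub>FE 0\<^esub> a \<odot>\<^bsub>FE 0\<^esub> basis_vec E {}) = koszul_aug f \<oplus>\<^bsub>U\<^esub> a \<odot>\<^bsub>UM\<^esub> \<one>\<^bsub>U\<^esub>"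
proof -
  note L = module_homs_linear[OF koszul_aug_hom]
  have b: "basis_vec E {} \<in> carrier (FE 0)" using basis_vec_closed[OF ring_E, of "{}" "ind 0"] by (simp add: ind_0)
  then have "a \<odot>\<^bsub>FE 0\<^esub> basis_vec E {} \<in> carrier (FE 0)"
    using left_module.lsmult_closed[OF FE_module] assms by blast
  then show ?thesis
    using linear_map_add[OF L assms(1)] linear_map_smult[OF L assms(2) b] by (simp add: koszul_aug_basis)
qed

lemma koszul_aug_closed: "x \<in> carrier (FE 0) \<Longrightarrow> koszul_aug x \<in> carrier U"
  using linear_map_closed[OF module_homs_linear[OF koszul_aug_hom]] by simp

text \<open>The link between the combinatorial complex and the augmentation: whatever the
  augmentation kills has zero collapse.\<close>

lemma collapse_theta:
  assumes "x \<in> carrier (FE 0)"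
  shows "collapse (theta 0 x) = left_act koszul_bimodule (koszul_aug x) (ext_gen {})"
  using ring_E assms
proof (induction x rule: free_module_induct)
  have e: "{} \<in> ind 0" "keys (ext_gen {}) \<subseteq> koszul_basis" using ext_gen_closed[of "{}" 0] by (simp_all add: ind_0)
  {
    case zero
    have "koszul_aug \<zero>\<^bsub>FE 0\<^esub> = \<zero>\<^bsub>U\<^esub>"
      using linear_map_zero[OF FE_module UM_module module_homs_linear[OF koszul_aug_hom]] by simp
    moreover have "left_act koszul_bimodule \<zero>\<^bsub>U\<^esub> (ext_gen {}) = 0"
      using K.left_add_scalar[of "\<zero>\<^bsub>U\<^esub>" "\<zero>\<^bsub>U\<^esub>" "ext_gen {}"] e by simp
    ultimately show ?case unfolding theta_zero by (simp add: collapse_def)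
  next
    case (step f I' a)
    then have "I' = {}" by (simp add: ind_0)
    then show ?case
      using step e koszul_aug_closed[OF step(1)] UM_one_module
      by (simp add: theta_step koszul_aug_step collapse_def lin_add K.left_add_scalar) (simp add: collapse_act flip: collapse_def)
  }
qed

text \<open>On chains with all variables on the right, \<open>collapse\<close> merely transfers
  \<beta> to the left, so no two terms merge.\<close>

lemma collapse_inj:
  assumes "keys r \<subseteq> {({#}, {}, \<beta>) |\<beta>. set_mset \<beta> \<subseteq> V}" "collapse r = 0"
  shows "r = 0"
proof -
  have "lookup (collapse r) (\<beta>, {}, {#}) = lookup r ({#}, {}, \<beta>)" for \<beta>
    using assms(1)
  proof (induction r rule: pm_induct)
    case (step p b c)
    then show ?case by (auto simp: collapse_def lin_add lookup_add lookup_single when_def split: if_splits)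
  qed (simp add: collapse_def)
  then have z: "lookup r ({#}, {}, \<beta>) = 0" for \<beta> using assms(2) by simp
  show ?thesis
  proof (rule keys_empty, rule subsetI)
    fix b assume b: "b \<in> keys r"
    then obtain \<beta> where "b = ({#}, {}, \<beta>)" using assms(1) by blast
    then show "b \<in> {}" using b z by (simp add: in_keys_iff)
  qed
qed

lemma koszul_aug_diff:
  assumes "x \<in> carrier (FE 1)"
  shows "koszul_aug (koszul_diff 0 x) = \<zero>\<^bsub>U\<^esub>"
proof -
  note L = module_homs_linear[OF koszul_aug_hom]
  interpret UMm: left_module E UM by (rule UM_module)
  have zero: "linear_map E (FE 1) UM (\<lambda>x. \<zero>\<^bsub>U\<^esub>)"
    by (rule linear_mapI) (use UMm.lsmult_r_null UMm.M.zero_closed in auto)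
  have comp: "linear_map E (FE 1) UM (\<lambda>x. koszul_aug (koszul_diff 0 x))"
    using linear_map_compose[OF module_homs_linear[OF koszul_diff_hom[of 0]] L] by simp
  have basis: "koszul_aug (koszul_diff 0 (basis_vec E I)) = \<zero>\<^bsub>U\<^esub>" if I: "I \<in> ind 1" for I
  proof -
    obtain i where i: "I = {i}" "i \<in> V" using I by (auto simp: ind_def card_1_singleton_iff)
    have b: "basis_vec E {} \<in> carrier (FE 0)" using basis_vec_closed[OF ring_E, of "{}" "ind 0"] by (simp add: ind_0)
    have c: "koszul_coeff i I \<odot>\<^bsub>FE 0\<^esub> basis_vec E {} \<in> carrier (FE 0)"
      using left_module.lsmult_closed[OF FE_module _ b] i(2) by simp
    interpret FE0: left_module E "FE 0" by (rule FE_module)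
    \<comment> \<open>For a single index the sign and the values of \<open>chi\<close> are 1: the
      boundary of e_i has coefficient v_i \<otimes> 1 - 1 \<otimes> v_i, which takes 1 to v_i -
      v_i.\<close>
    have "{j \<in> {i}. j < i} = {}" by auto
    then have e: "eps i {i} = 1" unfolding eps_def by (simp only: card.empty power_0)
    have "koszul_diff 0 (basis_vec E I) = koszul_coeff i I \<odot>\<^bsub>FE 0\<^esub> basis_vec E {}"
      using I c unfolding i(1) by (subst koszul_diff_basis) (simp_all add: koszul_boundary_def FE0.M.finsum_insert)
    then have "koszul_aug (koszul_diff 0 (basis_vec E I)) = koszul_coeff i I \<odot>\<^bsub>UM\<^esub> \<one>\<^bsub>U\<^esub>"
      using linear_map_smult[OF L _ b, of "koszul_coeff i I"] i(2) by (simp add: koszul_aug_basis)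
    also have "\<dots> = gen i \<oplus>\<^bsub>U\<^esub> (- 1) \<odot>\<^bsub>U\<^esub> gen i"
      using i(2) unfolding koszul_coeff_def i(1)
      by (subst UMm.lsmult_l_distr) (simp_all add: reg.env_left_tens e)
    also have "\<dots> = \<zero>\<^bsub>U\<^esub>"
      using V.lsmult_l_distr[of 1 "- 1" "gen i"] V.lsmult_l_null[of "gen i"] i(2) by simp
    finally show ?thesis .
  qed
  show ?thesis by (rule free_module_map_eq[OF ring_E UM_module comp zero basis assms])
qed

theorem koszul_resolution: "projective_resolution E UM FE koszul_diff koszul_aug"
  unfolding projective_resolution_def
proof (intro conjI allI)
  have b: "basis_vec E {} \<in> carrier (FE 0)" using basis_vec_closed[OF ring_E, of "{}" "ind 0"] by (simp add: ind_0)
  show "projective E (FE k)" for k by (rule projective_free_module[OF ring_E])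
  show "koszul_diff k \<in> module_homs E (FE (Suc k)) (FE k)" for k by (rule koszul_diff_hom)
  show "koszul_aug \<in> module_homs E (FE 0) UM" by (rule koszul_aug_hom)
  show "{x \<in> carrier (FE (Suc k)). koszul_diff k x = \<zero>\<^bsub>FE k\<^esub>} = koszul_diff (Suc k) ` carrier (FE (Suc (Suc k)))" for k
    by (rule koszul_diff_exact)
  show "koszul_aug ` carrier (FE 0) = carrier UM"
  proof (intro equalityI subsetI)
    fix u assume "u \<in> carrier UM"
    then have u: "u \<in> carrier U" by simp
    have c: "tens U u \<one>\<^bsub>U\<^esub> \<odot>\<^bsub>FE 0\<^esub> basis_vec E {} \<in> carrier (FE 0)"
      using left_module.lsmult_closed[OF FE_module _ b] u by simp
    have "koszul_aug (tens U u \<one>\<^bsub>U\<^esub> \<odot>\<^bsub>FE 0\<^esub> basis_vec E {}) = u"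
      using linear_map_smult[OF module_homs_linear[OF koszul_aug_hom] _ b, of "tens U u \<one>\<^bsub>U\<^esub>"] u
      by (simp add: koszul_aug_basis reg.env_left_tens)
    then show "u \<in> koszul_aug ` carrier (FE 0)" using c by (metis imageI)
  qed (use koszul_aug_closed in auto)
  show "{x \<in> carrier (FE 0). koszul_aug x = \<zero>\<^bsub>UM\<^esub>} = koszul_diff 0 ` carrier (FE 1)"
  proof (intro equalityI subsetI)
    fix x assume "x \<in> {x \<in> carrier (FE 0). koszul_aug x = \<zero>\<^bsub>UM\<^esub>}"
    then have x: "x \<in> carrier (FE 0)" "koszul_aug x = \<zero>\<^bsub>U\<^esub>" by auto
    have e: "keys (ext_gen {}) \<subseteq> koszul_basis" using ext_gen_closed[of "{}" 0] by (simp add: ind_0)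
    have z: "collapse (theta 0 x) = 0"
      using K.left_add_scalar[of "\<zero>\<^bsub>U\<^esub>" "\<zero>\<^bsub>U\<^esub>" "ext_gen {}"] e by (simp add: collapse_theta x)
    obtain w where "keys (theta 0 x) \<subseteq> basis_set V 0 w" using chain_basis_set[OF theta_keys[OF x(1)]] .
    \<comment> \<open>Modulo a boundary only terms with all variables on the right remain. The
      boundary and \<open>theta 0 x\<close> both collapse to zero, so by \<open>collapse_inj\<close>
      no such term is left.\<close>
    from koszul_reduce[OF finite_V this]
    obtain y where y: "keys y \<subseteq> basis_set V 1 w" "keys (theta 0 x - koszul y) \<subseteq> {({#}, {}, \<beta>) |\<beta>. set_mset \<beta> \<subseteq> V}"
      by blast
    have yc: "keys y \<subseteq> chain_basis 1" using y(1) basis_set_chain by blast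
    have "collapse (theta 0 x - koszul y) = 0"
      using z collapse_koszul[OF yc] by (simp add: collapse_def lin_diff)
    from collapse_inj[OF y(2) this] have ty: "theta 0 x = koszul y" by simp
    obtain y' where y': "y' \<in> carrier (FE 1)" "theta 1 y' = y" using theta_surj[OF yc] by blast
    have "theta 0 (koszul_diff 0 y') = theta 0 x"
      using theta_koszul_diff[of y' 0] y' ty by simp
    from theta_inj[OF koszul_diff_closed[of y' 0] x(1) this] y'(1)
    show "x \<in> koszul_diff 0 ` carrier (FE 1)" by auto
  next
    fix x assume "x \<in> koszul_diff 0 ` carrier (FE 1)"
    then show "x \<in> {x \<in> carrier (FE 0). koszul_aug x = \<zero>\<^bsub>UM\<^esub>}"
      using koszul_aug_diff koszul_diff_closed[of _ 0] by auto
  qed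
qed

end

section \<open>The complexes for homology and cohomology, and their duality\<close>

subsection \<open>The Koszul complex with coefficients\<close>

lemma finsum_free_module:
  assumes R: "ring R" and f: "f \<in> S \<rightarrow> carrier (free_module R I)"
  shows "(\<Oplus>\<^bsub>free_module R I\<^esub>s\<in>S. f s) j = (\<Oplus>\<^bsub>R\<^esub>s\<in>S. f s j)"
proof -
  interpret R: ring R by fact
  interpret F: left_module R "free_module R I" by (rule left_module_free_module[OF R])
  note val = free_module_val[OF R]
  show ?thesis
    using f
  proof (induction S rule: infinite_finite_induct)
    case (insert s S)
    then have "f t j \<in> carrier R" if "t \<in> insert s S" for t
      using that by (intro val[of "f t"]) auto
    with insert show ?case
      by (subst F.M.finsum_insert) (auto simp: free_module_simps(3) R.finsum_insert)
  qed (simp_all add: free_module_simps(2))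
qed

text \<open>\<open>finsum\<close> takes the whole record as its argument. Sums in
  \<open>env_left\<close> and \<open>env_right\<close> are moved to \<open>U\<close>, whose additive
  structure they share.\<close>

lemma finsum_structure_cong:
  assumes "abelian_group G" "abelian_group H"
    and eq: "carrier H = carrier G" "\<zero>\<^bsub>H\<^esub> = \<zero>\<^bsub>G\<^esub>" "\<And>x y. x \<oplus>\<^bsub>H\<^esub> y = x \<oplus>\<^bsub>G\<^esub> y"
    and f: "f \<in> S \<rightarrow> carrier G"
  shows "finsum H f S = finsum G f S"
proof -
  interpret G: abelian_group G by fact
  interpret H: abelian_group H by fact
  show ?thesis
    using f by (induction S rule: infinite_finite_induct) (auto simp: eq)
qed

context quantum
begin

text \<open>\<open>left_coeff\<close> and \<open>right_coeff\<close> are the coefficients of v_i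
  \<otimes> 1 and of 1 \<otimes> v_i in \<open>koszul_coeff\<close>, the minus sign of the
  differential belonging to the second.\<close>

definition left_coeff :: "nat \<Rightarrow> nat set \<Rightarrow> complex"
  where "left_coeff i I = eps i I / chi {#i#} (mset_set (I - {i}))"

definition right_coeff :: "nat \<Rightarrow> nat set \<Rightarrow> complex"
  where "right_coeff i I = - eps i I / chi (mset_set (I - {i})) {#i#}"

lemma koszul_coeff_eq:
  "koszul_coeff i I = tens U (left_coeff i I \<odot>\<^bsub>U\<^esub> gen i) \<one>\<^bsub>U\<^esub> \<oplus>\<^bsub>E\<^esub> tens U \<one>\<^bsub>U\<^esub> (right_coeff i I \<odot>\<^bsub>U\<^esub> gen i)"
  by (simp add: koszul_coeff_def left_coeff_def right_coeff_def)

lemma koszul_coeff_UM: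
  assumes "i \<in> V" "u \<in> carrier U"
  shows "koszul_coeff i I \<odot>\<^bsub>UM\<^esub> u = left_coeff i I \<odot>\<^bsub>U\<^esub> (gen i \<otimes>\<^bsub>U\<^esub> u) \<oplus>\<^bsub>U\<^esub> right_coeff i I \<odot>\<^bsub>U\<^esub> (u \<otimes>\<^bsub>U\<^esub> gen i)"
proof -
  interpret UMm: left_module E UM by (rule UM_module)
  show ?thesis
    using assms unfolding koszul_coeff_eq
    by (subst UMm.lsmult_l_distr) (simp_all add: reg.env_left_tens smult_mult)
qed

lemma finsum_UM: "f \<in> S \<rightarrow> carrier U \<Longrightarrow> finsum UM f S = finsum U f S"
  by (rule finsum_structure_cong[OF A.abelian_group_axioms left_module.axioms(2)[OF UM_module]]) simp_all

lemma koszul_boundary_val: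
  assumes "I \<in> ind (Suc k)"
  shows "koszul_boundary k I I' = (\<Oplus>\<^bsub>E\<^esub>i\<in>I. if I - {i} = I' then koszul_coeff i I else \<zero>\<^bsub>E\<^esub>)"
proof -
  have IV: "i \<in> V" if "i \<in> I" for i using assms that by (auto simp: ind_def)
  interpret FEk: left_module E "FE k" by (rule FE_module)
  have cl: "koszul_coeff i I \<odot>\<^bsub>FE k\<^esub> basis_vec E (I - {i}) \<in> carrier (FE k)" if "i \<in> I" for i
    using IV[OF that] by (intro FEk.lsmult_closed basis_vec_closed[OF ring_E ind_remove[OF assms that]]) simp
  have "koszul_boundary k I I' = (\<Oplus>\<^bsub>E\<^esub>i\<in>I. (koszul_coeff i I \<odot>\<^bsub>FE k\<^esub> basis_vec E (I - {i})) I')"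
    unfolding koszul_boundary_def by (rule finsum_free_module[OF ring_E]) (use cl in auto)
  also have "\<dots> = (\<Oplus>\<^bsub>E\<^esub>i\<in>I. if I - {i} = I' then koszul_coeff i I else \<zero>\<^bsub>E\<^esub>)"
    by (rule E.A.finsum_cong') (use IV in \<open>auto simp: free_module_simps(4) basis_vec_def\<close>)
  finally show ?thesis .
qed

text \<open>Only the removal of \<open>i\<close> itself leads from \<open>insert i I'\<close> back
  to \<open>I'\<close>, so a single term of the boundary contributes.\<close>

lemma koszul_boundary_insert:
  assumes "I' \<in> ind k" "i \<in> V" "i \<notin> I'"
  shows "koszul_boundary k (insert i I') I' = koszul_coeff i (insert i I')"
proof -
  have I': "finite I'" "I' \<subseteq> V" using ind_finite[OF assms(1)] assms(1) by (auto simp: ind_def)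
  have I: "insert i I' \<in> ind (Suc k)" using assms I' by (auto simp: ind_def)
  have e: "insert i I' - {j} = I' \<longleftrightarrow> i = j" if "j \<in> insert i I'" for j using that assms(3) by auto
  have "koszul_boundary k (insert i I') I' = (\<Oplus>\<^bsub>E\<^esub>j\<in>insert i I'. if i = j then koszul_coeff j (insert i I') else \<zero>\<^bsub>E\<^esub>)"
    unfolding koszul_boundary_val[OF I] by (rule E.A.finsum_cong') (use e assms I' in auto)
  also have "\<dots> = koszul_coeff i (insert i I')"
    by (rule E.A.finsum_singleton) (use assms I' in auto)
  finally show ?thesis .
qed

lemma koszul_boundary_zero:
  assumes "I \<in> ind (Suc k)" "\<And>i. i \<in> I \<Longrightarrow> I - {i} \<noteq> I'"
  shows "koszul_boundary k I I' = \<zero>\<^bsub>E\<^esub>"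
  unfolding koszul_boundary_val[OF assms(1)]
  by (rule E.A.add.finprod_one_eqI) (use assms(2) in auto)

lemma copower_koszul:
  assumes m: "m \<in> carrier (power_module E UM (ind k))" and I: "I \<in> ind (Suc k)"
  shows "copower_map UM E (ind k) (ind (Suc k)) (koszul_diff k) m I =
    (\<Oplus>\<^bsub>U\<^esub>i\<in>I. left_coeff i I \<odot>\<^bsub>U\<^esub> (gen i \<otimes>\<^bsub>U\<^esub> m (I - {i})) \<oplus>\<^bsub>U\<^esub> right_coeff i I \<odot>\<^bsub>U\<^esub> (m (I - {i}) \<otimes>\<^bsub>U\<^esub> gen i))"
proof -
  have mc: "m I' \<in> carrier U" if "I' \<in> ind k" for I' using m that by (simp add: power_module_simps)
  have IV: "i \<in> V" if "i \<in> I" for i using I that by (auto simp: ind_def)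
  interpret FEk: left_module E "FE k" by (rule FE_module)
  have b: "basis_vec E (I - {i}) \<in> carrier (FE k)" if "i \<in> I" for i
    by (rule basis_vec_closed[OF ring_E ind_remove[OF I that]])
  have L: "linear_map E (FE k) UM (lin_comb UM (ind k) m)"
    by (rule lin_comb_linear[OF ring_E UM_module]) (use mc in auto)
  have "copower_map UM E (ind k) (ind (Suc k)) (koszul_diff k) m I = lin_comb UM (ind k) m (koszul_boundary k I)"
    by (simp add: copower_map_def I koszul_diff_basis)
  also have "\<dots> = (\<Oplus>\<^bsub>UM\<^esub>i\<in>I. lin_comb UM (ind k) m (koszul_coeff i I \<odot>\<^bsub>FE k\<^esub> basis_vec E (I - {i})))"
    unfolding koszul_boundary_def
    by (rule linear_map_finsum[OF FE_module UM_module L]) (use b IV in auto)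
  also have "\<dots> = (\<Oplus>\<^bsub>U\<^esub>i\<in>I. lin_comb UM (ind k) m (koszul_coeff i I \<odot>\<^bsub>FE k\<^esub> basis_vec E (I - {i})))"
    by (rule finsum_UM) (use b IV linear_map_closed[OF L] in \<open>auto intro!: FEk.lsmult_closed\<close>)
  also have "\<dots> = (\<Oplus>\<^bsub>U\<^esub>i\<in>I. left_coeff i I \<odot>\<^bsub>U\<^esub> (gen i \<otimes>\<^bsub>U\<^esub> m (I - {i})) \<oplus>\<^bsub>U\<^esub> right_coeff i I \<odot>\<^bsub>U\<^esub> (m (I - {i}) \<otimes>\<^bsub>U\<^esub> gen i))"
  proof (rule A.finsum_cong')
    fix i assume i: "i \<in> I"
    have mi: "m (I - {i}) \<in> carrier U" by (rule mc[OF ind_remove[OF I i]])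
    have "lin_comb UM (ind k) m (koszul_coeff i I \<odot>\<^bsub>FE k\<^esub> basis_vec E (I - {i}))
        = koszul_coeff i I \<odot>\<^bsub>UM\<^esub> lin_comb UM (ind k) m (basis_vec E (I - {i}))"
      by (rule linear_map_smult[OF L _ b[OF i]]) (simp add: IV[OF i])
    also have "lin_comb UM (ind k) m (basis_vec E (I - {i})) = m (I - {i})"
      by (rule lin_comb_basis[OF UM_module _ finite_ind ind_remove[OF I i]]) (use mc in auto)
    finally show "lin_comb UM (ind k) m (koszul_coeff i I \<odot>\<^bsub>FE k\<^esub> basis_vec E (I - {i}))
      = left_coeff i I \<odot>\<^bsub>U\<^esub> (gen i \<otimes>\<^bsub>U\<^esub> m (I - {i})) \<oplus>\<^bsub>U\<^esub> right_coeff i I \<odot>\<^bsub>U\<^esub> (m (I - {i}) \<otimes>\<^bsub>U\<^esub> gen i)"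
      by (simp add: koszul_coeff_UM[OF IV[OF i] mi])
  qed (use mc[OF ind_remove[OF I]] IV in auto)
  finally show ?thesis .
qed

end

locale twisted_quantum = quantum +
  fixes \<sigma> :: "(nat list \<Rightarrow> complex) set \<Rightarrow> (nat list \<Rightarrow> complex) set"
  assumes sigma_hom: "\<sigma> \<in> ring_hom U U"
    and sigma_smult: "\<And>c u. u \<in> carrier U \<Longrightarrow> \<sigma> (c \<odot>\<^bsub>U\<^esub> u) = c \<odot>\<^bsub>U\<^esub> \<sigma> u"
    and sigma_gen: "\<And>i. i \<in> V \<Longrightarrow> \<sigma> (gen i) = (\<Prod>j\<in>V. Q j i) \<odot>\<^bsub>U\<^esub> gen i"
begin

abbreviation "p i \<equiv> (\<Prod>j\<in>V. Q j i)"
abbreviation "NM \<equiv> env_right U (twisted_bimodule \<sigma> U)"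

sublocale tw: bimod U "twisted_bimodule \<sigma> U"
  by (rule bimod_twisted[OF U_algebra sigma_hom sigma_smult])

lemma right_NM: "right_module E NM"
  by (intro right_module.intro right_module_axioms.intro E.calgebra_axioms tw.left_module_env_right)

lemma twisted_simps [simp]: "carrier (twisted_bimodule \<sigma> U) = carrier U"
  "left_act (twisted_bimodule \<sigma> U) a b = \<sigma> a \<otimes>\<^bsub>U\<^esub> b" "right_act (twisted_bimodule \<sigma> U) a b = a \<otimes>\<^bsub>U\<^esub> b"
  "\<zero>\<^bsub>twisted_bimodule \<sigma> U\<^esub> = \<zero>\<^bsub>U\<^esub>" "x \<oplus>\<^bsub>twisted_bimodule \<sigma> U\<^esub> y = x \<oplus>\<^bsub>U\<^esub> y"
  by (simp_all add: twisted_bimodule_def)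

lemma finsum_NM: "f \<in> S \<rightarrow> carrier U \<Longrightarrow> finsum NM f S = finsum U f S"
  by (rule finsum_structure_cong[OF A.abelian_group_axioms left_module.axioms(2)[OF tw.left_module_env_right]]) simp_all

text \<open>The right action is n (a \<otimes> b) = b n a, so v_i \<otimes> 1 multiplies from the
  right and 1 \<otimes> v_i from the left, opposite to \<open>koszul_coeff_UM\<close>. The twist of
  the left action contributes the factor \<open>p i\<close>.\<close>

lemma koszul_coeff_NM:
  assumes "i \<in> V" "u \<in> carrier U"
  shows "koszul_coeff i I \<odot>\<^bsub>NM\<^esub> u =
    left_coeff i I \<odot>\<^bsub>U\<^esub> (u \<otimes>\<^bsub>U\<^esub> gen i) \<oplus>\<^bsub>U\<^esub> (right_coeff i I * p i) \<odot>\<^bsub>U\<^esub> (gen i \<otimes>\<^bsub>U\<^esub> u)"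
proof -
  interpret N: right_module E NM by (rule right_NM)
  have s: "\<sigma> (c \<odot>\<^bsub>U\<^esub> gen i) = (c * p i) \<odot>\<^bsub>U\<^esub> gen i" for c
    using assms V.lsmult_assoc[of c "p i" "gen i"] by (simp add: sigma_smult sigma_gen)
  have "tens U (left_coeff i I \<odot>\<^bsub>U\<^esub> gen i) \<one>\<^bsub>U\<^esub> \<odot>\<^bsub>NM\<^esub> u = left_coeff i I \<odot>\<^bsub>U\<^esub> (u \<otimes>\<^bsub>U\<^esub> gen i)"
    "tens U \<one>\<^bsub>U\<^esub> (right_coeff i I \<odot>\<^bsub>U\<^esub> gen i) \<odot>\<^bsub>NM\<^esub> u = (right_coeff i I * p i) \<odot>\<^bsub>U\<^esub> (gen i \<otimes>\<^bsub>U\<^esub> u)"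
    using assms by (simp_all add: tw.env_right_tens s smult_mult ring_hom_one[OF sigma_hom])
  then show ?thesis
    using assms N.N_distr(1)[of "tens U (left_coeff i I \<odot>\<^bsub>U\<^esub> gen i) \<one>\<^bsub>U\<^esub>" "tens U \<one>\<^bsub>U\<^esub> (right_coeff i I \<odot>\<^bsub>U\<^esub> gen i)" u]
    by (simp add: koszul_coeff_eq)
qed

lemma power_koszul:
  assumes x: "x \<in> carrier (power_module E NM (ind (Suc k)))" and I': "I' \<in> ind k"
  shows "power_map E NM (ind (Suc k)) (koszul_diff k) x I' =
    (\<Oplus>\<^bsub>U\<^esub>i\<in>V - I'. left_coeff i (insert i I') \<odot>\<^bsub>U\<^esub> (x (insert i I') \<otimes>\<^bsub>U\<^esub> gen i) \<oplus>\<^bsub>U\<^esub>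
      (right_coeff i (insert i I') * p i) \<odot>\<^bsub>U\<^esub> (gen i \<otimes>\<^bsub>U\<^esub> x (insert i I')))"
proof -
  interpret N: right_module E NM by (rule right_NM)
  have xc: "x I \<in> carrier U" if "I \<in> ind (Suc k)" for I using x that by (simp add: power_module_simps)
  have fI': "finite I'" "I' \<subseteq> V" using ind_finite[OF I'] I' by (auto simp: ind_def)
  have ins: "insert i I' \<in> ind (Suc k)" if "i \<in> V - I'" for i using that I' fI' by (auto simp: ind_def)
  have bc: "koszul_boundary k I I' \<in> carrier E" if "I \<in> ind (Suc k)" for I
    by (rule free_module_val[OF ring_E koszul_boundary_closed[OF that]])
  have act: "z \<odot>\<^bsub>NM\<^esub> u \<in> carrier U" if "z \<in> carrier E" "u \<in> carrier U" for z u
    using N.N_smult_closed[of z u] that by simp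
  let ?h = "\<lambda>i. insert i I'"
  have inj: "inj_on ?h (V - I')" by (auto simp: inj_on_def)
  have "power_map E NM (ind (Suc k)) (koszul_diff k) x I' = (\<Oplus>\<^bsub>U\<^esub>I\<in>ind (Suc k). koszul_diff k (basis_vec E I) I' \<odot>\<^bsub>NM\<^esub> x I)"
    unfolding power_map_def
    by (rule finsum_NM) (use bc xc act in \<open>auto simp: koszul_diff_basis\<close>)
  also have "\<dots> = (\<Oplus>\<^bsub>U\<^esub>I\<in>ind (Suc k). koszul_boundary k I I' \<odot>\<^bsub>NM\<^esub> x I)"
    by (rule A.finsum_cong') (use bc xc act in \<open>auto simp: koszul_diff_basis\<close>)
  \<comment> \<open>The boundary of an index set has a component at \<open>I'\<close> only if the
    set arises from \<open>I'\<close> by adding one element; these sets are then parametrised by the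
    added element.\<close>
  also have "\<dots> = (\<Oplus>\<^bsub>U\<^esub>I\<in>?h ` (V - I'). koszul_boundary k I I' \<odot>\<^bsub>NM\<^esub> x I)"
  proof (rule A.add.finprod_mono_neutral_cong_right)
    fix I assume I: "I \<in> ind (Suc k) - ?h ` (V - I')"
    have "I - {i} \<noteq> I'" if "i \<in> I" for i
    proof
      assume "I - {i} = I'"
      then have "I = insert i I'" "i \<in> V - I'" using that I by (auto simp: ind_def)
      then show False using I by blast
    qed
    then show "koszul_boundary k I I' \<odot>\<^bsub>NM\<^esub> x I = \<zero>\<^bsub>U\<^esub>"
      using I xc[of I] N.N_simps(2)[of "x I"] by (simp add: koszul_boundary_zero)
  qed (use ins bc xc act in auto)
  also have "\<dots> = (\<Oplus>\<^bsub>U\<^esub>i\<in>V - I'. koszul_boundary k (?h i) I' \<odot>\<^bsub>NM\<^esub> x (?h i))"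
    by (rule A.finsum_reindex[OF _ inj]) (use ins bc xc act in auto)
  also have "\<dots> = (\<Oplus>\<^bsub>U\<^esub>i\<in>V - I'. left_coeff i (insert i I') \<odot>\<^bsub>U\<^esub> (x (insert i I') \<otimes>\<^bsub>U\<^esub> gen i) \<oplus>\<^bsub>U\<^esub>
      (right_coeff i (insert i I') * p i) \<odot>\<^bsub>U\<^esub> (gen i \<otimes>\<^bsub>U\<^esub> x (insert i I')))"
    by (rule A.finsum_cong') (use xc[OF ins] in \<open>auto simp: koszul_boundary_insert[OF I'] koszul_coeff_NM\<close>)
  finally show ?thesis .
qed

end

subsection \<open>Duality\<close>

text \<open>A chain isomorphism reversing degrees, available in degrees 0 to \<open>n\<close>. The
  assumption \<open>top\<close> supplies the two ends: every element of \<open>W n\<close> is a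
  cocycle, as every element of \<open>V 0\<close> is a cycle, and no nonzero boundary reaches
  \<open>V n\<close>, as none reaches \<open>W 0\<close>.\<close>

lemma homology_cohomology_duality:
  assumes V: "\<And>k. left_module complex_field (V k)" and W: "\<And>k. left_module complex_field (W k)"
    and d: "\<And>k. linear_map complex_field (V (Suc k)) (V k) (d k)"
    and D: "\<And>k. linear_map complex_field (W k) (W (Suc k)) (D k)"
    and dd: "\<And>k x. x \<in> carrier (V (Suc (Suc k))) \<Longrightarrow> d k (d (Suc k) x) = \<zero>\<^bsub>V k\<^esub>"
    and f: "\<And>k. k \<le> n \<Longrightarrow> linear_map complex_field (V k) (W (n - k)) (f k)"
    and g: "\<And>k. k \<le> n \<Longrightarrow> linear_map complex_field (W (n - k)) (V k) (g k)"
    and gf: "\<And>k x. k \<le> n \<Longrightarrow> x \<in> carrier (V k) \<Longrightarrow> g k (f k x) = x"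
    and fg: "\<And>k y. k \<le> n \<Longrightarrow> y \<in> carrier (W (n - k)) \<Longrightarrow> f k (g k y) = y"
    and fd: "\<And>k x. k < n \<Longrightarrow> x \<in> carrier (V (Suc k)) \<Longrightarrow> D (n - Suc k) (f (Suc k) x) = f k (d k x)"
    and top: "carrier (V (Suc n)) \<subseteq> {\<zero>\<^bsub>V (Suc n)\<^esub>}" "carrier (W (Suc n)) \<subseteq> {\<zero>\<^bsub>W (Suc n)\<^esub>}"
    and k: "k \<le> n"
  shows "module_iso complex_field (homology V d k) (cohomology W D (n - k))"
proof -
  let ?Z = "{x \<in> carrier (V k). case k of 0 \<Rightarrow> True | Suc j \<Rightarrow> d j x = \<zero>\<^bsub>V j\<^esub>}"
  let ?B = "d k ` carrier (V (Suc k))"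
  let ?Z' = "{x \<in> carrier (W (n - k)). D (n - k) x = \<zero>\<^bsub>W (Suc (n - k))\<^esub>}"
  let ?B' = "case n - k of 0 \<Rightarrow> {\<zero>\<^bsub>W 0\<^esub>} | Suc j \<Rightarrow> D j ` carrier (W j)"
  interpret Vk: left_module complex_field "V k" by (rule V)
  interpret Wk: left_module complex_field "W (n - k)" by (rule W)
  note fk = linear_map_closed[OF f[OF k]] and gk = linear_map_closed[OF g[OF k]]
  have Z: "submodule ?Z complex_field (V k)"
  proof (cases k)
    case 0
    have "submodule (carrier (V k)) complex_field (V k)" by (rule Vk.submodule_leftI) auto
    then show ?thesis using 0 by simp
  next
    case (Suc j)
    then show ?thesis using linear_map_kernel_submodule[OF V V d[of j]] by simp
  qed
  have B: "submodule ?B complex_field (V k)" by (rule linear_map_image_submodule[OF V V d])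
  have BZ: "?B \<subseteq> ?Z" using linear_map_closed[OF d] by (cases k) (auto simp: dd)
  have Z': "submodule ?Z' complex_field (W (n - k))" by (rule linear_map_kernel_submodule[OF W W D])
  have B': "submodule ?B' complex_field (W (n - k))"
  proof (cases "n - k")
    case 0
    have "submodule {\<zero>\<^bsub>W (n - k)\<^esub>} complex_field (W (n - k))"
      by (rule Wk.submodule_leftI) (auto simp: Wk.lsmult_r_null)
    then show ?thesis using 0 by simp
  next
    case (Suc j)
    then show ?thesis using linear_map_image_submodule[OF W W D[of j]] by simp
  qed
  have fZ: "f k x \<in> ?Z' \<longleftrightarrow> x \<in> ?Z" if x: "x \<in> carrier (V k)" for x
  proof (cases k)
    case 0
    have "D n (f k x) = \<zero>\<^bsub>W (Suc n)\<^esub>"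
      using linear_map_closed[OF D, of "f k x" n] fk[OF x] top(2) 0 by auto
    then show ?thesis using 0 fk[OF x] x by auto
  next
    case (Suc j)
    \<comment> \<open>Degree \<open>j\<close> of \<open>V\<close> corresponds to degree
      \<open>Suc (n - k)\<close> of \<open>W\<close>, the target of \<open>D (n - k)\<close>; so the
      two differentials match.\<close>
    then have j: "j < n" "j \<le> n" "n - j = Suc (n - k)" using k by auto
    have dx: "d j x \<in> carrier (V j)" using linear_map_closed[OF d, of x j] x Suc by simp
    have "D (n - k) (f k x) = f j (d j x)" using fd[OF j(1), of x] x Suc by simp
    moreover have "f j (d j x) = \<zero>\<^bsub>W (n - j)\<^esub> \<longleftrightarrow> d j x = \<zero>\<^bsub>V j\<^esub>"
      using gf[OF j(2) dx] linear_map_zero[OF V W f[OF j(2)]] linear_map_zero[OF W V g[OF j(2)]] by auto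
    ultimately show ?thesis using Suc fk[OF x] x j(3) by simp
  qed
  have fB: "f k ` ?B = ?B'"
  proof (cases "n - k")
    case 0
    then have kn: "k = n" using k by simp
    interpret Vn: left_module complex_field "V (Suc n)" by (rule V)
    have "carrier (V (Suc n)) = {\<zero>\<^bsub>V (Suc n)\<^esub>}" using top(1) Vn.M.zero_closed by blast
    then show ?thesis
      using linear_map_zero[OF V V d[of n]] linear_map_zero[OF V W f[OF k]] by (simp add: kn)
  next
    case (Suc j)
    then have j: "k < n" "Suc k \<le> n" "n - Suc k = j" using k by auto
    have "f k ` ?B = (\<lambda>x. D j (f (Suc k) x)) ` carrier (V (Suc k))"
      using fd[OF j(1)] j(3) by (simp add: image_image)
    also have "\<dots> = D j ` (f (Suc k) ` carrier (V (Suc k)))" by (simp add: image_image)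
    also have "f (Suc k) ` carrier (V (Suc k)) = carrier (W j)"
      using linear_map_closed[OF f[OF j(2)]] linear_map_closed[OF g[OF j(2)]] fg[OF j(2)] j(3) by force
    finally show ?thesis using Suc by simp
  qed
  have Zc: "?Z \<subseteq> carrier (V k)" "?Z' \<subseteq> carrier (W (n - k))" by auto
  \<comment> \<open>That coboundaries are cocycles is transported from \<open>V\<close> through
    \<open>fB\<close> and \<open>fZ\<close>.\<close>
  have B'Z: "?B' \<subseteq> ?Z'" unfolding fB[symmetric] using fZ BZ Zc by blast
  show ?thesis
    unfolding homology_def cohomology_def
  proof (rule module_iso_subquot[OF V Z B BZ W Z' B' B'Z f[OF k] _ _ g[OF k]])
    show "f k x \<in> ?Z'" if "x \<in> ?Z" for x using fZ that Zc by blast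
    show "f k x \<in> ?B'" if "x \<in> ?B" for x using fB that by blast
    show "g k y \<in> ?Z" if y: "y \<in> ?Z'" for y
    proof -
      have yc: "y \<in> carrier (W (n - k))" using y by blast
      have "f k (g k y) \<in> ?Z'" unfolding fg[OF k yc] by (rule y)
      then show ?thesis unfolding fZ[OF gk[OF yc]] .
    qed
    show "g k y \<in> ?B" if y: "y \<in> ?B'" for y
    proof -
      obtain x where x: "x \<in> ?B" "y = f k x" using y unfolding fB[symmetric] by (rule imageE)
      have "x \<in> carrier (V k)" using x(1) BZ by blast
      from gf[OF k this] show ?thesis using x by (simp only:)
    qed
    show "x \<ominus>\<^bsub>V k\<^esub> g k (f k x) \<in> ?B" if x: "x \<in> ?Z" for x
    proof -
      have xc: "x \<in> carrier (V k)" using x by blast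
      have "x \<ominus>\<^bsub>V k\<^esub> x = \<zero>\<^bsub>V k\<^esub>" using xc by (simp add: Vk.minus_eq_zero_iff)
      then show ?thesis unfolding gf[OF k xc] using Vk.submodule_leftD(2)[OF B] by (simp only:)
    qed
    show "y \<ominus>\<^bsub>W (n - k)\<^esub> f k (g k y) \<in> ?B'" if y: "y \<in> ?Z'" for y
    proof -
      have yc: "y \<in> carrier (W (n - k))" using y by blast
      have "y \<ominus>\<^bsub>W (n - k)\<^esub> y = \<zero>\<^bsub>W (n - k)\<^esub>" using yc by (simp add: Wk.minus_eq_zero_iff)
      then show ?thesis unfolding fg[OF k yc] using Wk.submodule_leftD(2)[OF B'] by (simp only:)
    qed
  qed
qed

lemma singleton_module_iso:
  assumes "left_module R X'" "left_module R Y" "carrier X' \<subseteq> {a}" "carrier Y \<subseteq> {b}"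
  shows "module_iso R X' Y"
proof -
  interpret X': left_module R X' by fact
  interpret Y: left_module R Y by fact
  have c: "carrier X' = {\<zero>\<^bsub>X'\<^esub>}" "carrier Y = {\<zero>\<^bsub>Y\<^esub>}"
    using assms X'.M.zero_closed Y.M.zero_closed by blast+
  show ?thesis
    by (rule module_isoI[of _ _ _ "\<lambda>_. \<zero>\<^bsub>Y\<^esub>" "\<lambda>_. \<zero>\<^bsub>X'\<^esub>"])
      (use assms c in \<open>auto intro!: linear_mapI simp: X'.lsmult_r_null Y.lsmult_r_null\<close>)
qed

lemma quot_module_singleton: "carrier E \<subseteq> {a} \<Longrightarrow> \<exists>b. carrier (quot_module E W) \<subseteq> {b}"
  unfolding quot_module_simps by blast

lemma left_module_zero_subspace:
  assumes "left_module complex_field E"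
  shows "left_module complex_field (zero_subspace E)"
proof -
  interpret E: left_module complex_field E by fact
  show ?thesis
    unfolding zero_subspace_def
    by (rule E.left_module_sub, rule E.submodule_leftI) (auto simp: E.lsmult_r_null)
qed

lemma (in right_module) power_map_power_map:
  assumes t: "linear_map A (free_module A I) (free_module A I') t"
    and t': "linear_map A (free_module A I') (free_module A I'') t'"
    and fin: "finite I" "finite I'" and tt: "\<And>x. x \<in> carrier (free_module A I) \<Longrightarrow> t' (t x) = \<zero>\<^bsub>free_module A I''\<^esub>"
    and x: "x \<in> carrier (power_module A N I)"
  shows "power_map A N I' t' (power_map A N I t x) = \<zero>\<^bsub>power_module A N I''\<^esub>"
proof (rule power_module_ext[OF fin(1) left_module_power_right
      linear_map_compose[OF power_map_linear[OF t] power_map_linear[OF t']] _ _ x])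
  interpret P: left_module complex_field "power_module A N I''" by (rule left_module_power_right)
  show "linear_map complex_field (power_module A N I) (power_module A N I'') (\<lambda>_. \<zero>\<^bsub>power_module A N I''\<^esub>)"
    using P.lsmult_r_null by (auto intro!: linear_mapI)
  fix n i assume n: "n \<in> carrier N" and i: "i \<in> I"
  have b: "basis_vec A i \<in> carrier (free_module A I)" by (rule basis_vec_closed[OF A.ring_axioms i])
  show "power_map A N I' t' (power_map A N I t (pairing N n (basis_vec A i))) = \<zero>\<^bsub>power_module A N I''\<^esub>"
    unfolding power_map_pairing[OF t fin(1) n b] power_map_pairing[OF t' fin(2) n linear_map_closed[OF t b]] tt[OF b]
    by (rule pairing_zero[OF n])
qed

text \<open>The indices of \<open>W\<close> below \<open>i\<close> split into those in
  \<open>S\<close> and those outside it; inserting \<open>i\<close> changes neither count, as only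
  smaller indices matter.\<close>

lemma eps_complement:
  assumes "finite W" "S \<subseteq> W" "i \<in> S"
  shows "eps i S * eps i (insert i (W - S)) = eps i W"
proof -
  have "{j \<in> W. j < i} = {j \<in> S. j < i} \<union> {j \<in> insert i (W - S). j < i}" using assms by auto
  moreover have "{j \<in> S. j < i} \<inter> {j \<in> insert i (W - S). j < i} = {}" using assms by auto
  moreover have "finite {j \<in> S. j < i}" "finite {j \<in> insert i (W - S). j < i}"
    using assms finite_subset[OF assms(2,1)] by auto
  ultimately have "card {j \<in> W. j < i} = card {j \<in> S. j < i} + card {j \<in> insert i (W - S). j < i}"
    by (metis card_Un_disjoint)
  then show ?thesis by (simp add: eps_def power_add)
qed

context quantum
begin

text \<open>Determined up to a common factor by the first equation of \<open>dual_coeff_step\<close>; the second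
  one then holds because of the twist by the \<open>p\<^sub>i\<close>.\<close>

definition dual_coeff :: "nat set \<Rightarrow> complex"
  where "dual_coeff S = (\<Prod>j\<in>S. - eps j V * chi {#j#} (mset_set V)) / chi (mset_set S) (mset_set S)"

lemma dual_coeff_nonzero [simp]: "finite S \<Longrightarrow> dual_coeff S \<noteq> 0"
  by (simp add: dual_coeff_def)

text \<open>The product over \<open>j\<close> of \<open>q j i = Q j i * q i j\<close>. Through this
  identity the automorphism enters the duality: its eigenvalue at v_i measures the asymmetry of
  \<open>chi\<close> between v_i and the product of all generators.\<close>

lemma twist_chi: "i \<in> V \<Longrightarrow> (\<Prod>j\<in>V. Q j i) * chi {#i#} (mset_set V) = chi (mset_set V) {#i#}"
  using q_Q[of _ i] by (simp add: chi_def V_def flip: prod_unfold_prod_mset prod.distrib)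

lemma chi_self: "i \<in> V \<Longrightarrow> chi {#i#} {#i#} = 1"
  by (simp add: chi_def q_def)

text \<open>These equations make \<open>dual\<close> a chain map; they compare the coefficients of x
  v_i and of v_i x. Splitting \<open>V\<close> into {i}, S - {i} and V - S expresses every factor by
  A, B, C and D. The first equation amounts to the recursion for \<open>dual_coeff\<close> along
  \<open>S\<close>; the second needs in addition p A C = B D, which is
  \<open>twist_chi\<close>.\<close>

lemma dual_coeff_step:
  assumes S: "S \<subseteq> V" "i \<in> S"
  shows "dual_coeff S * left_coeff i (insert i (V - S)) = dual_coeff (S - {i}) * right_coeff i S"
    and "dual_coeff S * (right_coeff i (insert i (V - S)) * (\<Prod>j\<in>V. Q j i)) = dual_coeff (S - {i}) * left_coeff i S"
proof -
  define A where "A = chi {#i#} (mset_set (S - {i}))"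
  define B where "B = chi (mset_set (S - {i})) {#i#}"
  define C where "C = chi {#i#} (mset_set (V - S))"
  define D where "D = chi (mset_set (V - S)) {#i#}"
  define e where "e = eps i S"
  define f where "f = eps i (insert i (V - S))"
  define p where "p = (\<Prod>j\<in>V. Q j i)"
  note defs = A_def B_def C_def D_def e_def f_def p_def
  have nz: "A \<noteq> 0" "B \<noteq> 0" "C \<noteq> 0" "D \<noteq> 0" by (simp_all add: defs)
  have fS: "finite S" by (rule finite_subset[OF S(1)]) simp
  have iV: "i \<in> V" using S by auto
  have ii: "chi {#i#} {#i#} = 1" by (rule chi_self[OF iV])
  have mS: "mset_set S = add_mset i (mset_set (S - {i}))"
    using mset_set.remove[OF fS S(2)] by simp
  have "V = S \<union> (V - S)" using S by auto
  then have mV: "mset_set V = mset_set S + mset_set (V - S)"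
    using mset_set_Union[OF fS, of "V - S"] by simp
  define M where "M = mset_set (S - {i})"
  have iS: "chi {#i#} (add_mset i M) = A" "chi (add_mset i M) {#i#} = B" "chi (add_mset i M) M = A * chi M M"
    using chi_add_mset(2)[of "{#i#}" i M] chi_add_mset(1)[of i M "{#i#}"] chi_add_mset(1)[of i M M]
    by (simp_all add: ii A_def B_def M_def)
  have chiV: "chi {#i#} (mset_set V) = A * C" "chi (mset_set V) {#i#} = B * D"
    unfolding mV mS chi_add by (simp_all add: iS C_def D_def flip: M_def)
  have p: "p * (A * C) = B * D" using twist_chi[OF iV] by (simp add: chiV p_def)
  have ef: "eps i V = e * f" using eps_complement[OF finite_V S] by (simp add: defs)
  have ff: "f * f = 1" by (simp add: f_def)
  have SS: "chi (mset_set S) (mset_set S) = chi (mset_set (S - {i})) (mset_set (S - {i})) * (A * B)"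
    using chi_add_mset(2)[of "add_mset i M" i M] by (simp add: mS iS ac_simps flip: M_def)
  \<comment> \<open>After cancelling A the ratio of the two dual coefficients is - e f C / B, as the
    first equation requires.\<close>
  have d: "dual_coeff S = dual_coeff (S - {i}) * (- (e * f) * (A * C)) / (A * B)"
    unfolding dual_coeff_def prod.remove[OF fS S(2)] SS chiV(1) ef by (simp add: field_simps)
  have ins: "insert i (V - S) - {i} = V - S" using S by auto
  have lc: "left_coeff i (insert i (V - S)) = f / C" "right_coeff i (insert i (V - S)) = - f / D"
    "left_coeff i S = e / A" "right_coeff i S = - e / B"
    by (simp_all add: left_coeff_def right_coeff_def ins defs)
  show "dual_coeff S * left_coeff i (insert i (V - S)) = dual_coeff (S - {i}) * right_coeff i S"
    unfolding lc d using nz ff by (simp add: field_simps)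
  have p': "p = B * D / (A * C)" using p nz by (simp add: field_simps)
  show "dual_coeff S * (right_coeff i (insert i (V - S)) * (\<Prod>j\<in>V. Q j i)) = dual_coeff (S - {i}) * left_coeff i S"
    unfolding lc d p_def[symmetric] p' using nz ff by (simp add: field_simps)
qed

end

context twisted_quantum
begin

text \<open>A Hodge star: cochains of degree \<open>m\<close> are read off from chains of degree n -
  m at complementary index sets, with the scalars \<open>dual_coeff\<close>; \<open>codual\<close>
  undoes it.\<close>

definition dual where
  "dual m x = (\<lambda>S. if S \<in> ind m then dual_coeff S \<odot>\<^bsub>U\<^esub> x (V - S) else \<zero>\<^bsub>U\<^esub>)"

definition codual where
  "codual k y = (\<lambda>I. if I \<in> ind k then (1 / dual_coeff (V - I)) \<odot>\<^bsub>U\<^esub> y (V - I) else \<zero>\<^bsub>U\<^esub>)"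

lemma card_V: "card V = n"
  by (simp add: V_def)

lemma ind_complement: "k \<le> n \<Longrightarrow> S \<subseteq> V \<Longrightarrow> V - S \<in> ind k \<longleftrightarrow> S \<in> ind (n - k)"
  using finite_subset[OF _ finite_V, of S] card_mono[OF finite_V, of S] by (auto simp: ind_def card_Diff_subset card_V)

lemma ind_subset: "S \<in> ind k \<Longrightarrow> S \<subseteq> V"
  by (simp add: ind_def)

lemma ind_top: "n < k \<Longrightarrow> ind k = {}"
  using card_mono[OF finite_V] by (auto simp: ind_def card_V) (meson leD)

text \<open>In a power module the scalars act through the unit of \<open>E\<close>. On both
  bimodules this is the scalar multiplication of \<open>U\<close>, on the twisted one because
  \<sigma> fixes the unit.\<close>

lemma power_NM_smult:
  "x \<in> carrier (power_module E NM (ind k)) \<Longrightarrow> c \<odot>\<^bsub>power_module E NM (ind k)\<^esub> x = (\<lambda>I. c \<odot>\<^bsub>U\<^esub> x I)"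
  and power_UM_smult:
  "y \<in> carrier (power_module E UM (ind k)) \<Longrightarrow> c \<odot>\<^bsub>power_module E UM (ind k)\<^esub> y = (\<lambda>I. c \<odot>\<^bsub>U\<^esub> y I)"
proof -
  have s: "E.scal c = tens U (c \<odot>\<^bsub>U\<^esub> \<one>\<^bsub>U\<^esub>) \<one>\<^bsub>U\<^esub>" by (simp add: tens_one tens_smult(1))
  have "E.scal c \<odot>\<^bsub>NM\<^esub> u = c \<odot>\<^bsub>U\<^esub> u" "E.scal c \<odot>\<^bsub>UM\<^esub> u = c \<odot>\<^bsub>U\<^esub> u" if "u \<in> carrier U" for u
    using that by (simp_all add: s tw.env_right_tens reg.env_left_tens ring_hom_one[OF sigma_hom] scal_mult)
  moreover have "x I \<in> carrier U" if "x \<in> carrier (power_module E NM (ind k))" for x I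
    using that by (cases "I \<in> ind k") (simp_all add: power_module_simps)
  moreover have "y I \<in> carrier U" if "y \<in> carrier (power_module E UM (ind k))" for y I
    using that by (cases "I \<in> ind k") (simp_all add: power_module_simps)
  ultimately show "x \<in> carrier (power_module E NM (ind k)) \<Longrightarrow> c \<odot>\<^bsub>power_module E NM (ind k)\<^esub> x = (\<lambda>I. c \<odot>\<^bsub>U\<^esub> x I)"
    "y \<in> carrier (power_module E UM (ind k)) \<Longrightarrow> c \<odot>\<^bsub>power_module E UM (ind k)\<^esub> y = (\<lambda>I. c \<odot>\<^bsub>U\<^esub> y I)"
    by (simp_all only: power_module_simps(4))
qed

lemma power_NM: "x \<in> carrier (power_module E NM (ind k)) \<longleftrightarrow> (\<forall>I\<in>ind k. x I \<in> carrier U) \<and> (\<forall>I. I \<notin> ind k \<longrightarrow> x I = \<zero>\<^bsub>U\<^esub>)"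
  and power_UM: "x \<in> carrier (power_module E UM (ind k)) \<longleftrightarrow> (\<forall>I\<in>ind k. x I \<in> carrier U) \<and> (\<forall>I. I \<notin> ind k \<longrightarrow> x I = \<zero>\<^bsub>U\<^esub>)"
  by (simp_all add: power_module_simps)

lemma power_add:
  "x \<oplus>\<^bsub>power_module E NM (ind k)\<^esub> y = (\<lambda>I. x I \<oplus>\<^bsub>U\<^esub> y I)"
  "x \<oplus>\<^bsub>power_module E UM (ind k)\<^esub> y = (\<lambda>I. x I \<oplus>\<^bsub>U\<^esub> y I)"
  by (simp_all add: power_module_simps)

lemma smult_distrib: "u \<in> carrier U \<Longrightarrow> v \<in> carrier U \<Longrightarrow> c \<odot>\<^bsub>U\<^esub> (u \<oplus>\<^bsub>U\<^esub> v) = c \<odot>\<^bsub>U\<^esub> u \<oplus>\<^bsub>U\<^esub> c \<odot>\<^bsub>U\<^esub> v"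
  using V.lsmult_r_distr by simp

lemma smult_smult: "u \<in> carrier U \<Longrightarrow> c \<odot>\<^bsub>U\<^esub> (d \<odot>\<^bsub>U\<^esub> u) = (c * d) \<odot>\<^bsub>U\<^esub> u"
  using V.lsmult_assoc by simp

lemma smult_zero: "c \<odot>\<^bsub>U\<^esub> \<zero>\<^bsub>U\<^esub> = \<zero>\<^bsub>U\<^esub>"
  using V.lsmult_r_null by simp

lemma dual_linear:
  assumes "k \<le> n"
  shows "linear_map complex_field (power_module E NM (ind k)) (power_module E UM (ind (n - k))) (dual (n - k))"
proof (rule linear_mapI)
  have c: "V - S \<in> ind k" if "S \<in> ind (n - k)" for S
    using ind_complement[OF assms ind_subset[OF that]] that by simp
  fix x y a
  assume x: "x \<in> carrier (power_module E NM (ind k))"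
  have xc: "x (V - S) \<in> carrier U" if "S \<in> ind (n - k)" for S using x c[OF that] by (simp add: power_NM)
  show dx: "dual (n - k) x \<in> carrier (power_module E UM (ind (n - k)))"
    using xc by (simp add: power_UM dual_def)
  show "dual (n - k) (a \<odot>\<^bsub>power_module E NM (ind k)\<^esub> x) = a \<odot>\<^bsub>power_module E UM (ind (n - k))\<^esub> dual (n - k) x"
    unfolding power_NM_smult[OF x] power_UM_smult[OF dx]
    by (rule ext) (simp add: dual_def xc smult_smult smult_zero mult.commute)
  assume y: "y \<in> carrier (power_module E NM (ind k))"
  have yc: "y (V - S) \<in> carrier U" if "S \<in> ind (n - k)" for S using y c[OF that] by (simp add: power_NM)
  show "dual (n - k) (x \<oplus>\<^bsub>power_module E NM (ind k)\<^esub> y) = dual (n - k) x \<oplus>\<^bsub>power_module E UM (ind (n - k))\<^esub> dual (n - k) y"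
    unfolding power_add by (rule ext) (simp add: dual_def xc yc smult_distrib)
qed

lemma codual_linear:
  assumes "k \<le> n"
  shows "linear_map complex_field (power_module E UM (ind (n - k))) (power_module E NM (ind k)) (codual k)"
proof (rule linear_mapI)
  have c: "V - I \<in> ind (n - k)" if "I \<in> ind k" for I
    using ind_complement[of "n - k" I] ind_subset[OF that] that assms by simp
  fix x y a
  assume x: "x \<in> carrier (power_module E UM (ind (n - k)))"
  have xc: "x (V - S) \<in> carrier U" if "S \<in> ind k" for S using x c[OF that] by (simp add: power_UM)
  show dx: "codual k x \<in> carrier (power_module E NM (ind k))"
    using xc by (simp add: power_NM codual_def)
  show "codual k (a \<odot>\<^bsub>power_module E UM (ind (n - k))\<^esub> x) = a \<odot>\<^bsub>power_module E NM (ind k)\<^esub> codual k x"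
    unfolding power_UM_smult[OF x] power_NM_smult[OF dx]
    by (rule ext) (simp add: codual_def xc smult_smult smult_zero mult.commute)
  assume y: "y \<in> carrier (power_module E UM (ind (n - k)))"
  have yc: "y (V - S) \<in> carrier U" if "S \<in> ind k" for S using y c[OF that] by (simp add: power_UM)
  show "codual k (x \<oplus>\<^bsub>power_module E UM (ind (n - k))\<^esub> y) = codual k x \<oplus>\<^bsub>power_module E NM (ind k)\<^esub> codual k y"
    unfolding power_add by (rule ext) (simp add: codual_def xc yc smult_distrib)
qed

lemma codual_dual:
  assumes "k \<le> n" "x \<in> carrier (power_module E NM (ind k))"
  shows "codual k (dual (n - k) x) = x"
proof
  fix I
  show "codual k (dual (n - k) x) I = x I"
  proof (cases "I \<in> ind k")
    case True
    have "V - I \<in> ind (n - k)" "V - (V - I) = I"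
      using ind_complement[of "n - k" I] ind_subset[OF True] True assms(1) by auto
    moreover have "x I \<in> carrier U" using assms(2) True by (simp add: power_NM)
    ultimately show ?thesis using True by (simp add: codual_def dual_def smult_smult)
  next
    case False
    then show ?thesis using assms(2) by (simp add: codual_def power_NM)
  qed
qed

lemma dual_codual:
  assumes "k \<le> n" "y \<in> carrier (power_module E UM (ind (n - k)))"
  shows "dual (n - k) (codual k y) = y"
proof
  fix S
  show "dual (n - k) (codual k y) S = y S"
  proof (cases "S \<in> ind (n - k)")
    case True
    have "V - S \<in> ind k" "V - (V - S) = S"
      using ind_complement[OF assms(1) ind_subset[OF True]] True ind_subset[OF True] by auto
    moreover have "y S \<in> carrier U" using assms(2) True by (simp add: power_UM)
    ultimately show ?thesis using True ind_finite[OF True] by (simp add: codual_def dual_def smult_smult)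
  next
    case False
    then show ?thesis using assms(2) by (simp add: dual_def power_UM)
  qed
qed

lemma finsum_smult: "f \<in> S \<rightarrow> carrier U \<Longrightarrow> c \<odot>\<^bsub>U\<^esub> (\<Oplus>\<^bsub>U\<^esub>i\<in>S. f i) = (\<Oplus>\<^bsub>U\<^esub>i\<in>S. c \<odot>\<^bsub>U\<^esub> f i)"
  using V.lsmult_finsum[of c f S] by simp

text \<open>At \<open>S\<close> the cochain differential removes an index i of \<open>S\<close>, and
  the chain differential at V - S adds one; V - (S - {i}) = insert i (V - S) matches the terms one
  by one. Left and right products exchange their places, and \<open>dual_coeff_step\<close> compares
  their coefficients.\<close>

lemma dual_chain_map:
  assumes k: "k < n" and x: "x \<in> carrier (power_module E NM (ind (Suc k)))"
  shows "copower_map UM E (ind (n - Suc k)) (ind (Suc (n - Suc k))) (koszul_diff (n - Suc k)) (dual (n - Suc k) x)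
    = dual (n - k) (power_map E NM (ind (Suc k)) (koszul_diff k) x)"
proof
  define m where "m = n - Suc k"
  have m: "Suc m = n - k" "Suc k \<le> n" "n - Suc k = m" "k \<le> n" using k by (auto simp: m_def)
  fix S
  have dx: "dual m x \<in> carrier (power_module E UM (ind m))"
    using linear_map_closed[OF dual_linear[OF m(2)] x] m(3) by simp
  show "copower_map UM E (ind (n - Suc k)) (ind (Suc (n - Suc k))) (koszul_diff (n - Suc k)) (dual (n - Suc k) x) S
    = dual (n - k) (power_map E NM (ind (Suc k)) (koszul_diff k) x) S"
  proof (cases "S \<in> ind (Suc m)")
    case False
    then show ?thesis using m by (simp add: copower_map_def dual_def)
  next
    case True
    have S: "S \<subseteq> V" by (rule ind_subset[OF True])
    have VS: "V - S \<in> ind k" using ind_complement[OF m(4) S] True m by simp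
    have VVS: "V - (V - S) = S" using S by auto
    have Si: "S - {i} \<in> ind m" "V - (S - {i}) = insert i (V - S)" "insert i (V - S) \<in> ind (Suc k)" "i \<in> V" if i: "i \<in> S" for i
    proof -
      show 1: "S - {i} \<in> ind m" by (rule ind_remove[OF True i])
      show 2: "V - (S - {i}) = insert i (V - S)" "i \<in> V" using i S by auto
      show "insert i (V - S) \<in> ind (Suc k)"
        using ind_complement[OF m(2) ind_subset[OF 1]] 1 m(3) unfolding 2(1) by simp
    qed
    let ?x = "\<lambda>i. x (insert i (V - S))"
    have xc: "?x i \<in> carrier U" if "i \<in> S" for i using x Si(3)[OF that] by (simp add: power_NM)
    have g: "gen i \<otimes>\<^bsub>U\<^esub> ?x i \<in> carrier U" "?x i \<otimes>\<^bsub>U\<^esub> gen i \<in> carrier U" if "i \<in> S" for i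
      using xc[OF that] Si(4)[OF that] by simp_all
    have "copower_map UM E (ind m) (ind (Suc m)) (koszul_diff m) (dual m x) S =
      (\<Oplus>\<^bsub>U\<^esub>i\<in>S. left_coeff i S \<odot>\<^bsub>U\<^esub> (gen i \<otimes>\<^bsub>U\<^esub> dual m x (S - {i})) \<oplus>\<^bsub>U\<^esub> right_coeff i S \<odot>\<^bsub>U\<^esub> (dual m x (S - {i}) \<otimes>\<^bsub>U\<^esub> gen i))"
      by (rule copower_koszul[OF dx True])
    also have "\<dots> = (\<Oplus>\<^bsub>U\<^esub>i\<in>S. dual_coeff S \<odot>\<^bsub>U\<^esub> (left_coeff i (insert i (V - S)) \<odot>\<^bsub>U\<^esub> (?x i \<otimes>\<^bsub>U\<^esub> gen i) \<oplus>\<^bsub>U\<^esub>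
        (right_coeff i (insert i (V - S)) * p i) \<odot>\<^bsub>U\<^esub> (gen i \<otimes>\<^bsub>U\<^esub> ?x i)))"
    proof (rule A.finsum_cong')
      fix i assume i: "i \<in> S"
      have d: "dual m x (S - {i}) = dual_coeff (S - {i}) \<odot>\<^bsub>U\<^esub> ?x i"
        using Si(1,2)[OF i] by (simp add: dual_def)
      have "left_coeff i S \<odot>\<^bsub>U\<^esub> (gen i \<otimes>\<^bsub>U\<^esub> dual m x (S - {i})) \<oplus>\<^bsub>U\<^esub> right_coeff i S \<odot>\<^bsub>U\<^esub> (dual m x (S - {i}) \<otimes>\<^bsub>U\<^esub> gen i)
        = (dual_coeff (S - {i}) * right_coeff i S) \<odot>\<^bsub>U\<^esub> (?x i \<otimes>\<^bsub>U\<^esub> gen i) \<oplus>\<^bsub>U\<^esub>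
          (dual_coeff (S - {i}) * left_coeff i S) \<odot>\<^bsub>U\<^esub> (gen i \<otimes>\<^bsub>U\<^esub> ?x i)"
        unfolding d using xc[OF i] Si(4)[OF i] by (simp add: smult_mult smult_smult A.a_comm mult.commute)
      also have "\<dots> = dual_coeff S \<odot>\<^bsub>U\<^esub> (left_coeff i (insert i (V - S)) \<odot>\<^bsub>U\<^esub> (?x i \<otimes>\<^bsub>U\<^esub> gen i) \<oplus>\<^bsub>U\<^esub>
        (right_coeff i (insert i (V - S)) * p i) \<odot>\<^bsub>U\<^esub> (gen i \<otimes>\<^bsub>U\<^esub> ?x i))"
        unfolding dual_coeff_step[OF S i, symmetric] using g[OF i] by (simp add: smult_distrib smult_smult)
      finally show "left_coeff i S \<odot>\<^bsub>U\<^esub> (gen i \<otimes>\<^bsub>U\<^esub> dual m x (S - {i})) \<oplus>\<^bsub>U\<^esub> right_coeff i S \<odot>\<^bsub>U\<^esub> (dual m x (S - {i}) \<otimes>\<^bsub>U\<^esub> gen i)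
        = dual_coeff S \<odot>\<^bsub>U\<^esub> (left_coeff i (insert i (V - S)) \<odot>\<^bsub>U\<^esub> (?x i \<otimes>\<^bsub>U\<^esub> gen i) \<oplus>\<^bsub>U\<^esub>
        (right_coeff i (insert i (V - S)) * p i) \<odot>\<^bsub>U\<^esub> (gen i \<otimes>\<^bsub>U\<^esub> ?x i))" .
    qed (use g in auto)
    also have "\<dots> = dual_coeff S \<odot>\<^bsub>U\<^esub> power_map E NM (ind (Suc k)) (koszul_diff k) x (V - S)"
      unfolding power_koszul[OF x VS] VVS by (rule finsum_smult[symmetric]) (use g in auto)
    finally show ?thesis using True m by (simp add: dual_def)
  qed
qed

theorem koszul_duality:
  assumes "k \<le> n"
  shows "module_iso complex_field
    (homology (\<lambda>k. power_module E NM (ind k)) (\<lambda>k. power_map E NM (ind (Suc k)) (koszul_diff k)) k)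
    (cohomology (\<lambda>k. power_module E UM (ind k)) (\<lambda>k. copower_map UM E (ind k) (ind (Suc k)) (koszul_diff k)) (n - k))"
proof -
  interpret N: right_module E NM by (rule right_NM)
  interpret Y: coefficient_module E UM
    by (intro coefficient_module.intro coefficient_module_axioms.intro E.calgebra_axioms UM_module)
  note R = projective_resolutionD[OF koszul_resolution]
  show ?thesis
  proof (rule homology_cohomology_duality[where f = "\<lambda>k. dual (n - k)" and g = codual, OF N.left_module_power_right E.left_module_power[OF UM_module]
      N.power_map_linear[OF R(3)] Y.copower_map_linear[OF R(3)] N.power_map_power_map[OF R(3) R(3) finite_ind finite_ind R(6)]
      dual_linear codual_linear codual_dual dual_codual dual_chain_map _ _ assms])
    show "carrier (power_module E NM (ind (Suc n))) \<subseteq> {\<zero>\<^bsub>power_module E NM (ind (Suc n))\<^esub>}"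
      "carrier (power_module E UM (ind (Suc n))) \<subseteq> {\<zero>\<^bsub>power_module E UM (ind (Suc n))\<^esub>}"
      using ind_top[of "Suc n"] by (auto simp: power_module_simps)
  qed
qed

lemma power_top: "n < k \<Longrightarrow> \<exists>a. carrier (power_module E Y (ind k)) \<subseteq> {a}"
  using ind_top[of k] by (intro exI[of _ "\<lambda>_. \<zero>\<^bsub>Y\<^esub>"]) (auto simp: power_module_simps)

text \<open>\<open>projective_resolution_exists\<close> guarantees that the choice behind
  \<open>chosen_resolution\<close> does yield a resolution, which is then exchanged for the Koszul
  one in both functors.\<close>

lemma Tor_Ext_koszul:
  "module_iso complex_field (Tor E NM UM k)
    (homology (\<lambda>k. power_module E NM (ind k)) (\<lambda>k. power_map E NM (ind (Suc k)) (koszul_diff k)) k)"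
  "module_iso complex_field (Ext E UM UM k)
    (cohomology (\<lambda>k. power_module E UM (ind k)) (\<lambda>k. copower_map UM E (ind k) (ind (Suc k)) (koszul_diff k)) k)"
proof -
  interpret N: right_module E NM by (rule right_NM)
  interpret Y: coefficient_module E UM
    by (intro coefficient_module.intro coefficient_module_axioms.intro E.calgebra_axioms UM_module)
  obtain P d where c: "chosen_resolution E UM = (P, d)" by (cases "chosen_resolution E UM")
  have "case chosen_resolution E UM of (P, d) \<Rightarrow> \<exists>e. projective_resolution E UM P d e"
    unfolding chosen_resolution_def by (rule someI_ex) (use projective_resolution_exists[OF UM_module] in auto)
  then obtain e where P: "projective_resolution E UM P d e" unfolding c by auto
  show "module_iso complex_field (Tor E NM UM k)
    (homology (\<lambda>k. power_module E NM (ind k)) (\<lambda>k. power_map E NM (ind (Suc k)) (koszul_diff k)) k)"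
    using N.tensor_homology_iso[OF UM_module P koszul_resolution finite_ind] by (simp add: Tor_def c)
  show "module_iso complex_field (Ext E UM UM k)
    (cohomology (\<lambda>k. power_module E UM (ind k)) (\<lambda>k. copower_map UM E (ind k) (ind (Suc k)) (koszul_diff k)) k)"
    using Y.hom_cohomology_iso[OF UM_module P koszul_resolution finite_ind] by (simp add: Ext_def c)
qed

lemma Tor_Ext_top:
  assumes "n < k"
  shows "\<exists>a. carrier (homology (\<lambda>k. power_module E NM (ind k)) d k) \<subseteq> {a}"
    "\<exists>a. carrier (cohomology (\<lambda>k. power_module E UM (ind k)) d' k) \<subseteq> {a}"
proof -
  obtain a b where "carrier (power_module E NM (ind k)) \<subseteq> {a}" "carrier (power_module E UM (ind k)) \<subseteq> {b}"
    using power_top[OF assms] by metis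
  then show "\<exists>a. carrier (homology (\<lambda>k. power_module E NM (ind k)) d k) \<subseteq> {a}"
    "\<exists>a. carrier (cohomology (\<lambda>k. power_module E UM (ind k)) d' k) \<subseteq> {a}"
    unfolding homology_def cohomology_def
    by (intro quot_module_singleton[of _ a] quot_module_singleton[of _ b]; auto)+
qed

lemma left_module_Tor_Ext: "left_module complex_field (Tor E NM UM k)" "left_module complex_field (Ext E UM UM k)"
  using Tor_Ext_koszul by (auto simp: module_iso_def)

lemma zero_subspace_singleton: "carrier (zero_subspace E') \<subseteq> {\<zero>\<^bsub>E'\<^esub>}"
  by (simp add: zero_subspace_def)

text \<open>For \<open>k\<close> below 0 or above \<open>n\<close> one side is zero by convention
  and the other because {1..n} has no subset of more than n elements;
  \<open>singleton_module_iso\<close> then relates two zero spaces.\<close>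

lemma hochschild_duality:
  "module_iso complex_field (hochschild_homology U (twisted_bimodule \<sigma> U) k)
    (hochschild_cohomology U (regular_bimodule U) (int n - k))"
proof -
  have trivial: "module_iso complex_field A B"
    if "module_iso complex_field A C" "carrier C \<subseteq> {c}" "left_module complex_field B" "carrier B \<subseteq> {b}"
    for A :: "(complex, 'x) module" and B :: "(complex, 'y) module" and C :: "(complex, 'z) module" and b c
  proof -
    have "left_module complex_field C" using that(1) by (simp add: module_iso_def)
    from module_iso_trans[OF that(1) singleton_module_iso[OF this that(3,2,4)]] show ?thesis .
  qed
  consider "k < 0" | "k > int n" | "0 \<le> k" "k \<le> int n" by linarith
  then show ?thesis
  proof cases
    case 1
    have e: "hochschild_homology U (twisted_bimodule \<sigma> U) k = zero_subspace (Tor E NM UM 0)"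
      "hochschild_cohomology U (regular_bimodule U) (int n - k) = Ext E UM UM (nat (int n - k))"
      using 1 by (simp_all add: hochschild_homology_def hochschild_cohomology_def Let_def)
    have "n < nat (int n - k)" using 1 by linarith
    from Tor_Ext_top(2)[OF this] obtain a where
      "carrier (cohomology (\<lambda>k. power_module E UM (ind k)) (\<lambda>k. copower_map UM E (ind k) (ind (Suc k)) (koszul_diff k)) (nat (int n - k))) \<subseteq> {a}"
      by blast
    from trivial[OF Tor_Ext_koszul(2) this left_module_zero_subspace[OF left_module_Tor_Ext(1)] zero_subspace_singleton]
    show ?thesis unfolding e by (rule module_iso_sym)
  next
    case 2
    have e: "hochschild_homology U (twisted_bimodule \<sigma> U) k = Tor E NM UM (nat k)"
      "hochschild_cohomology U (regular_bimodule U) (int n - k) = zero_subspace (Ext E UM UM 0)"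
      using 2 by (simp_all add: hochschild_homology_def hochschild_cohomology_def Let_def)
    have "n < nat k" using 2 by linarith
    from Tor_Ext_top(1)[OF this] obtain a where
      "carrier (homology (\<lambda>k. power_module E NM (ind k)) (\<lambda>k. power_map E NM (ind (Suc k)) (koszul_diff k)) (nat k)) \<subseteq> {a}"
      by blast
    from trivial[OF Tor_Ext_koszul(1) this left_module_zero_subspace[OF left_module_Tor_Ext(2)] zero_subspace_singleton]
    show ?thesis unfolding e .
  next
    case 3
    have e: "hochschild_homology U (twisted_bimodule \<sigma> U) k = Tor E NM UM (nat k)"
      "hochschild_cohomology U (regular_bimodule U) (int n - k) = Ext E UM UM (n - nat k)"
      using 3 by (simp_all add: hochschild_homology_def hochschild_cohomology_def Let_def nat_diff_distrib)
    have "nat k \<le> n" using 3 by linarith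
    from module_iso_trans[OF Tor_Ext_koszul(1) module_iso_trans[OF koszul_duality[OF this] module_iso_sym[OF Tor_Ext_koszul(2)]]]
    show ?thesis unfolding e .
  qed
qed

end

theorem proposition2p3p5:
  fixes n :: nat
    and Q :: "nat \<Rightarrow> nat \<Rightarrow> complex"
    and \<sigma> :: "(nat list \<Rightarrow> complex) set \<Rightarrow> (nat list \<Rightarrow> complex) set"
    and k :: int
  assumes "n \<ge> 1"
    and "\<forall>i\<in>{1..n}. \<forall>j\<in>{1..n}. Q i j \<noteq> 0"
    and "mult_skew_symmetric n Q"
    and "algebra_automorphism (quantum_space n Q) \<sigma>"
    and "\<forall>i\<in>{1..n}. \<sigma> (quantum_gen n Q i) =
           (\<Prod>j=1..n. Q j i) \<odot>\<^bsub>quantum_space n Q\<^esub> quantum_gen n Q i"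
  shows "vector_space_iso
    (hochschild_homology (quantum_space n Q) (twisted_bimodule \<sigma> (quantum_space n Q)) k)
    (hochschild_cohomology (quantum_space n Q) (regular_bimodule (quantum_space n Q)) (int n - k))"
proof -
  interpret quantum n Q by unfold_locales (use assms in auto)
  have gen: "quantum_gen n Q i = gen i" for i by (simp add: quantum_gen_def cls_def V_def)
  interpret twisted_quantum n Q \<sigma>
  proof
    show "\<sigma> \<in> ring_hom U U" using assms(4) by (simp add: algebra_automorphism_def ring_iso_def)
    show "\<sigma> (c \<odot>\<^bsub>U\<^esub> u) = c \<odot>\<^bsub>U\<^esub> \<sigma> u" if "u \<in> carrier U" for c u
      using assms(4) that by (simp add: algebra_automorphism_def)
    show "\<sigma> (gen i) = (\<Prod>j\<in>V. Q j i) \<odot>\<^bsub>U\<^esub> gen i" if "i \<in> V" for i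
      using assms(5) that unfolding gen V_def by blast
  qed
  show ?thesis by (rule vector_space_isoI) (rule hochschild_duality)
qed

end
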